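(* For $\beta>0$ consider the McKean-Vlasov equation with the noisy Transformer potential $W_\beta(\theta)=\frac{e^{\beta\cos\theta}-1}{\beta}$, and put $\kappa^*(\beta)=\beta/I_1(\beta)$ and $R(\beta)=I_2(\beta)/I_1(\beta)$. There exist $0<\beta_-<\beta_+$ such that $\kappa^*(\beta)$ is a continuous (phase) transition point for $\beta\le\beta_-$, and there exists a discontinuous (phase) transition point $\kappa_c(\beta)<\kappa^*(\beta)$ for $\beta>\beta_+$. Further, $$\beta_+\le R^{-1}(1/2)\approx2.447,$$ where the bifurcation at the first bifurcation point $\kappa^*(\beta)$ changes from being supercritical to subcritical as $\beta$ crosses $R^{-1}(1/2)$.
   Context: $\mathbb{S}^1=[0,2\pi)$; densities are with respect to $d\theta/2\pi$. $I_\ell(\beta)=\frac1{2\pi}\int_0^{2\pi}e^{\beta\cos\phi}\cos(\ell\phi)\,d\phi$ is the modified Bessel function of the first kind. The potential has Fourier coefficients $a_\ell(\beta)=2I_\ell(\beta)/\beta$, $\ell\ge1$, in $W_\beta(\theta)=\sum_{\ell\ge1}a_\ell(\beta)\cos\ell\theta$ (the constant term, which is irrelevant for the equation, is suppressed). $R$ is strictly increasing on $(0,\infty)$. The stationary equation is $p''=\kappa(p(W_\beta\star p)')'$, $(W\star p)(\theta)=\frac1{2\pi}\int_0^{2\pi}W(\theta-\phi)p(\phi)d\phi$, $\kappa>0$. Let $\mathcal{P}^+_{ac}(\mathbb{S}^1)$ be the absolutely continuous probability measures with strictly positive density, and $$\mathcal{F}(\rho,\kappa)=\frac1{2\pi}\int_0^{2\pi}\rho\log\rho\,d\theta-\frac{\kappa}{8\pi^2}\int_0^{2\pi}\!\!\int_0^{2\pi}W_\beta(\theta-\phi)\rho(\theta)\rho(\phi)\,d\theta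 d\phi .$$ Let $p_0\equiv1$ be the uniform density. $\kappa_c>0$ is a transition point if (i) for $\kappa<\kappa_c$, $p_0$ is the unique global minimizer of $\mathcal{F}(\cdot,\kappa)$; (ii) at $\kappa_c$, $p_0$ is a global minimizer; (iii) for $\kappa>\kappa_c$ there is a global minimizer $\rho_\kappa\ne p_0$ in $\mathcal{P}^+_{ac}(\mathbb{S}^1)$. It is a continuous transition point if $p_0$ is the unique minimizer at $\kappa_c$ and, for any family of minimizers $\{\rho_\kappa:\kappa>\kappa_c\}$, $\lim_{\kappa\downarrow\kappa_c}\|\rho_\kappa-p_0\|_{H^1}=0$, with $\|p\|_{H^1}^2=\int_0^{2\pi}(p^2+|p'|^2)d\theta$; it is discontinuous if at least one of these conditions is violated. Supercritical/subcritical: near $(p_0,\kappa^*(\beta))$ the even non-trivial stationary solutions in $H^1(\mathbb{S}^1)$ form a unique local branch, parametrized by $s\in(-\delta,\delta)$, with Fourier modes $\underline p(s)=(\frac1{2\pi}\int_0^{2\pi} p\cos\ell\theta\, d\theta)_{\ell\ge1}=se_1+o(s)$ (in the norm $(\sum(1+\ell^2)x_\ell^2)^{1/2}$) and twice differentiable intensity $\kappa(s)$ with $\kappa(0)=\kappa^*(\beta)$, $\kappa'(0)=0$; the bifurcation is supercritical if $\kappa''(0)>0$ and subcritical if $\kappa''(0)<0$. *)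

theory Defs
  imports "HOL-Analysis.Analysis" "HOL-Library.Landau_Symbols"
begin

text \<open>
  Functions on the circle are functions on the reals of which only the values on
  \<open>[0, 2\<pi>)\<close> matter, and these only up to Lebesgue-null sets.
\<close>

abbreviation circle :: "real set" where
  "circle \<equiv> {0..<2 * pi}"

definition bessel_I :: "nat \<Rightarrow> real \<Rightarrow> real" where
  "bessel_I l \<beta> = 1 / (2 * pi) * (LINT \<phi>:circle|lborel. exp (\<beta> * cos \<phi>) * cos (real l * \<phi>))"

definition bessel_R :: "real \<Rightarrow> real" where
  "bessel_R \<beta> = bessel_I 2 \<beta> / bessel_I 1 \<beta>"

definition bessel_R_inv :: "real \<Rightarrow> real" where
  "bessel_R_inv = the_inv_into {0<..} bessel_R"

definition kappa_star :: "real \<Rightarrow> real" where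
  "kappa_star \<beta> = \<beta> / bessel_I 1 \<beta>"

definition transformer_W :: "real \<Rightarrow> real \<Rightarrow> real" where
  "transformer_W \<beta> \<theta> = (exp (\<beta> * cos \<theta>) - 1) / \<beta>"

definition W_conv :: "real \<Rightarrow> (real \<Rightarrow> real) \<Rightarrow> real \<Rightarrow> real" where
  "W_conv \<beta> p \<theta> = 1 / (2 * pi) * (LINT \<phi>:circle|lborel. transformer_W \<beta> (\<theta> - \<phi>) * p \<phi>)"


section \<open>Free energy and transition points\<close>

text \<open>Densities are taken with respect to \<open>d\<theta>/2\<pi>\<close>.\<close>

definition pos_densities :: "(real \<Rightarrow> real) set" where
  "pos_densities = {\<rho>. set_integrable lborel circle \<rho> \<and>
     (AE \<theta>\<in>circle in lborel. 0 < \<rho> \<theta>) \<and>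
     1 / (2 * pi) * (LINT \<theta>:circle|lborel. \<rho> \<theta>) = 1}"

definition is_uniform :: "(real \<Rightarrow> real) \<Rightarrow> bool" where
  "is_uniform \<rho> \<longleftrightarrow> (AE \<theta>\<in>circle in lborel. \<rho> \<theta> = 1)"

text \<open>
  Since \<open>x ln x\<close> is bounded below and \<open>transformer_W\<close> is bounded, the free energy of a density
  is always defined in \<open>(-\<infinity>, \<infinity>]\<close>; it is \<open>\<infinity>\<close> exactly when \<open>\<rho> ln \<rho>\<close> is not integrable
  (where the Bochner integral would default to \<open>0\<close>).
\<close>

definition free_energy :: "real \<Rightarrow> real \<Rightarrow> (real \<Rightarrow> real) \<Rightarrow> ereal" where
  "free_energy \<beta> \<kappa> \<rho> =
     (if set_integrable lborel circle (\<lambda>\<theta>. \<rho> \<theta> * ln (\<rho> \<theta>))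
      then ereal (1 / (2 * pi) * (LINT \<theta>:circle|lborel. \<rho> \<theta> * ln (\<rho> \<theta>))
        - \<kappa> / (8 * pi\<^sup>2) * (LINT \<theta>:circle|lborel. LINT \<phi>:circle|lborel.
            transformer_W \<beta> (\<theta> - \<phi>) * \<rho> \<theta> * \<rho> \<phi>))
      else \<infinity>)"

definition global_minimizer :: "real \<Rightarrow> real \<Rightarrow> (real \<Rightarrow> real) \<Rightarrow> bool" where
  "global_minimizer \<beta> \<kappa> \<rho> \<longleftrightarrow>
     \<rho> \<in> pos_densities \<and> (\<forall>\<sigma>\<in>pos_densities. free_energy \<beta> \<kappa> \<rho> \<le> free_energy \<beta> \<kappa> \<sigma>)"

definition uniform_unique_minimizer :: "real \<Rightarrow> real \<Rightarrow> bool" where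
  "uniform_unique_minimizer \<beta> \<kappa> \<longleftrightarrow>
     global_minimizer \<beta> \<kappa> (\<lambda>_. 1) \<and> (\<forall>\<rho>. global_minimizer \<beta> \<kappa> \<rho> \<longrightarrow> is_uniform \<rho>)"

definition transition_point :: "real \<Rightarrow> real \<Rightarrow> bool" where
  "transition_point \<beta> \<kappa>\<^sub>c \<longleftrightarrow> 0 < \<kappa>\<^sub>c \<and>
     (\<forall>\<kappa>. 0 < \<kappa> \<and> \<kappa> < \<kappa>\<^sub>c \<longrightarrow> uniform_unique_minimizer \<beta> \<kappa>) \<and>
     global_minimizer \<beta> \<kappa>\<^sub>c (\<lambda>_. 1) \<and>
     (\<forall>\<kappa>>\<kappa>\<^sub>c. \<exists>\<rho>. global_minimizer \<beta> \<kappa> \<rho> \<and> \<not> is_uniform \<rho>)"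

definition square_integrable :: "(real \<Rightarrow> real) \<Rightarrow> bool" where
  "square_integrable f \<longleftrightarrow>
     set_borel_measurable lborel circle f \<and> set_integrable lborel circle (\<lambda>\<theta>. (f \<theta>)\<^sup>2)"

definition smooth_periodic :: "(real \<Rightarrow> real) \<Rightarrow> bool" where
  "smooth_periodic \<phi> \<longleftrightarrow>
     (\<forall>\<theta>. \<phi> (\<theta> + 2 * pi) = \<phi> \<theta>) \<and> (\<forall>n. (deriv ^^ n) \<phi> differentiable_on UNIV)"

text \<open>\<open>weak_deriv p q\<close>: both are in \<open>L\<^sup>2\<close> of the circle and \<open>p' = q\<close> weakly on the circle.\<close>

definition weak_deriv :: "(real \<Rightarrow> real) \<Rightarrow> (real \<Rightarrow> real) \<Rightarrow> bool" where
  "weak_deriv p q \<longleftrightarrow> square_integrable p \<and> square_integrable q \<and>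
     (\<forall>\<phi>. smooth_periodic \<phi> \<longrightarrow>
        (LINT \<theta>:circle|lborel. p \<theta> * deriv \<phi> \<theta>) = - (LINT \<theta>:circle|lborel. q \<theta> * \<phi> \<theta>))"

definition in_H1 :: "(real \<Rightarrow> real) \<Rightarrow> bool" where
  "in_H1 p \<longleftrightarrow> (\<exists>q. weak_deriv p q)"

text \<open>The choice of \<open>q\<close> is immaterial: weak derivatives are unique almost everywhere.\<close>

definition H1_norm :: "(real \<Rightarrow> real) \<Rightarrow> ennreal" where
  "H1_norm p =
     (if in_H1 p
      then let q = (SOME q. weak_deriv p q)
           in ennreal (sqrt (LINT \<theta>:circle|lborel. (p \<theta>)\<^sup>2 + (q \<theta>)\<^sup>2))
      else \<infinity>)"

definition minimizers_converge :: "real \<Rightarrow> real \<Rightarrow> bool" where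
  "minimizers_converge \<beta> \<kappa>\<^sub>c \<longleftrightarrow>
     (\<forall>\<rho> :: real \<Rightarrow> real \<Rightarrow> real. (\<forall>\<kappa>>\<kappa>\<^sub>c. global_minimizer \<beta> \<kappa> (\<rho> \<kappa>)) \<longrightarrow>
        ((\<lambda>\<kappa>. H1_norm (\<lambda>\<theta>. \<rho> \<kappa> \<theta> - 1)) \<longlongrightarrow> 0) (at_right \<kappa>\<^sub>c))"

definition continuous_transition_point :: "real \<Rightarrow> real \<Rightarrow> bool" where
  "continuous_transition_point \<beta> \<kappa>\<^sub>c \<longleftrightarrow> transition_point \<beta> \<kappa>\<^sub>c \<and>
     uniform_unique_minimizer \<beta> \<kappa>\<^sub>c \<and> minimizers_converge \<beta> \<kappa>\<^sub>c"

definition discontinuous_transition_point :: "real \<Rightarrow> real \<Rightarrow> bool" where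
  "discontinuous_transition_point \<beta> \<kappa>\<^sub>c \<longleftrightarrow> transition_point \<beta> \<kappa>\<^sub>c \<and>
     (\<not> uniform_unique_minimizer \<beta> \<kappa>\<^sub>c \<or> \<not> minimizers_converge \<beta> \<kappa>\<^sub>c)"


section \<open>Stationary solutions and the local bifurcation\<close>

text \<open>
  The equation \<open>p'' = \<kappa> (p (W \<star> p)')'\<close> for \<open>p\<close> in \<open>H\<^sup>1\<close>, read weakly as
  \<open>(p' - \<kappa> p (W \<star> p)')' = 0\<close>; the function \<open>W \<star> p\<close> is smooth, so its derivative is classical.
\<close>

definition stationary :: "real \<Rightarrow> real \<Rightarrow> (real \<Rightarrow> real) \<Rightarrow> bool" where
  "stationary \<beta> \<kappa> p \<longleftrightarrow> p \<in> pos_densities \<and>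
     (\<exists>q. weak_deriv p q \<and>
          weak_deriv (\<lambda>\<theta>. q \<theta> - \<kappa> * (p \<theta> * deriv (W_conv \<beta> p) \<theta>)) (\<lambda>_. 0))"

text \<open>On \<open>[0, 2\<pi>)\<close>, evenness is the symmetry \<open>p(2\<pi> - \<theta>) = p(\<theta>)\<close>.\<close>

definition even_on_circle :: "(real \<Rightarrow> real) \<Rightarrow> bool" where
  "even_on_circle p \<longleftrightarrow> (AE \<theta>\<in>circle in lborel. p (2 * pi - \<theta>) = p \<theta>)"

definition nontrivial_even_stationary :: "real \<Rightarrow> real \<Rightarrow> (real \<Rightarrow> real) \<Rightarrow> bool" where
  "nontrivial_even_stationary \<beta> \<kappa> p \<longleftrightarrow>
     stationary \<beta> \<kappa> p \<and> even_on_circle p \<and> \<not> is_uniform p"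

text \<open>\<open>(p\<^sub>0, \<kappa>)\<close> is a limit of non-trivial even stationary solutions.\<close>

definition bifurcation_point :: "real \<Rightarrow> real \<Rightarrow> bool" where
  "bifurcation_point \<beta> \<kappa> \<longleftrightarrow> 0 < \<kappa> \<and>
     (\<forall>\<epsilon>>0. \<exists>p \<kappa>'. nontrivial_even_stationary \<beta> \<kappa>' p \<and>
        \<bar>\<kappa>' - \<kappa>\<bar> < \<epsilon> \<and> H1_norm (\<lambda>\<theta>. p \<theta> - 1) < ennreal \<epsilon>)"

definition first_bifurcation_point :: "real \<Rightarrow> real \<Rightarrow> bool" where
  "first_bifurcation_point \<beta> \<kappa> \<longleftrightarrow>
     bifurcation_point \<beta> \<kappa> \<and> (\<forall>\<kappa>'. bifurcation_point \<beta> \<kappa>' \<longrightarrow> \<kappa> \<le> \<kappa>')"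

definition fourier_mode :: "(real \<Rightarrow> real) \<Rightarrow> nat \<Rightarrow> real" where
  "fourier_mode p l = 1 / (2 * pi) * (LINT \<theta>:circle|lborel. p \<theta> * cos (real l * \<theta>))"

text \<open>
  Sequences are indexed by \<open>l \<ge> 1\<close>. The series converges for the cosine modes of any
  function in \<open>H\<^sup>1\<close>, the only case in which the norm is used.
\<close>

definition mode_norm :: "(nat \<Rightarrow> real) \<Rightarrow> real" where
  "mode_norm x = sqrt (\<Sum>n. (1 + (real (Suc n))\<^sup>2) * (x (Suc n))\<^sup>2)"

text \<open>
  \<open>(p s, \<kappa> s)\<close> for \<open>-\<delta> < s < \<delta>\<close> is the local branch at \<open>(p\<^sub>0, \<kappa>\<^sup>*(\<beta>))\<close>: a curve, continuous in
  \<open>H\<^sup>1\<close>, that contains all even non-trivial stationary solutions in some neighbourhood of that point.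
\<close>

definition bifurcation_branch ::
    "real \<Rightarrow> real \<Rightarrow> (real \<Rightarrow> real \<Rightarrow> real) \<Rightarrow> (real \<Rightarrow> real) \<Rightarrow> bool" where
  "bifurcation_branch \<beta> \<delta> p \<kappa> \<longleftrightarrow> 0 < \<delta> \<and>
     is_uniform (p 0) \<and> \<kappa> 0 = kappa_star \<beta> \<and> deriv \<kappa> 0 = 0 \<and>
     (\<forall>s\<in>{-\<delta><..<\<delta>}. s \<noteq> 0 \<longrightarrow> nontrivial_even_stationary \<beta> (\<kappa> s) (p s)) \<and>
     (\<forall>s\<in>{-\<delta><..<\<delta>}. ((\<lambda>t. H1_norm (\<lambda>\<theta>. p t \<theta> - p s \<theta>)) \<longlongrightarrow> 0) (at s)) \<and>
     (\<forall>s\<in>{-\<delta><..<\<delta>}. \<kappa> differentiable (at s) \<and> deriv \<kappa> differentiable (at s)) \<and>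
     (\<lambda>s. mode_norm (\<lambda>l. fourier_mode (p s) l - (if l = 1 then s else 0))) \<in> o[at 0](\<lambda>s. s) \<and>
     (\<exists>\<epsilon>>0. \<forall>p' \<kappa>'. nontrivial_even_stationary \<beta> \<kappa>' p' \<and>
        \<bar>\<kappa>' - kappa_star \<beta>\<bar> < \<epsilon> \<and> H1_norm (\<lambda>\<theta>. p' \<theta> - 1) < ennreal \<epsilon> \<longrightarrow>
        (\<exists>s\<in>{-\<delta><..<\<delta>}. \<kappa>' = \<kappa> s \<and> (AE \<theta>\<in>circle in lborel. p' \<theta> = p s \<theta>)))"

text \<open>
  The expansion \<open>s e\<^sub>1 + o(s)\<close> and local uniqueness determine \<open>\<kappa>''(0)\<close> independently of the
  chosen parametrization.
\<close>

definition supercritical :: "real \<Rightarrow> bool" where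
  "supercritical \<beta> \<longleftrightarrow> (\<exists>\<delta> p \<kappa>. bifurcation_branch \<beta> \<delta> p \<kappa> \<and> deriv (deriv \<kappa>) 0 > 0)"

definition subcritical :: "real \<Rightarrow> bool" where
  "subcritical \<beta> \<longleftrightarrow> (\<exists>\<delta> p \<kappa>. bifurcation_branch \<beta> \<delta> p \<kappa> \<and> deriv (deriv \<kappa>) 0 < 0)"

end

theory Submission
  imports Defs "HOL-Complex_Analysis.Complex_Analysis"
begin

text \<open>
  The function \<open>exp (\<beta> cos \<theta>)\<close> generates the Bessel functions, so convolution with the potential is
  diagonal in Fourier modes and multiplies the modes of frequency \<open>l\<close> by \<open>I\<^sub>l / \<beta>\<close>. Everything is
  therefore expressed by the sequence \<open>z\<close> of modes of a density. By Gibbs' variational principle the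
  free energy of a density with modes \<open>z\<close> is at least
  \<open>\<kappa> \<Sum> (I\<^sub>l / \<beta>) z\<^sub>l\<^sup>2 - ln Z(z)\<close>, where \<open>Z\<close> is the partition function of the field that \<open>z\<close> creates,
  and the Gibbs density of this field does at least as well as that bound. Hence minimizers exist by
  compactness of the cube of modes, and the uniform density is a minimizer exactly when this reduced
  energy is nonnegative. Minimizers and stationary solutions alike are self-consistent: they are the
  Gibbs density of their own field.

  The weight of the first mode reaches \<open>1 / \<kappa>\<close> at \<open>\<kappa> = \<kappa>\<^sup>*\<close>. Above this value the first mode alone
  makes the reduced energy negative; below it a contraction estimate isolates the uniform density
  among the self-consistent ones. If \<open>R > 1/2\<close>, then at \<open>\<kappa>\<^sup>*\<close> the modes \<open>t\<close> and \<open>h t\<^sup>2\<close> of frequencies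
  one and two together give negative energy at order \<open>t\<^sup>4\<close>. The transition then happens strictly below
  \<open>\<kappa>\<^sup>*\<close>, where isolation forbids minimizers close to the uniform density, so it is discontinuous. For
  small \<open>\<beta>\<close> the weights of all higher modes are small compared with the first one, and the reduced
  energy at \<open>\<kappa>\<^sup>*\<close> controls the fourth power of the first mode and the weighted squares of the others.
  This gives uniqueness at \<open>\<kappa>\<^sup>*\<close> and convergence of minimizers.

  For the bifurcation write the cosine modes of an even solution as \<open>s (1, v\<^sub>1, v\<^sub>2, \<dots>)\<close> and
  \<open>\<kappa> = \<kappa>\<^sup>* v\<^sub>0\<close>. After division by \<open>s\<close> the self-consistency equation becomes a fixed-point problem for
  \<open>v\<close> whose linear part at \<open>s = 0\<close> has norm \<open>R < 1\<close> in the supremum norm. It is solved by iteration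
  for complex \<open>s\<close>, so the branch is holomorphic in \<open>s\<close>, and the same contraction gives local
  uniqueness. Expanding to second order yields
  \<open>v\<^sub>0 = 1 + s\<^sup>2 (1 - 2 R) / (2 (1 - R)) + O(s\<^sup>3)\<close>, so that the sign of \<open>\<kappa>''(0)\<close> is the sign of
  \<open>1/2 - R\<close>. Finally \<open>R\<close> is strictly increasing, and two evaluations of a power series locate the
  solution of \<open>R = 1/2\<close>.
\<close>

section \<open>The circle and its trigonometric basis\<close>

text \<open>
  Normalized Lebesgue measure on the circle, so that \<open>avg\<close> is the mean and
  densities have mean one.
\<close>

definition cm :: "real measure" where
  "cm = density (restrict_space lborel circle) (\<lambda>_. ennreal (1 / (2 * pi)))"

abbreviation avg :: "(real \<Rightarrow> 'a::{banach, second_countable_topology}) \<Rightarrow> 'a" where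
  "avg f \<equiv> integral\<^sup>L cm f"

lemma space_cm [simp]: "space cm = circle"
  by (simp add: cm_def space_restrict_space)

lemma sets_cm: "sets cm = sets (restrict_space borel circle)"
  by (simp add: cm_def sets_restrict_space)

lemma borel_measurable_cm_iff:
  fixes f :: "real \<Rightarrow> 'a::real_normed_vector"
  shows "f \<in> borel_measurable cm \<longleftrightarrow> set_borel_measurable lborel circle f"
proof -
  have "f \<in> borel_measurable cm \<longleftrightarrow> f \<in> borel_measurable (restrict_space lborel circle)"
    by (simp add: cm_def)
  also have "\<dots> \<longleftrightarrow> set_borel_measurable lborel circle f"
    by (subst borel_measurable_restrict_space_iff) (auto simp: set_borel_measurable_def)
  finally show ?thesis .
qed

lemma measurable_cm_borel [simp]:
  "f \<in> borel_measurable borel \<Longrightarrow> f \<in> borel_measurable cm"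
  unfolding cm_def by (simp add: measurable_restrict_space1)

lemma integrable_cm_iff:
  fixes f :: "real \<Rightarrow> 'a::{banach, second_countable_topology}"
  shows "integrable cm f \<longleftrightarrow> set_integrable lborel circle f"
proof -
  have "integrable cm f \<longleftrightarrow> integrable (restrict_space lborel circle) f"
  proof (cases "f \<in> borel_measurable (restrict_space lborel circle)")
    case True
    have "integrable (restrict_space lborel circle) f"
      if "integrable (restrict_space lborel circle) (\<lambda>x. (1 / (2 * pi)) *\<^sub>R f x)"
      using integrable_scaleR_right[OF that, of "2 * pi"] by simp
    then show ?thesis using True unfolding cm_def
      by (subst integrable_density) auto
  next
    case False
    then show ?thesis by (auto simp: cm_def dest: borel_measurable_integrable)
  qed
  also have "\<dots> \<longleftrightarrow> set_integrable lborel circle f"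
    by (subst integrable_restrict_space) (auto simp: set_integrable_def)
  finally show ?thesis .
qed

lemma avg_eq:
  fixes f :: "real \<Rightarrow> real"
  shows "avg f = 1 / (2 * pi) * (LINT t:circle|lborel. f t)"
proof (cases "f \<in> borel_measurable (restrict_space lborel circle)")
  case True
  then have "avg f = integral\<^sup>L (restrict_space lborel circle) (\<lambda>x. (1 / (2 * pi)) *\<^sub>R f x)"
    unfolding cm_def by (subst integral_density) auto
  also have "\<dots> = 1 / (2 * pi) * (LINT t:circle|lborel. f t)"
    by (simp add: integral_restrict_space set_lebesgue_integral_def)
  finally show ?thesis .
next
  case False
  then have "\<not> integrable cm f" "\<not> set_integrable lborel circle f"
    unfolding integrable_cm_iff[symmetric]
    by (auto simp: cm_def dest: borel_measurable_integrable)
  then show ?thesis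
    by (simp add: not_integrable_integral_eq set_lebesgue_integral_def set_integrable_def)
qed

lemma LINT_eq_avg:
  fixes f :: "real \<Rightarrow> real"
  shows "(LINT t:circle|lborel. f t) = 2 * pi * avg f"
  by (simp add: avg_eq)

lemma AE_cm_iff: "(AE x in cm. P x) \<longleftrightarrow> (AE x\<in>circle in lborel. P x)"
proof -
  have "(AE x in cm. P x) \<longleftrightarrow> (AE x in restrict_space lborel circle. P x)"
    unfolding cm_def by (subst AE_density) auto
  also have "\<dots> \<longleftrightarrow> (AE x\<in>circle in lborel. P x)"
    by (subst AE_restrict_space_iff) auto
  finally show ?thesis .
qed

lemma finite_measure_cm: "finite_measure cm"
proof
  have *: "(\<integral>\<^sup>+x. ennreal (1/(2*pi)) * indicator circle x \<partial>restrict_space lborel circle)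
     = (\<integral>\<^sup>+x. ennreal (1/(2*pi)) \<partial>restrict_space lborel circle)"
    by (rule nn_integral_cong) (auto simp: space_restrict_space)
  have "emeasure cm (space cm) = (\<integral>\<^sup>+x. ennreal (1/(2*pi)) \<partial>restrict_space lborel circle)"
    unfolding space_cm unfolding cm_def *[symmetric]
    by (subst emeasure_density) (auto simp: space_restrict_space sets_restrict_space)
  also have "\<dots> < \<infinity>"
    by (simp add: emeasure_restrict_space ennreal_mult_less_top)
  finally show "emeasure cm (space cm) \<noteq> \<infinity>" by simp
qed

interpretation cm: finite_measure cm by (rule finite_measure_cm)

lemma avg_const_real [simp]: "avg (\<lambda>_. c::real) = c"
  by (subst avg_eq) (simp add: set_lebesgue_integral_def)

lemma measure_cm_space [simp]: "measure cm circle = 1"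
  using avg_const_real[of 1] by (subst (asm) lebesgue_integral_const) simp

lemma integrable_cm_continuous:
  fixes f :: "real \<Rightarrow> 'a::{banach, second_countable_topology}"
  assumes "continuous_on UNIV f"
  shows "integrable cm f"
proof -
  have "compact (f ` {0..2*pi})"
    by (intro compact_continuous_image continuous_on_subset[OF assms]) auto
  then obtain B where "\<forall>y\<in>f ` {0..2*pi}. norm y \<le> B"
    using compact_imp_bounded bounded_iff by blast
  then show ?thesis
    by (intro cm.integrable_const_bound[where B=B] AE_I2)
       (auto intro!: measurable_cm_borel borel_measurable_continuous_onI assms)
qed

lemma avg_norm_le:
  fixes f :: "real \<Rightarrow> 'a::{banach, second_countable_topology}"
  assumes "\<And>x. norm (f x) \<le> B"
  shows "norm (avg f) \<le> B"
proof (cases "integrable cm f")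
  case True
  have "norm (avg f) \<le> avg (\<lambda>x. norm (f x))" by (rule integral_norm_bound)
  also have "\<dots> \<le> avg (\<lambda>_. B)"
    by (intro integral_mono) (use True assms in auto)
  finally show ?thesis by simp
next
  case False
  then show ?thesis using order_trans[OF norm_ge_zero assms[of 0]]
    by (simp add: not_integrable_integral_eq)
qed

lemma avg_HK:
  fixes f :: "real \<Rightarrow> real"
  assumes "continuous_on UNIV f"
  shows "avg f = 1 / (2 * pi) * integral {0..2*pi} f"
proof -
  have c: "continuous_on {0..2*pi} f" using assms continuous_on_subset by blast
  have i: "set_integrable lborel {0..2*pi} f"
    by (rule borel_integrable_atLeastAtMost') (rule c)
  have "(LINT t:circle|lborel. f t) = (LINT t:{0..2*pi}|lborel. f t)"
    unfolding set_lebesgue_integral_def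
  proof (rule integral_cong_AE)
    show "AE x in lborel. indicator circle x *\<^sub>R f x = indicator {0..2 * pi} x *\<^sub>R f x"
      using AE_lborel_singleton[of "2*pi"] by eventually_elim (auto simp: indicator_def)
  qed (use borel_measurable_continuous_onI[OF assms] in auto)
  also have "\<dots> = integral {0..2*pi} f"
    by (rule set_borel_integral_eq_integral(2)[OF i])
  finally show ?thesis by (simp add: avg_eq)
qed

lemma avg_deriv_periodic:
  fixes f f' :: "real \<Rightarrow> real"
  assumes "\<And>x. (f has_real_derivative f' x) (at x)" "continuous_on UNIV f'" "f (2*pi) = f 0"
  shows "avg f' = 0"
proof -
  have "(f' has_integral (f (2*pi) - f 0)) {0..2*pi}"
    by (rule fundamental_theorem_of_calculus)
       (auto simp flip: has_real_derivative_iff_has_vector_derivative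
         intro!: has_field_derivative_at_within assms)
  then show ?thesis using assms by (simp add: avg_HK integral_unique)
qed

lemma continuous_on_UNIV_deriv:
  fixes f f' :: "real \<Rightarrow> real"
  assumes "\<And>x. (f has_real_derivative f' x) (at x)"
  shows "continuous_on UNIV f"
  using assms DERIV_isCont continuous_at_imp_continuous_on by blast

lemma avg_by_parts:
  fixes f f' g g' :: "real \<Rightarrow> real"
  assumes "\<And>x. (f has_real_derivative f' x) (at x)" "continuous_on UNIV f'" "f (2*pi) = f 0"
    and "\<And>x. (g has_real_derivative g' x) (at x)" "continuous_on UNIV g'" "g (2*pi) = g 0"
  shows "avg (\<lambda>x. f x * g' x) = - avg (\<lambda>x. f' x * g x)"
proof -
  have c: "continuous_on UNIV f" "continuous_on UNIV g"
    using assms continuous_on_UNIV_deriv by blast+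
  have "avg (\<lambda>x. f' x * g x + f x * g' x) = 0"
  proof (rule avg_deriv_periodic[where f="\<lambda>x. f x * g x"])
    show "((\<lambda>x. f x * g x) has_real_derivative f' x * g x + f x * g' x) (at x)" for x
      by (rule derivative_eq_intros assms refl | simp)+
  qed (use assms c in \<open>auto intro!: continuous_intros\<close>)
  then show ?thesis
    by (subst (asm) Bochner_Integration.integral_add)
       (use assms c in \<open>auto intro!: integrable_cm_continuous continuous_intros\<close>)
qed

lemma cos_2pi_nat [simp]: "cos (real l * (2 * pi)) = 1" "cos (real l * 2 * pi) = 1"
  and sin_2pi_nat [simp]: "sin (real l * (2 * pi)) = 0" "sin (real l * 2 * pi) = 0"
  using cos_int_2pin[of "int l"] sin_int_2pin[of "int l"] by (auto simp: mult_ac)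

lemma avg_cos: "avg (\<lambda>t. cos (real l * t)) = (if l = 0 then 1 else 0)"
proof (cases "l = 0")
  case False
  then show ?thesis
    by (simp, intro avg_deriv_periodic[where f="\<lambda>t. sin (real l * t) / real l"])
       (auto intro!: derivative_eq_intros continuous_intros)
qed simp

lemma avg_sin: "avg (\<lambda>t. sin (real l * t)) = 0"
proof (cases "l = 0")
  case False
  then show ?thesis
    by (intro avg_deriv_periodic[where f="\<lambda>t. - cos (real l * t) / real l"])
       (auto intro!: derivative_eq_intros continuous_intros)
qed simp

lemma cos_cos_nat:
  "cos (real k * t) * cos (real l * t) =
    (cos (real (k + l) * t) + cos (real (max k l - min k l) * t)) / 2"
proof -
  have "cos (real (max k l - min k l) * t) = cos (real k * t - real l * t)"
  proof (cases "k \<le> l")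
    case True
    then show ?thesis
      using cos_minus[of "real k * t - real l * t"] by (simp add: of_nat_diff algebra_simps)
  qed (simp add: of_nat_diff algebra_simps)
  then show ?thesis by (simp add: cos_times_cos algebra_simps)
qed

lemma sin_sin_nat:
  "sin (real k * t) * sin (real l * t) =
    (cos (real (max k l - min k l) * t) - cos (real (k + l) * t)) / 2"
proof -
  have "cos (real (max k l - min k l) * t) = cos (real k * t - real l * t)"
  proof (cases "k \<le> l")
    case True
    then show ?thesis
      using cos_minus[of "real k * t - real l * t"] by (simp add: of_nat_diff algebra_simps)
  qed (simp add: of_nat_diff algebra_simps)
  then show ?thesis by (simp add: sin_times_sin algebra_simps)
qed

lemma sin_cos_nat:
  "sin (real k * t) * cos (real l * t) =
    (sin (real (k + l) * t) + (if k \<ge> l then 1 else -1) * sin (real (max k l - min k l) * t)) / 2"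
proof -
  have "(if k \<ge> l then 1 else -1) * sin (real (max k l - min k l) * t) = sin (real k * t - real l * t)"
  proof (cases "k \<le> l")
    case True
    then show ?thesis
      using sin_minus[of "real k * t - real l * t"] by (auto simp: of_nat_diff algebra_simps)
  qed (simp add: of_nat_diff algebra_simps)
  then show ?thesis unfolding sin_times_cos by (simp only: of_nat_add distrib_right)
qed

definition freq :: "nat \<Rightarrow> nat" where "freq j = j div 2 + 1"

text \<open>
  One sequence lists the real Fourier basis except the constant: even indices carry the cosines
  and odd ones the sines, both at frequency \<open>freq j\<close>; up to the factor \<open>freq
  j\<close>, \<open>tb'\<close> is the derivative.
\<close>

definition tb :: "nat \<Rightarrow> real \<Rightarrow> real" where
  "tb j t = (if even j then cos (real (freq j) * t) else sin (real (freq j) * t))"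

definition tb' :: "nat \<Rightarrow> real \<Rightarrow> real" where
  "tb' j t = (if even j then - sin (real (freq j) * t) else cos (real (freq j) * t))"

lemma freq_pos: "freq j \<ge> 1" by (simp add: freq_def)

lemma tb_le: "\<bar>tb j t\<bar> \<le> 1" by (simp add: tb_def)
lemma tb'_le: "\<bar>tb' j t\<bar> \<le> 1" by (simp add: tb'_def)

lemma tb_deriv: "(tb j has_real_derivative real (freq j) * tb' j x) (at x)"
proof -
  have "((\<lambda>t. if even j then cos (real (freq j) * t) else sin (real (freq j) * t))
     has_real_derivative real (freq j) * tb' j x) (at x)"
    unfolding tb'_def by (cases "even j") (auto intro!: derivative_eq_intros)
  then show ?thesis unfolding tb_def[abs_def] .
qed

lemma tb_continuous [continuous_intros]: "continuous_on A (tb j)"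
  using continuous_on_UNIV_deriv[OF tb_deriv] continuous_on_subset by blast

lemma tb'_continuous [continuous_intros]: "continuous_on A (tb' j)"
  unfolding tb'_def[abs_def] by (cases "even j") (auto intro!: continuous_intros)

lemma tb_periodic: "tb j (t + 2*pi) = tb j t" "tb j (2*pi) = tb j 0"
proof -
  have *: "real (freq j) * (t + 2*pi) = real (freq j) * t + real (freq j) * (2 * pi)"
    by (simp add: algebra_simps)
  show "tb j (t + 2*pi) = tb j t" unfolding tb_def * cos_add sin_add by simp
  show "tb j (2*pi) = tb j 0" by (simp add: tb_def)
qed

lemma tb_measurable [measurable]: "tb j \<in> borel_measurable borel"
  by (intro borel_measurable_continuous_onI continuous_intros)

lemma avg_tb [simp]: "avg (tb j) = 0"
  using freq_pos[of j] by (cases "even j") (auto simp: tb_def[abs_def] avg_cos avg_sin)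

lemma integrable_cos_nat [simp]: "integrable cm (\<lambda>t. cos (real l * t))"
  and integrable_sin_nat [simp]: "integrable cm (\<lambda>t. sin (real l * t))"
  by (intro integrable_cm_continuous continuous_intros)+

lemma avg_cos_cos: "avg (\<lambda>t. cos (real k * t) * cos (real l * t)) =
   (if k = l then (if k = 0 then 1 else 1/2) else 0)"
  unfolding cos_cos_nat
  by (auto simp: avg_cos max_def min_def simp del: of_nat_add of_nat_diff of_nat_max of_nat_min)

lemma avg_sin_sin: "avg (\<lambda>t. sin (real k * t) * sin (real l * t)) =
   (if k = l \<and> k \<noteq> 0 then 1/2 else 0)"
  unfolding sin_sin_nat
  by (auto simp: avg_cos max_def min_def simp del: of_nat_add of_nat_diff of_nat_max of_nat_min)

lemma avg_sin_cos: "avg (\<lambda>t. sin (real k * t) * cos (real l * t)) = 0"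
  unfolding sin_cos_nat
  by (simp add: avg_sin del: of_nat_add of_nat_diff of_nat_max of_nat_min)

lemma avg_tb_tb: "avg (\<lambda>t. tb i t * tb j t) = (if i = j then 1/2 else 0)"
proof -
  have "avg (\<lambda>t. cos (real l * t) * sin (real k * t)) = 0" for k l
    using avg_sin_cos[of k l] by (simp add: mult.commute)
  moreover have "i = j \<longleftrightarrow> even i = even j \<and> freq i = freq j"
    unfolding freq_def by (metis add_right_cancel even_two_times_div_two odd_two_times_div_two_succ)
  ultimately show ?thesis
    using freq_pos[of i]
    by (cases "even i"; cases "even j") (auto simp: tb_def avg_cos_cos avg_sin_sin avg_sin_cos)
qed

lemma avg_pos:
  fixes f :: "real \<Rightarrow> real"
  assumes "continuous_on UNIV f" "\<And>x. f x \<ge> 0" "x0 \<in> {0..2*pi}" "f x0 \<noteq> 0"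
  shows "avg f > 0"
proof -
  have c: "continuous_on {0..2*pi} f" using assms continuous_on_subset by blast
  have "integral {0..2*pi} f \<noteq> 0"
    using integral_eq_0_iff[OF c] assms by auto
  moreover have "integral {0..2*pi} f \<ge> 0"
    by (rule integral_nonneg) (use c assms in \<open>auto intro: integrable_continuous_real\<close>)
  ultimately show ?thesis by (simp add: avg_HK[OF assms(1)])
qed

inductive trig_poly :: "(real \<Rightarrow> real) \<Rightarrow> bool" where
  cos: "trig_poly (\<lambda>t. cos (real l * t))"
| sin: "trig_poly (\<lambda>t. sin (real l * t))"
| add: "trig_poly f \<Longrightarrow> trig_poly g \<Longrightarrow> trig_poly (\<lambda>t. f t + g t)"
| scale: "trig_poly f \<Longrightarrow> trig_poly (\<lambda>t. c * f t)"

lemma trig_poly_const: "trig_poly (\<lambda>_. c)"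
  using trig_poly.scale[OF trig_poly.cos[of 0], of c] by simp

lemma trig_poly_cos_mult: "trig_poly f \<Longrightarrow> trig_poly (\<lambda>t. cos (real l * t) * f t)"
proof (induction rule: trig_poly.induct)
  case (cos k)
  have "trig_poly (\<lambda>t. (1/2) * (cos (real (l + k) * t) + cos (real (max l k - min l k) * t)))"
    by (intro trig_poly.intros)
  then show ?case unfolding cos_cos_nat by simp
next
  case (sin k)
  have "trig_poly (\<lambda>t. (1/2) * (sin (real (k + l) * t) + (if k \<ge> l then 1 else -1) * sin (real (max k l - min k l) * t)))"
    by (intro trig_poly.intros)
  then show ?case unfolding mult.commute[of "cos _"] sin_cos_nat by simp
next
  case (add f g)
  then show ?case using trig_poly.add[OF add.IH] by (simp add: algebra_simps)
next
  case (scale f c)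
  then show ?case using trig_poly.scale[OF scale.IH, of c] by (simp add: algebra_simps)
qed

lemma trig_poly_sin_mult: "trig_poly f \<Longrightarrow> trig_poly (\<lambda>t. sin (real l * t) * f t)"
proof (induction rule: trig_poly.induct)
  case (cos k)
  then show ?case using trig_poly_cos_mult[OF trig_poly.sin[of l], of k] by (simp add: mult.commute)
next
  case (sin k)
  have "trig_poly (\<lambda>t. (1/2) * (cos (real (max l k - min l k) * t) + (-1) * cos (real (l + k) * t)))"
    by (intro trig_poly.intros)
  then show ?case unfolding sin_sin_nat by simp
next
  case (add f g)
  then show ?case using trig_poly.add[OF add.IH] by (simp add: algebra_simps)
next
  case (scale f c)
  then show ?case using trig_poly.scale[OF scale.IH, of c] by (simp add: algebra_simps)
qed

lemma trig_poly_mult: "trig_poly f \<Longrightarrow> trig_poly g \<Longrightarrow> trig_poly (\<lambda>t. f t * g t)"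
proof (induction rule: trig_poly.induct)
  case (add f h)
  then show ?case using trig_poly.add[OF add.IH] by (simp add: algebra_simps)
next
  case (scale f c)
  then show ?case using trig_poly.scale[OF scale.IH, of c] by (simp add: algebra_simps)
qed (auto intro: trig_poly_cos_mult trig_poly_sin_mult)

lemma trig_poly_deriv:
  "trig_poly f \<Longrightarrow> \<exists>f'. trig_poly f' \<and> (\<forall>x. (f has_real_derivative f' x) (at x))"
proof (induction rule: trig_poly.induct)
  case (cos l)
  have "trig_poly (\<lambda>t. (- real l) * sin (real l * t))" by (intro trig_poly.intros)
  then show ?case by (intro exI[of _ "\<lambda>t. (- real l) * sin (real l * t)"])
     (auto intro!: derivative_eq_intros)
next
  case (sin l)
  show ?case by (rule exI[of _ "\<lambda>t. real l * cos (real l * t)"])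
     (auto intro!: derivative_eq_intros trig_poly.intros)
next
  case (add f g)
  then obtain f' g' where "trig_poly f'" "trig_poly g'"
    "\<forall>x. (f has_real_derivative f' x) (at x)" "\<forall>x. (g has_real_derivative g' x) (at x)" by blast
  then show ?case by (intro exI[of _ "\<lambda>x. f' x + g' x"]) (auto intro!: derivative_intros trig_poly.intros)
next
  case (scale f c)
  then obtain f' where "trig_poly f'" "\<forall>x. (f has_real_derivative f' x) (at x)" by blast
  then show ?case by (intro exI[of _ "\<lambda>x. c * f' x"])
    (auto intro!: derivative_eq_intros trig_poly.intros)
qed

lemma trig_poly_deriv_iter: "trig_poly f \<Longrightarrow> trig_poly ((deriv ^^ n) f)"
proof (induction n arbitrary: f)
  case (Suc n)
  obtain f' where f': "trig_poly f'" "\<forall>x. (f has_real_derivative f' x) (at x)"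
    using trig_poly_deriv[OF Suc.prems] by blast
  have "deriv f = f'" using f' by (auto intro!: ext DERIV_imp_deriv)
  then show ?case using Suc.IH[OF f'(1)] by (simp only: funpow_Suc_right o_def)
qed simp

lemma trig_poly_differentiable: "trig_poly f \<Longrightarrow> f differentiable_on UNIV"
  using trig_poly_deriv by (metis differentiable_at_imp_differentiable_on real_differentiable_def)

lemma trig_poly_continuous: "trig_poly f \<Longrightarrow> continuous_on A f"
  using trig_poly_differentiable differentiable_imp_continuous_on continuous_on_subset by blast

lemma trig_poly_periodic: "trig_poly f \<Longrightarrow> f (t + 2*pi) = f t"
proof (induction rule: trig_poly.induct)
  case (cos l)
  have "real l * (t + 2*pi) = real l * t + real l * (2 * pi)" by (simp add: algebra_simps)
  then show ?case unfolding cos_add by (simp add: cos_add)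
next
  case (sin l)
  have "real l * (t + 2*pi) = real l * t + real l * (2 * pi)" by (simp add: algebra_simps)
  then show ?case by (simp add: sin_add)
qed auto

lemma trig_poly_smooth: "trig_poly f \<Longrightarrow> smooth_periodic f"
  unfolding smooth_periodic_def
  using trig_poly_periodic trig_poly_differentiable trig_poly_deriv_iter by blast

lemma poly_cis_trig_poly:
  fixes g :: "complex \<Rightarrow> real"
  shows "real_polynomial_function g \<Longrightarrow> trig_poly (\<lambda>t. g (cis t))"
proof (induction rule: real_polynomial_function.induct)
  case (linear f)
  interpret bounded_linear f by fact
  have "f (cis t) = f 1 * cos (real 1 * t) + f \<i> * sin (real 1 * t)" for t
  proof -
    have "cis t = cos t *\<^sub>R 1 + sin t *\<^sub>R \<i>" by (simp add: complex_eq_iff)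
    then show ?thesis by (simp add: add scaleR)
  qed
  then show ?case by (simp only:) (intro trig_poly.intros)
qed (auto intro: trig_poly_const trig_poly.intros trig_poly_mult)

text \<open>
  Real polynomials in two variables restrict to trigonometric polynomials on the unit circle, so
  this is the Stone--Weierstrass theorem there.
\<close>

lemma trig_poly_approx_sphere:
  fixes g :: "complex \<Rightarrow> real"
  assumes "continuous_on (sphere 0 1) g" "\<epsilon> > 0"
  obtains h where "trig_poly h" "\<And>t. \<bar>g (cis t) - h t\<bar> < \<epsilon>"
proof -
  obtain p where "real_polynomial_function p" "\<And>x. x \<in> sphere 0 1 \<Longrightarrow> \<bar>g x - p x\<bar> < \<epsilon>"
    using Stone_Weierstrass_real_polynomial_function[OF _ assms] by auto
  then show thesis using that[of "\<lambda>t. p (cis t)"] poly_cis_trig_poly by auto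
qed

lemma periodic_cis_eq:
  assumes per: "\<And>t. f (t + 2*pi) = f (t::real)" and "cis a = cis b"
  shows "f a = f b"
proof -
  interpret periodic_fun_simple f "2*pi" by standard (rule per)
  obtain n :: int where "a = b + 2 * pi * n"
    using assms(2) sin_cos_eq_iff[of a b] unfolding complex_eq_iff by auto
  then show ?thesis using plus_of_int[of b n] by (simp add: mult_ac)
qed

lemma trig_poly_approx:
  fixes f :: "real \<Rightarrow> real"
  assumes cont: "continuous_on UNIV f" and per: "\<And>t. f (t + 2*pi) = f t" and "\<epsilon> > 0"
  obtains h where "trig_poly h" "\<And>t. \<bar>f t - h t\<bar> < \<epsilon>"
proof -
  define g where "g z = f (Arg2pi z)" for z
  have eq: "g z = f (Arg z)" if "z \<noteq> 0" for z
    unfolding g_def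
  proof (rule periodic_cis_eq[of f, OF per])
    show "cis (Arg2pi z) = cis (Arg z)"
      using that Arg2pi_eq[of z] cis_Arg[of z]
      by (metis Arg_eq cis_conv_exp exp_not_eq_zero mult_cancel_left norm_eq_zero of_real_eq_0_iff)
  qed
  have fc: "isCont f x" for x using cont by (simp add: continuous_on_eq_continuous_at)
  have "continuous (at z within sphere 0 1) g" if "z \<in> sphere 0 1" for z
  proof (cases "z \<in> \<real>\<^sub>\<ge>\<^sub>0")
    case False
    then have "isCont g z" unfolding g_def using continuous_at_Arg2pi fc by (metis isCont_o2)
    then show ?thesis by (simp add: continuous_at_imp_continuous_at_within)
  next
    case True
    moreover have "z \<noteq> 0" using that by auto
    ultimately have "z \<notin> \<real>\<^sub>\<le>\<^sub>0"
      by (auto simp: complex_nonneg_Reals_iff complex_nonpos_Reals_iff complex_eq_iff)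
    then have "isCont (\<lambda>z. f (Arg z)) z" using continuous_at_Arg fc by (metis isCont_o2)
    then have "continuous (at z within sphere 0 1) (\<lambda>z. f (Arg z))"
      by (simp add: continuous_at_imp_continuous_at_within)
    then show ?thesis
      by (rule continuous_transform_within[where \<delta>=1])
         (use that in \<open>auto intro!: eq[symmetric]\<close>)
  qed
  then have "continuous_on (sphere 0 1) g" by (simp add: continuous_on_eq_continuous_within)
  then obtain h where h: "trig_poly h" "\<And>t. \<bar>g (cis t) - h t\<bar> < \<epsilon>"
    using trig_poly_approx_sphere[OF _ \<open>\<epsilon> > 0\<close>] by blast
  have "g (cis t) = f t" for t
    unfolding g_def
    by (rule periodic_cis_eq[of f, OF per]) (metis Arg2pi_eq cis_conv_exp norm_cis mult_1 of_real_1)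
  then show thesis using h that by auto
qed

lemma trig_poly_isometry:
  assumes \<sigma>: "\<sigma> = 1 \<or> \<sigma> = -1"
  shows "trig_poly h \<Longrightarrow> avg (\<lambda>t. h (\<sigma> * t + c)) = avg h"
proof (induction rule: trig_poly.induct)
  case (cos l)
  have "cos (real l * (\<sigma> * t + c)) = cos (real l * c) * cos (real l * t) - (\<sigma> * sin (real l * c)) * sin (real l * t)" for t
    using \<sigma> by (auto simp: distrib_left cos_add)
  then show ?case by (simp add: avg_cos avg_sin)
next
  case (sin l)
  have "sin (real l * (\<sigma> * t + c)) = (\<sigma> * cos (real l * c)) * sin (real l * t) + sin (real l * c) * cos (real l * t)" for t
    using \<sigma> by (auto simp: distrib_left sin_add)
  then show ?case by (cases "l = 0") (simp_all add: avg_cos avg_sin)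
next
  case (add f g)
  have c: "continuous_on UNIV (\<lambda>t. f (\<sigma> * t + c))" "continuous_on UNIV (\<lambda>t. g (\<sigma> * t + c))"
    by (rule continuous_on_compose2[OF trig_poly_continuous[where A=UNIV]]; use add in \<open>auto intro!: continuous_intros\<close>)+
  have i: "integrable cm (\<lambda>t. f (\<sigma> * t + c))" "integrable cm (\<lambda>t. g (\<sigma> * t + c))" "integrable cm f" "integrable cm g"
    by (intro integrable_cm_continuous c trig_poly_continuous add)+
  then show ?case by (simp add: add.IH)
qed simp

text \<open>
  Rotations and reflections preserve the mean of trigonometric polynomials by inspection of the
  basis, hence that of continuous periodic functions by uniform approximation.
\<close>

lemma avg_isometry:
  fixes f :: "real \<Rightarrow> real"
  assumes \<sigma>: "\<sigma> = 1 \<or> \<sigma> = -1" and f: "continuous_on UNIV f" "\<And>t. f (t + 2*pi) = f t"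
  shows "avg (\<lambda>t. f (\<sigma> * t + c)) = avg f"
proof -
  have fc: "continuous_on UNIV (\<lambda>t. f (\<sigma> * t + c))" by (rule continuous_on_compose2[OF f(1)]) (auto intro!: continuous_intros)
  have "\<bar>avg (\<lambda>t. f (\<sigma> * t + c)) - avg f\<bar> \<le> 2 * e" if e: "e > 0" for e
  proof -
    obtain h where h: "trig_poly h" "\<And>t. \<bar>f t - h t\<bar> < e"
      using trig_poly_approx[OF f e] by blast
    have hc: "continuous_on UNIV h" "continuous_on UNIV (\<lambda>t. h (\<sigma> * t + c))"
      using trig_poly_continuous[OF h(1)] by (auto intro!: continuous_on_compose2[of UNIV h UNIV "\<lambda>t. \<sigma> * t + c"] continuous_intros)
    have "norm (avg (\<lambda>t. f (\<sigma> * t + c) - h (\<sigma> * t + c))) \<le> e" "norm (avg (\<lambda>t. f t - h t)) \<le> e"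
      by (rule avg_norm_le; use h(2) less_imp_le in auto)+
    then show ?thesis using trig_poly_isometry[OF \<sigma> h(1), of c] f(1) fc hc
      by (simp add: integrable_cm_continuous)
  qed
  from this[of "\<bar>avg (\<lambda>t. f (\<sigma> * t + c)) - avg f\<bar> / 4"] show ?thesis by (cases "avg (\<lambda>t. f (\<sigma> * t + c)) = avg f") auto
qed

section \<open>Uniqueness of Fourier modes\<close>

lemma ident_measurable_cm [measurable]: "(\<lambda>x. x) \<in> borel_measurable cm"
  by (rule measurable_cm_borel) simp

lemma trig_poly_orth:
  assumes f: "integrable cm (f :: real \<Rightarrow> real)"
    and z: "\<And>l. avg (\<lambda>t. f t * cos (real l * t)) = 0" "\<And>l. avg (\<lambda>t. f t * sin (real l * t)) = 0"
  shows "trig_poly g \<Longrightarrow> integrable cm (\<lambda>t. f t * g t) \<and> avg (\<lambda>t. f t * g t) = 0"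
proof (induction rule: trig_poly.induct)
  case (cos l)
  have "integrable cm (\<lambda>t. f t * cos (real l * t))"
    by (rule Bochner_Integration.integrable_bound[OF f])
       (use borel_measurable_integrable[OF f] in \<open>auto simp: abs_mult mult_left_le\<close>)
  then show ?case using z by simp
next
  case (sin l)
  have "integrable cm (\<lambda>t. f t * sin (real l * t))"
    by (rule Bochner_Integration.integrable_bound[OF f])
       (use borel_measurable_integrable[OF f] in \<open>auto simp: abs_mult mult_left_le\<close>)
  then show ?case using z by simp
next
  case (add g h)
  then show ?case by (simp add: algebra_simps)
next
  case (scale g c)
  then show ?case by (simp add: mult.left_commute)
qed

lemma continuous_orth:
  fixes f :: "real \<Rightarrow> real" and g :: "real \<Rightarrow> real"
  assumes f: "integrable cm f"
    and z: "\<And>l. avg (\<lambda>t. f t * cos (real l * t)) = 0" "\<And>l. avg (\<lambda>t. f t * sin (real l * t)) = 0"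
    and g: "g \<in> borel_measurable borel"
    and ap: "\<And>\<epsilon>. \<epsilon> > 0 \<Longrightarrow> \<exists>h. trig_poly h \<and> (\<forall>t. \<bar>g t - h t\<bar> < \<epsilon>)"
  shows "avg (\<lambda>t. f t * g t) = 0"
proof -
  define A where "A = avg (\<lambda>t. \<bar>f t\<bar>)"
  have A0: "A \<ge> 0" unfolding A_def by simp
  have "\<bar>avg (\<lambda>t. f t * g t)\<bar> \<le> \<epsilon>" if "\<epsilon> > 0" for \<epsilon>
  proof -
    define e where "e = \<epsilon> / (A + 1)"
    have e0: "e > 0" using that A0 by (simp add: e_def)
    then obtain h where h: "trig_poly h" "\<And>t. \<bar>g t - h t\<bar> < e" using ap by blast
    have hm: "h \<in> borel_measurable borel"
      by (intro borel_measurable_continuous_onI trig_poly_continuous h)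
    have fh: "integrable cm (\<lambda>t. f t * h t)" "avg (\<lambda>t. f t * h t) = 0"
      using trig_poly_orth[OF f z h(1)] by auto
    have fm: "f \<in> borel_measurable cm" using f by auto
    have gm: "g \<in> borel_measurable cm" "h \<in> borel_measurable cm" using g hm by auto
    have d: "integrable cm (\<lambda>t. f t * (g t - h t))"
    proof (rule Bochner_Integration.integrable_bound[where f="\<lambda>t. e * f t"])
      show "AE x in cm. norm (f x * (g x - h x)) \<le> norm (e * f x)"
        using h(2) e0 by (intro AE_I2) (simp add: abs_mult mult.commute[of e] mult_left_mono less_imp_le)
    qed (use f fm gm in auto)
    have "avg (\<lambda>t. f t * g t) = avg (\<lambda>t. f t * (g t - h t) + f t * h t)"
      by (simp add: algebra_simps)
    also have "\<dots> = avg (\<lambda>t. f t * (g t - h t))" using d fh by simp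
    finally have "\<bar>avg (\<lambda>t. f t * g t)\<bar> \<le> avg (\<lambda>t. \<bar>f t * (g t - h t)\<bar>)"
      using integral_abs_bound by metis
    also have "\<dots> \<le> avg (\<lambda>t. e * \<bar>f t\<bar>)"
    proof (rule integral_mono)
      show "integrable cm (\<lambda>t. \<bar>f t * (g t - h t)\<bar>)" using d by (rule integrable_abs)
      show "\<bar>f x * (g x - h x)\<bar> \<le> e * \<bar>f x\<bar>" for x
        using h(2)[of x] by (simp add: abs_mult mult.commute[of e] mult_left_mono less_imp_le)
    qed (use f in auto)
    also have "\<dots> = e * A" by (simp add: A_def)
    also have "\<dots> \<le> \<epsilon>" using A0 that by (simp add: e_def field_simps)
    finally show ?thesis .
  qed
  then show ?thesis by (metis abs_le_zero_iff dense_le_bounded le_less_linear less_le_not_le zero_less_abs_iff dense)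
qed

text \<open>
  The functions \<open>max 0 (1 - n d)\<close> of the distance \<open>d\<close> to an arc are
  continuous on the circle and decrease to the indicator of the arc.
\<close>

lemma modes_zero_interval:
  fixes f :: "real \<Rightarrow> real"
  assumes f: "integrable cm f"
    and z: "\<And>l. avg (\<lambda>t. f t * cos (real l * t)) = 0" "\<And>l. avg (\<lambda>t. f t * sin (real l * t)) = 0"
    and ab: "0 \<le> a" "a \<le> b" "b < 2*pi"
  shows "avg (\<lambda>t. f t * indicator {a..b} t) = 0"
proof -
  define C where "C = cis ` {a..b}"
  have C: "closed C" "C \<noteq> {}" unfolding C_def
    using ab by (auto intro!: compact_imp_closed compact_continuous_image continuous_intros)
  define g where "g n x = max 0 (1 - real n * infdist (cis x) C)" for n x
  have gc: "continuous_on A (g n)" for n A unfolding g_def[abs_def]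
    by (intro continuous_intros)
  have gm: "g n \<in> borel_measurable cm" for n
    using gc by (intro measurable_cm_borel borel_measurable_continuous_onI) auto
  have g01: "0 \<le> g n x" "g n x \<le> 1" for n x by (auto simp: g_def infdist_nonneg)
  have fm: "f \<in> borel_measurable cm" using f by auto
  have in_C: "cis x \<in> C \<longleftrightarrow> x \<in> {a..b}" if "x \<in> circle" for x
  proof
    assume "cis x \<in> C"
    then obtain y where y: "y \<in> {a..b}" "cis x = cis y" unfolding C_def by auto
    have "cos x = cos y" "sin x = sin y" using y(2) by (auto simp: complex_eq_iff)
    then obtain n :: int where n: "x = y + 2 * pi * n" using sin_cos_eq_iff[of x y] by blast
    have "\<bar>2 * pi * real_of_int n\<bar> < 2 * pi * 1" using that y ab n by auto
    then have "\<bar>real_of_int n\<bar> < 1" by (simp add: abs_mult)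
    then have "n = 0" by linarith
    then show "x \<in> {a..b}" using n y by simp
  qed (auto simp: C_def)
  have "avg (\<lambda>t. f t * g n t) = 0" for n
  proof (rule continuous_orth[OF f z])
    show "g n \<in> borel_measurable borel" using gc by (intro borel_measurable_continuous_onI)
    fix \<epsilon> :: real assume "\<epsilon> > 0"
    have "continuous_on (sphere 0 1) (\<lambda>z. max 0 (1 - real n * infdist z C))"
      by (intro continuous_intros)
    from trig_poly_approx_sphere[OF this \<open>\<epsilon> > 0\<close>]
    show "\<exists>h. trig_poly h \<and> (\<forall>t. \<bar>g n t - h t\<bar> < \<epsilon>)" unfolding g_def by metis
  qed
  moreover have "(\<lambda>n. avg (\<lambda>t. f t * g n t)) \<longlonglongrightarrow> avg (\<lambda>t. f t * indicator {a..b} t)"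
  proof (rule integral_dominated_convergence[where w="\<lambda>t. \<bar>f t\<bar>"])
    show "AE x in cm. (\<lambda>n. f x * g n x) \<longlonglongrightarrow> f x * indicator {a..b} x"
    proof (rule AE_I2)
      fix x assume "x \<in> space cm"
      then have x: "x \<in> circle" by simp
      have "(\<lambda>n. g n x) \<longlonglongrightarrow> indicator {a..b} x"
      proof (cases "x \<in> {a..b}")
        case True
        then have "infdist (cis x) C = 0" using in_C[OF x] C by simp
        then show ?thesis using True by (simp add: g_def)
      next
        case False
        then have "cis x \<notin> C" using in_C[OF x] by simp
        then have d: "infdist (cis x) C > 0" using C by (metis infdist_pos_not_in_closed)
        obtain N where N: "real N * infdist (cis x) C > 1" using d reals_Archimedean3 by blast
        have "g n x = 0" if "n \<ge> N" for n
        proof -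
          have "real N * infdist (cis x) C \<le> real n * infdist (cis x) C"
            using that d by (intro mult_right_mono) auto
          then show ?thesis using N by (simp add: g_def)
        qed
        then show ?thesis using False by (auto intro!: tendsto_eventually eventually_sequentiallyI)
      qed
      then show "(\<lambda>n. f x * g n x) \<longlonglongrightarrow> f x * indicator {a..b} x" by (intro tendsto_intros)
    qed
    show "AE x in cm. norm (f x * g n x) \<le> \<bar>f x\<bar>" for n
      using g01 by (auto simp: abs_mult mult_left_le)
    show "(\<lambda>t. f t * indicat_real {a..b} t) \<in> borel_measurable cm"
      by (intro borel_measurable_times fm measurable_cm_borel borel_measurable_indicator) auto
  qed (use f fm gm in auto)
  ultimately show ?thesis by (simp only: LIMSEQ_const_iff)
qed

text \<open>
  Orthogonality to arcs extends to all Borel sets because arcs generate them; testing on the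
  sets where \<open>f\<close> is positive or negative shows that both are null.
\<close>

proposition modes_zero_AE:
  fixes f :: "real \<Rightarrow> real"
  assumes f: "integrable cm f"
    and z: "\<And>l. avg (\<lambda>t. f t * cos (real l * t)) = 0" "\<And>l. avg (\<lambda>t. f t * sin (real l * t)) = 0"
  shows "AE t in cm. f t = 0"
proof -
  have fm [measurable]: "f \<in> borel_measurable cm" using f by auto
  have av0: "avg f = 0" using z(1)[of 0] by simp
  have fi: "integrable cm (\<lambda>x. f x * indicator A x)" if "A \<in> sets borel" for A :: "real set"
  proof (rule Bochner_Integration.integrable_bound[OF f])
    have "(indicator A :: real \<Rightarrow> real) \<in> borel_measurable cm"
      by (intro measurable_cm_borel borel_measurable_indicator that)
    then show "(\<lambda>x. f x * indicator A x) \<in> borel_measurable cm" by (intro borel_measurable_times fm)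
  qed (auto split: split_indicator)
  \<comment> \<open>Half-lines form an intersection-stable generator of the Borel sets.\<close>
  have main: "avg (\<lambda>x. f x * indicator A x) = 0" if "A \<in> sets borel" for A :: "real set"
  proof -
    have "Int_stable (range (\<lambda>a::real. {..a}))"
      by (auto simp: Int_stable_def)
    moreover have "range (\<lambda>a::real. {..a}) \<subseteq> Pow UNIV" by simp
    moreover have "A \<in> sigma_sets UNIV (range (\<lambda>a::real. {..a}))"
      using that by (subst (asm) borel_eq_atMost) simp
    ultimately show ?thesis
    proof (induction rule: sigma_sets_induct_disjoint[consumes 3, case_names basic empty compl union])
      case (basic A)
      then obtain a where A: "A = {..a}" by auto
      consider "a < 0" | "0 \<le> a" "a < 2*pi" | "2*pi \<le> a" by linarith
      then show ?case
      proof cases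
        case 1
        then have "avg (\<lambda>x. f x * indicator A x) = avg (\<lambda>_. 0)"
          by (intro Bochner_Integration.integral_cong) (auto simp: A)
        then show ?thesis by simp
      next
        case 2
        then have "avg (\<lambda>x. f x * indicator A x) = avg (\<lambda>x. f x * indicator {0..a} x)"
          by (intro Bochner_Integration.integral_cong) (auto simp: A indicator_def)
        then show ?thesis using modes_zero_interval[OF f z, of 0 a] 2 by simp
      next
        case 3
        then have "avg (\<lambda>x. f x * indicator A x) = avg f"
          by (intro Bochner_Integration.integral_cong) (auto simp: A indicator_def)
        then show ?thesis using av0 by simp
      qed
    next
      case (compl A)
      have A: "A \<in> sets borel" using compl.hyps by (subst borel_eq_atMost) simp
      have "avg (\<lambda>x. f x * indicator (UNIV - A) x) = avg (\<lambda>x. f x - f x * indicator A x)"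
        by (intro Bochner_Integration.integral_cong) (auto simp: indicator_def)
      also have "\<dots> = 0" using f fi[OF A] compl av0 by simp
      finally show ?case .
    next
      case (union A)
      have A: "A i \<in> sets borel" for i using union.hyps by (subst borel_eq_atMost) auto
      have "((\<lambda>i. avg (\<lambda>x. f x * indicator (\<Union>j<i. A j) x)) \<longlonglongrightarrow> avg (\<lambda>x. f x * indicator (\<Union>i. A i) x))"
      proof (rule integral_dominated_convergence[where w="\<lambda>x. \<bar>f x\<bar>"])
        show "AE x in cm. (\<lambda>i. f x * indicator (\<Union>j<i. A j) x) \<longlonglongrightarrow> f x * indicator (\<Union> (range A)) x"
          by (intro AE_I2 tendsto_intros LIMSEQ_indicator_UN)
        show "(\<lambda>x. f x * indicator (\<Union> (range A)) x) \<in> borel_measurable cm"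
          by (rule borel_measurable_integrable, rule fi) (use A in auto)
        show "(\<lambda>x. f x * indicator (\<Union>j<i. A j) x) \<in> borel_measurable cm" for i
          by (rule borel_measurable_integrable, rule fi) (use A in auto)
        show "AE x in cm. norm (f x * indicator (\<Union>j<i. A j) x) \<le> \<bar>f x\<bar>" for i
          by (intro AE_I2) (simp split: split_indicator)
      qed (rule integrable_abs[OF f])
      moreover have "avg (\<lambda>x. f x * indicator (\<Union>j<i. A j) x) = 0" for i
      proof -
        have "avg (\<lambda>x. f x * indicator (\<Union>j<i. A j) x) = avg (\<lambda>x. \<Sum>j<i. f x * indicator (A j) x)"
        proof (intro Bochner_Integration.integral_cong refl)
          fix x
          show "f x * indicator (\<Union>j<i. A j) x = (\<Sum>j<i. f x * indicator (A j) x)"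
            using union.hyps(1)
            by (subst indicator_UN_disjoint) (auto simp: sum_distrib_left disjoint_family_on_def)
        qed
        also have "\<dots> = 0" using fi A union.IH by (subst Bochner_Integration.integral_sum) auto
        finally show ?thesis .
      qed
      ultimately show ?case by (simp only: LIMSEQ_const_iff)
    qed simp
  qed
  have cmA: "avg (\<lambda>x. f x * indicator A x) = 0" if "A \<in> sets cm" for A
  proof -
    have "A \<in> sets borel" using that by (auto simp: sets_cm sets_restrict_space)
    then show ?thesis by (rule main)
  qed
  have pos: "AE x in cm. \<not> c * f x > 0" for c :: real
  proof -
    define A where "A = {x\<in>space cm. c * f x > 0}"
    have A: "A \<in> sets cm" unfolding A_def by measurable
    have fA: "integrable cm (\<lambda>x. f x * indicator A x)"
      by (rule fi) (use A in \<open>auto simp: sets_cm sets_restrict_space\<close>)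
    then have gi: "integrable cm (\<lambda>x. c * (f x * indicator A x))" by simp
    have "avg (\<lambda>x. c * (f x * indicator A x)) = 0" using cmA[OF A] by simp
    then have "AE x in cm. c * (f x * indicator A x) = 0"
      by (subst (asm) integral_nonneg_eq_0_iff_AE[OF gi]) (auto simp: A_def split: split_indicator)
    then show ?thesis using AE_space
    proof eventually_elim
      case (elim x)
      then show ?case by (auto simp: A_def split: split_indicator_asm)
    qed
  qed
  show ?thesis using pos[of 1] pos[of "-1"] by eventually_elim simp
qed

section \<open>Weak derivatives\<close>

lemma square_integrable_cm:
  "square_integrable f \<longleftrightarrow> f \<in> borel_measurable cm \<and> integrable cm (\<lambda>x. (f x)\<^sup>2)"
  by (simp add: square_integrable_def borel_measurable_cm_iff integrable_cm_iff)

lemma square_integrable_imp_integrable: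
  assumes "square_integrable f" shows "integrable cm f"
proof (rule Bochner_Integration.integrable_bound[where f="\<lambda>x. 1 + (f x)\<^sup>2"])
  show "AE x in cm. norm (f x) \<le> norm (1 + (f x)\<^sup>2)"
  proof (intro AE_I2)
    fix x
    have "0 \<le> (\<bar>f x\<bar> - 1)\<^sup>2" by simp
    also have "\<dots> = (f x)\<^sup>2 - 2 * \<bar>f x\<bar> + 1" by (simp add: power2_diff)
    finally show "norm (f x) \<le> norm (1 + (f x)\<^sup>2)" by simp
  qed
qed (use assms in \<open>auto simp: square_integrable_cm\<close>)

lemma integrable_mult_bounded:
  fixes f g :: "real \<Rightarrow> real"
  assumes "integrable cm f" "g \<in> borel_measurable cm" "\<And>x. \<bar>g x\<bar> \<le> B"
  shows "integrable cm (\<lambda>x. f x * g x)"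
proof (rule Bochner_Integration.integrable_bound[where f="\<lambda>x. B * f x"])
  have "B \<ge> 0" using assms(3)[of 0] by linarith
  then show "AE x in cm. norm (f x * g x) \<le> norm (B * f x)"
    using assms(3) by (intro AE_I2) (simp add: abs_mult mult.commute[of B] mult_left_mono)
qed (use assms in auto)

lemma periodic_bounded:
  fixes f :: "real \<Rightarrow> real"
  assumes "continuous_on UNIV f" "\<And>x. f (x + 2*pi) = f x"
  obtains B where "\<And>x. \<bar>f x\<bar> \<le> B" "B > 0"
proof -
  obtain h where h: "trig_poly h" "\<And>t. \<bar>f t - h t\<bar> < 1"
    using trig_poly_approx[OF assms zero_less_one] by blast
  have "\<exists>B. \<forall>x. \<bar>h x\<bar> \<le> B" using h(1)
  proof (induction rule: trig_poly.induct)
    case (add f g)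
    then obtain A B where "\<forall>x. \<bar>f x\<bar> \<le> A" "\<forall>x. \<bar>g x\<bar> \<le> B" by auto
    then show ?case by (intro exI[of _ "A + B"]) (meson abs_triangle_ineq add_mono order_trans)
  next
    case (scale f c)
    then obtain A where "\<forall>x. \<bar>f x\<bar> \<le> A" by auto
    then show ?case by (intro exI[of _ "\<bar>c\<bar> * A"]) (auto simp: abs_mult mult_left_mono)
  qed (auto intro: exI[of _ 1])
  then obtain B where B: "\<And>x. \<bar>h x\<bar> \<le> B" by auto
  have "B \<ge> 0" using B[of 0] by linarith
  moreover have "\<bar>f x\<bar> \<le> B + 1" for x using h(2)[of x] B[of x] by linarith
  ultimately show thesis using that[of "B + 1"] by auto
qed

lemma weak_deriv_avg:
  assumes "weak_deriv p q" "smooth_periodic \<phi>"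
  shows "avg (\<lambda>t. p t * deriv \<phi> t) = - avg (\<lambda>t. q t * \<phi> t)"
proof -
  have "2 * pi * avg (\<lambda>t. p t * deriv \<phi> t) = 2 * pi * (- avg (\<lambda>t. q t * \<phi> t))"
    using assms unfolding weak_deriv_def LINT_eq_avg by (metis mult_minus_right)
  then show ?thesis by (simp only: mult_cancel_left) simp
qed

lemma smooth_periodicD:
  assumes "smooth_periodic \<phi>"
  shows "(\<phi> has_real_derivative deriv \<phi> x) (at x)" "continuous_on A (deriv \<phi>)"
    "\<phi> (x + 2 * pi) = \<phi> x" "continuous_on A \<phi>"
proof -
  have "(deriv ^^ 0) \<phi> differentiable_on UNIV" "(deriv ^^ 1) \<phi> differentiable_on UNIV"
    using assms unfolding smooth_periodic_def by blast+
  then have d: "\<phi> differentiable_on UNIV" "deriv \<phi> differentiable_on UNIV" by auto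
  show "(\<phi> has_real_derivative deriv \<phi> x) (at x)"
    using d(1) by (metis DERIV_deriv_iff_real_differentiable UNIV_I differentiable_on_def)
  show "continuous_on A (deriv \<phi>)" "continuous_on A \<phi>"
    using d differentiable_imp_continuous_on continuous_on_subset by blast+
  show "\<phi> (x + 2 * pi) = \<phi> x" using assms by (simp add: smooth_periodic_def)
qed

lemma square_integrable_continuous:
  assumes "continuous_on UNIV f" shows "square_integrable f"
  unfolding square_integrable_cm
  by (auto intro!: measurable_cm_borel borel_measurable_continuous_onI integrable_cm_continuous continuous_intros assms)

lemma weak_deriv_C1:
  assumes "\<And>x. (f has_real_derivative f' x) (at x)" "continuous_on UNIV f'" "f (2*pi) = f 0"
  shows "weak_deriv f f'"
  unfolding weak_deriv_def LINT_eq_avg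
proof (intro conjI allI impI)
  show "square_integrable f" "square_integrable f'"
    using assms continuous_on_UNIV_deriv by (blast intro: square_integrable_continuous)+
  fix \<phi> assume p: "smooth_periodic \<phi>"
  have "avg (\<lambda>x. f x * deriv \<phi> x) = - avg (\<lambda>x. f' x * \<phi> x)"
    by (rule avg_by_parts) (use assms smooth_periodicD[OF p] smooth_periodicD(3)[OF p, of 0] in auto)
  then show "2 * pi * avg (\<lambda>x. f x * deriv \<phi> x) = - (2 * pi * avg (\<lambda>x. f' x * \<phi> x))" by simp
qed

lemma weak_deriv_cong:
  assumes "weak_deriv g q" "f \<in> borel_measurable cm" "AE x in cm. f x = g x"
  shows "weak_deriv f q"
proof -
  have gm: "g \<in> borel_measurable cm" and gi: "integrable cm (\<lambda>x. (g x)\<^sup>2)"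
    using assms by (auto simp: weak_deriv_def square_integrable_cm)
  have "integrable cm (\<lambda>x. (f x)\<^sup>2)"
    by (subst integrable_cong_AE[where g="\<lambda>x. (g x)\<^sup>2"]) (use assms gm gi in auto)
  then have 1: "square_integrable f" using assms(2) by (simp add: square_integrable_cm)
  have 2: "avg (\<lambda>x. f x * deriv \<phi> x) = avg (\<lambda>x. g x * deriv \<phi> x)" if "smooth_periodic \<phi>" for \<phi>
  proof (rule integral_cong_AE)
    have "deriv \<phi> \<in> borel_measurable cm"
      by (intro measurable_cm_borel borel_measurable_continuous_onI smooth_periodicD(2)[OF that])
    then show "(\<lambda>x. f x * deriv \<phi> x) \<in> borel_measurable cm" "(\<lambda>x. g x * deriv \<phi> x) \<in> borel_measurable cm"
      using assms(2) gm by auto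
  qed (use assms(3) in auto)
  show ?thesis using assms(1) 1 2 unfolding weak_deriv_def LINT_eq_avg by simp
qed

lemma weak_deriv_unique:
  assumes "weak_deriv p q" "weak_deriv p q'"
  shows "AE x in cm. q x = q' x"
proof -
  have i: "integrable cm q" "integrable cm q'"
    using assms by (auto simp: weak_deriv_def intro: square_integrable_imp_integrable)
  have *: "avg (\<lambda>t. (q t - q' t) * h t) = 0" if "trig_poly h" for h
  proof -
    have s: "smooth_periodic h" using that by (rule trig_poly_smooth)
    obtain B where "\<And>x. \<bar>h x\<bar> \<le> B"
      using periodic_bounded[OF smooth_periodicD(4)[OF s] smooth_periodicD(3)[OF s]] by blast
    then have "integrable cm (\<lambda>x. q x * h x)" "integrable cm (\<lambda>x. q' x * h x)"
      using i by (auto intro!: integrable_mult_bounded measurable_cm_borel borel_measurable_continuous_onI smooth_periodicD(4)[OF s])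
    moreover have "avg (\<lambda>x. q x * h x) = avg (\<lambda>x. q' x * h x)"
      using weak_deriv_avg[OF assms(1) s] weak_deriv_avg[OF assms(2) s] by simp
    ultimately show ?thesis by (simp add: left_diff_distrib)
  qed
  have "AE x in cm. q x - q' x = 0"
    by (rule modes_zero_AE) (use i in \<open>auto intro!: * trig_poly.intros\<close>)
  then show ?thesis by simp
qed

text \<open>
  Testing with sines and cosines annihilates all modes of the function minus its mean.
\<close>

lemma weak_deriv_zero:
  assumes "weak_deriv p (\<lambda>_. 0)"
  shows "AE x in cm. p x = avg p"
proof -
  have p: "integrable cm p"
    using assms by (auto simp: weak_deriv_def intro: square_integrable_imp_integrable)
  have pm: "integrable cm (\<lambda>x. p x * cos (real l * x))" "integrable cm (\<lambda>x. p x * sin (real l * x))" for l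
    by (rule integrable_mult_bounded[where B=1]; use p in auto)+
  have c: "avg (\<lambda>x. p x * cos (real l * x)) = 0" if "l \<noteq> 0" for l
  proof -
    have s: "smooth_periodic (\<lambda>x. (1 / real l) * sin (real l * x))"
      by (intro trig_poly_smooth trig_poly.intros)
    have "deriv (\<lambda>x. (1 / real l) * sin (real l * x)) = (\<lambda>x. cos (real l * x))"
      by (rule ext, rule DERIV_imp_deriv) (use that in \<open>auto intro!: derivative_eq_intros\<close>)
    then show ?thesis using weak_deriv_avg[OF assms s] by simp
  qed
  have s: "avg (\<lambda>x. p x * sin (real l * x)) = 0" for l
  proof (cases "l = 0")
    case False
    have s: "smooth_periodic (\<lambda>x. (- 1 / real l) * cos (real l * x))"
      by (intro trig_poly_smooth trig_poly.intros)
    have "deriv (\<lambda>x. (- 1 / real l) * cos (real l * x)) = (\<lambda>x. sin (real l * x))"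
      by (rule ext, rule DERIV_imp_deriv) (use False in \<open>auto intro!: derivative_eq_intros\<close>)
    then show ?thesis using weak_deriv_avg[OF assms s] by simp
  qed simp
  have "AE x in cm. p x - avg p = 0"
  proof (rule modes_zero_AE)
    show "avg (\<lambda>x. (p x - avg p) * cos (real l * x)) = 0" for l
      using c[of l] pm by (cases "l = 0") (simp_all add: left_diff_distrib avg_cos p)
    show "avg (\<lambda>x. (p x - avg p) * sin (real l * x)) = 0" for l
      using s[of l] pm by (simp add: left_diff_distrib avg_sin)
  qed (use p in auto)
  then show ?thesis by simp
qed

lemma trig_poly_antideriv:
  "trig_poly h \<Longrightarrow> \<exists>c G. trig_poly G \<and> (\<forall>x. (G has_real_derivative h x - c) (at x))"
proof (induction rule: trig_poly.induct)
  case (cos l)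
  show ?case
  proof (cases "l = 0")
    case True
    then show ?thesis
      by (intro exI[of _ 1] exI[of _ "\<lambda>_. 0"]) (auto intro: trig_poly_const)
  next
    case False
    have "trig_poly (\<lambda>x. (1 / real l) * sin (real l * x))" by (intro trig_poly.intros)
    with False show ?thesis
      by (intro exI[of _ 0] exI[of _ "\<lambda>x. (1 / real l) * sin (real l * x)"]) (auto intro!: derivative_eq_intros)
  qed
next
  case (sin l)
  have "trig_poly (\<lambda>x. (- 1 / real l) * cos (real l * x))" by (intro trig_poly.intros)
  then show ?case
    by (intro exI[of _ 0] exI[of _ "\<lambda>x. (- 1 / real l) * cos (real l * x)"])
       (cases "l = 0"; auto intro!: derivative_eq_intros)
next
  case (add f g)
  then obtain c d F G where *: "trig_poly F" "\<forall>x. (F has_real_derivative f x - c) (at x)"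
    "trig_poly G" "\<forall>x. (G has_real_derivative g x - d) (at x)" by blast
  then show ?case
    by (intro exI[of _ "c + d"] exI[of _ "\<lambda>x. F x + G x"])
       (auto intro!: derivative_eq_intros trig_poly.add)
next
  case (scale f a)
  then obtain c F where *: "trig_poly F" "\<forall>x. (F has_real_derivative f x - c) (at x)" by blast
  then show ?case
    by (intro exI[of _ "a * c"] exI[of _ "\<lambda>x. a * F x"])
       (auto intro!: derivative_eq_intros trig_poly.scale simp: algebra_simps)
qed

text \<open>
  The test functions of the definition are smooth, whereas exponentials of potentials are only
  known to be \<open>C\<^sup>1\<close> here. Antiderivatives of trigonometric approximations of
  \<open>\<phi>'\<close> are smooth test functions that converge to \<open>\<phi>\<close>
  together with their derivatives.
\<close>

lemma weak_deriv_test_C1: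
  assumes w: "weak_deriv p q"
    and d: "\<And>x. (\<phi> has_real_derivative \<phi>' x) (at x)" and c: "continuous_on UNIV \<phi>'"
    and per: "\<And>x. \<phi> (x + 2*pi) = \<phi> x"
  shows "avg (\<lambda>x. p x * \<phi>' x) = - avg (\<lambda>x. q x * \<phi> x)"
proof -
  have i: "integrable cm p" "integrable cm q"
    using w by (auto simp: weak_deriv_def intro: square_integrable_imp_integrable)
  have per': "\<phi>' (x + 2*pi) = \<phi>' x" for x
  proof -
    have "((\<lambda>x. \<phi> (x + 2*pi)) has_real_derivative \<phi>' (x + 2*pi)) (at x)"
      using DERIV_at_within_shift[of \<phi> "\<phi>' (x+2*pi)" "2*pi" x UNIV] d[of "x+2*pi"] by (simp add: add.commute)
    then show ?thesis using d[of x] per DERIV_unique by auto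
  qed
  have phic: "continuous_on UNIV \<phi>" using d by (rule continuous_on_UNIV_deriv)
  obtain B where B: "\<And>x. \<bar>\<phi> x\<bar> \<le> B" using periodic_bounded[OF phic per] by blast
  obtain B' where B': "\<And>x. \<bar>\<phi>' x\<bar> \<le> B'" using periodic_bounded[OF c per'] by blast
  have av0: "avg \<phi>' = 0" by (rule avg_deriv_periodic[OF d c]) (use per[of 0] in simp)
  have phim: "\<phi> \<in> borel_measurable cm" "\<phi>' \<in> borel_measurable cm"
    using phic c by (auto intro!: measurable_cm_borel borel_measurable_continuous_onI)
  define K where "K = 2 * avg (\<lambda>x. \<bar>p x\<bar>) + 2 * (2*pi) * avg (\<lambda>x. \<bar>q x\<bar>)"
  have K0: "K \<ge> 0" unfolding K_def by simp
  define D where "D = avg (\<lambda>x. p x * \<phi>' x) + avg (\<lambda>x. q x * \<phi> x)"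
  have key: "\<bar>D\<bar> \<le> K * e" if e: "e > 0" for e
  proof -
    obtain h where h: "trig_poly h" "\<And>x. \<bar>\<phi>' x - h x\<bar> < e"
      using trig_poly_approx[OF c per' e] by blast
    have hc: "continuous_on A h" for A by (rule trig_poly_continuous[OF h(1)])
    obtain m G1 where G1: "trig_poly G1" "\<And>x. (G1 has_real_derivative h x - m) (at x)"
      using trig_poly_antideriv[OF h(1)] by blast
    define g where "g x = h x + (- m)" for x
    have g: "trig_poly g" unfolding g_def[abs_def] by (intro trig_poly.add h trig_poly_const)
    have gc: "continuous_on A g" for A by (rule trig_poly_continuous[OF g])
    define G where "G x = G1 x + (\<phi> 0 - G1 0)" for x
    have tG: "trig_poly G" unfolding G_def[abs_def] by (intro trig_poly.add G1 trig_poly_const)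
    have G: "(G has_real_derivative g x) (at x)" for x
      unfolding G_def g_def by (auto intro!: derivative_eq_intros G1)
    have Gper: "G (x + 2*pi) = G x" for x by (rule trig_poly_periodic[OF tG])
    have "\<bar>m\<bar> \<le> e"
    proof -
      have "avg g = 0" by (rule avg_deriv_periodic[OF G gc]) (use Gper[of 0] in simp)
      then have m: "m = avg h" unfolding g_def
        by (subst (asm) Bochner_Integration.integral_add) (auto intro!: integrable_cm_continuous hc)
      have "avg (\<lambda>x. \<phi>' x - h x) = - m"
        unfolding m using av0 by (subst Bochner_Integration.integral_diff) (auto intro!: integrable_cm_continuous c hc)
      moreover have "norm (avg (\<lambda>x. \<phi>' x - h x)) \<le> e"
        by (rule avg_norm_le) (use h(2) less_imp_le in auto)
      ultimately show ?thesis by simp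
    qed
    then have ge: "\<bar>\<phi>' x - g x\<bar> \<le> 2 * e" for x using h(2)[of x] unfolding g_def by linarith
    have dG: "deriv G = g" using G by (auto intro!: ext DERIV_imp_deriv)
    have "smooth_periodic G" by (rule trig_poly_smooth[OF tG])
    then have wG: "avg (\<lambda>x. p x * g x) = - avg (\<lambda>x. q x * G x)"
      using weak_deriv_avg[OF w] dG by metis
    have GG: "\<bar>\<phi> x - G x\<bar> \<le> 2 * (2*pi) * e" if "x \<in> circle" for x
    proof -
      have "norm ((\<phi> x - G x) - (\<phi> 0 - G 0)) \<le> (2 * e) * norm (x - 0)"
      proof (rule field_differentiable_bound[of UNIV _ "\<lambda>x. \<phi>' x - g x"])
        show "((\<lambda>x. \<phi> x - G x) has_field_derivative \<phi>' z - g z) (at z within UNIV)" for z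
          by (intro derivative_intros d G)
      qed (use ge in auto)
      also have "\<dots> \<le> (2*e) * (2*pi)" using that e by (intro mult_left_mono) auto
      finally show ?thesis by (simp add: G_def mult_ac)
    qed
    have Gc: "continuous_on UNIV G" using G by (rule continuous_on_UNIV_deriv)
    obtain BG where BG: "\<And>x. \<bar>G x\<bar> \<le> BG" using periodic_bounded[OF Gc Gper] by blast
    obtain Bg where Bg: "\<And>x. \<bar>g x\<bar> \<le> Bg" using periodic_bounded[OF gc trig_poly_periodic[OF g]] by blast
    have gm: "g \<in> borel_measurable cm" "G \<in> borel_measurable cm"
      using Gc gc by (auto intro!: measurable_cm_borel borel_measurable_continuous_onI)
    have ii: "integrable cm (\<lambda>x. p x * \<phi>' x)" "integrable cm (\<lambda>x. q x * \<phi> x)"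
      "integrable cm (\<lambda>x. p x * g x)" "integrable cm (\<lambda>x. q x * G x)"
      using integrable_mult_bounded[OF i(1) phim(2) B'] integrable_mult_bounded[OF i(2) phim(1) B]
        integrable_mult_bounded[OF i(1) gm(1) Bg] integrable_mult_bounded[OF i(2) gm(2) BG] by auto
    have "D = avg (\<lambda>x. p x * (\<phi>' x - g x)) + avg (\<lambda>x. q x * (\<phi> x - G x))"
      unfolding D_def using wG ii by (simp add: right_diff_distrib)
    also have "\<bar>\<dots>\<bar> \<le> avg (\<lambda>x. \<bar>p x * (\<phi>' x - g x)\<bar>) + avg (\<lambda>x. \<bar>q x * (\<phi> x - G x)\<bar>)"
      by (rule order_trans[OF abs_triangle_ineq add_mono[OF integral_abs_bound integral_abs_bound]])
    also have "\<dots> \<le> avg (\<lambda>x. (2*e) * \<bar>p x\<bar>) + avg (\<lambda>x. (2 * (2*pi) * e) * \<bar>q x\<bar>)"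
    proof (intro add_mono integral_mono)
      show "\<bar>p x * (\<phi>' x - g x)\<bar> \<le> 2 * e * \<bar>p x\<bar>" for x
        using mult_left_mono[OF ge[of x], of "\<bar>p x\<bar>"] by (simp add: abs_mult mult_ac)
      show "\<bar>q x * (\<phi> x - G x)\<bar> \<le> 2 * (2 * pi) * e * \<bar>q x\<bar>" if "x \<in> space cm" for x
        using mult_left_mono[OF GG[of x], of "\<bar>q x\<bar>"] that by (simp add: abs_mult mult_ac)
    qed (use ii i in \<open>auto simp: right_diff_distrib\<close>)
    also have "\<dots> = K * e" unfolding K_def by (simp add: algebra_simps)
    finally show ?thesis .
  qed
  have "D = 0"
  proof (rule ccontr)
    assume "D \<noteq> 0"
    then have "\<bar>D\<bar> \<le> K * (\<bar>D\<bar> / (2 * (K + 1)))" using K0 by (intro key) auto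
    then have "\<bar>D\<bar> * (2 * (K + 1)) \<le> K * \<bar>D\<bar>" using K0 by (simp add: pos_le_divide_eq)
    then have "\<bar>D\<bar> * (K + 2) \<le> 0" by (simp add: algebra_simps)
    then show False using \<open>D \<noteq> 0\<close> K0 by (simp add: mult_le_0_iff)
  qed
  then show ?thesis by (simp add: D_def)
qed

section \<open>The Sobolev norm\<close>

lemma H1_norm_le:
  assumes fm: "f \<in> borel_measurable cm" and fg: "AE x in cm. f x = g x"
    and g: "\<And>x. (g has_real_derivative g' x) (at x)" "continuous_on UNIV g'" "g (2*pi) = g 0"
    and b: "\<And>x. \<bar>g x\<bar> \<le> B" "\<And>x. \<bar>g' x\<bar> \<le> B"
  shows "H1_norm f \<le> ennreal (4 * B)"
proof -
  have B0: "B \<ge> 0" using b(1)[of 0] by linarith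
  have w: "weak_deriv f g'" by (rule weak_deriv_cong[OF weak_deriv_C1[OF g] fm fg])
  define q where "q = (SOME q. weak_deriv f q)"
  have q: "weak_deriv f q" unfolding q_def using w by (rule someI[of "weak_deriv f"])
  have qm: "q \<in> borel_measurable cm" using q by (auto simp: weak_deriv_def square_integrable_cm)
  have ae: "AE x in cm. q x = g' x" by (rule weak_deriv_unique[OF q w])
  have gc: "continuous_on UNIV g" using g(1) by (rule continuous_on_UNIV_deriv)
  have "avg (\<lambda>x. (f x)\<^sup>2 + (q x)\<^sup>2) = avg (\<lambda>x. (g x)\<^sup>2 + (g' x)\<^sup>2)"
  proof (rule integral_cong_AE)
    show "AE x in cm. (f x)\<^sup>2 + (q x)\<^sup>2 = (g x)\<^sup>2 + (g' x)\<^sup>2" using fg ae by eventually_elim simp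
    show "(\<lambda>x. (g x)\<^sup>2 + (g' x)\<^sup>2) \<in> borel_measurable cm"
      by (intro measurable_cm_borel borel_measurable_continuous_onI continuous_intros gc g)
  qed (use fm qm in auto)
  also have "\<dots> \<le> 2 * B\<^sup>2"
  proof -
    have "norm (avg (\<lambda>x. (g x)\<^sup>2 + (g' x)\<^sup>2)) \<le> 2 * B\<^sup>2"
    proof (rule avg_norm_le)
      fix x
      have "(g x)\<^sup>2 \<le> B\<^sup>2" "(g' x)\<^sup>2 \<le> B\<^sup>2" using b B0 by (metis abs_le_square_iff abs_of_nonneg)+
      then show "norm ((g x)\<^sup>2 + (g' x)\<^sup>2) \<le> 2 * B\<^sup>2" by simp
    qed
    then show ?thesis by simp
  qed
  finally have "(LINT t:circle|lborel. (f t)\<^sup>2 + (q t)\<^sup>2) \<le> 2 * pi * (2 * B\<^sup>2)"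
    unfolding LINT_eq_avg by (intro mult_left_mono) auto
  also have "\<dots> \<le> 16 * B\<^sup>2"
    using pi_less_4 mult_right_mono[of pi 4 "B\<^sup>2"] by simp
  also have "\<dots> = (4 * B)\<^sup>2" by (simp add: power2_eq_square)
  finally have "sqrt (LINT t:circle|lborel. (f t)\<^sup>2 + (q t)\<^sup>2) \<le> 4 * B"
    using B0 by (metis real_sqrt_le_mono abs_of_nonneg mult_nonneg_nonneg real_sqrt_abs zero_le_numeral)
  moreover have "in_H1 f" using w by (auto simp: in_H1_def)
  ultimately show ?thesis
    unfolding H1_norm_def Let_def q_def[symmetric] using B0 by (auto intro!: ennreal_leI)
qed

text \<open>
  By the Cauchy--Schwarz inequality smallness in \<open>H\<^sup>1\<close> implies smallness in
  mean, which is the form in which closeness to the uniform density is used.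
\<close>

lemma H1_norm_less_imp:
  assumes "H1_norm f < ennreal \<epsilon>"
  shows "square_integrable f" "avg (\<lambda>x. \<bar>f x\<bar>) \<le> \<epsilon>"
proof -
  have in_H1: "in_H1 f" using assms by (auto simp: H1_norm_def split: if_splits)
  define q where "q = (SOME q. weak_deriv f q)"
  have q: "weak_deriv f q" using in_H1 unfolding q_def in_H1_def by (rule someI_ex)
  show sf: "square_integrable f" using q by (simp add: weak_deriv_def)
  have fi: "integrable cm f" by (rule square_integrable_imp_integrable[OF sf])
  have f2: "integrable cm (\<lambda>x. (f x)\<^sup>2)" "integrable cm (\<lambda>x. (q x)\<^sup>2)"
    using q by (auto simp: weak_deriv_def square_integrable_cm)
  have less: "ennreal (sqrt (LINT t:circle|lborel. (f t)\<^sup>2 + (q t)\<^sup>2)) < ennreal \<epsilon>"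
    using assms in_H1 unfolding H1_norm_def Let_def q_def by simp
  then have e0: "\<epsilon> > 0"
    by (metis ennreal_less_zero_iff ennreal_neg not_less_zero not_le_imp_less)
  have "sqrt (2 * pi * avg (\<lambda>t. (f t)\<^sup>2 + (q t)\<^sup>2)) < \<epsilon>"
    using less unfolding LINT_eq_avg by (subst (asm) ennreal_less_iff) auto
  moreover have "sqrt (avg (\<lambda>t. (f t)\<^sup>2)) \<le> sqrt (2 * pi * avg (\<lambda>t. (f t)\<^sup>2 + (q t)\<^sup>2))"
  proof (rule real_sqrt_le_mono)
    have "avg (\<lambda>t. (f t)\<^sup>2) \<le> avg (\<lambda>t. (f t)\<^sup>2 + (q t)\<^sup>2)"
      by (rule integral_mono) (use f2 in auto)
    also have "\<dots> \<le> (2 * pi) * avg (\<lambda>t. (f t)\<^sup>2 + (q t)\<^sup>2)"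
    proof -
      have "1 * avg (\<lambda>t. (f t)\<^sup>2 + (q t)\<^sup>2) \<le> (2 * pi) * avg (\<lambda>t. (f t)\<^sup>2 + (q t)\<^sup>2)"
        by (rule mult_right_mono) (use pi_ge_two in auto)
      then show ?thesis by linarith
    qed
    finally show "avg (\<lambda>t. (f t)\<^sup>2) \<le> 2 * pi * avg (\<lambda>t. (f t)\<^sup>2 + (q t)\<^sup>2)" .
  qed
  moreover have "avg (\<lambda>x. \<bar>f x\<bar>) \<le> sqrt (avg (\<lambda>t. (f t)\<^sup>2))"
  proof (rule real_le_rsqrt)
    define m where "m = avg (\<lambda>x. \<bar>f x\<bar>)"
    have "0 \<le> avg (\<lambda>x. (\<bar>f x\<bar> - m)\<^sup>2)" by (rule Bochner_Integration.integral_nonneg) simp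
    also have "\<dots> = avg (\<lambda>x. (f x)\<^sup>2 - 2 * m * \<bar>f x\<bar> + m\<^sup>2)"
      by (simp add: power2_diff algebra_simps)
    also have "\<dots> = avg (\<lambda>x. (f x)\<^sup>2) - 2 * m * m + m\<^sup>2"
      using fi f2 by (simp add: m_def)
    finally show "(avg (\<lambda>x. \<bar>f x\<bar>))\<^sup>2 \<le> avg (\<lambda>t. (f t)\<^sup>2)"
      unfolding m_def[symmetric] by (simp add: power2_eq_square)
  qed
  ultimately show "avg (\<lambda>x. \<bar>f x\<bar>) \<le> \<epsilon>" by linarith
qed

section \<open>Modified Bessel functions\<close>

text \<open>
  Termwise averaging of a series that is dominated by a summable multiple of one integrable
  function.
\<close>

lemma avg_sums:
  fixes f :: "nat \<Rightarrow> real \<Rightarrow> 'a::{banach, second_countable_topology}"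
  assumes fm: "\<And>n. f n \<in> borel_measurable cm" and h: "integrable cm (h :: real \<Rightarrow> real)"
    and b: "\<And>n x. norm (f n x) \<le> M n * h x" and M: "summable M" "\<And>n. M n \<ge> 0"
    and s: "\<And>x. (\<lambda>n. f n x) sums g x"
  shows "(\<lambda>n. avg (f n)) sums avg g" "integrable cm g"
proof -
  have h0: "M n * h x \<ge> 0" for n x using b[of n x] norm_ge_zero order_trans by blast
  have fi: "integrable cm (f n)" for n
  proof (rule Bochner_Integration.integrable_bound)
    show "integrable cm (\<lambda>x. M n * h x)" using h by simp
    show "AE x in cm. norm (f n x) \<le> norm (M n * h x)" using b h0 by (intro AE_I2) simp
  qed (rule fm)
  have gm: "g \<in> borel_measurable cm"
  proof (rule borel_measurable_LIMSEQ_metric)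
    show "(\<lambda>x. \<Sum>n<N. f n x) \<in> borel_measurable cm" for N using fm by (intro borel_measurable_sum)
    show "(\<lambda>N. \<Sum>n<N. f n x) \<longlonglongrightarrow> g x" for x using s[of x] by (simp add: sums_def)
  qed
  have sm: "(\<Sum>n<N. M n) \<le> suminf M" for N by (rule sum_le_suminf) (use M in auto)
  define h' where "h' x = \<bar>h x\<bar>" for x
  have bb: "norm (\<Sum>n<N. f n x) \<le> suminf M * \<bar>h x\<bar>" for N x
  proof -
    have "norm (\<Sum>n<N. f n x) \<le> (\<Sum>n<N. M n * h x)"
      by (rule order_trans[OF norm_sum sum_mono[OF b]])
    also have "\<dots> \<le> (\<Sum>n<N. M n) * \<bar>h x\<bar>" unfolding sum_distrib_right
      by (intro sum_mono mult_left_mono) (use M in auto)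
    also have "\<dots> \<le> suminf M * \<bar>h x\<bar>" by (intro mult_right_mono sm) simp
    finally show ?thesis .
  qed
  have "(\<lambda>N. avg (\<lambda>x. \<Sum>n<N. f n x)) \<longlonglongrightarrow> avg g" and i: "integrable cm g"
  proof -
    have 1: "AE x in cm. (\<lambda>N. \<Sum>n<N. f n x) \<longlonglongrightarrow> g x" using s by (simp add: sums_def)
    have 2: "integrable cm (\<lambda>x. suminf M * \<bar>h x\<bar>)" using h by simp
    have 3: "(\<lambda>x. \<Sum>n<N. f n x) \<in> borel_measurable cm" for N using fm by (intro borel_measurable_sum)
    have 4: "AE x in cm. norm (\<Sum>n<N. f n x) \<le> suminf M * \<bar>h x\<bar>" for N using bb by (intro AE_I2)
    show "(\<lambda>N. avg (\<lambda>x. \<Sum>n<N. f n x)) \<longlonglongrightarrow> avg g"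
      by (rule integral_dominated_convergence[OF gm 3 2 1 4])
    show "integrable cm g" by (rule integrable_dominated_convergence[OF gm 3 2 1 4])
  qed
  then show "(\<lambda>n. avg (f n)) sums avg g" "integrable cm g" using fi by (simp_all add: sums_def)
qed

lemma avg_sums_bounded:
  fixes f :: "nat \<Rightarrow> real \<Rightarrow> 'a::{banach, second_countable_topology}"
  assumes "\<And>n. f n \<in> borel_measurable cm" "\<And>n x. norm (f n x) \<le> M n" "summable M"
    "\<And>x. (\<lambda>n. f n x) sums g x"
  shows "(\<lambda>n. avg (f n)) sums avg g" "integrable cm g"
proof -
  have "M n \<ge> 0" for n using assms(2)[of n 0] norm_ge_zero order_trans by blast
  then show "(\<lambda>n. avg (f n)) sums avg g" "integrable cm g"
    using avg_sums[of f "\<lambda>_. 1" M g] assms by auto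
qed

lemma bessel_I_avg: "bessel_I l x = avg (\<lambda>t. exp (x * cos t) * cos (real l * t))"
  unfolding bessel_I_def avg_eq ..

lemma integrable_expcos [simp]: "integrable cm (\<lambda>t. exp (x * cos t) * cos (real l * t))"
  by (intro integrable_cm_continuous continuous_intros)

lemma bessel_by_parts:
  "real l * bessel_I l x = x * avg (\<lambda>t. exp (x * cos t) * (sin t * sin (real l * t)))"
proof -
  have "avg (\<lambda>t. exp (x * cos t) * (real l * cos (real l * t))) =
     - avg (\<lambda>t. (- x * sin t * exp (x * cos t)) * sin (real l * t))"
    by (rule avg_by_parts) (auto intro!: derivative_eq_intros continuous_intros)
  also have "\<dots> = avg (\<lambda>t. x * (exp (x * cos t) * (sin t * sin (real l * t))))"
    by (subst integral_minus[symmetric]) (simp add: mult_ac)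
  also have "avg (\<lambda>t. exp (x * cos t) * (real l * cos (real l * t))) = real l * bessel_I l x"
    unfolding bessel_I_avg by (subst integral_mult_right_zero[symmetric]) (simp add: mult_ac)
  finally show ?thesis by simp
qed

text \<open>
  The product formula for sines turns integration by parts into the three-term recursion.
\<close>

lemma bessel_rec:
  "real (Suc l) * bessel_I (Suc l) x = x / 2 * (bessel_I l x - bessel_I (l + 2) x)"
proof -
  have *: "exp (x * cos t) * (sin t * sin (real (Suc l) * t)) =
    (exp (x * cos t) * cos (real l * t) - exp (x * cos t) * cos (real (l + 2) * t)) / 2" for t
  proof -
    have "max 1 (Suc l) - min 1 (Suc l) = l" "1 + Suc l = l + 2" by auto
    then have "sin t * sin (real (Suc l) * t) = (cos (real l * t) - cos (real (l + 2) * t)) / 2"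
      using sin_sin_nat[of 1 t "Suc l"] by simp
    then show ?thesis by (simp only: times_divide_eq_right right_diff_distrib)
  qed
  show ?thesis
    unfolding bessel_by_parts * by (simp add: bessel_I_avg del: of_nat_add of_nat_Suc)
qed

text \<open>
  Since \<open>exp x * I\<^sub>l(x)\<close> is the mode of \<open>exp (x (1 + cos))\<close>,
  expanding the exponential reduces monotonicity in \<open>l\<close> to the modes of \<open>(1 +
  cos)\<^sup>n\<close>, which obey a recursion that preserves nonnegativity and monotonicity.
\<close>

definition cos_pow_mode :: "nat \<Rightarrow> nat \<Rightarrow> real" where
  "cos_pow_mode n l = avg (\<lambda>t. (1 + cos t) ^ n * cos (real l * t))"

lemma cos_pow_mode_0: "cos_pow_mode 0 l = (if l = 0 then 1 else 0)"
  by (simp add: cos_pow_mode_def avg_cos)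

lemma cos_pow_mode_Suc:
  "cos_pow_mode (Suc n) l = cos_pow_mode n l + (cos_pow_mode n (l + 1) + cos_pow_mode n (if l = 0 then 1 else l - 1)) / 2"
proof -
  have i: "integrable cm (\<lambda>t. (1 + cos t) ^ n * cos (real l * t))" for l
    by (intro integrable_cm_continuous continuous_intros)
  have *: "cos t * cos (real l * t) = (cos (real (l + 1) * t) + cos (real (if l = 0 then 1 else l - 1) * t)) / 2" for t
    using cos_cos_nat[of 1 t l] by (cases l) (auto simp: max_def min_def add.commute)
  have "(1 + cos t) ^ Suc n * cos (real l * t) = (1 + cos t) ^ n * cos (real l * t) +
     ((1 + cos t) ^ n * cos (real (l + 1) * t) + (1 + cos t) ^ n * cos (real (if l = 0 then 1 else l - 1) * t)) / 2" for t
  proof -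
    have "(1 + cos t) ^ Suc n * cos (real l * t) =
        (1 + cos t) ^ n * cos (real l * t) + (1 + cos t) ^ n * (cos t * cos (real l * t))"
      by (simp add: algebra_simps)
    then show ?thesis unfolding * by (simp only: distrib_left times_divide_eq_right)
  qed
  then show ?thesis unfolding cos_pow_mode_def
    by (simp only: ) (simp add: i del: of_nat_add of_nat_Suc of_nat_diff power_Suc)
qed

lemma cos_pow_mode_mono: "cos_pow_mode n (Suc l) \<le> cos_pow_mode n l \<and> 0 \<le> cos_pow_mode n l"
proof (induction n arbitrary: l)
  case 0
  then show ?case by (simp add: cos_pow_mode_0)
next
  case (Suc n)
  have d: "cos_pow_mode n (Suc k) \<le> cos_pow_mode n k" "0 \<le> cos_pow_mode n k" for k using Suc.IH by auto
  show ?case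
  proof (cases l)
    case 0
    then show ?thesis using d[of 0] d[of 1] d[of 2] by (simp add: cos_pow_mode_Suc numeral_2_eq_2)
  next
    case (Suc k)
    have "cos_pow_mode (Suc n) l = cos_pow_mode n (Suc k) + (cos_pow_mode n (Suc (Suc k)) + cos_pow_mode n k) / 2"
      "cos_pow_mode (Suc n) (Suc l) = cos_pow_mode n (Suc (Suc k)) + (cos_pow_mode n (Suc (Suc (Suc k))) + cos_pow_mode n (Suc k)) / 2"
      unfolding cos_pow_mode_Suc Suc by simp_all
    moreover have "a2 + (a3 + a1) / 2 \<le> a1 + (a2 + a0) / 2 \<and> 0 \<le> a1 + (a2 + a0) / 2"
      if "a1 \<le> a0" "0 \<le> a1" "a2 \<le> a1" "0 \<le> a2" "a3 \<le> a2" for a0 a1 a2 a3 :: real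
      using that by (auto simp: field_simps)
    ultimately show ?thesis using d by metis
  qed
qed

lemma bessel_exp_series:
  assumes "x \<ge> 0"
  shows "(\<lambda>n. x ^ n / fact n * cos_pow_mode n l) sums (exp x * bessel_I l x)"
proof -
  have s: "(\<lambda>n. x ^ n / fact n * ((1 + cos t) ^ n * cos (real l * t))) sums (exp (x * (1 + cos t)) * cos (real l * t))" for t
    using sums_mult2[OF exp_converges[of "x * (1 + cos t)"], of "cos (real l * t)"]
    unfolding power_mult_distrib by (simp add: scaleR_conv_of_real divide_inverse mult_ac)
  have "(\<lambda>n. avg (\<lambda>t. x ^ n / fact n * ((1 + cos t) ^ n * cos (real l * t)))) sums
     avg (\<lambda>t. exp (x * (1 + cos t)) * cos (real l * t))"
  proof (rule avg_sums_bounded(1)[OF _ _ _ s])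
    show "summable (\<lambda>n. (2 * x) ^ n / fact n)" using summable_exp[of "2 * x"] by (simp add: field_simps)
    show "norm (x ^ n / fact n * ((1 + cos t) ^ n * cos (real l * t))) \<le> (2 * x) ^ n / fact n" for n t
    proof -
      have c: "0 \<le> 1 + cos t" "1 + cos t \<le> 2" using cos_ge_minus_one[of t] cos_le_one[of t] by linarith+
      have "\<bar>(1 + cos t) ^ n * cos (real l * t)\<bar> \<le> 2 ^ n * 1"
        unfolding abs_mult using c by (intro mult_mono) (auto simp: power_abs intro!: power_mono)
      then have "x ^ n / fact n * \<bar>(1 + cos t) ^ n * cos (real l * t)\<bar> \<le> x ^ n / fact n * 2 ^ n"
        using assms by (intro mult_left_mono) auto
      then show ?thesis using assms by (simp add: abs_mult power_mult_distrib mult_ac)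
    qed
  qed (intro measurable_cm_borel borel_measurable_continuous_onI continuous_intros)
  moreover have "avg (\<lambda>t. exp (x * (1 + cos t)) * cos (real l * t)) = exp x * bessel_I l x"
    unfolding bessel_I_avg by (subst integral_mult_right_zero[symmetric]) (simp add: algebra_simps exp_add)
  ultimately show ?thesis by (simp add: cos_pow_mode_def)
qed

lemma bessel_antimono: assumes "x \<ge> 0" shows "bessel_I (Suc l) x \<le> bessel_I l x"
proof -
  have "exp x * bessel_I (Suc l) x \<le> exp x * bessel_I l x"
    by (rule sums_le[OF _ bessel_exp_series[OF assms] bessel_exp_series[OF assms]])
       (intro mult_left_mono conjunct1[OF cos_pow_mode_mono], use assms in simp)
  then show ?thesis by simp
qed

lemma bessel_nonneg: assumes "x \<ge> 0" shows "0 \<le> bessel_I l x"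
proof -
  have "0 \<le> exp x * bessel_I l x"
    by (rule sums_le[OF _ sums_zero bessel_exp_series[OF assms]])
       (intro mult_nonneg_nonneg conjunct2[OF cos_pow_mode_mono], use assms in simp)
  then show ?thesis by (simp add: zero_le_mult_iff)
qed

lemma bessel_2_less_1: assumes "x > 0" shows "bessel_I 2 x < bessel_I 1 x"
proof -
  have x: "x \<ge> 0" using assms by simp
  have "(\<lambda>n. x ^ n / fact n * (cos_pow_mode n 1 - cos_pow_mode n 2)) sums (exp x * bessel_I 1 x - exp x * bessel_I 2 x)"
    using sums_diff[OF bessel_exp_series[OF x, of 1] bessel_exp_series[OF x, of 2]] by (simp add: right_diff_distrib)
  moreover have "0 \<le> x ^ n / fact n * (cos_pow_mode n 1 - cos_pow_mode n 2)" for n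
    using cos_pow_mode_mono[of n 1] x by (auto simp: numeral_2_eq_2 intro!: mult_nonneg_nonneg)
  moreover have "0 < x ^ 1 / fact 1 * (cos_pow_mode 1 1 - cos_pow_mode 1 2)"
    using assms by (simp add: cos_pow_mode_Suc[of 0, simplified] cos_pow_mode_0)
  ultimately have "0 < exp x * bessel_I 1 x - exp x * bessel_I 2 x"
    using suminf_pos2[of "\<lambda>n. x ^ n / fact n * (cos_pow_mode n 1 - cos_pow_mode n 2)" 1] unfolding sums_iff by auto
  then show ?thesis by simp
qed

lemma bessel_le_2: assumes "x \<ge> 0" "l \<ge> 2" shows "bessel_I l x \<le> bessel_I 2 x"
  using assms(2)
proof (induction l rule: dec_induct)
  case (step n)
  then show ?case using bessel_antimono[OF assms(1), of n] by linarith
qed simp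

lemma bessel_1_pos: "x > 0 \<Longrightarrow> bessel_I 1 x > 0"
  using bessel_2_less_1[of x] bessel_nonneg[of x 2] by linarith

lemma bessel_Suc_le: assumes "x \<ge> 0" shows "bessel_I (Suc l) x \<le> x / (2 * real (Suc l)) * bessel_I l x"
proof -
  have "real (Suc l) * bessel_I (Suc l) x \<le> x / 2 * bessel_I l x"
    unfolding bessel_rec using bessel_nonneg[OF assms, of "l + 2"] assms by (intro mult_left_mono) auto
  then have "bessel_I (Suc l) x * real (Suc l) \<le> x / 2 * bessel_I l x"
    by (simp only: mult.commute[of "bessel_I (Suc l) x"])
  then have "bessel_I (Suc l) x \<le> (x / 2 * bessel_I l x) / real (Suc l)"
    by (simp only: pos_le_divide_eq of_nat_0_less_iff zero_less_Suc)
  then show ?thesis by simp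
qed

text \<open>
  The recursion makes the sequence decay faster than geometrically; the ratio test applies.
\<close>

lemma bessel_summable:
  assumes "x \<ge> 0" shows "summable (\<lambda>l. (real l)\<^sup>2 * bessel_I l x)"
proof -
  obtain N :: nat where N: "real N > 4 * x + 1" using reals_Archimedean2 by blast
  show ?thesis
  proof (rule summable_ratio_test[where c="1/2" and N="N + 1"])
    fix n assume n: "n \<ge> N + 1"
    then have n1: "real n \<ge> 1" "real n \<ge> 4 * x" using N by linarith+
    have "(real (Suc n))\<^sup>2 \<le> (2 * real n)\<^sup>2" using n1 by (intro power_mono) auto
    then have "(real (Suc n))\<^sup>2 * (x / (2 * real (Suc n)) * bessel_I n x) \<le>
        (2 * real n)\<^sup>2 * (x / (2 * real (Suc n)) * bessel_I n x)"
      using assms bessel_nonneg[OF assms] by (intro mult_right_mono) auto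
    also have "x / (2 * real (Suc n)) \<le> 1 / 8" using n1 assms by (simp add: field_simps)
    then have "(2 * real n)\<^sup>2 * (x / (2 * real (Suc n)) * bessel_I n x) \<le> (2 * real n)\<^sup>2 * (1 / 8 * bessel_I n x)"
      using bessel_nonneg[OF assms] by (intro mult_left_mono mult_right_mono) auto
    finally have "(real (Suc n))\<^sup>2 * (x / (2 * real (Suc n)) * bessel_I n x) \<le> 1/2 * ((real n)\<^sup>2 * bessel_I n x)"
      by (simp add: power_mult_distrib mult_ac)
    moreover have "(real (Suc n))\<^sup>2 * bessel_I (Suc n) x \<le> (real (Suc n))\<^sup>2 * (x / (2 * real (Suc n)) * bessel_I n x)"
      by (intro mult_left_mono bessel_Suc_le assms) auto
    ultimately have "(real (Suc n))\<^sup>2 * bessel_I (Suc n) x \<le> 1/2 * ((real n)\<^sup>2 * bessel_I n x)"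
      by (rule order_trans[rotated])
    moreover have "norm ((real m)\<^sup>2 * bessel_I m x) = (real m)\<^sup>2 * bessel_I m x" for m
      using bessel_nonneg[OF assms, of m] by (simp add: abs_mult)
    ultimately show "norm ((real (Suc n))\<^sup>2 * bessel_I (Suc n) x) \<le> 1/2 * norm ((real n)\<^sup>2 * bessel_I n x)"
      by (simp only:)
  qed simp
qed

lemma avg_expcos_sin: "avg (\<lambda>t. exp (x * cos t) * sin (real l * t)) = 0"
proof -
  have "avg (\<lambda>t. exp (x * cos (-1 * t + 0)) * sin (real l * (-1 * t + 0))) = avg (\<lambda>t. exp (x * cos t) * sin (real l * t))"
  proof (rule avg_isometry[of "-1" "\<lambda>t. exp (x * cos t) * sin (real l * t)" 0])
    show "exp (x * cos (t + 2 * pi)) * sin (real l * (t + 2 * pi)) = exp (x * cos t) * sin (real l * t)" for t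
      unfolding trig_poly_periodic[OF trig_poly.sin[of l], of t] by simp
  qed (auto intro!: continuous_intros)
  then show ?thesis by simp
qed

lemma avg_zero_continuous_imp:
  fixes f :: "real \<Rightarrow> real"
  assumes "continuous_on UNIV f" "\<And>x. f (x + 2*pi) = f x" "AE x in cm. f x = 0"
  shows "f x = 0"
proof (rule ccontr)
  assume x: "f x \<noteq> 0"
  have "f (Arg2pi (cis x)) = f x"
    by (rule periodic_cis_eq[of f, OF assms(2)]) (metis Arg2pi_eq cis_conv_exp norm_cis mult_1 of_real_1)
  then have "avg (\<lambda>x. \<bar>f x\<bar>) > 0"
    using x Arg2pi[of "cis x"] assms(1)
    by (intro avg_pos[of _ "Arg2pi (cis x)"]) (auto intro!: continuous_intros)
  moreover have "avg (\<lambda>x. \<bar>f x\<bar>) = avg (\<lambda>x. 0)"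
    by (rule integral_cong_AE)
       (use assms in \<open>auto intro!: measurable_cm_borel borel_measurable_continuous_onI continuous_intros\<close>)
  ultimately show False by simp
qed

text \<open>
  Both sides are continuous and have the same Fourier modes.
\<close>

lemma bessel_generating:
  assumes x: "x \<ge> 0"
  shows "(\<lambda>l. 2 * bessel_I (Suc l) x * cos (real (Suc l) * t)) sums (exp (x * cos t) - bessel_I 0 x)"
proof -
  have sumb: "summable (\<lambda>l. 2 * bessel_I (Suc l) x)"
  proof (rule summable_mult, rule summable_comparison_test)
    show "\<exists>N. \<forall>n\<ge>N. norm (bessel_I (Suc n) x) \<le> (real (Suc n))\<^sup>2 * bessel_I (Suc n) x"
    proof (intro exI allI impI)
      fix n
      have "1 * bessel_I (Suc n) x \<le> (real (Suc n))\<^sup>2 * bessel_I (Suc n) x"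
        using bessel_nonneg[OF x] by (intro mult_right_mono) (auto intro: one_le_power)
      then show "norm (bessel_I (Suc n) x) \<le> (real (Suc n))\<^sup>2 * bessel_I (Suc n) x"
        using bessel_nonneg[OF x, of "Suc n"] by simp
    qed
    show "summable (\<lambda>n. (real (Suc n))\<^sup>2 * bessel_I (Suc n) x)"
      using bessel_summable[OF x] by (subst summable_Suc_iff)
  qed
  have bd: "norm (2 * bessel_I (Suc l) x * cos (real (Suc l) * t)) \<le> 2 * bessel_I (Suc l) x" for l t
    using bessel_nonneg[OF x] by (simp add: abs_mult mult_left_le)
  define S where "S t = (\<Sum>l. 2 * bessel_I (Suc l) x * cos (real (Suc l) * t))" for t
  have S: "(\<lambda>l. 2 * bessel_I (Suc l) x * cos (real (Suc l) * t)) sums S t" for t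
    unfolding S_def by (intro summable_sums summable_comparison_test'[OF sumb, of 0] bd)
  have ul: "uniform_limit UNIV (\<lambda>n t. \<Sum>i<n. 2 * bessel_I (Suc i) x * cos (real (Suc i) * t)) S sequentially"
    unfolding S_def by (rule Weierstrass_m_test[OF bd sumb])
  have Sc: "continuous_on UNIV S"
    by (rule uniform_limit_theorem[OF _ ul]) (auto intro!: always_eventually continuous_intros)
  define D where "D t = exp (x * cos t) - bessel_I 0 x - S t" for t
  have Dc: "continuous_on UNIV D" unfolding D_def by (intro continuous_intros Sc)
  have Dper: "D (t + 2*pi) = D t" for t
  proof -
    have "cos (real (Suc l) * (t + 2*pi)) = cos (real (Suc l) * t)" for l
      using trig_poly_periodic[OF trig_poly.cos[of "Suc l"], of t] .
    then show ?thesis unfolding D_def S_def by simp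
  qed
  have Smode: "(\<lambda>l. avg (\<lambda>t. 2 * bessel_I (Suc l) x * cos (real (Suc l) * t) * h t)) sums avg (\<lambda>t. S t * h t)"
    if h: "continuous_on UNIV h" "\<And>t. \<bar>h t\<bar> \<le> 1" for h :: "real \<Rightarrow> real"
  proof (rule avg_sums_bounded(1)[OF _ _ sumb])
    show "(\<lambda>l. 2 * bessel_I (Suc l) x * cos (real (Suc l) * t) * h t) sums (S t * h t)" for t
      by (rule sums_mult2[OF S])
    show "norm (2 * bessel_I (Suc l) x * cos (real (Suc l) * t) * h t) \<le> 2 * bessel_I (Suc l) x" for l t
      using mult_mono[OF bd[of l t] h(2)[of t]] bessel_nonneg[OF x] by (simp add: abs_mult)
  qed (intro measurable_cm_borel borel_measurable_continuous_onI continuous_intros h)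
  have ic: "integrable cm (\<lambda>t. exp (x * cos t) * h t)" "integrable cm (\<lambda>t. S t * h t)" "integrable cm h"
    if "continuous_on UNIV h" for h :: "real \<Rightarrow> real"
    by (intro integrable_cm_continuous continuous_intros Sc that)+
  have "AE t in cm. D t = 0"
  proof (rule modes_zero_AE)
    show "integrable cm D" using Dc by (rule integrable_cm_continuous)
    fix k :: nat
    have ck: "continuous_on UNIV (\<lambda>t. cos (real k * t))" "continuous_on UNIV (\<lambda>t. sin (real k * t))"
      by (intro continuous_intros)+
    have "(\<lambda>l. 2 * bessel_I (Suc l) x * (if Suc l = k then 1/2 else 0)) sums avg (\<lambda>t. S t * cos (real k * t))"
      using Smode[OF ck(1)] by (simp add: mult.assoc avg_cos_cos if_distrib cong: if_cong del: of_nat_Suc)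
    moreover have "(\<lambda>l. 2 * bessel_I (Suc l) x * (if Suc l = k then 1/2 else 0)) sums (if k = 0 then 0 else bessel_I k x)"
      using sums_If_finite_set[of "{l. Suc l = k}" "\<lambda>l. bessel_I (Suc l) x"]
      by (cases k) (auto simp: if_distrib cong: if_cong intro!: sums_finite[of "{_}", THEN sums_cong[THEN iffD1, rotated]] sums_single)
    ultimately have S1: "avg (\<lambda>t. S t * cos (real k * t)) = (if k = 0 then 0 else bessel_I k x)"
      by (rule sums_unique2)
    show "avg (\<lambda>t. D t * cos (real k * t)) = 0"
      unfolding D_def using ic[OF ck(1)]
      by (simp add: left_diff_distrib S1 avg_cos bessel_I_avg[symmetric])
    have "(\<lambda>l. 0) sums avg (\<lambda>t. S t * sin (real k * t))"
      using Smode[OF ck(2)] avg_sin_cos[of k] by (simp add: mult.assoc mult.commute[of "cos _"] del: of_nat_Suc)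
    then have S2: "avg (\<lambda>t. S t * sin (real k * t)) = 0" by (simp add: sums_iff)
    show "avg (\<lambda>t. D t * sin (real k * t)) = 0"
      unfolding D_def using ic[OF ck(2)]
      by (simp add: left_diff_distrib S2 avg_sin avg_expcos_sin)
  qed
  from avg_zero_continuous_imp[OF Dc Dper this, of t] have "S t = exp (x * cos t) - bessel_I 0 x"
    by (simp add: D_def)
  then show ?thesis using S[of t] by simp
qed

lemma avg_cos_pow_rec: "real (n + 2) * avg (\<lambda>t. cos t ^ (n + 2)) = real (n + 1) * avg (\<lambda>t. cos t ^ n)"
proof -
  have i: "integrable cm (\<lambda>t. cos t ^ k)" for k by (intro integrable_cm_continuous continuous_intros)
  have "avg (\<lambda>t. cos t ^ (n + 1) * cos t) = - avg (\<lambda>t. (real (n + 1) * cos t ^ n * (- sin t)) * sin t)"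
  proof (rule avg_by_parts)
    show "((\<lambda>t. cos t ^ (n + 1)) has_real_derivative real (n + 1) * cos t ^ n * - sin t) (at t)" for t :: real
      using DERIV_power[OF DERIV_cos[of t], of "n + 1"] by (simp add: mult_ac)
  qed (auto intro!: derivative_eq_intros continuous_intros)
  also have "\<dots> = avg (\<lambda>t. real (n + 1) * (cos t ^ n - cos t ^ (n + 2)))"
  proof (subst integral_minus[symmetric], rule Bochner_Integration.integral_cong[OF refl])
    fix t :: real
    have "sin t * sin t = 1 - cos t * cos t" using sin_squared_eq[of t] by (simp add: power2_eq_square)
    then show "- (real (n + 1) * cos t ^ n * - sin t * sin t) = real (n + 1) * (cos t ^ n - cos t ^ (n + 2))"
      by (simp add: mult.assoc) (simp add: algebra_simps)
  qed
  also have "\<dots> = real (n + 1) * (avg (\<lambda>t. cos t ^ n) - avg (\<lambda>t. cos t ^ (n + 2)))"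
    using i[of n] i[of "n + 2"] by (simp del: power_Suc add_2_eq_Suc')
  finally show ?thesis by (simp add: algebra_simps)
qed

lemma avg_cos_pow_odd: "avg (\<lambda>t. cos t ^ (2 * k + 1)) = 0"
proof (induction k)
  case 0
  then show ?case using avg_cos[of 1] by simp
next
  case (Suc k)
  then show ?case using avg_cos_pow_rec[of "2 * k + 1"] by simp
qed

lemma avg_cos_pow_even: "avg (\<lambda>t. cos t ^ (2 * k)) = fact (2 * k) / (4 ^ k * (fact k)\<^sup>2)"
proof (induction k)
  case (Suc k)
  have "real (2 * k + 2) * avg (\<lambda>t. cos t ^ (2 * k + 2)) = real (2 * k + 1) * (fact (2 * k) / (4 ^ k * (fact k)\<^sup>2))"
    using avg_cos_pow_rec[of "2 * k"] Suc.IH by simp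
  then have "avg (\<lambda>t. cos t ^ (2 * k + 2)) = real (2 * k + 1) * (fact (2 * k) / (4 ^ k * (fact k)\<^sup>2)) / real (2 * k + 2)"
    by (simp only: eq_divide_eq mult.commute[of "avg _"]) simp
  also have "\<dots> = fact (2 * k + 2) / (4 ^ (k + 1) * (fact (k + 1))\<^sup>2)"
  proof -
    have "(2 * c - 1) * (a / (p * b\<^sup>2)) / (2 * c) = (2 * c) * ((2 * c - 1) * a) / (4 * p * (c * b)\<^sup>2)"
      if "p > 0" "b > 0" "c > 0" for a b c p :: real
      using that by (simp add: field_simps power2_eq_square)
    from this[of "4 ^ k" "fact k" "real k + 1" "fact (2 * k)"] show ?thesis by (simp add: algebra_simps)
  qed
  finally show ?case by simp
qed simp

lemma avg_expcos_poly_series: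
  fixes p :: "real \<Rightarrow> real"
  assumes p: "continuous_on UNIV p"
  shows "(\<lambda>n. x ^ n / fact n * avg (\<lambda>t. cos t ^ n * p (cos t))) sums avg (\<lambda>t. exp (x * cos t) * p (cos t))"
proof -
  have "compact (p ` {-1..1})" using p continuous_on_subset by (intro compact_continuous_image) auto
  then obtain B where B: "\<And>c. \<bar>c\<bar> \<le> 1 \<Longrightarrow> \<bar>p c\<bar> \<le> B"
    using compact_imp_bounded[of "p ` {-1..1}"] unfolding bounded_iff by (force simp: abs_le_iff)
  have pc: "continuous_on UNIV (\<lambda>t. p (cos t))"
    by (rule continuous_on_compose2[OF p]) (auto intro!: continuous_intros)
  have s: "(\<lambda>n. x ^ n / fact n * ((cos t) ^ n * p (cos t))) sums (exp (x * cos t) * p (cos t))" for t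
    using sums_mult2[OF exp_converges[of "x * cos t"], of "p (cos t)"]
    unfolding power_mult_distrib by (simp add: scaleR_conv_of_real divide_inverse mult_ac)
  have "(\<lambda>n. avg (\<lambda>t. x ^ n / fact n * ((cos t) ^ n * p (cos t)))) sums avg (\<lambda>t. exp (x * cos t) * p (cos t))"
  proof (rule avg_sums_bounded(1)[OF _ _ _ s])
    show "summable (\<lambda>n. \<bar>x\<bar> ^ n / fact n * B)" using summable_mult2[OF summable_exp[of "\<bar>x\<bar>"], of B] by (simp add: field_simps)
    show "norm (x ^ n / fact n * ((cos t) ^ n * p (cos t))) \<le> \<bar>x\<bar> ^ n / fact n * B" for n t
    proof -
      have "\<bar>(cos t) ^ n * p (cos t)\<bar> \<le> 1 * B"
        unfolding abs_mult by (intro mult_mono B) (auto simp: power_abs intro!: power_le_one)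
      then have "\<bar>x\<bar> ^ n / fact n * \<bar>(cos t) ^ n * p (cos t)\<bar> \<le> \<bar>x\<bar> ^ n / fact n * (1 * B)"
        by (intro mult_left_mono) auto
      then show ?thesis by (simp add: abs_mult power_abs)
    qed
  qed (intro measurable_cm_borel borel_measurable_continuous_onI continuous_intros pc)
  then show ?thesis by simp
qed

lemma bessel_0_series: "(\<lambda>k. (x\<^sup>2 / 4) ^ k / (fact k)\<^sup>2) sums bessel_I 0 x"
proof -
  define f where "f n = x ^ n / fact n * avg (\<lambda>t. cos t ^ n)" for n
  have "f sums bessel_I 0 x"
    using avg_expcos_poly_series[of "\<lambda>_. 1" x] by (simp add: f_def[abs_def] bessel_I_avg)
  moreover have "strict_mono (\<lambda>k::nat. 2 * k)" by (simp add: strict_mono_def)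
  moreover have "f n = 0" if "n \<notin> range (\<lambda>k::nat. 2 * k)" for n
  proof -
    have "odd n" using that by (metis evenE rangeI)
    then obtain k where "n = 2 * k + 1" by (metis oddE)
    then show ?thesis using avg_cos_pow_odd[of k] by (simp add: f_def)
  qed
  ultimately have "(\<lambda>k. f (2 * k)) sums bessel_I 0 x" using sums_mono_reindex[of "\<lambda>k. 2 * k" f] by simp
  then show ?thesis unfolding f_def avg_cos_pow_even by (simp add: power_mult power_divide)
qed

text \<open>
  The sign of \<open>I\<^sub>1 - 2 I\<^sub>2\<close> decides whether \<open>R\<close> is below
  \<open>1/2\<close>. Pairing consecutive powers of \<open>x\<close> makes all terms of large
  index negative, so that few terms determine the sign.
\<close>

lemma bessel_gap_series: "(\<lambda>k. (x\<^sup>2 / 4) ^ k * (x / 2 - 2 * real k) / (fact k * fact (k + 1))) sums (bessel_I 1 x - 2 * bessel_I 2 x)"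
proof -
  define f where "f n = x ^ n / fact n * avg (\<lambda>t. cos t ^ n * (cos t - 4 * (cos t)\<^sup>2 + 2))" for n
  have i: "integrable cm (\<lambda>t. cos t ^ k)" for k by (intro integrable_cm_continuous continuous_intros)
  have "f sums avg (\<lambda>t. exp (x * cos t) * (cos t - 4 * (cos t)\<^sup>2 + 2))"
    unfolding f_def[abs_def] by (rule avg_expcos_poly_series[of "\<lambda>c. c - 4 * c\<^sup>2 + 2"]) (intro continuous_intros)
  also have "avg (\<lambda>t. exp (x * cos t) * (cos t - 4 * (cos t)\<^sup>2 + 2)) =
     avg (\<lambda>t. exp (x * cos t) * cos (real 1 * t) - 2 * (exp (x * cos t) * cos (real 2 * t)))"
    by (rule Bochner_Integration.integral_cong[OF refl]) (simp add: cos_double_cos ring_distribs)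
  also have "\<dots> = bessel_I 1 x - 2 * bessel_I 2 x"
    unfolding bessel_I_avg using integrable_expcos[of x 1] integrable_expcos[of x 2] by simp
  finally have "(\<lambda>n. sum f {n * 2..<n * 2 + 2}) sums (bessel_I 1 x - 2 * bessel_I 2 x)"
    by (rule sums_group) simp
  moreover have "sum f {k * 2..<k * 2 + 2} = (x\<^sup>2 / 4) ^ k * (x / 2 - 2 * real k) / (fact k * fact (k + 1))" for k
  proof -
    define m where "m n = avg (\<lambda>t. cos t ^ n)" for n
    have fm: "f n = x ^ n / fact n * (m (n + 1) - 4 * m (n + 2) + 2 * m n)" for n
    proof -
      have "avg (\<lambda>t. cos t ^ n * (cos t - 4 * (cos t)\<^sup>2 + 2)) =
        avg (\<lambda>t. cos t ^ (n + 1) - 4 * cos t ^ (n + 2) + 2 * cos t ^ n)"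
        by (rule Bochner_Integration.integral_cong[OF refl]) (simp add: algebra_simps power2_eq_square)
      also have "\<dots> = m (n + 1) - 4 * m (n + 2) + 2 * m n"
        using i[of n] i[of "n + 1"] i[of "n + 2"] by (simp add: m_def del: power_Suc add_2_eq_Suc')
      finally show ?thesis by (simp add: f_def)
    qed
    have o: "m (2 * k + 1) = 0" "m (2 * k + 3) = 0"
      using avg_cos_pow_odd[of k] avg_cos_pow_odd[of "k + 1"] by (simp_all add: m_def numeral_3_eq_3)
    have e0: "m (2 * k) = fact (2 * k) / (4 ^ k * (fact k)\<^sup>2)" by (simp add: m_def avg_cos_pow_even)
    have "real (2 * k + 2) * m (2 * k + 2) = real (2 * k + 1) * m (2 * k)"
      unfolding m_def by (rule avg_cos_pow_rec)
    then have e1: "m (2 * k + 2) = real (2 * k + 1) * m (2 * k) / real (2 * k + 2)"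
      by (simp add: eq_divide_eq mult.commute)
    have "sum f {k * 2..<k * 2 + 2} = f (2 * k) + f (2 * k + 1)" by (simp add: mult.commute)
    also have "\<dots> = x ^ (2 * k) / fact (2 * k) * (2 * m (2 * k) - 4 * m (2 * k + 2)) + x ^ (2 * k + 1) / fact (2 * k + 1) * m (2 * k + 2)"
      using o unfolding fm by (simp add: numeral_3_eq_3)
    also have "x ^ (2 * k) = 4 ^ k * (x\<^sup>2 / 4) ^ k" by (simp add: power_mult power_divide)
    also have "x ^ (2 * k + 1) = x * (4 ^ k * (x\<^sup>2 / 4) ^ k)" by (simp add: power_mult power_divide)
    also have "4 ^ k * (x\<^sup>2 / 4) ^ k / fact (2 * k) * (2 * m (2 * k) - 4 * m (2 * k + 2)) +
        x * (4 ^ k * (x\<^sup>2 / 4) ^ k) / fact (2 * k + 1) * m (2 * k + 2) =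
       (x\<^sup>2 / 4) ^ k * (x / 2 - 2 * real k) / (fact k * fact (k + 1))"
    proof -
      have "p * q / a * (2 * (a / (p * b\<^sup>2)) - 4 * (u * (a / (p * b\<^sup>2)) / (2 * c))) + x * (p * q) / (u * a) * (u * (a / (p * b\<^sup>2)) / (2 * c))
         = q * (x / 2 - 2 * (c - 1)) / (b * (c * b))"
        if "p > 0" "a > 0" "b > 0" "c > 0" "u > 0" "u = 2 * c - 1" for a b c p q u :: real
        using that(1-5) by (simp add: field_simps power2_eq_square) (simp add: that(6) algebra_simps)
      from this[of "4 ^ k" "fact (2 * k)" "fact k" "real k + 1" "2 * real k + 1" "(x\<^sup>2 / 4) ^ k"]
      show ?thesis unfolding e1 e0 by (simp add: algebra_simps)
    qed
    finally show ?thesis .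
  qed
  ultimately show ?thesis by simp
qed

section \<open>The ratio of Bessel functions\<close>

text \<open>
  Integration by parts gives \<open>I\<^sub>1\<close> and \<open>I\<^sub>2\<close> as
  \<open>x\<close> times the means of this weight and of \<open>cos\<close> times it, so
  \<open>R\<close> is the expectation of \<open>cos\<close> under the weight.
\<close>

definition sinw :: "real \<Rightarrow> real \<Rightarrow> real" where "sinw x t = (sin t)\<^sup>2 * exp (x * cos t)"

lemma sinw_cont [continuous_intros]: "continuous_on A (sinw x)"
  unfolding sinw_def[abs_def] by (intro continuous_intros)

lemma bessel_1_sinw: "bessel_I 1 x = x * avg (sinw x)"
  using bessel_by_parts[of 1 x] by (simp add: sinw_def[abs_def] power2_eq_square mult_ac)

lemma bessel_2_sinw: "bessel_I 2 x = x * avg (\<lambda>t. cos t * sinw x t)"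
proof -
  have "2 * bessel_I 2 x = x * avg (\<lambda>t. 2 * (cos t * sinw x t))"
    using bessel_by_parts[of 2 x] unfolding sinw_def power2_eq_square of_nat_numeral sin_double by (simp add: mult_ac)
  then show ?thesis by simp
qed

lemma sinw_avg_pos: "avg (sinw x) > 0"
  by (rule avg_pos[where ?x0.0="pi/2"]) (auto intro!: continuous_intros simp: sinw_def)

lemma bessel_R_sinw: "x > 0 \<Longrightarrow> bessel_R x = avg (\<lambda>t. cos t * sinw x t) / avg (sinw x)"
  by (simp add: bessel_R_def bessel_1_sinw bessel_2_sinw del: One_nat_def)

text \<open>
  Increasing \<open>x\<close> multiplies the weight by the increasing function \<open>exp ((y -
  x) cos)\<close> of \<open>cos\<close>, and by Chebyshev's argument this raises the expectation
  of \<open>cos\<close>.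
\<close>

lemma bessel_R_strict_mono: assumes "0 < x" "x < y" shows "bessel_R x < bessel_R y"
proof -
  define c where "c = bessel_R x"
  have ci: "integrable cm (\<lambda>w. cos w * sinw x w)" "integrable cm (sinw x)" for x
    by (intro integrable_cm_continuous continuous_intros)+
  have 1: "avg (\<lambda>w. (cos w - c) * sinw x w) = 0"
    using sinw_avg_pos[of x] ci[of x] by (simp add: left_diff_distrib c_def bessel_R_sinw assms)
  define g where "g w = (cos w - c) * sinw x w * (exp ((y - x) * cos w) - exp ((y - x) * c))" for w
  have gc: "continuous_on UNIV g" unfolding g_def by (intro continuous_intros)
  \<comment> \<open>Strictness needs a point where neither \<open>sin\<close> nor \<open>cos - c\<close> vanishes.\<close>
  have "\<exists>t\<in>{pi/3, pi/2}. cos t \<noteq> c" by (cases "c = 0") (auto simp: cos_60)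
  then obtain t where t: "t \<in> {pi/3, pi/2}" "cos t \<noteq> c" by blast
  have t': "t \<in> {0..2*pi}" "sin t \<noteq> 0" using t sin_60 by (auto simp del: divide_eq_eq_numeral1 eq_divide_eq_numeral1)
  have "avg g > 0"
  proof (rule avg_pos[OF gc _ t'(1)])
    show "g w \<ge> 0" for w
    proof -
      have "(cos w - c) * (exp ((y - x) * cos w) - exp ((y - x) * c)) \<ge> 0"
      proof (cases "cos w \<ge> c")
        case True
        then have "(y - x) * c \<le> (y - x) * cos w" using assms by (intro mult_left_mono) auto
        then show ?thesis using True by (intro mult_nonneg_nonneg) auto
      next
        case False
        then have "(y - x) * cos w \<le> (y - x) * c" using assms by (intro mult_left_mono) auto
        then show ?thesis using False by (intro mult_nonpos_nonpos) auto
      qed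
      then have "0 \<le> sinw x w * ((cos w - c) * (exp ((y - x) * cos w) - exp ((y - x) * c)))"
        by (rule mult_nonneg_nonneg[rotated]) (simp add: sinw_def)
      then show ?thesis by (simp add: g_def mult_ac)
    qed
    show "g t \<noteq> 0" using t t' assms by (simp add: g_def sinw_def)
  qed
  also have "avg g = avg (\<lambda>w. (cos w * sinw y w - c * sinw y w) - exp ((y - x) * c) * ((cos w - c) * sinw x w))"
  proof (rule Bochner_Integration.integral_cong[OF refl])
    fix w
    have "sinw x w * exp ((y - x) * cos w) = sinw y w"
      unfolding sinw_def mult.assoc exp_add[symmetric] by (simp add: algebra_simps)
    then have "g w = (cos w - c) * sinw y w - (cos w - c) * sinw x w * exp ((y - x) * c)"
      unfolding g_def by (metis mult.assoc right_diff_distrib)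
    then show "g w = (cos w * sinw y w - c * sinw y w) - exp ((y - x) * c) * ((cos w - c) * sinw x w)"
      by (simp add: algebra_simps)
  qed
  also have "\<dots> = avg (\<lambda>w. cos w * sinw y w) - c * avg (sinw y)"
    using ci[of y] ci[of x] 1 by (subst Bochner_Integration.integral_diff) (auto simp: left_diff_distrib)
  finally have "c * avg (sinw y) < avg (\<lambda>w. cos w * sinw y w)" by simp
  then have "c < bessel_R y"
    using sinw_avg_pos[of y] assms by (simp add: bessel_R_sinw pos_less_divide_eq)
  then show ?thesis by (simp add: c_def)
qed

lemma bessel_continuous: "continuous_on S (bessel_I l)"
proof -
  have "continuous_on UNIV (\<lambda>x. integral (cbox 0 (2 * pi)) (\<lambda>t. exp (x * cos t) * cos (real l * t)))"
    by (rule integral_continuous_on_param) (auto intro!: continuous_intros simp: split_beta)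
  then have "continuous_on UNIV (\<lambda>x. 1 / (2 * pi) * integral {0..2 * pi} (\<lambda>t. exp (x * cos t) * cos (real l * t)))"
    by (intro continuous_intros) simp
  moreover have "bessel_I l = (\<lambda>x. 1 / (2 * pi) * integral {0..2 * pi} (\<lambda>t. exp (x * cos t) * cos (real l * t)))"
    unfolding bessel_I_avg by (intro ext avg_HK continuous_intros)
  ultimately show ?thesis using continuous_on_subset by fastforce
qed

text \<open>
  The tail of the series from index seven on is dominated by a geometric series of ratio one
  half; the rest is rational arithmetic.
\<close>

lemma bessel_gap_lower: "bessel_I 1 2.4465 - 2 * bessel_I 2 2.4465 > (0::real)"
proof -
  define t :: real where "t = 2.4465\<^sup>2 / 4"
  define d where "d k = t ^ k * (2.4465 / 2 - 2 * real k) / (fact k * fact (k + 1))" for k :: nat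
  define e where "e k = 2 * real k * t ^ k / (fact k * fact (k + 1))" for k :: nat
  have t: "0 < t" "t < 2" by (auto simp: t_def power2_eq_square)
  have ds: "d sums (bessel_I 1 2.4465 - 2 * bessel_I 2 2.4465)"
    using bessel_gap_series[of "2.4465"] by (simp add: d_def[abs_def] t_def)
  have de: "- e k \<le> d k" for k
  proof -
    have "t ^ k * (- (2 * real k)) \<le> t ^ k * (2.4465 / 2 - 2 * real k)" using t by (intro mult_left_mono) auto
    then have "t ^ k * (- (2 * real k)) / (fact k * fact (k + 1)) \<le> d k" unfolding d_def
      by (intro divide_right_mono) auto
    then show ?thesis by (simp add: e_def mult_ac)
  qed
  have eS: "e (Suc k) \<le> e k / 2" if "k \<ge> 7" for k
  proof -
    have "e (Suc k) = e k * (t / (real k * (real k + 2)))"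
      using that by (simp add: e_def divide_simps) (simp add: algebra_simps)
    also have "t / (real k * (real k + 2)) \<le> 1 / 2"
    proof -
      have "real k * (real k + 2) \<ge> 7 * 9" using that by (intro mult_mono) auto
      then show ?thesis using t by (simp add: field_simps)
    qed
    then have "e k * (t / (real k * (real k + 2))) \<le> e k * (1/2)"
      using t by (intro mult_left_mono) (auto simp: e_def)
    finally show ?thesis by simp
  qed
  have ek: "e (k + 7) \<le> e 7 * (1/2) ^ k" for k
  proof (induction k)
    case (Suc k)
    then show ?case using eS[of "k + 7"] by simp
  qed simp
  have "(\<lambda>k. e 7 * (1/2) ^ k) sums (e 7 * 2)" using geometric_sums[of "1/2::real"] by (intro sums_mult) simp
  then have g: "(\<lambda>k. - (e 7 * (1/2) ^ k)) sums (- (e 7 * 2))" by (rule sums_minus)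
  have s7: "(\<lambda>k. d (k + 7)) sums (bessel_I 1 2.4465 - 2 * bessel_I 2 2.4465 - (\<Sum>k<7. d k))"
    using ds by (simp add: sums_iff_shift)
  have d7: "- (e 7 * (1/2) ^ k) \<le> d (k + 7)" for k using de[of "k + 7"] ek[of k] by linarith
  have "- (e 7 * 2) \<le> bessel_I 1 2.4465 - 2 * bessel_I 2 2.4465 - (\<Sum>k<7. d k)"
    by (rule sums_le[OF d7 g s7])
  moreover have "(\<Sum>k<7. d k) - 2 * e 7 > 0"
    by (simp add: d_def e_def t_def eval_nat_numeral lessThan_Suc fact_numeral power_divide)
  ultimately show ?thesis by linarith
qed

text \<open>
  All terms from the second one on are negative, so a partial sum is an upper bound.
\<close>

lemma bessel_gap_upper: "bessel_I 1 2.4475 - 2 * bessel_I 2 2.4475 < (0::real)"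
proof -
  define t :: real where "t = 2.4475\<^sup>2 / 4"
  define d where "d k = t ^ k * (2.4475 / 2 - 2 * real k) / (fact k * fact (k + 1))" for k :: nat
  have t: "0 < t" "t < 2" by (auto simp: t_def power2_eq_square)
  have ds: "d sums (bessel_I 1 2.4475 - 2 * bessel_I 2 2.4475)"
    using bessel_gap_series[of "2.4475"] by (simp add: d_def[abs_def] t_def)
  then have s6: "(\<lambda>k. d (k + 6)) sums (bessel_I 1 2.4475 - 2 * bessel_I 2 2.4475 - (\<Sum>k<6. d k))"
    by (simp add: sums_iff_shift)
  have d6: "d (k + 6) \<le> 0" for k
    unfolding d_def using t by (intro divide_nonpos_nonneg mult_nonneg_nonpos) auto
  have "bessel_I 1 2.4475 - 2 * bessel_I 2 2.4475 - (\<Sum>k<6. d k) \<le> 0"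
    by (rule sums_le[OF d6 s6 sums_zero])
  moreover have "(\<Sum>k<6. d k) < 0"
    by (simp add: d_def t_def eval_nat_numeral lessThan_Suc fact_numeral power_divide)
  ultimately show ?thesis by linarith
qed

lemma bessel_R_inj: "inj_on bessel_R {0<..}"
  by (intro inj_onI) (metis bessel_R_strict_mono greaterThan_iff less_irrefl linorder_neqE_linordered_idom)

proposition bessel_R_inv_half:
  shows "0 < bessel_R_inv (1/2)" "bessel_R (bessel_R_inv (1/2)) = 1/2" "\<bar>bessel_R_inv (1/2) - 2.447\<bar> < 0.0005"
proof -
  have "\<exists>x\<ge>2.4465. x \<le> 2.4475 \<and> - (bessel_I 1 x - 2 * bessel_I 2 x) = 0"
    by (rule IVT') (use bessel_gap_lower bessel_gap_upper in \<open>auto intro!: continuous_intros bessel_continuous\<close>)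
  then obtain x where x: "x \<ge> 2.4465" "x \<le> 2.4475" "bessel_I 1 x - 2 * bessel_I 2 x = 0" by auto
  then have Rx: "bessel_R x = 1/2" using bessel_1_pos[of x] by (simp add: bessel_R_def)
  have "x \<noteq> 2.4465" "x \<noteq> 2.4475" using x(3) bessel_gap_lower bessel_gap_upper by (metis less_irrefl)+
  moreover have "bessel_R_inv (1/2) = x"
    unfolding bessel_R_inv_def using the_inv_into_f_f[OF bessel_R_inj, of x] Rx x by simp
  ultimately show "0 < bessel_R_inv (1/2)" "bessel_R (bessel_R_inv (1/2)) = 1/2" "\<bar>bessel_R_inv (1/2) - 2.447\<bar> < 0.0005"
  proof -
    assume ne: "x \<noteq> 2.4465" "x \<noteq> 2.4475" and eq: "bessel_R_inv (1/2) = x"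
    have "2.4465 < x" "x < 2.4475" using x(1,2) ne by simp_all
    then have "x - 2.447 < 0.0005" "- (x - 2.447) < 0.0005" by simp_all
    then show "\<bar>bessel_R_inv (1/2) - 2.447\<bar> < 0.0005" unfolding eq by (simp only: abs_less_iff)
    show "0 < bessel_R_inv (1/2)" using \<open>2.4465 < x\<close> unfolding eq by simp
    show "bessel_R (bessel_R_inv (1/2)) = 1/2" unfolding eq by (rule Rx)
  qed
qed

section \<open>Trigonometric potentials\<close>

text \<open>
  Absolute convergence with frequency weights makes both the potential and its derivative
  uniformly convergent series.
\<close>

definition adm :: "(nat \<Rightarrow> real) \<Rightarrow> bool" where
  "adm a \<longleftrightarrow> summable (\<lambda>j. real (freq j) * \<bar>a j\<bar>)"

definition pnorm :: "(nat \<Rightarrow> real) \<Rightarrow> real" where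
  "pnorm a = (\<Sum>j. real (freq j) * \<bar>a j\<bar>)"

definition pot :: "(nat \<Rightarrow> real) \<Rightarrow> real \<Rightarrow> real" where
  "pot a t = (\<Sum>j. a j * tb j t)"

definition pot' :: "(nat \<Rightarrow> real) \<Rightarrow> real \<Rightarrow> real" where
  "pot' a t = (\<Sum>j. a j * (real (freq j) * tb' j t))"

lemma coef_le_freq: "\<bar>a j\<bar> \<le> real (freq j) * \<bar>a j\<bar>"
  using mult_right_mono[of 1 "real (freq j)" "\<bar>a j\<bar>"] freq_pos[of j] by simp

lemma pot_bound_term: "norm (a j * tb j t) \<le> real (freq j) * \<bar>a j\<bar>"
proof -
  have "norm (a j * tb j t) \<le> \<bar>a j\<bar>" using mult_left_mono[OF tb_le[of j t], of "\<bar>a j\<bar>"] by (simp add: abs_mult)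
  then show ?thesis using coef_le_freq[of a j] by linarith
qed

lemma pot'_bound_term: "norm (a j * (real (freq j) * tb' j t)) \<le> real (freq j) * \<bar>a j\<bar>"
  using mult_left_mono[OF tb'_le[of j t], of "real (freq j) * \<bar>a j\<bar>"] by (simp add: abs_mult mult_ac)

lemma pot_summable: "adm a \<Longrightarrow> summable (\<lambda>j. a j * tb j t)"
  unfolding adm_def by (rule summable_comparison_test'[of _ 0]) (assumption, rule pot_bound_term)

lemma pot'_summable: "adm a \<Longrightarrow> summable (\<lambda>j. a j * (real (freq j) * tb' j t))"
  unfolding adm_def by (rule summable_comparison_test'[of _ 0]) (assumption, rule pot'_bound_term)

lemma suminf_norm_le:
  fixes f :: "nat \<Rightarrow> 'a::banach"
  assumes "\<And>n. norm (f n) \<le> g n" "summable g"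
  shows "norm (suminf f) \<le> suminf g"
proof -
  have s: "summable (\<lambda>n. norm (f n))" by (rule summable_comparison_test'[OF assms(2), of 0]) (use assms in auto)
  show ?thesis
    by (rule order_trans[OF summable_norm[OF s] suminf_le[OF assms(1) s assms(2)]])
qed

lemma pot_le: "adm a \<Longrightarrow> \<bar>pot a t\<bar> \<le> pnorm a"
  unfolding pot_def pnorm_def adm_def using suminf_norm_le[of "\<lambda>j. a j * tb j t" "\<lambda>j. real (freq j) * \<bar>a j\<bar>", OF pot_bound_term[of a _ t]] by simp

lemma pot'_le: "adm a \<Longrightarrow> \<bar>pot' a t\<bar> \<le> pnorm a"
  unfolding pot'_def pnorm_def adm_def
  using suminf_norm_le[of "\<lambda>j. a j * (real (freq j) * tb' j t)" "\<lambda>j. real (freq j) * \<bar>a j\<bar>", OF pot'_bound_term[of a _ t]] by simp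

lemma pnorm_nonneg: "adm a \<Longrightarrow> pnorm a \<ge> 0"
  unfolding pnorm_def adm_def by (rule suminf_nonneg) auto

lemma pot_deriv: assumes "adm a" shows "(pot a has_real_derivative pot' a x) (at x)"
  unfolding pot_def[abs_def] pot'_def
proof (rule has_field_derivative_series'(2)[of UNIV])
  show "((\<lambda>x. a n * tb n x) has_real_derivative a n * (real (freq n) * tb' n x)) (at x within UNIV)" for n x
    by (auto intro!: derivative_eq_intros tb_deriv)
  show "uniformly_convergent_on UNIV (\<lambda>n x. \<Sum>i<n. a i * (real (freq i) * tb' i x))"
    by (rule Weierstrass_m_test'[of _ _ "\<lambda>i. real (freq i) * \<bar>a i\<bar>"])
       (use pot'_bound_term assms in \<open>auto simp: adm_def\<close>)
qed (use pot_summable[OF assms] in auto)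

lemma pot_continuous: "adm a \<Longrightarrow> continuous_on A (pot a)"
  using continuous_on_UNIV_deriv[OF pot_deriv] continuous_on_subset by blast

lemma pot'_continuous: assumes "adm a" shows "continuous_on A (pot' a)"
proof -
  have "uniform_limit UNIV (\<lambda>n x. \<Sum>i<n. a i * (real (freq i) * tb' i x)) (pot' a) sequentially"
    unfolding pot'_def[abs_def]
    by (rule Weierstrass_m_test[of _ _ "\<lambda>i. real (freq i) * \<bar>a i\<bar>"])
       (use pot'_bound_term assms in \<open>auto simp: adm_def\<close>)
  then have "continuous_on UNIV (pot' a)"
    by (rule uniform_limit_theorem[rotated]) (auto intro!: always_eventually continuous_intros)
  then show ?thesis using continuous_on_subset by blast
qed

lemma pot_periodic: "pot a (t + 2*pi) = pot a t" "pot a (2 * pi) = pot a 0"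
  by (simp_all add: pot_def tb_periodic)

lemma pot_cm [simp]: "adm a \<Longrightarrow> pot a \<in> borel_measurable cm"
  by (intro measurable_cm_borel borel_measurable_continuous_onI pot_continuous)

lemma pot_scale: "adm a \<Longrightarrow> pot (\<lambda>j. c * a j) t = c * pot a t"
  unfolding pot_def using suminf_mult[OF pot_summable, of a c t] by (simp add: mult_ac)

lemma pot'_scale: "adm a \<Longrightarrow> pot' (\<lambda>j. c * a j) t = c * pot' a t"
  unfolding pot'_def using suminf_mult[OF pot'_summable, of a c t] by (simp add: mult_ac)

lemma adm_diff: "adm a \<Longrightarrow> adm b \<Longrightarrow> adm (\<lambda>j. a j - b j)"
proof -
  assume "adm a" "adm b"
  then have "summable (\<lambda>j. real (freq j) * \<bar>a j\<bar> + real (freq j) * \<bar>b j\<bar>)" unfolding adm_def by (rule summable_add)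
  then show ?thesis unfolding adm_def
  proof (rule summable_comparison_test'[of _ 0])
    fix j
    show "norm (real (freq j) * \<bar>a j - b j\<bar>) \<le> real (freq j) * \<bar>a j\<bar> + real (freq j) * \<bar>b j\<bar>"
      unfolding distrib_left[symmetric] by (simp add: mult_left_mono)
  qed
qed

lemma pot_diff: "adm a \<Longrightarrow> adm b \<Longrightarrow> pot (\<lambda>j. a j - b j) t = pot a t - pot b t"
  unfolding pot_def using suminf_diff[OF pot_summable pot_summable, of a b t] by (simp add: left_diff_distrib)

lemma pot'_diff: "adm a \<Longrightarrow> adm b \<Longrightarrow> pot' (\<lambda>j. a j - b j) t = pot' a t - pot' b t"
  unfolding pot'_def using suminf_diff[OF pot'_summable pot'_summable, of a b t] by (simp add: left_diff_distrib)

definition mode :: "(real \<Rightarrow> real) \<Rightarrow> nat \<Rightarrow> real" where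
  "mode \<rho> j = avg (\<lambda>t. \<rho> t * tb j t)"

lemma tb_cm: "tb j \<in> borel_measurable cm" by (rule measurable_cm_borel) measurable

lemma integrable_mult_tb: "integrable cm \<rho> \<Longrightarrow> integrable cm (\<lambda>t. \<rho> t * tb j t)"
  by (rule integrable_mult_bounded[where B=1]) (auto intro: tb_cm tb_le)

lemma avg_mult_pot:
  assumes "integrable cm \<rho>" "adm a"
  shows "(\<lambda>j. a j * mode \<rho> j) sums avg (\<lambda>t. \<rho> t * pot a t)" "integrable cm (\<lambda>t. \<rho> t * pot a t)"
proof -
  have s: "(\<lambda>j. \<rho> t * (a j * tb j t)) sums (\<rho> t * pot a t)" for t
    unfolding pot_def by (intro sums_mult summable_sums pot_summable assms)
  have m: "(\<lambda>t. \<rho> t * (a j * tb j t)) \<in> borel_measurable cm" for j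
    by (intro borel_measurable_times borel_measurable_integrable[OF assms(1)] borel_measurable_const tb_cm)
  have b: "norm (\<rho> t * (a j * tb j t)) \<le> real (freq j) * \<bar>a j\<bar> * \<bar>\<rho> t\<bar>" for j t
    using mult_left_mono[OF pot_bound_term[of a j t], of "\<bar>\<rho> t\<bar>"] by (simp add: abs_mult mult_ac)
  have M: "summable (\<lambda>j. real (freq j) * \<bar>a j\<bar>)" "0 \<le> real (freq j) * \<bar>a j\<bar>" for j
    using assms(2) by (auto simp: adm_def)
  note * = avg_sums[OF m integrable_abs[OF assms(1)] b M s]
  have "avg (\<lambda>t. \<rho> t * (a j * tb j t)) = a j * mode \<rho> j" for j
  proof -
    have "avg (\<lambda>t. \<rho> t * (a j * tb j t)) = avg (\<lambda>t. a j * (\<rho> t * tb j t))" by (simp add: mult_ac)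
    then show ?thesis by (simp add: mode_def)
  qed
  then show "(\<lambda>j. a j * mode \<rho> j) sums avg (\<lambda>t. \<rho> t * pot a t)" "integrable cm (\<lambda>t. \<rho> t * pot a t)"
    using * by simp_all
qed

lemma avg_pot: assumes "adm a" shows "avg (pot a) = 0"
proof -
  have "mode (\<lambda>_. 1) j = 0" for j using avg_tb[of j] by (simp add: mode_def)
  then have "(\<lambda>j. 0) sums avg (pot a)" using avg_mult_pot(1)[of "\<lambda>_. 1" a] assms by simp
  then show ?thesis by (simp add: sums_iff)
qed

section \<open>The interaction in Fourier modes\<close>

definition wt :: "real \<Rightarrow> nat \<Rightarrow> real" where "wt \<beta> j = bessel_I (freq j) \<beta> / \<beta>"

definition W0 :: "real \<Rightarrow> real" where "W0 \<beta> = (bessel_I 0 \<beta> - 1) / \<beta>"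

lemma wt_nonneg: "\<beta> > 0 \<Longrightarrow> wt \<beta> j \<ge> 0"
  by (simp add: wt_def bessel_nonneg)

lemma sums_pairs:
  fixes g :: "nat \<Rightarrow> real"
  assumes "g sums x" "f sums y"
  shows "(\<lambda>j. if even j then f (j div 2) else g (j div 2)) sums (x + y)"
proof -
  have "(\<lambda>n. if even n then f (n div 2) else g ((n - 1) div 2)) = (\<lambda>j. if even j then f (j div 2) else g (j div 2))"
    by (rule ext) (auto elim: oddE)
  then show ?thesis using sums_if[OF assms] by simp
qed

lemma summable_freq:
  fixes f :: "nat \<Rightarrow> real"
  assumes "summable f" shows "summable (\<lambda>j. f (freq j))"
proof -
  have "summable (\<lambda>l. f (l + 1))" using assms by (subst summable_iff_shift)
  then show ?thesis using sums_pairs[OF summable_sums summable_sums, of "\<lambda>l. f (l + 1)" "\<lambda>l. f (l + 1)"]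
    unfolding freq_def by (simp add: sums_iff)
qed

lemma wt_summable_sq: assumes "\<beta> > 0" shows "summable (\<lambda>j. (real (freq j))\<^sup>2 * wt \<beta> j)"
proof -
  have "summable (\<lambda>j. (real (freq j))\<^sup>2 * bessel_I (freq j) \<beta> / \<beta>)"
    by (intro summable_divide summable_freq[of "\<lambda>l. (real l)\<^sup>2 * bessel_I l \<beta>"] bessel_summable) (use assms in simp)
  then show ?thesis by (simp add: wt_def)
qed

lemma wt_summable_freq: assumes "\<beta> > 0" shows "summable (\<lambda>j. real (freq j) * wt \<beta> j)"
proof (rule summable_comparison_test'[OF wt_summable_sq[OF assms], of 0])
  fix j
  have "real (freq j) * 1 \<le> (real (freq j)) * real (freq j)" using freq_pos[of j] by (intro mult_left_mono) auto
  then show "norm (real (freq j) * wt \<beta> j) \<le> (real (freq j))\<^sup>2 * wt \<beta> j"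
    using wt_nonneg[OF assms, of j] by (simp add: power2_eq_square mult_right_mono)
qed

lemma wt_summable: assumes "\<beta> > 0" shows "summable (wt \<beta>)"
  by (rule summable_comparison_test'[OF wt_summable_freq[OF assms], of 0])
     (use coef_le_freq[of "wt \<beta>"] wt_nonneg[OF assms] in auto)

text \<open>
  The generating series of the Bessel functions and the addition theorem for the cosine
  diagonalize the interaction.
\<close>

lemma transformer_W_sums:
  assumes "\<beta> > 0"
  shows "(\<lambda>j. 2 * wt \<beta> j * tb j t * tb j \<phi>) sums (transformer_W \<beta> (t - \<phi>) - W0 \<beta>)"
proof -
  define c where "c l = 2 * bessel_I (Suc l) \<beta> / \<beta> * (cos (real (Suc l) * t) * cos (real (Suc l) * \<phi>))" for l
  define s where "s l = 2 * bessel_I (Suc l) \<beta> / \<beta> * (sin (real (Suc l) * t) * sin (real (Suc l) * \<phi>))" for l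
  have b: "\<bar>2 * wt \<beta> j * tb j t * tb j \<phi>\<bar> \<le> 2 * wt \<beta> j" for j
  proof -
    have "\<bar>tb j t * tb j \<phi>\<bar> \<le> 1 * 1" unfolding abs_mult by (intro mult_mono tb_le) auto
    then have "2 * wt \<beta> j * \<bar>tb j t * tb j \<phi>\<bar> \<le> 2 * wt \<beta> j * (1 * 1)"
      by (rule mult_left_mono) (use wt_nonneg[OF assms] in simp)
    then show ?thesis using wt_nonneg[OF assms, of j] by (simp add: abs_mult)
  qed
  have sum: "summable (\<lambda>j. 2 * wt \<beta> j * tb j t * tb j \<phi>)"
    by (rule summable_comparison_test'[OF summable_mult[OF wt_summable[OF assms], of 2], of 0]) (use b in auto)
  have "(\<lambda>n. sum (\<lambda>j. 2 * wt \<beta> j * tb j t * tb j \<phi>) {n * 2..<n * 2 + 2}) sums (\<Sum>j. 2 * wt \<beta> j * tb j t * tb j \<phi>)"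
    by (rule sums_group[OF summable_sums[OF sum]]) simp
  moreover have "sum (\<lambda>j. 2 * wt \<beta> j * tb j t * tb j \<phi>) {n * 2..<n * 2 + 2} =
      2 * bessel_I (Suc n) \<beta> * cos (real (Suc n) * (t - \<phi>)) / \<beta>" for n
  proof -
    have "{n * 2..<n * 2 + 2} = {n * 2, n * 2 + 1}" by auto
    moreover have "cos (real (Suc n) * (t - \<phi>)) = cos (real (Suc n) * t) * cos (real (Suc n) * \<phi>) + sin (real (Suc n) * t) * sin (real (Suc n) * \<phi>)"
      unfolding right_diff_distrib by (rule cos_diff)
    ultimately show ?thesis by (simp add: wt_def tb_def freq_def ring_distribs add_divide_distrib mult.assoc del: of_nat_Suc)
  qed
  moreover have "(\<lambda>n. 2 * bessel_I (Suc n) \<beta> * cos (real (Suc n) * (t - \<phi>)) / \<beta>) sums ((exp (\<beta> * cos (t - \<phi>)) - bessel_I 0 \<beta>) / \<beta>)"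
    by (rule sums_divide[OF bessel_generating]) (use assms in simp)
  ultimately have "(\<Sum>j. 2 * wt \<beta> j * tb j t * tb j \<phi>) = (exp (\<beta> * cos (t - \<phi>)) - bessel_I 0 \<beta>) / \<beta>"
    using sums_unique2 by (metis (no_types, lifting) sums_cong)
  also have "\<dots> = transformer_W \<beta> (t - \<phi>) - W0 \<beta>" by (simp add: transformer_W_def W0_def diff_divide_distrib)
  finally show ?thesis using summable_sums[OF sum] by simp
qed

text \<open>
  The coefficients of \<open>\<kappa>\<close> times the convolution of \<open>W\<close> with a
  density of modes \<open>z\<close>, without the constant term.
\<close>

definition coef :: "real \<Rightarrow> real \<Rightarrow> (nat \<Rightarrow> real) \<Rightarrow> nat \<Rightarrow> real" where
  "coef \<beta> \<kappa> z j = \<kappa> * (2 * wt \<beta> j * z j)"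

text \<open>
  The modes of a density lie in this cube, which is compact in the product topology.
\<close>

definition cube :: "(nat \<Rightarrow> real) \<Rightarrow> bool" where "cube z \<longleftrightarrow> (\<forall>j. \<bar>z j\<bar> \<le> 1)"

definition Lam :: "real \<Rightarrow> real" where "Lam \<beta> = (\<Sum>j. 2 * (real (freq j) * wt \<beta> j))"

lemma Lam_nonneg: "\<beta> > 0 \<Longrightarrow> Lam \<beta> \<ge> 0"
  unfolding Lam_def by (intro suminf_nonneg summable_mult wt_summable_freq) (auto simp: wt_nonneg)

lemma coef_adm_bound:
  assumes "\<beta> > 0" "\<And>j. \<bar>z j\<bar> \<le> m"
  shows "adm (coef \<beta> \<kappa> z)" "pnorm (coef \<beta> \<kappa> z) \<le> \<bar>\<kappa>\<bar> * (Lam \<beta> * m)"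
proof -
  have b: "real (freq j) * \<bar>coef \<beta> \<kappa> z j\<bar> \<le> \<bar>\<kappa>\<bar> * m * (2 * (real (freq j) * wt \<beta> j))" for j
  proof -
    have "real (freq j) * \<bar>coef \<beta> \<kappa> z j\<bar> = \<bar>\<kappa>\<bar> * (2 * (real (freq j) * wt \<beta> j)) * \<bar>z j\<bar>"
      using wt_nonneg[OF assms(1), of j] by (simp add: coef_def abs_mult)
    also have "\<dots> \<le> \<bar>\<kappa>\<bar> * (2 * (real (freq j) * wt \<beta> j)) * m"
      using wt_nonneg[OF assms(1), of j] assms(2) by (intro mult_left_mono) auto
    finally show ?thesis by (simp add: mult_ac)
  qed
  have s: "summable (\<lambda>j. \<bar>\<kappa>\<bar> * m * (2 * (real (freq j) * wt \<beta> j)))"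
    by (intro summable_mult wt_summable_freq assms)
  show a: "adm (coef \<beta> \<kappa> z)" unfolding adm_def
    by (rule summable_comparison_test'[OF s, of 0]) (use b in auto)
  have "pnorm (coef \<beta> \<kappa> z) \<le> (\<Sum>j. \<bar>\<kappa>\<bar> * m * (2 * (real (freq j) * wt \<beta> j)))"
    unfolding pnorm_def by (rule suminf_le[OF b _ s]) (use a in \<open>simp add: adm_def\<close>)
  also have "\<dots> = \<bar>\<kappa>\<bar> * m * Lam \<beta>"
    unfolding Lam_def by (intro suminf_mult summable_mult wt_summable_freq assms)
  finally show "pnorm (coef \<beta> \<kappa> z) \<le> \<bar>\<kappa>\<bar> * (Lam \<beta> * m)" by (simp add: mult_ac)
qed

lemma coef_adm: "\<beta> > 0 \<Longrightarrow> cube z \<Longrightarrow> adm (coef \<beta> \<kappa> z)"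
  using coef_adm_bound(1)[of \<beta> z 1] by (simp add: cube_def)

lemma coef_scale: "coef \<beta> \<kappa> z = (\<lambda>j. \<kappa> * coef \<beta> 1 z j)" by (rule ext) (simp add: coef_def)

lemma pot_coef_scale: "\<beta> > 0 \<Longrightarrow> cube z \<Longrightarrow> pot (coef \<beta> \<kappa> z) t = \<kappa> * pot (coef \<beta> 1 z) t"
  "\<beta> > 0 \<Longrightarrow> cube z \<Longrightarrow> pot' (coef \<beta> \<kappa> z) t = \<kappa> * pot' (coef \<beta> 1 z) t"
  by (subst coef_scale, simp add: pot_scale pot'_scale coef_adm)+

section \<open>Gibbs densities and the reduced energy\<close>

lemma pos_densities_iff:
  "\<rho> \<in> pos_densities \<longleftrightarrow> integrable cm \<rho> \<and> (AE t in cm. 0 < \<rho> t) \<and> avg \<rho> = 1"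
  unfolding pos_densities_def by (simp add: integrable_cm_iff AE_cm_iff avg_eq)

lemma avg_abs_le_imp: assumes "\<rho> \<in> pos_densities" shows "avg (\<lambda>t. \<bar>\<rho> t\<bar>) = 1"
proof -
  have "avg (\<lambda>t. \<bar>\<rho> t\<bar>) = avg \<rho>"
    by (rule integral_cong_AE) (use assms in \<open>auto simp: pos_densities_iff\<close>)
  then show ?thesis using assms by (simp add: pos_densities_iff)
qed

lemma mode_diff_le:
  assumes "integrable cm \<rho>" shows "\<bar>mode \<rho> j\<bar> \<le> avg (\<lambda>t. \<bar>\<rho> t - c\<bar>)"
proof -
  have i: "integrable cm (\<lambda>t. \<rho> t - c)" using assms by simp
  have "mode \<rho> j = avg (\<lambda>t. (\<rho> t - c) * tb j t)"
    using integrable_mult_tb[OF assms, of j] integrable_mult_tb[of "\<lambda>_. c" j] by (simp add: mode_def left_diff_distrib)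
  also have "\<bar>\<dots>\<bar> \<le> avg (\<lambda>t. \<bar>(\<rho> t - c) * tb j t\<bar>)" by (rule integral_abs_bound)
  also have "\<dots> \<le> avg (\<lambda>t. \<bar>\<rho> t - c\<bar>)"
  proof (rule integral_mono)
    show "integrable cm (\<lambda>t. \<bar>(\<rho> t - c) * tb j t\<bar>)" by (intro integrable_abs integrable_mult_tb i)
    show "\<bar>(\<rho> t - c) * tb j t\<bar> \<le> \<bar>\<rho> t - c\<bar>" for t
      using mult_left_mono[OF tb_le[of j t], of "\<bar>\<rho> t - c\<bar>"] by (simp add: abs_mult)
  qed (use i in auto)
  finally show ?thesis .
qed

lemma mode_cube: assumes "\<rho> \<in> pos_densities" shows "cube (mode \<rho>)"
  using mode_diff_le[of \<rho> _ 0] assms avg_abs_le_imp[OF assms] by (simp add: cube_def pos_densities_iff)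

lemma W_conv_pot:
  assumes "\<beta> > 0" "\<rho> \<in> pos_densities"
  shows "W_conv \<beta> \<rho> t = W0 \<beta> + pot (coef \<beta> 1 (mode \<rho>)) t"
    "integrable cm (\<lambda>\<phi>. transformer_W \<beta> (t - \<phi>) * \<rho> \<phi>)"
proof -
  have ri: "integrable cm \<rho>" and r1: "avg \<rho> = 1" using assms by (auto simp: pos_densities_iff)
  define a where "a j = 2 * wt \<beta> j * tb j t" for j
  have aa: "adm a" using coef_adm[OF assms(1), of "\<lambda>j. tb j t" 1] tb_le unfolding a_def coef_def cube_def by simp
  have W: "transformer_W \<beta> (t - \<phi>) = W0 \<beta> + pot a \<phi>" for \<phi>
    using sums_unique[OF transformer_W_sums[OF assms(1), of t \<phi>]] unfolding pot_def a_def by simp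
  have *: "(\<lambda>\<phi>. transformer_W \<beta> (t - \<phi>) * \<rho> \<phi>) = (\<lambda>\<phi>. W0 \<beta> * \<rho> \<phi> + \<rho> \<phi> * pot a \<phi>)"
    by (auto simp: W algebra_simps)
  show "integrable cm (\<lambda>\<phi>. transformer_W \<beta> (t - \<phi>) * \<rho> \<phi>)"
    unfolding * using avg_mult_pot(2)[OF ri aa] ri by simp
  have "W_conv \<beta> \<rho> t = avg (\<lambda>\<phi>. transformer_W \<beta> (t - \<phi>) * \<rho> \<phi>)" by (simp add: W_conv_def avg_eq)
  also have "\<dots> = W0 \<beta> + avg (\<lambda>\<phi>. \<rho> \<phi> * pot a \<phi>)"
    unfolding * using avg_mult_pot(2)[OF ri aa] ri r1 by simp
  also have "avg (\<lambda>\<phi>. \<rho> \<phi> * pot a \<phi>) = pot (coef \<beta> 1 (mode \<rho>)) t"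
    using sums_unique[OF avg_mult_pot(1)[OF ri aa]] by (simp add: pot_def a_def coef_def mult_ac)
  finally show "W_conv \<beta> \<rho> t = W0 \<beta> + pot (coef \<beta> 1 (mode \<rho>)) t" .
qed

definition en :: "real \<Rightarrow> (nat \<Rightarrow> real) \<Rightarrow> real" where "en \<beta> z = (\<Sum>j. wt \<beta> j * (z j)\<^sup>2)"

definition ent :: "(real \<Rightarrow> real) \<Rightarrow> real" where "ent \<rho> = avg (\<lambda>t. \<rho> t * ln (\<rho> t))"

lemma en_term: assumes "\<beta> > 0" "cube z" shows "0 \<le> wt \<beta> j * (z j)\<^sup>2" "wt \<beta> j * (z j)\<^sup>2 \<le> wt \<beta> j"
proof -
  have "(z j)\<^sup>2 \<le> 1" using assms by (simp add: cube_def abs_square_le_1)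
  then show "0 \<le> wt \<beta> j * (z j)\<^sup>2" "wt \<beta> j * (z j)\<^sup>2 \<le> wt \<beta> j"
    using wt_nonneg[OF assms(1), of j] by (auto intro: mult_left_le)
qed

lemma en_summable: assumes "\<beta> > 0" "cube z" shows "summable (\<lambda>j. wt \<beta> j * (z j)\<^sup>2)"
  by (rule summable_comparison_test'[OF wt_summable[OF assms(1)], of 0]) (use en_term[OF assms] in auto)

lemma en_nonneg: "\<beta> > 0 \<Longrightarrow> cube z \<Longrightarrow> 0 \<le> en \<beta> z"
  unfolding en_def by (intro suminf_nonneg en_summable en_term)

lemma en_le: assumes "\<beta> > 0" "cube z" shows "en \<beta> z \<le> (\<Sum>j. wt \<beta> j)"
  unfolding en_def by (intro suminf_le en_summable en_term wt_summable assms)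

lemma avg_mult_pot_coef:
  assumes "\<beta> > 0" "integrable cm \<rho>" "cube (mode \<rho>)"
  shows "avg (\<lambda>t. \<rho> t * pot (coef \<beta> \<kappa> (mode \<rho>)) t) = 2 * \<kappa> * en \<beta> (mode \<rho>)"
proof -
  have "avg (\<lambda>t. \<rho> t * pot (coef \<beta> \<kappa> (mode \<rho>)) t) = (\<Sum>j. coef \<beta> \<kappa> (mode \<rho>) j * mode \<rho> j)"
    using sums_unique[OF avg_mult_pot(1)[OF assms(2) coef_adm[OF assms(1,3), of \<kappa>]]] .
  also have "\<dots> = (\<Sum>j. (2 * \<kappa>) * (wt \<beta> j * (mode \<rho> j)\<^sup>2))" by (simp add: coef_def power2_eq_square mult_ac)
  also have "\<dots> = 2 * \<kappa> * en \<beta> (mode \<rho>)" unfolding en_def by (intro suminf_mult en_summable assms)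
  finally show ?thesis .
qed

lemma free_energy_eq:
  assumes "\<beta> > 0" "\<rho> \<in> pos_densities"
  shows "free_energy \<beta> \<kappa> \<rho> = (if integrable cm (\<lambda>t. \<rho> t * ln (\<rho> t))
     then ereal (ent \<rho> - \<kappa> * en \<beta> (mode \<rho>) - \<kappa> * W0 \<beta> / 2) else \<infinity>)"
proof -
  have ri: "integrable cm \<rho>" and r1: "avg \<rho> = 1" using assms by (auto simp: pos_densities_iff)
  have cu: "cube (mode \<rho>)" by (rule mode_cube[OF assms(2)])
  have inner: "avg (\<lambda>\<phi>. transformer_W \<beta> (t - \<phi>) * \<rho> t * \<rho> \<phi>) = \<rho> t * (W0 \<beta> + pot (coef \<beta> 1 (mode \<rho>)) t)" for t
  proof -
    have "avg (\<lambda>\<phi>. transformer_W \<beta> (t - \<phi>) * \<rho> t * \<rho> \<phi>) = avg (\<lambda>\<phi>. \<rho> t * (transformer_W \<beta> (t - \<phi>) * \<rho> \<phi>))"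
      by (simp add: mult_ac)
    also have "\<dots> = \<rho> t * W_conv \<beta> \<rho> t" by (simp add: W_conv_def avg_eq)
    finally show ?thesis by (simp add: W_conv_pot[OF assms])
  qed
  have "avg (\<lambda>t. \<rho> t * (W0 \<beta> + pot (coef \<beta> 1 (mode \<rho>)) t)) = W0 \<beta> + 2 * en \<beta> (mode \<rho>)"
    using avg_mult_pot_coef[OF assms(1) ri cu, of 1] avg_mult_pot(2)[OF ri coef_adm[OF assms(1) cu, of 1]] ri r1
    by (simp add: distrib_left)
  then have "(LINT t:circle|lborel. LINT \<phi>:circle|lborel. transformer_W \<beta> (t - \<phi>) * \<rho> t * \<rho> \<phi>)
     = 2 * pi * (2 * pi * (W0 \<beta> + 2 * en \<beta> (mode \<rho>)))"
    unfolding LINT_eq_avg by (simp add: inner)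
  then have "\<kappa> / (8 * pi\<^sup>2) * (LINT t:circle|lborel. LINT \<phi>:circle|lborel. transformer_W \<beta> (t - \<phi>) * \<rho> t * \<rho> \<phi>)
     = \<kappa> * en \<beta> (mode \<rho>) + \<kappa> * W0 \<beta> / 2"
    by (simp add: field_simps power2_eq_square)
  then show ?thesis unfolding free_energy_def by (simp add: integrable_cm_iff[symmetric] LINT_eq_avg ent_def)
qed

definition gibbs :: "(nat \<Rightarrow> real) \<Rightarrow> real \<Rightarrow> real" where
  "gibbs a t = exp (pot a t) / avg (\<lambda>t. exp (pot a t))"

lemma exp_pot_avg_pos: assumes "adm a" shows "avg (\<lambda>t. exp (pot a t)) > 0"
  by (rule avg_pos[where ?x0.0=0]) (auto intro!: continuous_intros pot_continuous assms)

lemma integrable_exp_pot: assumes "adm a" shows "integrable cm (\<lambda>t. exp (pot a t))"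
  by (intro integrable_cm_continuous continuous_intros pot_continuous assms)

lemma gibbs_continuous: assumes "adm a" shows "continuous_on A (gibbs a)"
  unfolding gibbs_def[abs_def] using exp_pot_avg_pos[OF assms]
  by (intro continuous_intros pot_continuous assms) auto

lemma gibbs_pos: "adm a \<Longrightarrow> gibbs a t > 0"
  unfolding gibbs_def using exp_pot_avg_pos by simp

lemma gibbs_cm: "adm a \<Longrightarrow> gibbs a \<in> borel_measurable cm"
  by (intro measurable_cm_borel borel_measurable_continuous_onI gibbs_continuous)

lemma integrable_gibbs: "adm a \<Longrightarrow> integrable cm (gibbs a)"
  by (intro integrable_cm_continuous gibbs_continuous)

lemma avg_gibbs: "adm a \<Longrightarrow> avg (gibbs a) = 1"
  unfolding gibbs_def[abs_def] using exp_pot_avg_pos[of a] by simp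

lemma gibbs_density: "adm a \<Longrightarrow> gibbs a \<in> pos_densities"
  by (simp add: pos_densities_iff integrable_gibbs avg_gibbs gibbs_pos)

lemma ln_gibbs: "adm a \<Longrightarrow> ln (gibbs a t) = pot a t - ln (avg (\<lambda>t. exp (pot a t)))"
  unfolding gibbs_def using exp_pot_avg_pos[of a] by (simp add: ln_div)

lemma gibbs_ent_integrable: "adm a \<Longrightarrow> integrable cm (\<lambda>t. gibbs a t * ln (gibbs a t))"
  by (intro integrable_cm_continuous continuous_intros gibbs_continuous) (use gibbs_pos in \<open>auto simp: less_imp_neq[symmetric]\<close>)

lemma gibbs_ent:
  assumes "adm a"
  shows "ent (gibbs a) = avg (\<lambda>t. gibbs a t * pot a t) - ln (avg (\<lambda>t. exp (pot a t)))"
  unfolding ent_def ln_gibbs[OF assms] right_diff_distrib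
  using avg_mult_pot(2)[OF integrable_gibbs[OF assms] assms] integrable_gibbs[OF assms] avg_gibbs[OF assms] by simp

text \<open>
  The gap is the relative entropy with respect to the Gibbs density, the mean of a nonnegative
  function that vanishes only where the two densities agree.
\<close>

lemma gibbs_variational:
  assumes r: "\<rho> \<in> pos_densities" and e: "integrable cm (\<lambda>x. \<rho> x * ln (\<rho> x))" and a: "adm a"
  shows "avg (\<lambda>x. \<rho> x * pot a x) - ln (avg (\<lambda>x. exp (pot a x))) \<le> ent \<rho>" (is "?L \<le> _")
    and "ent \<rho> = avg (\<lambda>x. \<rho> x * pot a x) - ln (avg (\<lambda>x. exp (pot a x))) \<Longrightarrow> AE x in cm. \<rho> x = gibbs a x"
proof -
  have ri: "integrable cm \<rho>" and r1: "avg \<rho> = 1" and rp: "AE x in cm. 0 < \<rho> x" using r by (auto simp: pos_densities_iff)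
  define h where "h x = \<rho> x * ln (\<rho> x) - \<rho> x * ln (gibbs a x) - \<rho> x + gibbs a x" for x
  have i2: "integrable cm (\<lambda>x. \<rho> x * ln (gibbs a x))"
    unfolding ln_gibbs[OF a] right_diff_distrib using avg_mult_pot(2)[OF ri a] ri by simp
  have hi: "integrable cm h" unfolding h_def using e i2 ri integrable_gibbs[OF a] by simp
  have "avg h = ent \<rho> - avg (\<lambda>x. \<rho> x * ln (gibbs a x))"
    unfolding h_def using e i2 ri integrable_gibbs[OF a] r1 avg_gibbs[OF a] by (simp add: ent_def)
  also have "avg (\<lambda>x. \<rho> x * ln (gibbs a x)) = ?L"
    unfolding ln_gibbs[OF a] right_diff_distrib using avg_mult_pot(2)[OF ri a] ri r1 by simp
  finally have avh: "avg h = ent \<rho> - ?L" .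
  have pt: "0 \<le> t * ln t - t * ln s - t + s \<and> (t * ln t - t * ln s - t + s = 0 \<longrightarrow> t = s)" if "t > 0" "s > 0" for t s :: real
  proof -
    have l: "ln (s / t) \<le> s / t - 1" by (rule ln_le_minus_one) (use that in simp)
    have eq: "t * ln t - t * ln s - t + s = t * ((s / t - 1) - ln (s / t))" using that by (simp add: ln_div field_simps)
    have "t = s" if "t * ln t - t * ln s - t + s = 0"
    proof -
      have "ln (s / t) = s / t - 1" using that \<open>t > 0\<close> unfolding eq by simp
      then have "s / t = 1" by (intro ln_eq_minus_one) (use \<open>t > 0\<close> \<open>s > 0\<close> in simp_all)
      then show ?thesis using \<open>t > 0\<close> by simp
    qed
    then show ?thesis using l that unfolding eq by simp
  qed
  have h0: "AE x in cm. 0 \<le> h x" using rp unfolding h_def by eventually_elim (use pt gibbs_pos[OF a] in blast)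
  have "0 \<le> avg h" by (rule integral_nonneg_AE[OF h0])
  then show "?L \<le> ent \<rho>" using avh by simp
  assume "ent \<rho> = ?L"
  then have "avg h = 0" using avh by simp
  then have "AE x in cm. h x = 0" using integral_nonneg_eq_0_iff_AE[OF hi h0] by simp
  then show "AE x in cm. \<rho> x = gibbs a x"
    using rp
  proof eventually_elim
    case (elim x)
    then show ?case using pt[OF elim(2) gibbs_pos[OF a, of x]] unfolding h_def by blast
  qed
qed

text \<open>
  The reduced energy: the value of \<open>en\<close> and the partition function of the field
  \<open>coef \<beta> \<kappa> z\<close> depend on the modes only.
\<close>

definition Gf :: "real \<Rightarrow> real \<Rightarrow> (nat \<Rightarrow> real) \<Rightarrow> real" where
  "Gf \<beta> \<kappa> z = \<kappa> * en \<beta> z - ln (avg (\<lambda>t. exp (pot (coef \<beta> \<kappa> z) t)))"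

lemma Gf_le:
  assumes "\<beta> > 0" "\<rho> \<in> pos_densities" "integrable cm (\<lambda>t. \<rho> t * ln (\<rho> t))"
  shows "Gf \<beta> \<kappa> (mode \<rho>) \<le> ent \<rho> - \<kappa> * en \<beta> (mode \<rho>)"
    and "ent \<rho> - \<kappa> * en \<beta> (mode \<rho>) = Gf \<beta> \<kappa> (mode \<rho>) \<Longrightarrow> AE t in cm. \<rho> t = gibbs (coef \<beta> \<kappa> (mode \<rho>)) t"
proof -
  have ri: "integrable cm \<rho>" using assms by (auto simp: pos_densities_iff)
  have cu: "cube (mode \<rho>)" by (rule mode_cube[OF assms(2)])
  note gv = gibbs_variational[OF assms(2,3) coef_adm[OF assms(1) cu, of \<kappa>], unfolded avg_mult_pot_coef[OF assms(1) ri cu]]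
  show "Gf \<beta> \<kappa> (mode \<rho>) \<le> ent \<rho> - \<kappa> * en \<beta> (mode \<rho>)" using gv(1) by (simp add: Gf_def)
  assume "ent \<rho> - \<kappa> * en \<beta> (mode \<rho>) = Gf \<beta> \<kappa> (mode \<rho>)"
  then show "AE t in cm. \<rho> t = gibbs (coef \<beta> \<kappa> (mode \<rho>)) t" using gv(2) by (simp add: Gf_def)
qed

text \<open>
  The interaction energy is convex in the modes, and its tangent at \<open>z\<close> is the
  field that defines the Gibbs density.
\<close>

lemma gibbs_le_Gf:
  assumes "\<beta> > 0" "\<kappa> \<ge> 0" "cube z"
  defines "\<rho> \<equiv> gibbs (coef \<beta> \<kappa> z)"
  shows "ent \<rho> - \<kappa> * en \<beta> (mode \<rho>) \<le> Gf \<beta> \<kappa> z"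
proof -
  have a: "adm (coef \<beta> \<kappa> z)" by (rule coef_adm[OF assms(1,3)])
  have r: "\<rho> \<in> pos_densities" unfolding \<rho>_def by (rule gibbs_density[OF a])
  have cu: "cube (mode \<rho>)" by (rule mode_cube[OF r])
  have s: "(\<lambda>j. coef \<beta> \<kappa> z j * mode \<rho> j) sums avg (\<lambda>t. \<rho> t * pot (coef \<beta> \<kappa> z) t)"
    unfolding \<rho>_def by (rule avg_mult_pot(1)[OF integrable_gibbs[OF a] a])
  have "ent \<rho> - \<kappa> * en \<beta> (mode \<rho>) - Gf \<beta> \<kappa> z = avg (\<lambda>t. \<rho> t * pot (coef \<beta> \<kappa> z) t) - \<kappa> * en \<beta> (mode \<rho>) - \<kappa> * en \<beta> z"
    unfolding \<rho>_def Gf_def gibbs_ent[OF a] by simp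
  also have "\<dots> \<le> 0"
  proof -
    have s1: "(\<lambda>j. coef \<beta> \<kappa> z j * mode \<rho> j - \<kappa> * (wt \<beta> j * (mode \<rho> j)\<^sup>2) - \<kappa> * (wt \<beta> j * (z j)\<^sup>2)) sums
       (avg (\<lambda>t. \<rho> t * pot (coef \<beta> \<kappa> z) t) - \<kappa> * en \<beta> (mode \<rho>) - \<kappa> * en \<beta> z)"
      unfolding en_def by (intro sums_diff s sums_mult summable_sums en_summable assms cu)
    have s2: "coef \<beta> \<kappa> z j * mode \<rho> j - \<kappa> * (wt \<beta> j * (mode \<rho> j)\<^sup>2) - \<kappa> * (wt \<beta> j * (z j)\<^sup>2) \<le> 0" for j
    proof -
      have "0 \<le> \<kappa> * (wt \<beta> j * (mode \<rho> j - z j)\<^sup>2)" using assms wt_nonneg[OF assms(1)] by simp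
      then show ?thesis by (simp add: coef_def power2_diff algebra_simps)
    qed
    show ?thesis by (rule sums_le[OF s2 s1 sums_zero])
  qed
  finally show ?thesis by simp
qed

lemma ent_uniform [simp]: "ent (\<lambda>_. 1) = 0" by (simp add: ent_def)
lemma mode_uniform: "mode (\<lambda>_. 1) = (\<lambda>_. 0)" by (rule ext) (simp add: mode_def)
lemma en_0 [simp]: "en \<beta> (\<lambda>_. 0) = 0" by (simp add: en_def)
lemma coef_0 [simp]: "coef \<beta> \<kappa> (\<lambda>_. 0) = (\<lambda>_. 0)" by (rule ext) (simp add: coef_def)
lemma pot_0 [simp]: "pot (\<lambda>_. 0) = (\<lambda>_. 0)" by (rule ext) (simp add: pot_def)
lemma gibbs_0 [simp]: "gibbs (\<lambda>_. 0) = (\<lambda>_. 1)" by (rule ext) (simp add: gibbs_def)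
lemma adm_0 [simp]: "adm (\<lambda>_. 0)" by (simp add: adm_def)
lemma pnorm_0 [simp]: "pnorm (\<lambda>_. 0) = 0" by (simp add: pnorm_def)
lemma uniform_density: "(\<lambda>_. 1) \<in> pos_densities" by (simp add: pos_densities_iff)

lemma is_uniform_cm: "is_uniform \<rho> \<longleftrightarrow> (AE t in cm. \<rho> t = 1)"
  by (simp add: is_uniform_def AE_cm_iff)

lemma ent_nonneg:
  assumes "\<rho> \<in> pos_densities" "integrable cm (\<lambda>t. \<rho> t * ln (\<rho> t))"
  shows "0 \<le> ent \<rho>" "ent \<rho> = 0 \<Longrightarrow> is_uniform \<rho>"
  using gibbs_variational[OF assms adm_0] by (simp_all add: is_uniform_cm)

lemma global_minimizer_iff:
  assumes "\<beta> > 0"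
  shows "global_minimizer \<beta> \<kappa> \<rho> \<longleftrightarrow> \<rho> \<in> pos_densities \<and> integrable cm (\<lambda>t. \<rho> t * ln (\<rho> t)) \<and>
    (\<forall>\<sigma>\<in>pos_densities. integrable cm (\<lambda>t. \<sigma> t * ln (\<sigma> t)) \<longrightarrow>
       ent \<rho> - \<kappa> * en \<beta> (mode \<rho>) \<le> ent \<sigma> - \<kappa> * en \<beta> (mode \<sigma>))" (is "?L = ?R")
proof
  assume L: ?L
  then have r: "\<rho> \<in> pos_densities" and le: "\<And>\<sigma>. \<sigma> \<in> pos_densities \<Longrightarrow> free_energy \<beta> \<kappa> \<rho> \<le> free_energy \<beta> \<kappa> \<sigma>"
    by (auto simp: global_minimizer_def)
  have i: "integrable cm (\<lambda>t. \<rho> t * ln (\<rho> t))"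
  proof (rule ccontr)
    assume "\<not> ?thesis"
    then show False using le[OF uniform_density] by (simp add: free_energy_eq[OF assms] r uniform_density)
  qed
  have "ent \<rho> - \<kappa> * en \<beta> (mode \<rho>) \<le> ent \<sigma> - \<kappa> * en \<beta> (mode \<sigma>)"
    if "\<sigma> \<in> pos_densities" "integrable cm (\<lambda>t. \<sigma> t * ln (\<sigma> t))" for \<sigma>
    using le[OF that(1)] that i r by (simp add: free_energy_eq[OF assms])
  then show ?R using r i by blast
next
  assume R: ?R
  show ?L unfolding global_minimizer_def
  proof (intro conjI ballI)
    fix \<sigma> assume "\<sigma> \<in> pos_densities"
    then show "free_energy \<beta> \<kappa> \<rho> \<le> free_energy \<beta> \<kappa> \<sigma>" using R by (auto simp: free_energy_eq[OF assms])
  qed (use R in simp)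
qed

text \<open>
  Replacing a density by the Gibbs density of its own field does not increase the free energy; a
  minimizer must attain equality in the variational principle.
\<close>

lemma minimizer_selfconsistent:
  assumes b: "\<beta> > 0" "\<kappa> \<ge> 0" and m: "global_minimizer \<beta> \<kappa> \<rho>"
  shows "AE t in cm. \<rho> t = gibbs (coef \<beta> \<kappa> (mode \<rho>)) t"
proof -
  have r: "\<rho> \<in> pos_densities" "integrable cm (\<lambda>t. \<rho> t * ln (\<rho> t))"
    and le: "\<And>\<sigma>. \<sigma> \<in> pos_densities \<Longrightarrow> integrable cm (\<lambda>t. \<sigma> t * ln (\<sigma> t)) \<Longrightarrow>
       ent \<rho> - \<kappa> * en \<beta> (mode \<rho>) \<le> ent \<sigma> - \<kappa> * en \<beta> (mode \<sigma>)"
    using m unfolding global_minimizer_iff[OF b(1)] by blast+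
  have cu: "cube (mode \<rho>)" by (rule mode_cube[OF r(1)])
  have a: "adm (coef \<beta> \<kappa> (mode \<rho>))" by (rule coef_adm[OF b(1) cu])
  have "ent \<rho> - \<kappa> * en \<beta> (mode \<rho>) \<le> Gf \<beta> \<kappa> (mode \<rho>)"
    using le[OF gibbs_density[OF a] gibbs_ent_integrable[OF a]] gibbs_le_Gf[OF b cu] by linarith
  then show ?thesis using Gf_le[OF b(1) r, of \<kappa>] by (simp add: order_antisym)
qed

lemma Gf_tendsto:
  assumes b: "\<beta> > 0" and c: "\<And>n. cube (z n)" and l: "\<And>j. (\<lambda>n. z n j) \<longlonglongrightarrow> y j"
  shows "(\<lambda>n. Gf \<beta> \<kappa> (z n)) \<longlonglongrightarrow> Gf \<beta> \<kappa> y" "cube y"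
proof -
  show cy: "cube y" unfolding cube_def
  proof
    fix j show "\<bar>y j\<bar> \<le> 1"
      by (rule LIMSEQ_le_const2[OF tendsto_rabs[OF l]]) (use c in \<open>auto simp: cube_def\<close>)
  qed
  have e: "(\<lambda>n. en \<beta> (z n)) \<longlonglongrightarrow> en \<beta> y" unfolding en_def
  proof (rule tannerys_theorem[THEN conjunct2, THEN conjunct2])
    show "eventually (\<lambda>(k, n). norm (wt \<beta> k * (z n k)\<^sup>2) \<le> wt \<beta> k) (at_top \<times>\<^sub>F sequentially)"
      using en_term[OF b c] by (intro always_eventually) auto
  qed (use wt_summable[OF b] in \<open>auto intro!: tendsto_intros l\<close>)
  have p: "(\<lambda>n. pot (coef \<beta> \<kappa> (z n)) t) \<longlonglongrightarrow> pot (coef \<beta> \<kappa> y) t" for t unfolding pot_def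
  proof (rule tannerys_theorem[THEN conjunct2, THEN conjunct2])
    have "norm (coef \<beta> \<kappa> (z n) k * tb k t) \<le> 2 * \<bar>\<kappa>\<bar> * wt \<beta> k" for k n
    proof -
      have "\<bar>z n k\<bar> * \<bar>tb k t\<bar> \<le> 1 * 1" by (intro mult_mono tb_le) (use c in \<open>auto simp: cube_def\<close>)
      then have "(2 * \<bar>\<kappa>\<bar> * wt \<beta> k) * (\<bar>z n k\<bar> * \<bar>tb k t\<bar>) \<le> (2 * \<bar>\<kappa>\<bar> * wt \<beta> k) * (1 * 1)"
        by (rule mult_left_mono) (use wt_nonneg[OF b] in simp)
      then show ?thesis using wt_nonneg[OF b, of k] by (simp add: coef_def abs_mult mult_ac)
    qed
    then show "eventually (\<lambda>(k, n). norm (coef \<beta> \<kappa> (z n) k * tb k t) \<le> 2 * \<bar>\<kappa>\<bar> * wt \<beta> k) (at_top \<times>\<^sub>F sequentially)"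
      by (intro always_eventually) auto
    show "summable (\<lambda>k. 2 * \<bar>\<kappa>\<bar> * wt \<beta> k)" by (intro summable_mult wt_summable b)
  qed (auto simp: coef_def intro!: tendsto_intros l)
  have a: "adm (coef \<beta> \<kappa> (z n))" "adm (coef \<beta> \<kappa> y)" for n by (intro coef_adm b c cy)+
  have "(\<lambda>n. avg (\<lambda>t. exp (pot (coef \<beta> \<kappa> (z n)) t))) \<longlonglongrightarrow> avg (\<lambda>t. exp (pot (coef \<beta> \<kappa> y) t))"
  proof (rule integral_dominated_convergence[where w="\<lambda>_. exp (\<bar>\<kappa>\<bar> * Lam \<beta>)"])
    show "AE t in cm. norm (exp (pot (coef \<beta> \<kappa> (z n)) t)) \<le> exp (\<bar>\<kappa>\<bar> * Lam \<beta>)" for n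
    proof (intro AE_I2)
      fix t
      show "norm (exp (pot (coef \<beta> \<kappa> (z n)) t)) \<le> exp (\<bar>\<kappa>\<bar> * Lam \<beta>)"
        using pot_le[OF a(1), of n t] coef_adm_bound(2)[OF b, of "z n" 1 \<kappa>] c by (simp add: cube_def)
    qed
  qed (use a integrable_exp_pot p in \<open>auto intro!: tendsto_intros\<close>)
  then show "(\<lambda>n. Gf \<beta> \<kappa> (z n)) \<longlonglongrightarrow> Gf \<beta> \<kappa> y"
    unfolding Gf_def using exp_pot_avg_pos[OF a(2)] by (intro tendsto_intros e) auto
qed

lemma cube_sequentially_compact:
  assumes "\<And>n. cube (z n)"
  obtains r y where "strict_mono (r :: nat \<Rightarrow> nat)" "\<And>j. (\<lambda>n. z (r n) j) \<longlonglongrightarrow> y j"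
proof -
  have "compactin (product_topology (\<lambda>_::nat. euclidean) UNIV) (PiE UNIV (\<lambda>_. {-1..1::real}))"
    by (subst compactin_PiE) (simp add: compactin_euclidean_iff)
  then have "compact (PiE UNIV (\<lambda>_::nat. {-1..1::real}))"
    by (simp add: euclidean_product_topology compactin_euclidean_iff)
  then have sc: "seq_compact (PiE UNIV (\<lambda>_::nat. {-1..1::real}))" by (rule compact_imp_seq_compact)
  have "\<forall>n. z n \<in> PiE UNIV (\<lambda>_. {-1..1})" using assms by (auto simp: cube_def PiE_def abs_le_iff minus_le_iff)
  then obtain y r where yr: "strict_mono (r :: nat \<Rightarrow> nat)" "(z \<circ> r) \<longlonglongrightarrow> y"
    using sc by (auto elim!: seq_compactE)
  have "(\<lambda>n. z (r n) j) \<longlonglongrightarrow> y j" for j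
  proof -
    have "continuous_on UNIV (\<lambda>f::nat \<Rightarrow> real. f j)" by (rule continuous_on_product_coordinates)
    from continuous_on_tendsto_compose[OF this yr(2)] show ?thesis by (simp add: o_def)
  qed
  with yr(1) show thesis by (rule that)
qed

text \<open>
  The modes of a minimizing sequence have a coordinatewise limit, the reduced energy is
  continuous there, and the Gibbs density of the limit realizes it.
\<close>

lemma exists_minimizer:
  assumes b: "\<beta> > 0" "\<kappa> \<ge> 0"
  shows "\<exists>\<rho>. global_minimizer \<beta> \<kappa> \<rho>"
proof -
  define Q where "Q = {\<rho>\<in>pos_densities. integrable cm (\<lambda>t. \<rho> t * ln (\<rho> t))}"
  define F where "F \<rho> = ent \<rho> - \<kappa> * en \<beta> (mode \<rho>)" for \<rho>
  have Q1: "(\<lambda>_. 1) \<in> Q" by (simp add: Q_def uniform_density)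
  have bd: "- (\<kappa> * (\<Sum>j. wt \<beta> j)) \<le> F \<rho>" if "\<rho> \<in> Q" for \<rho>
    using ent_nonneg(1)[of \<rho>] mult_left_mono[OF en_le[OF b(1) mode_cube, of \<rho>] b(2)] that by (simp add: F_def Q_def)
  define m where "m = Inf (F ` Q)"
  have bb: "bdd_below (F ` Q)" using bd by (auto intro!: bdd_belowI)
  have "\<exists>\<rho>. \<rho> \<in> Q \<and> F \<rho> < m + 1 / real (Suc n)" for n
  proof -
    have "Inf (F ` Q) < m + 1 / real (Suc n)" by (simp add: m_def)
    then show ?thesis using cInf_lessD[of "F ` Q" "m + 1 / real (Suc n)"] Q1 by blast
  qed
  then obtain R where R: "\<And>n. R n \<in> Q" "\<And>n. F (R n) < m + 1 / real (Suc n)" by metis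
  have c: "cube (mode (R n))" for n using R(1)[of n] by (simp add: Q_def mode_cube)
  obtain r y where ry: "strict_mono (r :: nat \<Rightarrow> nat)" "\<And>j. (\<lambda>n. mode (R (r n)) j) \<longlonglongrightarrow> y j"
    using cube_sequentially_compact[of "\<lambda>n. mode (R n)"] c by blast
  note G = Gf_tendsto[OF b(1) c ry(2)]
  have "Gf \<beta> \<kappa> y \<le> m"
  proof (rule LIMSEQ_le[OF G(1)[of \<kappa>]])
    show "(\<lambda>n. m + 1 / real (Suc (r n))) \<longlonglongrightarrow> m"
      using tendsto_add[OF tendsto_const[of m] LIMSEQ_subseq_LIMSEQ[OF LIMSEQ_inverse_real_of_nat ry(1)]]
      by (simp add: o_def inverse_eq_divide)
    have "Gf \<beta> \<kappa> (mode (R (r n))) \<le> m + 1 / real (Suc (r n))" for n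
      using Gf_le(1)[OF b(1), of "R (r n)" \<kappa>] R[of "r n"] by (simp add: Q_def F_def)
    then show "\<exists>N. \<forall>n\<ge>N. Gf \<beta> \<kappa> (mode (R (r n))) \<le> m + 1 / real (Suc (r n))" by blast
  qed
  define \<rho> where "\<rho> = gibbs (coef \<beta> \<kappa> y)"
  have a: "adm (coef \<beta> \<kappa> y)" by (rule coef_adm[OF b(1) G(2)])
  have rQ: "\<rho> \<in> Q" by (simp add: Q_def \<rho>_def gibbs_density[OF a] gibbs_ent_integrable[OF a])
  have "F \<rho> \<le> m" using gibbs_le_Gf[OF b G(2)] \<open>Gf \<beta> \<kappa> y \<le> m\<close> by (simp add: F_def \<rho>_def)
  moreover have "m \<le> F \<sigma>" if "\<sigma> \<in> Q" for \<sigma> unfolding m_def by (rule cInf_lower) (use that bb in auto)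
  ultimately have "\<forall>\<sigma>\<in>Q. F \<rho> \<le> F \<sigma>" by fastforce
  then have "global_minimizer \<beta> \<kappa> \<rho>" using rQ unfolding global_minimizer_iff[OF b(1)] Q_def F_def by blast
  then show ?thesis by blast
qed

section \<open>Transition points\<close>

definition unstable :: "real \<Rightarrow> real \<Rightarrow> bool" where
  "unstable \<beta> \<kappa> \<longleftrightarrow> (\<exists>z. cube z \<and> Gf \<beta> \<kappa> z < 0)"

lemma unstable_density:
  assumes "\<beta> > 0" "\<kappa> \<ge> 0"
  shows "unstable \<beta> \<kappa> \<longleftrightarrow> (\<exists>\<rho>\<in>pos_densities. integrable cm (\<lambda>t. \<rho> t * ln (\<rho> t)) \<and> ent \<rho> - \<kappa> * en \<beta> (mode \<rho>) < 0)"
proof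
  assume "unstable \<beta> \<kappa>"
  then obtain z where z: "cube z" "Gf \<beta> \<kappa> z < 0" by (auto simp: unstable_def)
  have a: "adm (coef \<beta> \<kappa> z)" by (rule coef_adm[OF assms(1) z(1)])
  show "\<exists>\<rho>\<in>pos_densities. integrable cm (\<lambda>t. \<rho> t * ln (\<rho> t)) \<and> ent \<rho> - \<kappa> * en \<beta> (mode \<rho>) < 0"
    using gibbs_density[OF a] gibbs_ent_integrable[OF a] gibbs_le_Gf[OF assms z(1)] z(2) by (meson le_less_trans)
next
  assume "\<exists>\<rho>\<in>pos_densities. integrable cm (\<lambda>t. \<rho> t * ln (\<rho> t)) \<and> ent \<rho> - \<kappa> * en \<beta> (mode \<rho>) < 0"
  then obtain \<rho> where r: "\<rho> \<in> pos_densities" "integrable cm (\<lambda>t. \<rho> t * ln (\<rho> t))" "ent \<rho> - \<kappa> * en \<beta> (mode \<rho>) < 0" by blast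
  then show "unstable \<beta> \<kappa>" unfolding unstable_def
    using mode_cube[OF r(1)] Gf_le(1)[OF assms(1) r(1,2), of \<kappa>] by (meson le_less_trans)
qed

text \<open>
  Raising \<open>\<kappa>\<close> only lowers the energy of a fixed density.
\<close>

lemma unstable_mono: assumes "\<beta> > 0" "0 \<le> \<kappa>" "\<kappa> \<le> \<kappa>'" "unstable \<beta> \<kappa>" shows "unstable \<beta> \<kappa>'"
proof -
  obtain \<rho> where r: "\<rho> \<in> pos_densities" "integrable cm (\<lambda>t. \<rho> t * ln (\<rho> t))" "ent \<rho> - \<kappa> * en \<beta> (mode \<rho>) < 0"
    using assms unstable_density by blast
  have "\<kappa> * en \<beta> (mode \<rho>) \<le> \<kappa>' * en \<beta> (mode \<rho>)"
    using assms(3) en_nonneg[OF assms(1) mode_cube[OF r(1)]] by (rule mult_right_mono)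
  then have "ent \<rho> - \<kappa>' * en \<beta> (mode \<rho>) < 0" using r(3) by linarith
  then show ?thesis using unstable_density[of \<beta> \<kappa>'] assms r by auto
qed

lemma unstable_open: assumes "\<beta> > 0" "0 < \<kappa>" "unstable \<beta> \<kappa>" shows "\<exists>\<kappa>'>0. \<kappa>' < \<kappa> \<and> unstable \<beta> \<kappa>'"
proof -
  obtain \<rho> where r: "\<rho> \<in> pos_densities" "integrable cm (\<lambda>t. \<rho> t * ln (\<rho> t))" "ent \<rho> - \<kappa> * en \<beta> (mode \<rho>) < 0"
    using assms unstable_density[of \<beta> \<kappa>] by auto
  have e: "0 \<le> ent \<rho>" "0 \<le> en \<beta> (mode \<rho>)"
    using ent_nonneg(1)[OF r(1,2)] en_nonneg[OF assms(1) mode_cube[OF r(1)]] by auto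
  then have en: "en \<beta> (mode \<rho>) > 0" using r(3) by (metis diff_zero less_eq_real_def mult_zero_right not_less)
  obtain q where q: "q = ent \<rho> / en \<beta> (mode \<rho>)" by blast
  have "q < \<kappa>" "0 \<le> q" unfolding q using r(3) en e by (simp_all add: field_simps)
  define \<kappa>' where "\<kappa>' = (q + \<kappa>) / 2"
  have k': "0 < \<kappa>'" "\<kappa>' < \<kappa>" "q < \<kappa>'"
    using \<open>q < \<kappa>\<close> \<open>0 \<le> q\<close> assms(2) by (simp_all add: \<kappa>'_def)
  have "ent \<rho> < \<kappa>' * en \<beta> (mode \<rho>)" using k'(3) en unfolding q by (simp add: pos_divide_less_eq)
  then have "ent \<rho> - \<kappa>' * en \<beta> (mode \<rho>) < 0" by simp
  then show ?thesis using unstable_density[of \<beta> \<kappa>'] assms(1) k' r by auto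
qed

lemma not_unstable_minimizer:
  assumes "\<beta> > 0" "\<kappa> \<ge> 0" "\<not> unstable \<beta> \<kappa>" shows "global_minimizer \<beta> \<kappa> (\<lambda>_. 1)"
  using assms unstable_density[OF assms(1,2)] unfolding global_minimizer_iff[OF assms(1)]
  by (auto simp: mode_uniform uniform_density not_less)

lemma unstable_minimizer:
  assumes "\<beta> > 0" "\<kappa> \<ge> 0" "unstable \<beta> \<kappa>" shows "\<exists>\<rho>. global_minimizer \<beta> \<kappa> \<rho> \<and> \<not> is_uniform \<rho>"
proof -
  obtain \<rho> where m: "global_minimizer \<beta> \<kappa> \<rho>" using exists_minimizer assms by blast
  then have r: "\<rho> \<in> pos_densities" and le: "\<And>\<sigma>. \<sigma> \<in> pos_densities \<Longrightarrow> integrable cm (\<lambda>t. \<sigma> t * ln (\<sigma> t)) \<Longrightarrow>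
       ent \<rho> - \<kappa> * en \<beta> (mode \<rho>) \<le> ent \<sigma> - \<kappa> * en \<beta> (mode \<sigma>)"
    unfolding global_minimizer_iff[OF assms(1)] by blast+
  obtain \<sigma> where s: "\<sigma> \<in> pos_densities" "integrable cm (\<lambda>t. \<sigma> t * ln (\<sigma> t))" "ent \<sigma> - \<kappa> * en \<beta> (mode \<sigma>) < 0"
    using assms unstable_density by blast
  have "\<not> is_uniform \<rho>"
  proof
    assume u: "is_uniform \<rho>"
    have rm: "\<rho> \<in> borel_measurable cm" using r by (auto simp: pos_densities_iff)
    have "ent \<rho> = avg (\<lambda>_. 0)" unfolding ent_def
      by (rule integral_cong_AE) (use u rm in \<open>auto simp: is_uniform_cm elim!: eventually_mono\<close>)
    moreover have "mode \<rho> j = avg (tb j)" for j unfolding mode_def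
      by (rule integral_cong_AE) (use u rm tb_cm in \<open>auto simp: is_uniform_cm elim!: eventually_mono\<close>)
    then have "mode \<rho> = (\<lambda>_. 0)" by auto
    ultimately have "ent \<rho> - \<kappa> * en \<beta> (mode \<rho>) = 0" by simp
    then show False using le[OF s(1,2)] s(3) by linarith
  qed
  with m show ?thesis by blast
qed

text \<open>
  Below \<open>k\<close> a competitor with nonpositive energy has no interaction energy, because
  its energy at the larger value \<open>k\<close> is still nonnegative; then its entropy
  vanishes as well, and it is uniform.
\<close>

lemma transition_pointI:
  assumes b: "\<beta> > 0" and k: "0 < k" "\<not> unstable \<beta> k" and un: "\<And>\<kappa>. k < \<kappa> \<Longrightarrow> unstable \<beta> \<kappa>"
  shows "transition_point \<beta> k"
  unfolding transition_point_def
proof (intro conjI allI impI)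
  have ns: "\<not> unstable \<beta> \<kappa>" if "0 \<le> \<kappa>" "\<kappa> \<le> k" for \<kappa> using unstable_mono[OF b that] k by blast
  show "global_minimizer \<beta> k (\<lambda>_. 1)" by (rule not_unstable_minimizer) (use b k in auto)
  show "\<exists>\<rho>. global_minimizer \<beta> \<kappa> \<rho> \<and> \<not> is_uniform \<rho>" if "k < \<kappa>" for \<kappa>
    by (rule unstable_minimizer) (use b k un that in auto)
  fix \<kappa> assume kk: "0 < \<kappa> \<and> \<kappa> < k"
  show "uniform_unique_minimizer \<beta> \<kappa>" unfolding uniform_unique_minimizer_def
  proof (intro conjI allI impI)
    show g1: "global_minimizer \<beta> \<kappa> (\<lambda>_. 1)" by (rule not_unstable_minimizer) (use b kk ns in auto)
    fix \<rho> assume m: "global_minimizer \<beta> \<kappa> \<rho>"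
    then have r: "\<rho> \<in> pos_densities" "integrable cm (\<lambda>t. \<rho> t * ln (\<rho> t))" unfolding global_minimizer_iff[OF b] by blast+
    have "ent \<rho> - \<kappa> * en \<beta> (mode \<rho>) \<le> 0"
      using m uniform_density unfolding global_minimizer_iff[OF b]
      by (auto simp: mode_uniform dest!: bspec[of _ _ "\<lambda>_. 1"])
    moreover have "ent \<rho> - k * en \<beta> (mode \<rho>) \<ge> 0"
      using unstable_density[OF b, of k] k r by (force simp: not_less)
    ultimately have "(k - \<kappa>) * en \<beta> (mode \<rho>) \<le> 0" by (simp add: algebra_simps)
    then have "en \<beta> (mode \<rho>) \<le> 0" using kk by (simp add: mult_le_0_iff)
    then have "en \<beta> (mode \<rho>) = 0" using en_nonneg[OF b mode_cube[OF r(1)]] by linarith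
    then have "ent \<rho> = 0" using \<open>ent \<rho> - \<kappa> * en \<beta> (mode \<rho>) \<le> 0\<close> ent_nonneg(1)[OF r] by simp
    then show "is_uniform \<rho>" by (rule ent_nonneg(2)[OF r])
  qed
qed (rule k)

section \<open>Exponential remainders\<close>

text \<open>
  The remainder of the exponential series, with the crude constant that suits all later uses.
\<close>

lemma exp_taylor:
  fixes x :: "'a::{real_normed_field, banach}"
  shows "norm (exp x - (\<Sum>n<k. x ^ n /\<^sub>R fact n)) \<le> norm x ^ k * exp (norm x)"
proof -
  have "exp x - (\<Sum>n<k. x ^ n /\<^sub>R fact n) = (\<Sum>n. x ^ (n + k) /\<^sub>R fact (n + k))"
    using suminf_split_initial_segment[OF summable_exp_generic[of x], of k] by (simp add: exp_def)
  also have "norm \<dots> \<le> (\<Sum>n. norm x ^ k * (norm x ^ n /\<^sub>R fact n))"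
  proof (rule suminf_norm_le)
    show "summable (\<lambda>n. norm x ^ k * (norm x ^ n /\<^sub>R fact n))"
      by (intro summable_mult summable_exp_generic)
    fix n
    have "(fact n :: real) \<le> fact (n + k)" by (rule fact_mono) simp
    then have "inverse (fact (n + k)) * norm x ^ (n + k) \<le> inverse (fact n :: real) * norm x ^ (n + k)"
      by (intro mult_right_mono le_imp_inverse_le) auto
    then show "norm (x ^ (n + k) /\<^sub>R fact (n + k)) \<le> norm x ^ k * (norm x ^ n /\<^sub>R fact n)"
      by (simp add: norm_power norm_mult power_add mult_ac)
  qed
  also have "\<dots> = norm x ^ k * exp (norm x)"
    unfolding exp_def by (intro suminf_mult summable_exp_generic)
  finally show ?thesis .
qed

lemma exp_remainder:
  fixes x :: "'a::{real_normed_field, banach}"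
  shows "norm (exp x - 1 - x) \<le> (norm x)\<^sup>2 * exp (norm x)"
  using exp_taylor[of x 2] by (simp add: numeral_2_eq_2 lessThan_Suc algebra_simps)

lemma exp_diff_le:
  fixes x y :: real
  assumes "\<bar>x\<bar> \<le> B" "\<bar>y\<bar> \<le> B"
  shows "\<bar>exp x - exp y\<bar> \<le> exp B * \<bar>x - y\<bar>"
proof -
  have "norm (exp x - exp y) \<le> exp B * norm (x - y)"
    by (rule field_differentiable_bound[of "{-B..B}" exp exp])
       (use assms in \<open>auto simp: abs_le_iff intro!: has_field_derivative_at_within DERIV_exp\<close>)
  then show ?thesis by simp
qed

lemma mode_pot: assumes "adm a" shows "avg (\<lambda>t. pot a t * tb j t) = a j / 2"
proof -
  have "integrable cm (tb j)" by (intro integrable_cm_continuous continuous_intros)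
  then have "(\<lambda>i. a i * mode (tb j) i) sums avg (\<lambda>t. tb j t * pot a t)"
    using avg_mult_pot(1) assms by blast
  then have "(\<lambda>i. if i = j then a i / 2 else 0) sums avg (\<lambda>t. pot a t * tb j t)"
    by (simp add: mode_def avg_tb_tb mult.commute if_distrib eq_commute cong: if_cong)
  then show ?thesis using sums_single[of j "\<lambda>i. a i / 2"] sums_unique2 by fastforce
qed

lemma exp_pot_avg_ge_1: assumes "adm a" shows "avg (\<lambda>t. exp (pot a t)) \<ge> 1"
proof -
  have i: "integrable cm (pot a)" by (intro integrable_cm_continuous pot_continuous assms)
  have "1 = avg (\<lambda>t. 1 + pot a t)" using i avg_pot[OF assms] by simp
  also have "\<dots> \<le> avg (\<lambda>t. exp (pot a t))"
    by (rule integral_mono) (use i integrable_exp_pot[OF assms] in auto)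
  finally show ?thesis .
qed

text \<open>
  To first order the modes of a Gibbs density are half the coefficients of its potential, up to
  the partition function; the error is quadratic uniformly in the index.
\<close>

lemma mode_gibbs_approx:
  assumes a: "adm a" and B: "pnorm a \<le> B"
  shows "\<bar>mode (gibbs a) j * avg (\<lambda>t. exp (pot a t)) - a j / 2\<bar> \<le> B\<^sup>2 * exp B"
proof -
  define Z where "Z = avg (\<lambda>t. exp (pot a t))"
  have Z: "Z > 0" using exp_pot_avg_pos[OF a] by (simp add: Z_def)
  have i: "integrable cm (\<lambda>t. exp (pot a t) * tb j t)" "integrable cm (tb j)" "integrable cm (\<lambda>t. pot a t * tb j t)"
    by (intro integrable_cm_continuous continuous_intros pot_continuous a)+
  have "mode (gibbs a) j * Z = avg (\<lambda>t. exp (pot a t) * tb j t)"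
    unfolding mode_def gibbs_def Z_def[symmetric] using Z by simp
  then have "mode (gibbs a) j * Z - a j / 2 = avg (\<lambda>t. exp (pot a t) * tb j t - tb j t - pot a t * tb j t)"
    using i mode_pot[OF a, of j] by simp
  also have "norm \<dots> \<le> B\<^sup>2 * exp B"
  proof (rule avg_norm_le)
    fix t
    have p: "\<bar>pot a t\<bar> \<le> B" using pot_le[OF a, of t] B by linarith
    have "norm (exp (pot a t) * tb j t - tb j t - pot a t * tb j t) = \<bar>exp (pot a t) - 1 - pot a t\<bar> * \<bar>tb j t\<bar>"
      unfolding real_norm_def abs_mult[symmetric] by (simp add: algebra_simps)
    also have "\<dots> \<le> (\<bar>pot a t\<bar>\<^sup>2 * exp \<bar>pot a t\<bar>) * 1"
      using exp_remainder[of "pot a t"] by (intro mult_mono tb_le) auto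
    also have "\<dots> \<le> (B\<^sup>2 * exp B) * 1"
      using p by (intro mult_mono power_mono) auto
    finally show "norm (exp (pot a t) * tb j t - tb j t - pot a t * tb j t) \<le> B\<^sup>2 * exp B" by simp
  qed
  finally show ?thesis by (simp add: Z_def)
qed

section \<open>Self-consistent densities\<close>

definition selfcons :: "real \<Rightarrow> real \<Rightarrow> (real \<Rightarrow> real) \<Rightarrow> bool" where
  "selfcons \<beta> \<kappa> \<rho> \<longleftrightarrow> \<rho> \<in> pos_densities \<and> (AE t in cm. \<rho> t = gibbs (coef \<beta> \<kappa> (mode \<rho>)) t)"

lemma mode_cong:
  assumes "\<rho> \<in> borel_measurable cm" "\<sigma> \<in> borel_measurable cm" "AE t in cm. \<rho> t = \<sigma> t"
  shows "mode \<rho> = mode \<sigma>"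
proof
  fix j show "mode \<rho> j = mode \<sigma> j" unfolding mode_def
    by (rule integral_cong_AE) (use assms tb_cm in \<open>auto elim!: eventually_mono\<close>)
qed

lemma pos_densities_cm: "\<rho> \<in> pos_densities \<Longrightarrow> \<rho> \<in> borel_measurable cm"
  by (auto simp: pos_densities_iff)

lemma selfcons_mode:
  assumes "\<beta> > 0" "selfcons \<beta> \<kappa> \<rho>"
  shows "mode \<rho> = mode (gibbs (coef \<beta> \<kappa> (mode \<rho>)))"
  using assms by (intro mode_cong) (auto simp: selfcons_def intro: gibbs_cm coef_adm mode_cube pos_densities_cm)

lemma minimizer_selfcons: "\<beta> > 0 \<Longrightarrow> \<kappa> \<ge> 0 \<Longrightarrow> global_minimizer \<beta> \<kappa> \<rho> \<Longrightarrow> selfcons \<beta> \<kappa> \<rho>"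
  using minimizer_selfconsistent by (simp add: selfcons_def global_minimizer_def)

lemma selfcons_uniformI:
  assumes "\<beta> > 0" "selfcons \<beta> \<kappa> \<rho>" "\<And>j. mode \<rho> j = 0" shows "is_uniform \<rho>"
proof -
  have "mode \<rho> = (\<lambda>_. 0)" using assms(3) by auto
  then show ?thesis using assms(2) by (simp add: selfcons_def is_uniform_cm)
qed

lemma kappa_star_pos: "\<beta> > 0 \<Longrightarrow> kappa_star \<beta> > 0"
  using bessel_1_pos[of \<beta>] by (simp add: kappa_star_def)

lemma wt_le: assumes "\<beta> > 0" shows "wt \<beta> j \<le> 1 / kappa_star \<beta>"
proof -
  have "bessel_I (freq j) \<beta> \<le> bessel_I 1 \<beta>"
  proof (cases "freq j = 1")
    case False
    then have "freq j \<ge> 2" using freq_pos[of j] by simp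
    then show ?thesis using bessel_le_2[of \<beta> "freq j"] bessel_2_less_1[OF assms] assms by simp
  qed simp
  then show ?thesis using assms by (simp add: wt_def kappa_star_def divide_right_mono)
qed

lemma wt_first: "\<beta> > 0 \<Longrightarrow> wt \<beta> 0 = 1 / kappa_star \<beta>" "\<beta> > 0 \<Longrightarrow> wt \<beta> (Suc 0) = 1 / kappa_star \<beta>"
  by (simp_all add: wt_def kappa_star_def freq_def)

lemma wt_later: assumes "\<beta> > 0" "j \<ge> 2" shows "wt \<beta> j \<le> bessel_R \<beta> / kappa_star \<beta>"
proof -
  have "freq j \<ge> 2" using assms(2) by (auto simp: freq_def)
  then have "bessel_I (freq j) \<beta> \<le> bessel_I 2 \<beta>" using bessel_le_2 assms by simp
  then show ?thesis using assms bessel_1_pos[of \<beta>] by (simp add: wt_def kappa_star_def bessel_R_def divide_right_mono)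
qed

text \<open>
  Self-consistency maps modes of size \<open>m\<close> to modes of size at most \<open>(k0 /
  \<kappa>\<^sup>*) m + C m\<^sup>2\<close>, because the first mode has the largest weight
  \<open>1 / \<kappa>\<^sup>*\<close>. Modes that are small must therefore vanish.
\<close>

lemma subcritical_isolation:
  assumes b: "\<beta> > 0" and k0: "0 \<le> k0" "k0 < kappa_star \<beta>"
  shows "\<exists>\<epsilon>>0. \<forall>\<kappa> \<rho>. 0 \<le> \<kappa> \<and> \<kappa> \<le> k0 \<and> selfcons \<beta> \<kappa> \<rho> \<and> avg (\<lambda>t. \<bar>\<rho> t - 1\<bar>) \<le> \<epsilon> \<longrightarrow> is_uniform \<rho>"
proof -
  define q where "q = k0 / kappa_star \<beta>"
  have q: "0 \<le> q" "q < 1" using k0 kappa_star_pos[OF b] by (auto simp: q_def)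
  define L where "L = k0 * Lam \<beta>"
  have L: "0 \<le> L" using Lam_nonneg[OF b] k0 by (simp add: L_def)
  define C where "C = L\<^sup>2 * exp L"
  have C: "0 \<le> C" by (simp add: C_def)
  define \<epsilon> where "\<epsilon> = min 1 ((1 - q) / (2 * (C + 1)))"
  have e: "\<epsilon> > 0" "\<epsilon> \<le> 1" "\<epsilon> \<le> (1 - q) / (2 * (C + 1))" using q C by (auto simp: \<epsilon>_def)
  have Ce: "C * \<epsilon> < 1 - q"
  proof -
    have "C * \<epsilon> \<le> (C + 1) * ((1 - q) / (2 * (C + 1)))" using e C by (intro mult_mono) auto
    also have "\<dots> = (1 - q) / 2" using C by (simp add: nonzero_divide_eq_eq field_simps)
    also have "\<dots> < 1 - q" using q by simp
    finally show ?thesis .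
  qed
  show ?thesis
  proof (intro exI[of _ \<epsilon>] conjI allI impI)
    fix \<kappa> \<rho> assume A: "0 \<le> \<kappa> \<and> \<kappa> \<le> k0 \<and> selfcons \<beta> \<kappa> \<rho> \<and> avg (\<lambda>t. \<bar>\<rho> t - 1\<bar>) \<le> \<epsilon>"
    then have r: "\<rho> \<in> pos_densities" and ri: "integrable cm \<rho>" by (auto simp: selfcons_def pos_densities_iff)
    define z where "z = mode \<rho>"
    have ze: "\<bar>z j\<bar> \<le> \<epsilon>" for j using mode_diff_le[OF ri, of j 1] A by (simp add: z_def)
    define m where "m = (SUP j. \<bar>z j\<bar>)"
    have bdd: "bdd_above (range (\<lambda>j. \<bar>z j\<bar>))" using ze by (auto intro!: bdd_aboveI)
    have zm: "\<bar>z j\<bar> \<le> m" for j unfolding m_def by (rule cSUP_upper[OF _ bdd]) simp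
    have m: "0 \<le> m" "m \<le> \<epsilon>" using zm[of 0] ze by (auto simp: m_def intro: cSUP_least)
    define a where "a = coef \<beta> \<kappa> z"
    have a: "adm a" "pnorm a \<le> L * m"
    proof -
      show "adm a" unfolding a_def by (rule coef_adm_bound(1)[OF b zm])
      have "pnorm a \<le> \<bar>\<kappa>\<bar> * (Lam \<beta> * m)" unfolding a_def by (rule coef_adm_bound(2)[OF b zm])
      also have "\<dots> \<le> k0 * (Lam \<beta> * m)" using A m Lam_nonneg[OF b] by (intro mult_right_mono) auto
      finally show "pnorm a \<le> L * m" by (simp add: L_def mult_ac)
    qed
    define Z where "Z = avg (\<lambda>t. exp (pot a t))"
    have Z: "Z \<ge> 1" unfolding Z_def by (rule exp_pot_avg_ge_1[OF a(1)])
    have zj: "\<bar>z j\<bar> \<le> q * m + C * m\<^sup>2" for j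
    proof -
      have "z j = mode (gibbs a) j" using selfcons_mode[OF b, of \<kappa> \<rho>] A by (simp add: a_def z_def)
      then have "\<bar>z j * Z - a j / 2\<bar> \<le> (L * m)\<^sup>2 * exp (L * m)"
        using mode_gibbs_approx[OF a, of j] by (simp add: Z_def)
      also have "\<dots> \<le> (L * m)\<^sup>2 * exp L"
        using m e L by (intro mult_left_mono) (auto intro: mult_left_le)
      also have "\<dots> = C * m\<^sup>2" by (simp add: C_def power_mult_distrib)
      finally have 1: "\<bar>z j * Z - a j / 2\<bar> \<le> C * m\<^sup>2" .
      have "\<bar>a j / 2\<bar> = \<kappa> * wt \<beta> j * \<bar>z j\<bar>" using A wt_nonneg[OF b, of j] by (simp add: a_def coef_def abs_mult)
      also have "\<dots> \<le> (k0 * (1 / kappa_star \<beta>)) * m"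
        using A wt_nonneg[OF b, of j] wt_le[OF b, of j] zm[of j] k0 m kappa_star_pos[OF b] by (intro mult_mono) auto
      finally have 2: "\<bar>a j / 2\<bar> \<le> q * m" by (simp add: q_def)
      have "\<bar>z j\<bar> * 1 \<le> \<bar>z j\<bar> * Z" using Z by (intro mult_left_mono) auto
      also have "\<dots> = \<bar>z j * Z\<bar>" using Z by (simp add: abs_mult)
      finally show ?thesis using 1 2 by linarith
    qed
    have "m \<le> q * m + C * m\<^sup>2" unfolding m_def by (rule cSUP_least) (use zj in \<open>auto simp: m_def\<close>)
    moreover have "C * m\<^sup>2 \<le> (C * \<epsilon>) * m"
      unfolding power2_eq_square mult.assoc using m C by (intro mult_left_mono mult_right_mono) auto
    ultimately have "(1 - q - C * \<epsilon>) * m \<le> 0" by (simp add: algebra_simps)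
    then have "m \<le> 0" using Ce by (simp add: mult_le_0_iff)
    then have "z j = 0" for j using zm[of j] by simp
    then show "is_uniform \<rho>" using selfcons_uniformI[OF b] A by (auto simp: z_def)
  qed (use e in simp)
qed

section \<open>Sobolev estimates for Gibbs densities\<close>

definition gibbs' :: "(nat \<Rightarrow> real) \<Rightarrow> real \<Rightarrow> real" where "gibbs' a t = pot' a t * gibbs a t"

lemma gibbs_deriv: assumes "adm a" shows "(gibbs a has_real_derivative gibbs' a x) (at x)"
  unfolding gibbs_def[abs_def] gibbs'_def using exp_pot_avg_pos[OF assms]
  by (auto intro!: derivative_eq_intros pot_deriv[OF assms])

lemma gibbs'_continuous: "adm a \<Longrightarrow> continuous_on A (gibbs' a)"
  unfolding gibbs'_def[abs_def] by (intro continuous_intros pot'_continuous gibbs_continuous)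

lemma gibbs_periodic: "gibbs a (t + 2 * pi) = gibbs a t" "gibbs a (2 * pi) = gibbs a 0"
  by (simp_all add: gibbs_def pot_periodic)

lemma gibbs_le: assumes "adm a" "pnorm a \<le> B" shows "gibbs a t \<le> exp B"
proof -
  have "exp (pot a t) \<le> exp B" using pot_le[OF assms(1), of t] assms(2) by simp
  moreover have "gibbs a t \<le> exp (pot a t) / 1" unfolding gibbs_def
    using exp_pot_avg_ge_1[OF assms(1)] by (intro divide_left_mono) auto
  ultimately show ?thesis by (metis div_by_1 order_trans)
qed

text \<open>
  Numerators, partition functions and derivatives of the potentials all depend on the
  coefficients in a Lipschitz way, with constants uniform over bounded potentials.
\<close>

lemma gibbs_lipschitz:
  assumes a: "adm a" "pnorm a \<le> B" and b: "adm b" "pnorm b \<le> B"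
  defines "d \<equiv> pnorm (\<lambda>j. a j - b j)"
  shows "\<bar>gibbs a t - gibbs b t\<bar> \<le> 2 * exp (2 * B) * (1 + B) * d"
    and "\<bar>gibbs' a t - gibbs' b t\<bar> \<le> 2 * exp (2 * B) * (1 + B) * d"
proof -
  have ad: "adm (\<lambda>j. a j - b j)" by (rule adm_diff[OF a(1) b(1)])
  have d0: "0 \<le> d" unfolding d_def by (rule pnorm_nonneg[OF ad])
  have B0: "0 \<le> B" using pnorm_nonneg[OF a(1)] a(2) by linarith
  have pa: "\<bar>pot a t\<bar> \<le> B" "\<bar>pot b t\<bar> \<le> B" "\<bar>pot' b t\<bar> \<le> B" for t
    using pot_le[OF a(1), of t] pot_le[OF b(1), of t] pot'_le[OF b(1), of t] a b by linarith+
  have pd: "\<bar>pot a t - pot b t\<bar> \<le> d" "\<bar>pot' a t - pot' b t\<bar> \<le> d" for t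
    using pot_le[OF ad, of t] pot'_le[OF ad, of t] by (simp_all add: d_def pot_diff pot'_diff a b)
  have ed: "\<bar>exp (pot a t) - exp (pot b t)\<bar> \<le> exp B * d" for t
    by (rule order_trans[OF exp_diff_le[OF pa(1,2)[of t]] mult_left_mono[OF pd(1)[of t]]]) simp
  define Za where "Za = avg (\<lambda>t. exp (pot a t))"
  define Zb where "Zb = avg (\<lambda>t. exp (pot b t))"
  have Z1: "Za \<ge> 1" "Zb \<ge> 1" unfolding Za_def Zb_def using exp_pot_avg_ge_1 a b by auto
  have ZB: "\<bar>Zb\<bar> \<le> exp B" unfolding Zb_def real_norm_def[symmetric] by (rule avg_norm_le) (use pa in \<open>auto simp: abs_le_iff\<close>)
  have Zd: "\<bar>Zb - Za\<bar> \<le> exp B * d"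
  proof -
    have "Zb - Za = avg (\<lambda>t. exp (pot b t) - exp (pot a t))"
      unfolding Za_def Zb_def using integrable_exp_pot a b by simp
    also have "norm \<dots> \<le> exp B * d" by (rule avg_norm_le) (use ed in \<open>simp add: abs_minus_commute\<close>)
    finally show ?thesis by simp
  qed
  have g: "\<bar>gibbs a t - gibbs b t\<bar> \<le> 2 * exp (2 * B) * d" for t
  proof -
    define ea where "ea = exp (pot a t)"
    define eb where "eb = exp (pot b t)"
    have eb: "\<bar>eb\<bar> \<le> exp B" using pa(2)[of t] by (simp add: eb_def)
    have "gibbs a t - gibbs b t = ((ea - eb) * Zb + eb * (Zb - Za)) / (Za * Zb)"
      unfolding gibbs_def Za_def[symmetric] Zb_def[symmetric] ea_def[symmetric] eb_def[symmetric]
      using Z1 by (simp add: field_simps)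
    also have "\<bar>\<dots>\<bar> \<le> \<bar>(ea - eb) * Zb + eb * (Zb - Za)\<bar> / 1"
      unfolding abs_divide using Z1 mult_mono[of 1 Za 1 Zb] by (intro divide_left_mono) auto
    also have "\<dots> \<le> \<bar>ea - eb\<bar> * \<bar>Zb\<bar> + \<bar>eb\<bar> * \<bar>Zb - Za\<bar>" by (simp add: abs_mult[symmetric])
    also have "\<dots> \<le> (exp B * d) * exp B + exp B * (exp B * d)"
      by (intro add_mono mult_mono) (use ed[of t] ZB Zd eb d0 in \<open>auto simp: ea_def eb_def\<close>)
    also have "\<dots> = 2 * (exp B * exp B) * d" by simp
    also have "exp B * exp B = exp (2 * B)" by (simp add: exp_add[symmetric])
    finally show ?thesis .
  qed
  have "2 * exp (2 * B) * d * 1 \<le> 2 * exp (2 * B) * d * (1 + B)" using B0 d0 by (intro mult_left_mono) auto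
  then show "\<bar>gibbs a t - gibbs b t\<bar> \<le> 2 * exp (2 * B) * (1 + B) * d" using g[of t] by (simp add: mult_ac)
  have "gibbs' a t - gibbs' b t = (pot' a t - pot' b t) * gibbs a t + pot' b t * (gibbs a t - gibbs b t)"
    by (simp add: gibbs'_def algebra_simps)
  also have "\<bar>\<dots>\<bar> \<le> \<bar>pot' a t - pot' b t\<bar> * \<bar>gibbs a t\<bar> + \<bar>pot' b t\<bar> * \<bar>gibbs a t - gibbs b t\<bar>"
    by (simp add: abs_mult[symmetric])
  also have "\<dots> \<le> d * exp B + B * (2 * exp (2 * B) * d)"
    by (intro add_mono mult_mono) (use pd[of t] pa[of t] g[of t] gibbs_le[OF a, of t] gibbs_pos[OF a(1), of t] d0 B0 in auto)
  also have "d * exp B \<le> d * (2 * exp (2 * B))"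
  proof (rule mult_left_mono[OF _ d0])
    have "exp B \<le> exp (2 * B)" using B0 by simp
    then show "exp B \<le> 2 * exp (2 * B)" using exp_gt_zero[of "2 * B"] by linarith
  qed
  finally show "\<bar>gibbs' a t - gibbs' b t\<bar> \<le> 2 * exp (2 * B) * (1 + B) * d" by (simp add: algebra_simps)
qed

lemma H1_gibbs_diff:
  assumes a: "adm a" "pnorm a \<le> B" and b: "adm b" "pnorm b \<le> B"
    and f: "f \<in> borel_measurable cm" "AE x in cm. f x = gibbs a x - gibbs b x"
  shows "H1_norm f \<le> ennreal (4 * (2 * exp (2 * B) * (1 + B) * pnorm (\<lambda>j. a j - b j)))"
proof (rule H1_norm_le[OF f])
  show "((\<lambda>x. gibbs a x - gibbs b x) has_real_derivative gibbs' a x - gibbs' b x) (at x)" for x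
    by (intro derivative_intros gibbs_deriv a b)
  show "continuous_on UNIV (\<lambda>x. gibbs' a x - gibbs' b x)" by (intro continuous_intros gibbs'_continuous a b)
qed (use gibbs_periodic gibbs_lipschitz[OF a b] in auto)

section \<open>Stationary solutions\<close>

lemma W_conv_deriv:
  assumes "\<beta> > 0" "p \<in> pos_densities"
  shows "\<kappa> * deriv (W_conv \<beta> p) t = pot' (coef \<beta> \<kappa> (mode p)) t"
proof -
  have cu: "cube (mode p)" by (rule mode_cube[OF assms(2)])
  have "W_conv \<beta> p = (\<lambda>t. W0 \<beta> + pot (coef \<beta> 1 (mode p)) t)" using W_conv_pot(1)[OF assms] by auto
  then have "deriv (W_conv \<beta> p) t = pot' (coef \<beta> 1 (mode p)) t"
    by (auto intro!: DERIV_imp_deriv derivative_eq_intros pot_deriv coef_adm assms cu)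
  then show ?thesis by (simp only: pot_coef_scale(2)[OF assms(1) cu, of \<kappa> t])
qed

text \<open>
  The derivative of a Gibbs density is the density times the derivative of its potential, which
  is the flux in the stationary equation.
\<close>

lemma selfcons_imp_stationary:
  assumes b: "\<beta> > 0" and s: "selfcons \<beta> \<kappa> p"
  shows "stationary \<beta> \<kappa> p"
proof -
  have p: "p \<in> pos_densities" and ae: "AE t in cm. p t = gibbs (coef \<beta> \<kappa> (mode p)) t" using s by (auto simp: selfcons_def)
  define a where "a = coef \<beta> \<kappa> (mode p)"
  have a: "adm a" unfolding a_def by (intro coef_adm b mode_cube p)
  have pm: "p \<in> borel_measurable cm" by (rule pos_densities_cm[OF p])
  have "weak_deriv p (gibbs' a)"
  proof (rule weak_deriv_cong[OF _ pm])
    show "weak_deriv (gibbs a) (gibbs' a)" by (intro weak_deriv_C1 gibbs_deriv gibbs'_continuous a gibbs_periodic)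
  qed (use ae in \<open>simp add: a_def\<close>)
  moreover have "weak_deriv (\<lambda>t. gibbs' a t - \<kappa> * (p t * deriv (W_conv \<beta> p) t)) (\<lambda>_. 0)"
  proof (rule weak_deriv_cong[of "\<lambda>_. 0"])
    show "weak_deriv (\<lambda>_. 0) (\<lambda>_. 0)" by (rule weak_deriv_C1) auto
    have eq: "\<kappa> * (p t * deriv (W_conv \<beta> p) t) = p t * pot' a t" for t
      using W_conv_deriv[OF b p, of \<kappa> t] by (simp add: a_def mult.left_commute)
    have "pot' a \<in> borel_measurable cm" "gibbs' a \<in> borel_measurable cm"
      by (intro measurable_cm_borel borel_measurable_continuous_onI pot'_continuous gibbs'_continuous a)+
    then show "(\<lambda>t. gibbs' a t - \<kappa> * (p t * deriv (W_conv \<beta> p) t)) \<in> borel_measurable cm"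
      unfolding eq using pm by (intro borel_measurable_diff borel_measurable_times)
    show "AE t in cm. gibbs' a t - \<kappa> * (p t * deriv (W_conv \<beta> p) t) = 0"
      unfolding eq using ae by eventually_elim (simp add: gibbs'_def a_def mult.commute)
  qed
  ultimately show ?thesis using p by (auto simp: stationary_def)
qed

text \<open>
  The stationary equation says that \<open>p' - p V'\<close> is a constant \<open>c\<close>,
  where \<open>V\<close> is the field of \<open>p\<close>. Testing with \<open>exp (- V)\<close>
  gives \<open>c = 0\<close>; then \<open>p exp (- V)\<close> has zero weak derivative and is
  constant.
\<close>

lemma stationary_imp_selfcons:
  assumes b: "\<beta> > 0" and s: "stationary \<beta> \<kappa> p"
  shows "selfcons \<beta> \<kappa> p"
proof -
  obtain q where p: "p \<in> pos_densities" and w: "weak_deriv p q"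
    and w0: "weak_deriv (\<lambda>t. q t - \<kappa> * (p t * deriv (W_conv \<beta> p) t)) (\<lambda>_. 0)"
    using s by (auto simp: stationary_def)
  define a where "a = coef \<beta> \<kappa> (mode p)"
  have a: "adm a" unfolding a_def by (intro coef_adm b mode_cube p)
  have eq: "\<kappa> * (p t * deriv (W_conv \<beta> p) t) = p t * pot' a t" for t
    using W_conv_deriv[OF b p, of \<kappa> t] by (simp add: a_def mult.left_commute)
  have pi: "integrable cm p" "square_integrable p" and qi: "integrable cm q"
    using w by (auto simp: weak_deriv_def intro: square_integrable_imp_integrable)
  define c where "c = avg (\<lambda>t. q t - p t * pot' a t)"
  have qc: "AE t in cm. q t = p t * pot' a t + c"
    using weak_deriv_zero[OF w0] unfolding eq c_def by eventually_elim simp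
  define E where "E t = exp (- pot a t)" for t
  have Ec: "continuous_on A E" for A unfolding E_def by (intro continuous_intros pot_continuous a)
  have Eper: "E (t + 2 * pi) = E t" for t by (simp add: E_def pot_periodic)
  have Ed: "(E has_real_derivative - pot' a x * E x) (at x)" for x
    unfolding E_def[abs_def] by (auto intro!: derivative_eq_intros pot_deriv[OF a])
  have Em: "h \<in> borel_measurable cm" if "continuous_on UNIV h" for h :: "real \<Rightarrow> real"
    using that by (intro measurable_cm_borel borel_measurable_continuous_onI)
  have mi: "integrable cm (\<lambda>x. p x * h x)" "integrable cm (\<lambda>x. q x * h x)"
    if hc: "continuous_on UNIV h" and hp: "\<And>x. h (x + 2 * pi) = h x" for h :: "real \<Rightarrow> real"
  proof -
    obtain B where B: "\<And>x. \<bar>h x\<bar> \<le> B" using periodic_bounded[OF hc hp] by blast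
    show "integrable cm (\<lambda>x. p x * h x)" "integrable cm (\<lambda>x. q x * h x)"
      by (rule integrable_mult_bounded[OF _ Em[OF hc] B], fact)+
  qed
  have pot'per: "pot' a (x + 2 * pi) = pot' a x" for x
  proof -
    have "((\<lambda>x. pot a (x + 2*pi)) has_real_derivative pot' a (x + 2*pi)) (at x)"
      using DERIV_at_within_shift[of "pot a" "pot' a (x+2*pi)" "2*pi" x UNIV] pot_deriv[OF a, of "x+2*pi"] by (simp add: add.commute)
    then show ?thesis using pot_deriv[OF a, of x] DERIV_unique by (simp add: pot_periodic)
  qed
  \<comment> \<open>The test function \<open>exp (- pot a) * \<psi>\<close> turns the flux into the derivative of \<open>p * exp (- pot a)\<close>.\<close>
  have test: "avg (\<lambda>x. p x * (E x * \<psi>' x)) = - c * avg (\<lambda>x. E x * \<psi> x)"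
    if d: "\<And>x. (\<psi> has_real_derivative \<psi>' x) (at x)" and c': "continuous_on UNIV \<psi>'"
      and per: "\<And>x. \<psi> (x + 2*pi) = \<psi> x" "\<And>x. \<psi>' (x + 2*pi) = \<psi>' x" for \<psi> \<psi>'
  proof -
    have pc: "continuous_on UNIV \<psi>" using d by (rule continuous_on_UNIV_deriv)
    have "avg (\<lambda>x. p x * (E x * \<psi>' x - pot' a x * E x * \<psi> x)) = - avg (\<lambda>x. q x * (E x * \<psi> x))"
    proof (rule weak_deriv_test_C1[OF w])
      show "((\<lambda>x. E x * \<psi> x) has_real_derivative E x * \<psi>' x - pot' a x * E x * \<psi> x) (at x)" for x
        by (rule derivative_eq_intros Ed d refl)+ simp
    qed (use c' pc per Eper in \<open>auto intro!: continuous_intros Ec pot'_continuous a\<close>)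
    also have "avg (\<lambda>x. q x * (E x * \<psi> x)) = avg (\<lambda>x. p x * (pot' a x * E x * \<psi> x) + c * (E x * \<psi> x))"
    proof (rule integral_cong_AE)
      show "AE x in cm. q x * (E x * \<psi> x) = p x * (pot' a x * E x * \<psi> x) + c * (E x * \<psi> x)"
        using qc by eventually_elim (simp add: algebra_simps)
      have "(\<lambda>x. pot' a x * E x * \<psi> x) \<in> borel_measurable cm" "(\<lambda>x. E x * \<psi> x) \<in> borel_measurable cm"
        by (intro Em continuous_intros Ec pc pot'_continuous a)+
      then show "(\<lambda>x. q x * (E x * \<psi> x)) \<in> borel_measurable cm"
        "(\<lambda>x. p x * (pot' a x * E x * \<psi> x) + c * (E x * \<psi> x)) \<in> borel_measurable cm"
        using pi qi by (auto intro!: borel_measurable_add borel_measurable_times)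
    qed
    finally have 1: "avg (\<lambda>x. p x * (E x * \<psi>' x - pot' a x * E x * \<psi> x)) = - avg (\<lambda>x. p x * (pot' a x * E x * \<psi> x) + c * (E x * \<psi> x))" .
    have i1: "integrable cm (\<lambda>x. p x * (E x * \<psi>' x))" "integrable cm (\<lambda>x. p x * (pot' a x * E x * \<psi> x))"
      by (rule mi; use per Eper pot'per in \<open>auto intro!: continuous_intros Ec c' pc pot'_continuous a\<close>)+
    have i2: "integrable cm (\<lambda>x. E x * \<psi> x)" by (intro integrable_cm_continuous continuous_intros Ec pc)
    show ?thesis using 1 i1 i2 by (simp add: right_diff_distrib)
  qed
  have "avg E > 0" by (rule avg_pos[OF Ec, where ?x0.0=0]) (auto simp: E_def)
  moreover have "c * avg E = 0" using test[of "\<lambda>_. 1" "\<lambda>_. 0"] by simp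
  ultimately have c0: "c = 0" by simp
  define u where "u x = p x * E x" for x
  have "weak_deriv u (\<lambda>_. 0)" unfolding weak_deriv_def LINT_eq_avg
  proof (intro conjI allI impI)
    obtain B where B: "\<And>x. \<bar>E x\<bar> \<le> B" using periodic_bounded[OF Ec Eper] by blast
    have um: "u \<in> borel_measurable cm" unfolding u_def using pi Em[OF Ec] by auto
    have "integrable cm (\<lambda>x. (p x)\<^sup>2 * (E x)\<^sup>2)"
    proof (rule integrable_mult_bounded)
      show "integrable cm (\<lambda>x. (p x)\<^sup>2)" using pi by (simp add: square_integrable_cm)
      show "\<bar>(E x)\<^sup>2\<bar> \<le> B\<^sup>2" for x using B[of x] by (simp add: abs_le_square_iff[symmetric])
    qed (intro Em continuous_intros Ec)
    then show "square_integrable u" using um by (simp add: square_integrable_cm u_def power_mult_distrib)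
    show "square_integrable (\<lambda>_. 0)" by (simp add: square_integrable_cm)
    fix \<phi> assume ph: "smooth_periodic \<phi>"
    have dper: "deriv \<phi> (x + 2 * pi) = deriv \<phi> x" for x
    proof -
      have "((\<lambda>x. \<phi> (x + 2*pi)) has_real_derivative deriv \<phi> (x + 2*pi)) (at x)"
        using DERIV_at_within_shift[of "\<phi>" "deriv \<phi> (x+2*pi)" "2*pi" x UNIV] smooth_periodicD(1)[OF ph, of "x+2*pi"] by (simp add: add.commute)
      then show ?thesis using smooth_periodicD(1)[OF ph, of x] DERIV_unique by (simp add: smooth_periodicD(3)[OF ph])
    qed
    have "avg (\<lambda>x. p x * (E x * deriv \<phi> x)) = 0"
      using test[OF smooth_periodicD(1)[OF ph] smooth_periodicD(2)[OF ph] smooth_periodicD(3)[OF ph] dper] c0 by simp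
    then show "2 * pi * avg (\<lambda>t. u t * deriv \<phi> t) = - (2 * pi * avg (\<lambda>t. 0 * \<phi> t))"
      by (simp add: u_def mult.assoc)
  qed
  then have "AE x in cm. u x = avg u" by (rule weak_deriv_zero)
  then have pe: "AE x in cm. p x = avg u * exp (pot a x)"
    by eventually_elim (simp add: u_def E_def exp_minus field_simps)
  have "1 = avg p" using p by (simp add: pos_densities_iff)
  also have "\<dots> = avg (\<lambda>x. avg u * exp (pot a x))"
    by (rule integral_cong_AE) (use pe pi in \<open>auto intro!: Em continuous_intros pot_continuous a\<close>)
  also have "\<dots> = avg u * avg (\<lambda>x. exp (pot a x))" by simp
  finally have "avg u = 1 / avg (\<lambda>x. exp (pot a x))" using exp_pot_avg_pos[OF a] by (simp add: field_simps)
  then have "AE x in cm. p x = gibbs a x" using pe by (simp add: gibbs_def)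
  then show ?thesis using p by (simp add: selfcons_def a_def)
qed

lemma stationary_iff_selfcons: "\<beta> > 0 \<Longrightarrow> stationary \<beta> \<kappa> p \<longleftrightarrow> selfcons \<beta> \<kappa> p"
  using selfcons_imp_stationary stationary_imp_selfcons by blast

section \<open>Stability and instability of the uniform density\<close>

lemma bessel_0_lower: "bessel_I 0 x \<ge> 1 + x\<^sup>2 / 4 + (x\<^sup>2 / 4)\<^sup>2 / 4"
proof -
  have "(\<Sum>k<3. (x\<^sup>2 / 4) ^ k / (fact k)\<^sup>2) \<le> (\<Sum>k. (x\<^sup>2 / 4) ^ k / (fact k)\<^sup>2)"
    by (rule sum_le_suminf[OF sums_summable[OF bessel_0_series]]) auto
  then show ?thesis using sums_unique[OF bessel_0_series[of x]]
    by (simp add: eval_nat_numeral lessThan_Suc)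
qed

lemma avg_exp_cos: "avg (\<lambda>t. exp (x * cos t)) = bessel_I 0 x"
  by (simp add: bessel_I_avg)

lemma ln_one_plus_lower: assumes "(u::real) \<ge> 0" shows "ln (1 + u) \<ge> u - u\<^sup>2"
proof (cases "u \<le> 1")
  case True
  then show ?thesis using ln_one_plus_pos_lower_bound[of u] assms by simp
next
  case False
  then have "u - u\<^sup>2 \<le> 0" by (simp add: power2_eq_square)
  moreover have "ln (1 + u) \<ge> 0" using assms by simp
  ultimately show ?thesis by linarith
qed

lemma pot_single: "pot (\<lambda>j. if j = i then c else 0) t = c * tb i t"
proof -
  have "(\<lambda>j. (if j = i then c else 0) * tb j t) = (\<lambda>j. if j = i then c * tb j t else 0)" by auto
  then have "(\<lambda>j. (if j = i then c else 0) * tb j t) sums (c * tb i t)"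
    using sums_single[of i "\<lambda>j. c * tb j t"] by (simp only:)
  then show ?thesis unfolding pot_def by (rule sums_unique[symmetric])
qed

text \<open>
  A first mode \<open>t\<close> has energy \<open>x t\<^sup>2\<close> minus \<open>x\<^sup>2
  t\<^sup>2\<close> up to fourth order, where \<open>x = \<kappa> / \<kappa>\<^sup>* >
  1\<close>.
\<close>

lemma unstable_above: assumes b: "\<beta> > 0" and k: "kappa_star \<beta> < \<kappa>" shows "unstable \<beta> \<kappa>"
proof -
  define x where "x = \<kappa> / kappa_star \<beta>"
  have x: "x > 1" using k kappa_star_pos[OF b] by (simp add: x_def)
  define t where "t = min 1 (sqrt ((x - 1) / (2 * x ^ 3)))"
  have t: "0 < t" "t \<le> 1" using x by (auto simp: t_def)
  have "t\<^sup>2 \<le> (sqrt ((x - 1) / (2 * x ^ 3)))\<^sup>2" by (rule power_mono) (use t in \<open>auto simp: t_def\<close>)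
  then have t2: "t\<^sup>2 \<le> (x - 1) / (2 * x ^ 3)" using x by simp
  define z where "z j = (if j = 0 then t else 0)" for j :: nat
  have cz: "cube z" using t by (simp add: cube_def z_def)
  have "coef \<beta> \<kappa> z = (\<lambda>j. if j = 0 then 2 * x * t else 0)"
    by (rule ext) (simp add: coef_def z_def wt_first[OF b] x_def)
  then have p: "pot (coef \<beta> \<kappa> z) y = 2 * x * t * cos y" for y
    by (simp add: pot_single tb_def freq_def)
  have "(\<lambda>j. wt \<beta> j * (z j)\<^sup>2) = (\<lambda>j. if j = 0 then wt \<beta> j * t\<^sup>2 else 0)" by (auto simp: z_def)
  then have "(\<lambda>j. wt \<beta> j * (z j)\<^sup>2) sums (wt \<beta> 0 * t\<^sup>2)"
    using sums_single[of 0 "\<lambda>j. wt \<beta> j * t\<^sup>2"] by (simp only:)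
  then have e: "\<kappa> * en \<beta> z = x * t\<^sup>2" unfolding en_def by (simp add: sums_iff wt_first[OF b] x_def)
  have I0: "1 + x\<^sup>2 * t\<^sup>2 \<le> bessel_I 0 (2 * x * t)"
  proof -
    have "0 \<le> ((2 * x * t)\<^sup>2 / 4)\<^sup>2 / 4" by simp
    then have "1 + (2 * x * t)\<^sup>2 / 4 \<le> bessel_I 0 (2 * x * t)" using bessel_0_lower[of "2 * x * t"] by linarith
    then show ?thesis by (simp add: power_mult_distrib)
  qed
  have "0 < 1 + x\<^sup>2 * t\<^sup>2" by (simp add: add_pos_nonneg)
  then have "ln (1 + x\<^sup>2 * t\<^sup>2) \<le> ln (bessel_I 0 (2 * x * t))" using I0 by (intro ln_mono)
  moreover have "x\<^sup>2 * t\<^sup>2 - (x\<^sup>2 * t\<^sup>2)\<^sup>2 \<le> ln (1 + x\<^sup>2 * t\<^sup>2)" by (rule ln_one_plus_lower) simp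
  moreover have "Gf \<beta> \<kappa> z = x * t\<^sup>2 - ln (bessel_I 0 (2 * x * t))"
    unfolding Gf_def e p by (simp add: avg_exp_cos)
  ultimately have "Gf \<beta> \<kappa> z \<le> x * t\<^sup>2 - x\<^sup>2 * t\<^sup>2 + (x\<^sup>2 * t\<^sup>2)\<^sup>2" by linarith
  also have "\<dots> = x * t\<^sup>2 * (1 - x + x ^ 3 * t\<^sup>2)" by (simp add: algebra_simps power2_eq_square power3_eq_cube)
  also have "\<dots> < 0"
  proof -
    have "x ^ 3 * t\<^sup>2 \<le> x ^ 3 * ((x - 1) / (2 * x ^ 3))" by (rule mult_left_mono[OF t2]) (use x in simp)
    also have "\<dots> = (x - 1) / 2" using x by simp
    finally have "1 - x + x ^ 3 * t\<^sup>2 < 0" using x by simp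
    then show ?thesis using x t by (simp add: mult_pos_neg)
  qed
  finally show ?thesis using cz by (auto simp: unstable_def)
qed

text \<open>
  The Cauchy--Schwarz inequality for a summable weight, from the nonnegativity of \<open>\<Sum>
  w (S y - A)\<^sup>2\<close>.
\<close>

lemma weighted_CS:
  fixes w y :: "nat \<Rightarrow> real"
  assumes w: "\<And>j. w j \<ge> 0" "summable w" and y: "\<And>j. 0 \<le> y j" "\<And>j. y j \<le> 1"
  shows "(\<Sum>j. w j * y j)\<^sup>2 \<le> (\<Sum>j. w j) * (\<Sum>j. w j * (y j)\<^sup>2)"
proof -
  define S where "S = (\<Sum>j. w j)"
  define A where "A = (\<Sum>j. w j * y j)"
  define E where "E = (\<Sum>j. w j * (y j)\<^sup>2)"
  have s1: "summable (\<lambda>j. w j * y j)"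
    by (rule summable_comparison_test'[OF w(2), of 0]) (use w y in \<open>auto simp: abs_mult mult_left_le\<close>)
  have s2: "summable (\<lambda>j. w j * (y j)\<^sup>2)"
    by (rule summable_comparison_test'[OF w(2), of 0]) (use w y in \<open>auto simp: abs_mult intro!: mult_left_le power_le_one\<close>)
  have S0: "S \<ge> 0" unfolding S_def by (rule suminf_nonneg) (use w in auto)
  have sS: "(\<lambda>j. S * S * (w j * (y j)\<^sup>2) - 2 * A * S * (w j * y j) + A * A * w j) sums (S * S * E - 2 * A * S * A + A * A * S)"
    unfolding A_def E_def S_def by (intro sums_add sums_diff sums_mult summable_sums s1 s2 w)
  have nn: "0 \<le> S * S * (w j * (y j)\<^sup>2) - 2 * A * S * (w j * y j) + A * A * w j" for j
  proof -
    have "0 \<le> w j * (S * y j - A)\<^sup>2" using w by simp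
    then show ?thesis by (simp add: power2_eq_square algebra_simps)
  qed
  have "0 \<le> S * S * E - 2 * A * S * A + A * A * S" by (rule sums_le[OF nn sums_zero sS])
  then have h: "0 \<le> S * (S * E - A\<^sup>2)" by (simp add: power2_eq_square algebra_simps)
  show ?thesis
  proof (cases "S = 0")
    case True
    then have "w j = 0" for j using w suminf_eq_zero_iff[OF w(2)] unfolding S_def by auto
    then show ?thesis by simp
  next
    case False
    then have "0 \<le> S * E - A\<^sup>2" using h S0 by (simp add: zero_le_mult_iff)
    then show ?thesis by (simp add: S_def A_def E_def)
  qed
qed

lemma avg_exp_pot_le:
  assumes a: "adm a" and B: "\<And>t. \<bar>pot a t\<bar> \<le> B"
  shows "avg (\<lambda>t. exp (pot a t)) \<le> 1 + B\<^sup>2 * exp B"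
proof -
  have i: "integrable cm (pot a)" by (intro integrable_cm_continuous pot_continuous a)
  have "avg (\<lambda>t. exp (pot a t)) \<le> avg (\<lambda>t. 1 + pot a t + B\<^sup>2 * exp B)"
  proof (rule integral_mono)
    fix t
    have "\<bar>pot a t\<bar>\<^sup>2 * exp \<bar>pot a t\<bar> \<le> B\<^sup>2 * exp B" using B by (intro mult_mono power_mono) auto
    then show "exp (pot a t) \<le> 1 + pot a t + B\<^sup>2 * exp B" using exp_remainder[of "pot a t"] by simp
  qed (use i integrable_exp_pot[OF a] in auto)
  also have "\<dots> = 1 + B\<^sup>2 * exp B" using i avg_pot[OF a] by simp
  finally show ?thesis .
qed

text \<open>
  The logarithm of the partition function is quadratic in the field, hence at most
  \<open>O(\<kappa>\<^sup>2)\<close> times the interaction energy, which wins for small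
  \<open>\<kappa>\<close>.
\<close>

lemma stable_small: assumes b: "\<beta> > 0" shows "\<exists>\<kappa>>0. \<not> unstable \<beta> \<kappa>"
proof -
  define S where "S = (\<Sum>j. wt \<beta> j)"
  have S0: "S \<ge> 0" unfolding S_def by (intro suminf_nonneg wt_summable wt_nonneg b)
  define \<kappa> where "\<kappa> = 1 / (4 * (S + 1) * exp 2)"
  have k: "\<kappa> > 0" using S0 by (simp add: \<kappa>_def)
  have kS: "4 * \<kappa> * S * exp 2 \<le> 1" using S0 by (simp add: \<kappa>_def)
  have kS2: "2 * \<kappa> * S \<le> 2"
  proof -
    have "4 * \<kappa> * S * 1 \<le> 4 * \<kappa> * S * exp 2" using k S0 by (intro mult_left_mono) auto
    then show ?thesis using kS by simp
  qed
  have "0 \<le> Gf \<beta> \<kappa> z" if cz: "cube z" for z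
  proof -
    define a where "a = coef \<beta> \<kappa> z"
    have a: "adm a" unfolding a_def by (rule coef_adm[OF b cz])
    define A where "A = (\<Sum>j. wt \<beta> j * \<bar>z j\<bar>)"
    have zb: "\<bar>z j\<bar> \<le> 1" for j using cz by (simp add: cube_def)
    have sA: "summable (\<lambda>j. wt \<beta> j * \<bar>z j\<bar>)"
      by (rule summable_comparison_test'[OF wt_summable[OF b], of 0]) (use wt_nonneg[OF b] zb in \<open>auto simp: abs_mult mult_left_le\<close>)
    have A0: "0 \<le> A" unfolding A_def by (intro suminf_nonneg sA) (use wt_nonneg[OF b] in auto)
    have AS: "A \<le> S" unfolding A_def S_def by (intro suminf_le sA wt_summable b mult_left_le zb wt_nonneg)
    have CS: "A\<^sup>2 \<le> S * en \<beta> z"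
      using weighted_CS[of "wt \<beta>" "\<lambda>j. \<bar>z j\<bar>"] wt_nonneg[OF b] wt_summable[OF b] zb by (simp add: A_def S_def en_def)
    have pb: "\<bar>pot a t\<bar> \<le> 2 * \<kappa> * A" for t
    proof -
      have "norm (\<Sum>j. a j * tb j t) \<le> (\<Sum>j. 2 * \<kappa> * (wt \<beta> j * \<bar>z j\<bar>))"
      proof (rule suminf_norm_le[OF _ summable_mult[OF sA]])
        show "norm (a j * tb j t) \<le> 2 * \<kappa> * (wt \<beta> j * \<bar>z j\<bar>)" for j
          using mult_left_mono[OF tb_le[of j t], of "2 * \<kappa> * (wt \<beta> j * \<bar>z j\<bar>)"] k wt_nonneg[OF b, of j]
          by (simp add: a_def coef_def abs_mult mult_ac)
      qed
      also have "\<dots> = 2 * \<kappa> * A" unfolding A_def by (rule suminf_mult[OF sA])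
      finally show ?thesis by (simp add: pot_def)
    qed
    have "avg (\<lambda>t. exp (pot a t)) \<le> 1 + (2 * \<kappa> * A)\<^sup>2 * exp (2 * \<kappa> * A)" by (rule avg_exp_pot_le[OF a pb])
    also have "(2 * \<kappa> * A)\<^sup>2 * exp (2 * \<kappa> * A) \<le> (4 * \<kappa>\<^sup>2 * (S * en \<beta> z)) * exp 2"
    proof (rule mult_mono)
      show "(2 * \<kappa> * A)\<^sup>2 \<le> 4 * \<kappa>\<^sup>2 * (S * en \<beta> z)" using mult_left_mono[OF CS, of "4 * \<kappa>\<^sup>2"] by (simp add: power_mult_distrib)
      have "2 * \<kappa> * A \<le> 2 * \<kappa> * S" using AS k by simp
      then show "exp (2 * \<kappa> * A) \<le> exp 2" using kS2 by simp
    qed (use S0 en_nonneg[OF b cz] in auto)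
    also have "\<dots> = (4 * \<kappa> * S * exp 2) * (\<kappa> * en \<beta> z)" by (simp add: power2_eq_square)
    also have "\<dots> \<le> 1 * (\<kappa> * en \<beta> z)" using kS k en_nonneg[OF b cz] by (intro mult_right_mono) auto
    finally have "avg (\<lambda>t. exp (pot a t)) \<le> 1 + \<kappa> * en \<beta> z" by simp
    moreover have "ln (avg (\<lambda>t. exp (pot a t))) \<le> avg (\<lambda>t. exp (pot a t)) - 1"
      by (rule ln_le_minus_one[OF exp_pot_avg_pos[OF a]])
    ultimately show ?thesis by (simp add: Gf_def a_def)
  qed
  then have "\<not> unstable \<beta> \<kappa>" by (auto simp: unstable_def not_less)
  then show ?thesis using k by blast
qed

section \<open>Instability at the first bifurcation point\<close>

lemma pot_two:
  assumes "i \<noteq> k"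
  shows "pot (\<lambda>j. if j = i then c else if j = k then d else 0) t = c * tb i t + d * tb k t"
proof -
  have "(\<lambda>j. (if j = i then c else if j = k then d else 0) * tb j t) =
    (\<lambda>j. (if j = i then c * tb j t else 0) + (if j = k then d * tb j t else 0))" using assms by auto
  moreover have "(\<lambda>j. (if j = i then c * tb j t else 0) + (if j = k then d * tb j t else 0)) sums (c * tb i t + d * tb k t)"
    by (rule sums_add[OF sums_single[of i "\<lambda>j. c * tb j t"] sums_single[of k "\<lambda>j. d * tb j t"]])
  ultimately show ?thesis unfolding pot_def by (simp add: sums_iff)
qed

lemma bessel_2_lower: assumes "x \<ge> 0" shows "bessel_I 2 x \<ge> x\<^sup>2 / 8 * exp (- x)"
proof -
  have nn: "0 \<le> x ^ n / fact n * cos_pow_mode n 2" for n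
    using cos_pow_mode_mono[of n 2] assms by (intro mult_nonneg_nonneg) auto
  have "(\<Sum>n\<in>{2}. x ^ n / fact n * cos_pow_mode n 2) \<le> exp x * bessel_I 2 x"
    unfolding sums_unique[OF bessel_exp_series[OF assms, of 2]]
    by (rule sum_le_suminf[OF sums_summable[OF bessel_exp_series[OF assms]]]) (use nn in auto)
  moreover have "cos_pow_mode 2 2 = 1 / 4"
    by (simp add: numeral_2_eq_2 cos_pow_mode_Suc cos_pow_mode_0)
  ultimately have "x\<^sup>2 / 8 \<le> exp x * bessel_I 2 x" by (simp add: fact_numeral)
  then have "exp (- x) * (x\<^sup>2 / 8) \<le> exp (- x) * (exp x * bessel_I 2 x)" by (rule mult_left_mono) simp
  then show ?thesis by (simp add: mult.assoc[symmetric] exp_add[symmetric] mult.commute)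
qed

text \<open>
  At \<open>\<kappa>\<^sup>*\<close> the first mode has zero energy to second order. A second
  mode \<open>h t\<^sup>2\<close> couples to a first mode \<open>t\<close> at order
  \<open>t\<^sup>4\<close>, and for the optimal \<open>h = 1 / (2 (1 - R))\<close> the total is
  negative when \<open>R > 1/2\<close>.
\<close>

lemma unstable_at_kappa_star:
  assumes b: "\<beta> > 0" and R: "bessel_R \<beta> > 1/2"
  shows "unstable \<beta> (kappa_star \<beta>)"
proof -
  define r where "r = bessel_R \<beta>"
  have r: "1/2 < r" "r < 1" using R bessel_2_less_1[OF b] bessel_1_pos[OF b] by (auto simp: r_def bessel_R_def)
  define h where "h = 1 / (2 * (1 - r))"
  define c where "c = 2 * r * h"
  have h: "h > 0" using r by (simp add: h_def)
  have c: "c > 1" using r by (simp add: c_def h_def field_simps)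
  define g where "g = r * h\<^sup>2"
  have g: "g > 0" using r h by (simp add: g_def)
  \<comment> \<open>The two sides of the comparison differ at order four by this coefficient; it is positive because \<open>c > 1\<close>, that is \<open>R > 1/2\<close>.\<close>
  have crit: "1/4 + c / 2 + c\<^sup>2 / 4 - g - 1/2 = (c - 1) / 4"
  proof -
    have "2 * (1 - r) * h = 1" using r by (simp add: h_def)
    then have "c\<^sup>2 / 4 - g = - c / 4" unfolding c_def g_def by (simp add: power2_eq_square) algebra
    then show ?thesis by (simp add: diff_divide_distrib)
  qed
  define e1 where "e1 = 1 + g"
  define K1 where "K1 = g + g\<^sup>2 + e1 ^ 3 * exp e1"
  define K2 where "K2 = exp 2 * (c ^ 3 * exp c)"
  define K where "K = K1 + K2 + c\<^sup>2 + c"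
  have K0: "K > 0" using c g by (auto simp: K_def K1_def K2_def e1_def intro!: add_pos_pos mult_pos_pos)
  define t where "t = min (min 1 (1 / (1 + h))) ((c - 1) / (8 * K))"
  have t: "0 < t" "t \<le> 1" "t \<le> 1 / (1 + h)" "t \<le> (c - 1) / (8 * K)"
    unfolding t_def by (auto intro: min.coboundedI1 min.coboundedI2) (use c h K0 in auto)
  have Kt: "K * t < (c - 1) / 4"
  proof -
    have "K * t \<le> K * ((c - 1) / (8 * K))" using t K0 by (intro mult_left_mono) auto
    also have "\<dots> = (c - 1) / 8" using K0 by simp
    finally show ?thesis using c by simp
  qed
  have tp: "t ^ m \<le> t ^ n" if "n \<le> m" for m n using t that by (intro power_decreasing) auto
  have ht: "h * t\<^sup>2 \<le> 1"
  proof -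
    have "t\<^sup>2 \<le> t" using tp[of 1 2] by simp
    then have "h * t\<^sup>2 \<le> h * (1 / (1 + h))" using t h by (intro mult_left_mono) auto
    also have "\<dots> \<le> 1" using h by (simp add: field_simps)
    finally show ?thesis .
  qed
  define z where "z j = (if j = 0 then t else if j = 2 then h * t\<^sup>2 else 0)" for j :: nat
  have cz: "cube z" using t h ht by (simp add: cube_def z_def)
  have w2: "kappa_star \<beta> * wt \<beta> 2 = r" "kappa_star \<beta> * wt \<beta> 0 = 1"
    using b bessel_1_pos[OF b] by (simp_all add: wt_def freq_def kappa_star_def r_def bessel_R_def numeral_2_eq_2)
  define a where "a = coef \<beta> (kappa_star \<beta>) z"
  have a: "adm a" unfolding a_def by (rule coef_adm[OF b cz])
  have aeq: "a = (\<lambda>j. if j = 0 then 2 * t else if j = 2 then c * t\<^sup>2 else 0)"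
  proof
    fix j
    have "a j = 2 * (kappa_star \<beta> * wt \<beta> j) * z j" by (simp add: a_def coef_def)
    then show "a j = (if j = 0 then 2 * t else if j = 2 then c * t\<^sup>2 else 0)"
      using w2 by (auto simp: z_def c_def)
  qed
  define u where "u x = 2 * t * cos x" for x
  define y where "y x = c * t\<^sup>2 * cos (2 * x)" for x
  have p: "pot a x = u x + y x" for x
    unfolding aeq by (subst pot_two) (auto simp: u_def y_def tb_def freq_def)
  define E where "E = t\<^sup>2 + g * t ^ 4"
  have en: "kappa_star \<beta> * en \<beta> z = E"
  proof -
    have "(\<lambda>j. wt \<beta> j * (z j)\<^sup>2) = (\<lambda>j. (if j = 0 then wt \<beta> j * t\<^sup>2 else 0) + (if j = 2 then wt \<beta> j * (h * t\<^sup>2)\<^sup>2 else 0))"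
      by (auto simp: z_def)
    moreover have "(\<lambda>j. (if j = 0 then wt \<beta> j * t\<^sup>2 else 0) + (if j = 2 then wt \<beta> j * (h * t\<^sup>2)\<^sup>2 else 0)) sums (wt \<beta> 0 * t\<^sup>2 + wt \<beta> 2 * (h * t\<^sup>2)\<^sup>2)"
      by (rule sums_add[OF sums_single[of 0 "\<lambda>j. wt \<beta> j * t\<^sup>2"] sums_single[of 2 "\<lambda>j. wt \<beta> j * (h * t\<^sup>2)\<^sup>2"]])
    ultimately have "en \<beta> z = wt \<beta> 0 * t\<^sup>2 + wt \<beta> 2 * (h * t\<^sup>2)\<^sup>2" unfolding en_def by (simp add: sums_iff)
    then have "kappa_star \<beta> * en \<beta> z = (kappa_star \<beta> * wt \<beta> 0) * t\<^sup>2 + (kappa_star \<beta> * wt \<beta> 2) * (h * t\<^sup>2)\<^sup>2"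
      by (simp add: algebra_simps)
    then show ?thesis unfolding w2 by (simp add: E_def g_def power_mult_distrib flip: power_mult)
  qed
  \<comment> \<open>The reduced energy is \<open>E\<close> minus the logarithm of the partition function; its negativity is shown by comparing \<open>exp E\<close> with the partition function up to order five in \<open>t\<close>.\<close>
  have E0: "0 \<le> E" using g by (simp add: E_def)
  have Ee: "E \<le> e1 * t\<^sup>2"
    using mult_left_mono[OF tp[of 2 4], of g] g by (simp add: E_def e1_def algebra_simps)
  have "exp E \<le> 1 + E + E\<^sup>2 / 2 + E ^ 3 * exp E"
    using exp_taylor[of E 3] E0 by (simp add: eval_nat_numeral lessThan_Suc)
  moreover have "E\<^sup>2 / 2 \<le> t ^ 4 / 2 + (g + g\<^sup>2) * t ^ 5"
  proof -
    have "E\<^sup>2 / 2 = t ^ 4 / 2 + g * t ^ 6 + g\<^sup>2 * t ^ 8 / 2"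
      unfolding E_def by (simp add: power2_eq_square eval_nat_numeral algebra_simps)
    moreover have "g * t ^ 6 \<le> g * t ^ 5" using tp[of 5 6] g by (intro mult_left_mono) auto
    moreover have "g\<^sup>2 * t ^ 8 / 2 \<le> g\<^sup>2 * t ^ 5"
    proof -
      have "g\<^sup>2 * t ^ 8 \<le> g\<^sup>2 * t ^ 5" using tp[of 5 8] by (intro mult_left_mono) auto
      moreover have "0 \<le> g\<^sup>2 * t ^ 5" using t by simp
      ultimately show ?thesis by linarith
    qed
    ultimately show ?thesis by (simp add: algebra_simps)
  qed
  moreover have "E ^ 3 * exp E \<le> e1 ^ 3 * exp e1 * t ^ 5"
  proof -
    have "e1 * t\<^sup>2 \<le> e1 * 1" using t g by (intro mult_left_mono) (auto simp: e1_def power_le_one)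
    then have "exp E \<le> exp e1" using Ee by simp
    moreover have "E ^ 3 \<le> (e1 * t\<^sup>2) ^ 3" using Ee E0 by (rule power_mono)
    ultimately have "E ^ 3 * exp E \<le> (e1 * t\<^sup>2) ^ 3 * exp e1" using E0 g t by (intro mult_mono) auto
    also have "\<dots> = e1 ^ 3 * exp e1 * t ^ 6" by (simp add: power_mult_distrib flip: power_mult)
    also have "\<dots> \<le> e1 ^ 3 * exp e1 * t ^ 5" using tp[of 5 6] g by (intro mult_left_mono) (auto simp: e1_def)
    finally show ?thesis .
  qed
  ultimately have up: "exp E \<le> 1 + t\<^sup>2 + (g + 1/2) * t ^ 4 + K1 * t ^ 5"
    unfolding K1_def E_def[symmetric] by (simp add: E_def algebra_simps)
  have uc: "continuous_on A u" "continuous_on A y" for A unfolding u_def[abs_def] y_def[abs_def] by (intro continuous_intros)+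
  have ub: "\<bar>u x\<bar> \<le> 2 * t" for x using t by (simp add: u_def abs_mult mult_left_le)
  have yb: "\<bar>y x\<bar> \<le> c * t\<^sup>2" for x using c by (simp add: y_def abs_mult mult_left_le)
  have pt: "exp (u x) + exp (u x) * y x + (y x)\<^sup>2 / 2 - (c\<^sup>2 + K2) * t ^ 5 \<le> exp (pot a x)" for x
  proof -
    have ct: "c * t\<^sup>2 \<le> c" using c t by (simp add: mult_left_le power_le_one)
    have "\<bar>exp (y x) - (1 + y x + (y x)\<^sup>2 / 2)\<bar> \<le> \<bar>y x\<bar> ^ 3 * exp \<bar>y x\<bar>"
      using exp_taylor[of "y x" 3] by (simp add: eval_nat_numeral lessThan_Suc)
    also have "\<dots> \<le> (c * t\<^sup>2) ^ 3 * exp c"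
      using yb[of x] ct by (intro mult_mono power_mono) auto
    finally have "1 + y x + (y x)\<^sup>2 / 2 - (c * t\<^sup>2) ^ 3 * exp c \<le> exp (y x)" by (simp add: abs_le_iff)
    then have "exp (u x) * (1 + y x + (y x)\<^sup>2 / 2 - (c * t\<^sup>2) ^ 3 * exp c) \<le> exp (u x) * exp (y x)"
      by (rule mult_left_mono) simp
    then have 1: "exp (u x) + exp (u x) * y x + exp (u x) * ((y x)\<^sup>2 / 2) - exp (u x) * ((c * t\<^sup>2) ^ 3 * exp c) \<le> exp (pot a x)"
      by (simp add: p exp_add algebra_simps)
    have "exp (u x) * ((c * t\<^sup>2) ^ 3 * exp c) \<le> exp 2 * ((c * t\<^sup>2) ^ 3 * exp c)"
      using ub[of x] t c by (intro mult_right_mono) auto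
    also have "\<dots> = K2 * t ^ 6" by (simp add: K2_def power_mult_distrib flip: power_mult)
    also have "\<dots> \<le> K2 * t ^ 5" using tp[of 5 6] c by (intro mult_left_mono) (auto simp: K2_def)
    finally have 2: "exp (u x) * ((c * t\<^sup>2) ^ 3 * exp c) \<le> K2 * t ^ 5" .
    obtain Q where Q: "Q = (y x)\<^sup>2 / 2" by blast
    have "(1 + u x) * Q \<le> exp (u x) * Q" unfolding Q by (intro mult_right_mono) auto
    moreover have "- (2 * t * ((c * t\<^sup>2)\<^sup>2 / 2)) \<le> u x * Q"
    proof -
      have "\<bar>u x * ((y x)\<^sup>2 / 2)\<bar> = \<bar>u x\<bar> * (\<bar>y x\<bar>\<^sup>2 / 2)" by (simp add: abs_mult)
      also have "\<dots> \<le> 2 * t * ((c * t\<^sup>2)\<^sup>2 / 2)"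
        using ub[of x] yb[of x] t by (intro mult_mono divide_right_mono power_mono) auto
      finally show ?thesis unfolding Q by (simp only: abs_le_iff) simp
    qed
    moreover have "2 * t * ((c * t\<^sup>2)\<^sup>2 / 2) = c\<^sup>2 * t ^ 5" by (simp add: power2_eq_square eval_nat_numeral)
    ultimately have "Q - c\<^sup>2 * t ^ 5 \<le> exp (u x) * Q" unfolding distrib_right by linarith
    then have "(y x)\<^sup>2 / 2 - c\<^sup>2 * t ^ 5 \<le> exp (u x) * ((y x)\<^sup>2 / 2)" unfolding Q .
    then show ?thesis using 1 2 by (simp add: algebra_simps)
  qed
  have ii: "integrable cm (\<lambda>x. exp (u x))" "integrable cm (\<lambda>x. exp (u x) * y x)" "integrable cm (\<lambda>x. (y x)\<^sup>2 / 2)"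
    by (intro integrable_cm_continuous continuous_intros uc; simp)+
  have "avg (\<lambda>x. exp (u x)) + avg (\<lambda>x. exp (u x) * y x) + avg (\<lambda>x. (y x)\<^sup>2 / 2) - (c\<^sup>2 + K2) * t ^ 5 =
      avg (\<lambda>x. exp (u x) + exp (u x) * y x + (y x)\<^sup>2 / 2 - (c\<^sup>2 + K2) * t ^ 5)"
    using ii by simp
  also have "\<dots> \<le> avg (\<lambda>x. exp (pot a x))"
    by (rule integral_mono) (use pt ii integrable_exp_pot[OF a] in auto)
  finally have low: "avg (\<lambda>x. exp (u x)) + avg (\<lambda>x. exp (u x) * y x) + avg (\<lambda>x. (y x)\<^sup>2 / 2) - (c\<^sup>2 + K2) * t ^ 5 \<le> avg (\<lambda>x. exp (pot a x))" .
  have 1: "avg (\<lambda>x. exp (u x)) \<ge> 1 + t\<^sup>2 + t ^ 4 / 4"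
    using bessel_0_lower[of "2 * t"] unfolding u_def avg_exp_cos by (simp add: power_mult_distrib flip: power_mult)
  have 2: "avg (\<lambda>x. exp (u x) * y x) \<ge> c / 2 * t ^ 4 - c * t ^ 5"
  proof -
    have "avg (\<lambda>x. exp (u x) * y x) = avg (\<lambda>x. c * t\<^sup>2 * (exp (2 * t * cos x) * cos (real 2 * x)))"
      by (simp add: u_def y_def mult_ac)
    also have "\<dots> = c * t\<^sup>2 * bessel_I 2 (2 * t)" unfolding bessel_I_avg by (rule integral_mult_right_zero)
    finally have eq: "avg (\<lambda>x. exp (u x) * y x) = c * t\<^sup>2 * bessel_I 2 (2 * t)" .
    have "(2 * t)\<^sup>2 / 8 * (1 - 2 * t) \<le> (2 * t)\<^sup>2 / 8 * exp (- (2 * t))"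
      using exp_ge_add_one_self[of "- (2 * t)"] by (intro mult_left_mono) auto
    also have "\<dots> \<le> bessel_I 2 (2 * t)" by (rule bessel_2_lower) (use t in simp)
    finally have "c * t\<^sup>2 * ((2 * t)\<^sup>2 / 8 * (1 - 2 * t)) \<le> c * t\<^sup>2 * bessel_I 2 (2 * t)"
      by (rule mult_left_mono) (use c in simp)
    then show ?thesis unfolding eq by (simp add: power2_eq_square eval_nat_numeral algebra_simps)
  qed
  have 3: "avg (\<lambda>x. (y x)\<^sup>2 / 2) = c\<^sup>2 / 4 * t ^ 4"
  proof -
    have "avg (\<lambda>x. (y x)\<^sup>2 / 2) = avg (\<lambda>x. (c\<^sup>2 * t ^ 4 / 2) * (cos (real 2 * x) * cos (real 2 * x)))"
      by (simp add: y_def power2_eq_square eval_nat_numeral mult_ac)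
    then show ?thesis by (simp add: avg_cos_cos del: of_nat_numeral)
  qed
  have "exp E < avg (\<lambda>x. exp (pot a x))"
  proof -
    have "t ^ 4 * (K * t) < t ^ 4 * ((c - 1) / 4)" using Kt t by (intro mult_strict_left_mono) auto
    then have "K * t ^ 5 < (1/4 + c / 2 + c\<^sup>2 / 4 - g - 1/2) * t ^ 4" unfolding crit by (simp add: eval_nat_numeral mult_ac)
    then have "1 + t\<^sup>2 + (g + 1/2) * t ^ 4 + K1 * t ^ 5 < (1 + t\<^sup>2 + t ^ 4 / 4) + (c / 2 * t ^ 4 - c * t ^ 5) + c\<^sup>2 / 4 * t ^ 4 - (c\<^sup>2 + K2) * t ^ 5"
      unfolding K_def by (simp add: algebra_simps)
    then show ?thesis using up low 1 2 3 by linarith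
  qed
  then have "E < ln (avg (\<lambda>x. exp (pot a x)))" using exp_pot_avg_pos[OF a] by (metis exp_less_cancel_iff exp_ln)
  then have "Gf \<beta> (kappa_star \<beta>) z < 0" unfolding Gf_def en a_def by simp
  then show ?thesis using cz by (auto simp: unstable_def)
qed

section \<open>Discontinuous transitions\<close>

text \<open>
  Nontrivial solutions close to the uniform density are excluded by isolation, uniformly for
  intensities near \<open>k\<close>.
\<close>

lemma below_kappa_star_not_bifurcation:
  assumes b: "\<beta> > 0" and k: "bifurcation_point \<beta> k" shows "kappa_star \<beta> \<le> k"
proof (rule ccontr)
  assume "\<not> ?thesis"
  then have lt: "k < kappa_star \<beta>" by simp
  have k0: "0 < k" using k by (simp add: bifurcation_point_def)
  obtain \<epsilon> where e: "\<epsilon> > 0" and iso: "\<And>\<kappa> \<rho>. 0 \<le> \<kappa> \<Longrightarrow> \<kappa> \<le> (k + kappa_star \<beta>) / 2 \<Longrightarrow> selfcons \<beta> \<kappa> \<rho> \<Longrightarrow> avg (\<lambda>t. \<bar>\<rho> t - 1\<bar>) \<le> \<epsilon> \<Longrightarrow> is_uniform \<rho>"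
    using subcritical_isolation[OF b, of "(k + kappa_star \<beta>) / 2"] k0 lt by auto
  define d where "d = min \<epsilon> (min k ((kappa_star \<beta> - k) / 2))"
  have d: "d > 0" "d \<le> \<epsilon>" "d \<le> k" "d \<le> (kappa_star \<beta> - k) / 2"
    unfolding d_def using e k0 lt by (simp, simp, simp add: min.coboundedI1 min.coboundedI2, metis min.cobounded2 min.coboundedI2)
  obtain p \<kappa>' where p: "nontrivial_even_stationary \<beta> \<kappa>' p" "\<bar>\<kappa>' - k\<bar> < d" "H1_norm (\<lambda>t. p t - 1) < ennreal d"
    using k d(1) unfolding bifurcation_point_def by blast
  have "is_uniform p"
  proof (rule iso)
    show "0 \<le> \<kappa>'" "\<kappa>' \<le> (k + kappa_star \<beta>) / 2" using p(2) d by (auto simp: abs_less_iff field_simps)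
    show "selfcons \<beta> \<kappa>' p" using p(1) stationary_imp_selfcons[OF b] by (simp add: nontrivial_even_stationary_def)
    show "avg (\<lambda>t. \<bar>p t - 1\<bar>) \<le> \<epsilon>" using H1_norm_less_imp(2)[OF p(3)] d(2) by linarith
  qed
  then show False using p(1) by (simp add: nontrivial_even_stationary_def)
qed

text \<open>
  The infimum of the unstable intensities lies strictly below \<open>\<kappa>\<^sup>*\<close>
  because instability is an open condition. Minimizers above it are not uniform, so isolation
  keeps them away from the uniform density.
\<close>

lemma discontinuous_transition:
  assumes b: "\<beta> > 0" and R: "bessel_R \<beta> > 1/2"
  shows "\<exists>\<kappa>\<^sub>c<kappa_star \<beta>. discontinuous_transition_point \<beta> \<kappa>\<^sub>c"
proof -
  define U where "U = {\<kappa>. 0 < \<kappa> \<and> unstable \<beta> \<kappa>}"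
  have us: "kappa_star \<beta> \<in> U" using unstable_at_kappa_star[OF assms] kappa_star_pos[OF b] by (simp add: U_def)
  have bb: "bdd_below U" by (rule bdd_belowI[of _ 0]) (auto simp: U_def)
  define k where "k = Inf U"
  obtain k1 where k1: "0 < k1" "\<not> unstable \<beta> k1" using stable_small[OF b] by blast
  have "k1 \<le> k" unfolding k_def
  proof (rule cInf_greatest)
    fix x assume "x \<in> U"
    then show "k1 \<le> x" using unstable_mono[OF b, of x k1] k1 by (cases "k1 \<le> x") (auto simp: U_def)
  qed (use us in auto)
  then have k0: "0 < k" using k1 by simp
  have ki: "k \<le> x" if "x \<in> U" for x unfolding k_def by (rule cInf_lower[OF that bb])
  have nk: "\<not> unstable \<beta> k"
  proof
    assume "unstable \<beta> k"
    then obtain k' where "k' > 0" "k' < k" "unstable \<beta> k'" using unstable_open[OF b k0] by blast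
    then show False using ki[of k'] by (simp add: U_def)
  qed
  have uk: "unstable \<beta> \<kappa>" if "k < \<kappa>" for \<kappa>
  proof -
    have "U \<noteq> {}" "Inf U < \<kappa>" using us that by (auto simp: k_def)
    from cInf_lessD[OF this] obtain x where x: "x \<in> U" "x < \<kappa>" by blast
    show ?thesis by (rule unstable_mono[OF b, of x \<kappa>]) (use x in \<open>auto simp: U_def\<close>)
  qed
  have lt: "k < kappa_star \<beta>"
    using ki[OF us] nk unstable_at_kappa_star[OF assms] by (metis less_eq_real_def)
  have tp: "transition_point \<beta> k" by (rule transition_pointI[OF b k0 nk uk])
  have "\<not> minimizers_converge \<beta> k"
  proof
    assume mc: "minimizers_converge \<beta> k"
    have "\<forall>\<kappa>>k. \<exists>\<rho>. global_minimizer \<beta> \<kappa> \<rho> \<and> \<not> is_uniform \<rho>"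
      using tp by (simp add: transition_point_def)
    then obtain \<rho> where rho: "\<And>\<kappa>. \<kappa> > k \<Longrightarrow> global_minimizer \<beta> \<kappa> (\<rho> \<kappa>)" "\<And>\<kappa>. \<kappa> > k \<Longrightarrow> \<not> is_uniform (\<rho> \<kappa>)"
      by metis
    have lim: "((\<lambda>\<kappa>. H1_norm (\<lambda>t. \<rho> \<kappa> t - 1)) \<longlongrightarrow> 0) (at_right k)"
      using mc rho(1) by (simp add: minimizers_converge_def)
    define k0' where "k0' = (k + kappa_star \<beta>) / 2"
    have k0': "k < k0'" "k0' < kappa_star \<beta>" using lt by (auto simp: k0'_def)
    obtain \<epsilon> where e: "\<epsilon> > 0" and iso: "\<And>\<kappa> \<rho>. 0 \<le> \<kappa> \<Longrightarrow> \<kappa> \<le> k0' \<Longrightarrow> selfcons \<beta> \<kappa> \<rho> \<Longrightarrow> avg (\<lambda>t. \<bar>\<rho> t - 1\<bar>) \<le> \<epsilon> \<Longrightarrow> is_uniform \<rho>"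
      using subcritical_isolation[OF b, of k0'] k0 k0' by auto
    have "eventually (\<lambda>\<kappa>. H1_norm (\<lambda>t. \<rho> \<kappa> t - 1) < ennreal \<epsilon>) (at_right k)"
      using order_tendstoD(2)[OF lim, of "ennreal \<epsilon>"] e by simp
    moreover have "eventually (\<lambda>\<kappa>. \<kappa> \<in> {k<..<k0'}) (at_right k)"
      using eventually_at_right_real[OF k0'(1)] .
    ultimately have "eventually (\<lambda>\<kappa>. False) (at_right k)"
    proof eventually_elim
      case (elim \<kappa>)
      then have kk: "k < \<kappa>" "\<kappa> < k0'" by auto
      have "is_uniform (\<rho> \<kappa>)"
      proof (rule iso)
        show "selfcons \<beta> \<kappa> (\<rho> \<kappa>)" by (rule minimizer_selfcons[OF b]) (use rho kk k0 in auto)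
      qed (use kk k0 H1_norm_less_imp(2)[OF elim(1)] in auto)
      then show False using rho(2) kk by simp
    qed
    then show False by (simp add: trivial_limit_def[symmetric])
  qed
  then show ?thesis using tp lt by (auto simp: discontinuous_transition_point_def)
qed

section \<open>Continuous transitions for small beta\<close>

text \<open>
  Compared with the exponential series, the series of \<open>I\<^sub>0\<close> loses at least a
  quarter of \<open>(x\<^sup>2 / 4)\<^sup>2\<close>; this loss makes the first mode stable at
  fourth order.
\<close>

lemma bessel_0_upper: "bessel_I 0 x \<le> exp (x\<^sup>2 / 4) - (x\<^sup>2 / 4)\<^sup>2 / 4"
proof -
  define u where "u = x\<^sup>2 / 4"
  have u: "u \<ge> 0" by (simp add: u_def)
  have "(\<lambda>k. u ^ k / fact k) sums exp u" using exp_converges[of u] by (simp add: field_simps)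
  from sums_diff[OF this bessel_0_series[of x, folded u_def]]
  have s: "(\<lambda>k. u ^ k / fact k - u ^ k / (fact k)\<^sup>2) sums (exp u - bessel_I 0 x)" .
  have nn: "0 \<le> u ^ k / fact k - u ^ k / (fact k)\<^sup>2" for k
  proof -
    have "(fact k :: real) \<le> (fact k)\<^sup>2" unfolding power2_eq_square by (simp add: fact_ge_1)
    then have "u ^ k / (fact k)\<^sup>2 \<le> u ^ k / fact k" using u by (intro divide_left_mono) auto
    then show ?thesis by simp
  qed
  have "(\<Sum>k\<in>{2}. u ^ k / fact k - u ^ k / (fact k)\<^sup>2) \<le> exp u - bessel_I 0 x"
    unfolding sums_unique[OF s] by (rule sum_le_suminf[OF sums_summable[OF s]]) (use nn in auto)
  then show ?thesis by (simp add: u_def fact_numeral power2_eq_square field_simps)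
qed

text \<open>
  A rotation merges the cosine and the sine into a single cosine.
\<close>

lemma avg_exp_first_mode:
  "avg (\<lambda>t. exp (2 * (z0 * cos t + z1 * sin t))) = bessel_I 0 (2 * sqrt (z0\<^sup>2 + z1\<^sup>2))"
proof -
  define s where "s = sqrt (z0\<^sup>2 + z1\<^sup>2)"
  define t0 where "t0 = Arg (Complex z0 z1)"
  have "Complex z0 z1 = rcis s t0" unfolding s_def t0_def using rcis_cmod_Arg[of "Complex z0 z1"] by (simp add: cmod_def)
  then have z: "z0 = s * cos t0" "z1 = s * sin t0" by (auto simp: complex_eq_iff)
  have "avg (\<lambda>t. exp (2 * (z0 * cos t + z1 * sin t))) = avg (\<lambda>t. exp (2 * s * cos (t + (- t0))))"
    unfolding z by (simp add: cos_diff algebra_simps)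
  also have "\<dots> = avg (\<lambda>t. exp (2 * s * cos (1 * t + (- t0))))" by simp
  also have "\<dots> = avg (\<lambda>t. exp (2 * s * cos t))"
    by (rule avg_isometry[of 1 "\<lambda>t. exp (2 * s * cos t)"]) (auto intro!: continuous_intros)
  finally show ?thesis by (simp add: avg_exp_cos s_def)
qed

text \<open>
  Relative to the first weight the weights decay like powers of \<open>\<beta> / 4\<close>; each
  frequency occurs twice.
\<close>

lemma wt_tail_sum:
  assumes b: "0 < \<beta>" "\<beta> \<le> 1"
  shows "summable (\<lambda>j. kappa_star \<beta> * wt \<beta> (j + 2))" "(\<Sum>j. kappa_star \<beta> * wt \<beta> (j + 2)) \<le> \<beta>"
proof -
  define r where "r l = bessel_I (Suc l) \<beta> / bessel_I 1 \<beta>" for l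
  have I1: "bessel_I 1 \<beta> > 0" using bessel_1_pos b by simp
  have rb: "r l \<le> (\<beta> / 4) ^ l" for l
  proof (induction l)
    case 0
    then show ?case using I1 by (simp add: r_def)
  next
    case (Suc l)
    have "\<beta> / (2 * real (Suc (Suc l))) \<le> \<beta> / 4" using b by (intro divide_left_mono) auto
    then have "bessel_I (Suc (Suc l)) \<beta> \<le> \<beta> / 4 * bessel_I (Suc l) \<beta>"
      using bessel_Suc_le[of \<beta> "Suc l"] mult_right_mono[of "\<beta> / (2 * real (Suc (Suc l)))" "\<beta> / 4" "bessel_I (Suc l) \<beta>"]
        bessel_nonneg[of \<beta> "Suc l"] b by (meson less_imp_le order_trans)
    then have "r (Suc l) \<le> \<beta> / 4 * r l" using I1 unfolding r_def by (simp add: divide_right_mono field_simps)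
    also have "\<dots> \<le> \<beta> / 4 * (\<beta> / 4) ^ l" using Suc b by (intro mult_left_mono) auto
    finally show ?case by simp
  qed
  have eq: "kappa_star \<beta> * wt \<beta> (j + 2) = r (freq j)" for j
    using b I1 by (simp add: kappa_star_def wt_def freq_def r_def)
  have gs: "(\<lambda>l. (\<beta> / 4) ^ (l + 1)) sums (\<beta> / 4 / (1 - \<beta> / 4))"
    using sums_mult[OF geometric_sums[of "\<beta> / 4"], of "\<beta> / 4"] b by simp
  have s: "(\<lambda>j. (\<beta> / 4) ^ freq j) sums (\<beta> / 4 / (1 - \<beta> / 4) + \<beta> / 4 / (1 - \<beta> / 4))"
    using sums_pairs[OF gs gs] by (simp add: freq_def)
  have nn: "0 \<le> r l" for l using I1 bessel_nonneg[of \<beta>] b by (simp add: r_def)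
  show sm: "summable (\<lambda>j. kappa_star \<beta> * wt \<beta> (j + 2))" unfolding eq
    by (rule summable_comparison_test'[OF sums_summable[OF s], of 0]) (use rb nn in auto)
  have "(\<Sum>j. kappa_star \<beta> * wt \<beta> (j + 2)) \<le> (\<Sum>j. (\<beta> / 4) ^ freq j)"
    by (rule suminf_le[OF _ sm sums_summable[OF s]]) (simp only: eq rb)
  also have "\<dots> = \<beta> / 4 / (1 - \<beta> / 4) + \<beta> / 4 / (1 - \<beta> / 4)" using s by (simp add: sums_iff)
  also have "\<beta> / 4 / (1 - \<beta> / 4) \<le> \<beta> / 4 / (1/2)" using b by (intro divide_left_mono) auto
  finally show "(\<Sum>j. kappa_star \<beta> * wt \<beta> (j + 2)) \<le> \<beta>" by simp
qed

text \<open>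
  The first mode alone contributes \<open>u - ln I\<^sub>0\<close>, which is bounded below by a
  multiple of \<open>u\<^sup>2\<close>. The higher modes perturb the exponent by at most
  \<open>2 A\<close> with \<open>A\<^sup>2 \<le> \<beta> D\<close>, so for small
  \<open>\<beta>\<close> the perturbation is absorbed by \<open>D\<close> and
  \<open>u\<^sup>2\<close>.
\<close>

lemma Gf_lower_small_beta:
  assumes b: "0 < \<beta>" "\<beta> \<le> 1/1000000" and cz: "cube z"
  defines "u \<equiv> (z 0)\<^sup>2 + (z 1)\<^sup>2"
  defines "D \<equiv> (\<Sum>j. kappa_star \<beta> * wt \<beta> (j + 2) * (z (j + 2))\<^sup>2)"
  shows "u\<^sup>2 / 64 + D / 2 \<le> Gf \<beta> (kappa_star \<beta>) z" "kappa_star \<beta> * en \<beta> z = u + D" "0 \<le> u" "0 \<le> D"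
proof -
  define k where "k = kappa_star \<beta>"
  have k0: "k > 0" unfolding k_def by (rule kappa_star_pos[OF b(1)])
  define w where "w j = k * wt \<beta> (j + 2)" for j
  define y where "y j = \<bar>z (j + 2)\<bar>" for j
  have zb: "\<bar>z j\<bar> \<le> 1" for j using cz by (simp add: cube_def)
  have y: "0 \<le> y j" "y j \<le> 1" for j using zb by (auto simp: y_def)
  have w0: "0 \<le> w j" for j using k0 wt_nonneg[OF b(1)] by (simp add: w_def)
  have wS: "summable w" "(\<Sum>j. w j) \<le> \<beta>" using wt_tail_sum[of \<beta>] b unfolding w_def k_def by auto
  have Deq: "D = (\<Sum>j. w j * (y j)\<^sup>2)" by (simp add: D_def w_def y_def k_def)
  have s1: "summable (\<lambda>j. w j * y j)"
    by (rule summable_comparison_test'[OF wS(1), of 0]) (use w0 y in \<open>auto simp: abs_mult mult_left_le\<close>)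
  have s2: "summable (\<lambda>j. w j * (y j)\<^sup>2)"
    by (rule summable_comparison_test'[OF wS(1), of 0]) (use w0 y in \<open>auto simp: abs_mult intro!: mult_left_le power_le_one\<close>)
  show D0: "0 \<le> D" unfolding Deq by (intro suminf_nonneg s2) (use w0 in auto)
  show u0: "0 \<le> u" by (simp add: u_def)
  have kw: "k * wt \<beta> 0 = 1" "k * wt \<beta> (Suc 0) = 1" using wt_first[OF b(1)] k0 by (simp_all add: k_def)
  have "k * en \<beta> z = (\<Sum>j. k * (wt \<beta> j * (z j)\<^sup>2))" unfolding en_def by (rule suminf_mult[symmetric, OF en_summable[OF b(1) cz]])
  also have "\<dots> = (\<Sum>j. k * (wt \<beta> (j + 2) * (z (j + 2))\<^sup>2)) + (\<Sum>j<2. k * (wt \<beta> j * (z j)\<^sup>2))"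
    by (rule suminf_split_initial_segment[OF summable_mult[OF en_summable[OF b(1) cz]]])
  also have "(\<Sum>j. k * (wt \<beta> (j + 2) * (z (j + 2))\<^sup>2)) = D" by (simp add: D_def k_def mult.assoc)
  also have "(\<Sum>j<2. k * (wt \<beta> j * (z j)\<^sup>2)) = u" using kw by (simp add: numeral_2_eq_2 lessThan_Suc u_def mult.assoc[symmetric])
  finally have enk: "k * en \<beta> z = u + D" by simp
  then show "kappa_star \<beta> * en \<beta> z = u + D" by (simp add: k_def)
  define A where "A = (\<Sum>j. w j * y j)"
  have A0: "0 \<le> A" unfolding A_def by (intro suminf_nonneg s1) (use w0 y in auto)
  have "A\<^sup>2 \<le> (\<Sum>j. w j) * D" unfolding A_def Deq by (rule weighted_CS[OF w0 wS(1) y])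
  also have "\<dots> \<le> \<beta> * D" by (rule mult_right_mono[OF wS(2) D0])
  finally have A2: "A\<^sup>2 \<le> \<beta> * D" .
  have "A \<le> (\<Sum>j. w j)" unfolding A_def by (intro suminf_le s1 wS mult_left_le y w0)
  then have A1: "2 * A \<le> 1" using wS(2) b by linarith
  define a where "a = coef \<beta> k z"
  have a: "adm a" unfolding a_def by (rule coef_adm[OF b(1) cz])
  define x where "x t = 2 * (z 0 * cos t + z 1 * sin t)" for t
  define \<delta> where "\<delta> t = pot a t - x t" for t
  have a01: "a 0 = 2 * z 0" "a 1 = 2 * z 1" using kw by (simp_all add: a_def coef_def mult.assoc[symmetric])
  have xtb: "x t = a 0 * tb 0 t + a 1 * tb 1 t" for t
    unfolding x_def a01 by (simp add: tb_def freq_def algebra_simps)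
  have db: "\<bar>\<delta> t\<bar> \<le> 2 * A" for t
  proof -
    have "pot a t = (\<Sum>j. a (j + 2) * tb (j + 2) t) + (\<Sum>j<2. a j * tb j t)"
      unfolding pot_def by (rule suminf_split_initial_segment[OF pot_summable[OF a]])
    then have "\<delta> t = (\<Sum>j. a (j + 2) * tb (j + 2) t)" by (simp add: \<delta>_def xtb numeral_2_eq_2 lessThan_Suc)
    also have "norm \<dots> \<le> (\<Sum>j. 2 * (w j * y j))"
    proof (rule suminf_norm_le[OF _ summable_mult[OF s1]])
      fix j
      have "\<bar>a (j + 2)\<bar> = 2 * (w j * y j)" using w0[of j] k0 wt_nonneg[OF b(1), of "j + 2"]
        by (simp add: a_def coef_def w_def y_def abs_mult)
      then show "norm (a (j + 2) * tb (j + 2) t) \<le> 2 * (w j * y j)"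
        using mult_left_mono[OF tb_le[of "j + 2" t], of "\<bar>a (j + 2)\<bar>"] by (simp add: abs_mult)
    qed
    also have "\<dots> = 2 * A" unfolding A_def by (rule suminf_mult[OF s1])
    finally show ?thesis by simp
  qed
  have u2: "u \<le> 2"
  proof -
    have "(z 0)\<^sup>2 \<le> 1" "(z 1)\<^sup>2 \<le> 1" using zb[of 0] zb[of 1] by (simp_all add: abs_square_le_1)
    then show ?thesis by (simp add: u_def)
  qed
  have x2: "(x t)\<^sup>2 \<le> 4 * u" for t
  proof -
    have nn: "0 \<le> (z 0 * sin t - z 1 * cos t)\<^sup>2" by simp
    have eq: "(z 0 * cos t + z 1 * sin t)\<^sup>2 + (z 0 * sin t - z 1 * cos t)\<^sup>2 = u * ((sin t)\<^sup>2 + (cos t)\<^sup>2)"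
      unfolding u_def by algebra
    have "(z 0 * cos t + z 1 * sin t)\<^sup>2 \<le> u" using nn eq unfolding sin_cos_squared_add by linarith
    then show ?thesis unfolding x_def power_mult_distrib by simp
  qed
  have x3: "\<bar>x t\<bar> \<le> 3" for t
  proof -
    have "(x t)\<^sup>2 \<le> 3\<^sup>2" using x2[of t] u2 by simp
    then show ?thesis using abs_le_square_iff[of "x t" 3] by simp
  qed
  have e3: "exp 3 \<le> (21::real)"
  proof -
    have "exp (3::real) = exp 1 ^ 3" using exp_of_nat_mult[of 3 "1::real"] by simp
    also have "\<dots> \<le> 2.72 ^ 3" using e_less_272 by (intro power_mono) auto
    finally show ?thesis by (simp add: power3_eq_cube)
  qed
  have e1: "exp 1 \<le> (3::real)" using e_less_272 by simp
  have xc: "continuous_on B x" for B unfolding x_def[abs_def] by (intro continuous_intros)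
  have dc: "continuous_on B \<delta>" for B unfolding \<delta>_def[abs_def] by (intro continuous_intros xc pot_continuous a)
  have ad: "avg \<delta> = 0"
  proof -
    have "avg x = 0" unfolding x_def[abs_def] using avg_tb[of 0] avg_tb[of 1] by (simp add: tb_def[abs_def] freq_def integrable_cm_continuous continuous_intros)
    then show ?thesis unfolding \<delta>_def[abs_def] using avg_pot[OF a] by (simp add: integrable_cm_continuous pot_continuous[OF a] xc)
  qed
  have axd: "avg (\<lambda>t. x t * \<delta> t) = 0"
  proof -
    have i: "integrable cm (\<lambda>t. pot a t * tb j t)" "integrable cm (\<lambda>t. tb i t * tb j t)" for i j
      by (intro integrable_cm_continuous continuous_intros pot_continuous a)+
    have "avg (\<lambda>t. x t * \<delta> t) = avg (\<lambda>t. a 0 * (pot a t * tb 0 t) + a 1 * (pot a t * tb 1 t)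
        - (a 0 * a 0 * (tb 0 t * tb 0 t) + 2 * a 0 * a 1 * (tb 0 t * tb 1 t) + a 1 * a 1 * (tb 1 t * tb 1 t)))"
      unfolding \<delta>_def xtb by (simp add: algebra_simps)
    also have "\<dots> = a 0 * (a 0 / 2) + a 1 * (a 1 / 2) - (a 0 * a 0 * (1/2) + 2 * a 0 * a 1 * 0 + a 1 * a 1 * (1/2))"
      by (simp add: i avg_tb_tb mode_pot[OF a])
    finally show ?thesis by simp
  qed
  define h where "h = 2 * A"
  have h0: "0 \<le> h" "h \<le> 1" using A0 A1 by (auto simp: h_def)
  have hD: "h\<^sup>2 \<le> 4 * \<beta> * D" using A2 by (simp add: h_def power_mult_distrib)
  have pt: "exp (pot a t) \<le> exp (x t) + \<delta> t + x t * \<delta> t + (84 * u * h + 63 * h\<^sup>2)" for t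
  proof -
    define X where "X = x t"
    define Y where "Y = \<delta> t"
    have eX: "exp X \<le> 21" using x3[of t] e3 by (simp add: X_def) (smt (verit) exp_le_cancel_iff)
    have "\<bar>(exp X - 1 - X) * Y\<bar> \<le> (4 * u * 21) * h"
    proof -
      have "\<bar>exp X - 1 - X\<bar> \<le> X\<^sup>2 * exp \<bar>X\<bar>" using exp_remainder[of X] by simp
      also have "\<dots> \<le> (4 * u) * 21"
      proof (rule mult_mono)
        have "exp \<bar>X\<bar> \<le> exp 3" using x3[of t] by (simp add: X_def)
        then show "exp \<bar>X\<bar> \<le> 21" using e3 by linarith
      qed (use x2[of t] u0 in \<open>auto simp: X_def\<close>)
      finally show ?thesis unfolding abs_mult using db[of t] u0 by (intro mult_mono) (auto simp: Y_def h_def)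
    qed
    moreover have "exp X * (exp Y - 1 - Y) \<le> 21 * (3 * h\<^sup>2)"
    proof -
      have "exp Y - 1 - Y \<le> Y\<^sup>2 * exp \<bar>Y\<bar>" using exp_remainder[of Y] by simp
      also have "\<dots> \<le> h\<^sup>2 * 3"
      proof (rule mult_mono)
        have Yh: "\<bar>Y\<bar> \<le> h" using db[of t] by (simp add: Y_def h_def)
        then show "Y\<^sup>2 \<le> h\<^sup>2" using power_mono[OF Yh, of 2] by simp
        have "exp \<bar>Y\<bar> \<le> exp 1" using Yh h0 by simp
        then show "exp \<bar>Y\<bar> \<le> 3" using e1 by linarith
      qed auto
      finally have "exp Y - 1 - Y \<le> 3 * h\<^sup>2" by simp
      then have "exp X * (exp Y - 1 - Y) \<le> exp X * (3 * h\<^sup>2)" by (intro mult_left_mono) auto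
      also have "\<dots> \<le> 21 * (3 * h\<^sup>2)" using eX by (intro mult_right_mono) auto
      finally show ?thesis .
    qed
    moreover have "exp (pot a t) = exp X + Y + X * Y + (exp X - 1 - X) * Y + exp X * (exp Y - 1 - Y)"
    proof -
      have "pot a t = X + Y" by (simp add: X_def Y_def \<delta>_def)
      then show ?thesis by (simp add: exp_add algebra_simps)
    qed
    ultimately show ?thesis unfolding X_def[symmetric] Y_def[symmetric] by (simp add: abs_le_iff)
  qed
  have ii: "integrable cm (\<lambda>t. exp (x t))" "integrable cm \<delta>" "integrable cm (\<lambda>t. x t * \<delta> t)"
    by (intro integrable_cm_continuous continuous_intros xc dc)+
  have "avg (\<lambda>t. exp (pot a t)) \<le> avg (\<lambda>t. exp (x t) + \<delta> t + x t * \<delta> t + (84 * u * h + 63 * h\<^sup>2))"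
    by (rule integral_mono) (use pt ii integrable_exp_pot[OF a] in auto)
  also have "\<dots> = bessel_I 0 (2 * sqrt u) + (84 * u * h + 63 * h\<^sup>2)"
    using ii ad axd by (simp add: avg_exp_first_mode[of "z 0" "z 1", folded x_def u_def])
  also have "bessel_I 0 (2 * sqrt u) \<le> exp u - u\<^sup>2 / 4"
    using bessel_0_upper[of "2 * sqrt u"] u0 by (simp add: power_mult_distrib)
  finally have Zle: "avg (\<lambda>t. exp (pot a t)) \<le> exp u - u\<^sup>2 / 4 + (84 * u * h + 63 * h\<^sup>2)" by simp
  define q where "q = 84 * u * h + 63 * h\<^sup>2"
  have q0: "0 \<le> q" using u0 h0 by (simp add: q_def)
  have eu: "exp u \<ge> 1" "exp u \<le> 8"
  proof -
    have "exp u \<le> exp 2" using u2 by simp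
    also have "exp 2 = exp (1::real) ^ 2" using exp_of_nat_mult[of 2 "1::real"] by simp
    also have "\<dots> \<le> 2.72 ^ 2" using e_less_272 by (intro power_mono) auto
    finally show "exp u \<le> 8" by (simp add: power2_eq_square)
  qed (use u0 in simp)
  have Zfac: "exp u - u\<^sup>2 / 4 + q \<le> exp u * (1 + (q - u\<^sup>2 / 32))"
  proof -
    have "exp u * (u\<^sup>2 / 32) \<le> 8 * (u\<^sup>2 / 32)" by (intro mult_right_mono eu) auto
    moreover have "1 * q \<le> exp u * q" by (intro mult_right_mono eu q0)
    ultimately show ?thesis by (simp add: algebra_simps)
  qed
  have Zpos: "avg (\<lambda>t. exp (pot a t)) > 0" by (rule exp_pot_avg_pos[OF a])
  then have pos: "0 < 1 + (q - u\<^sup>2 / 32)"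
  proof -
    have "0 < exp u * (1 + (q - u\<^sup>2 / 32))" using Zpos Zle Zfac unfolding q_def[symmetric] by linarith
    then show ?thesis by (simp add: zero_less_mult_iff)
  qed
  have "ln (avg (\<lambda>t. exp (pot a t))) \<le> ln (exp u * (1 + (q - u\<^sup>2 / 32)))"
    using Zpos Zle Zfac unfolding q_def[symmetric] by (intro ln_mono) auto
  also have "\<dots> = u + ln (1 + (q - u\<^sup>2 / 32))" using pos by (simp add: ln_mult)
  also have "ln (1 + (q - u\<^sup>2 / 32)) \<le> q - u\<^sup>2 / 32" using ln_le_minus_one[OF pos] by simp
  finally have "D + u\<^sup>2 / 32 - q \<le> Gf \<beta> k z" unfolding Gf_def enk a_def by simp
  moreover have "q \<le> u\<^sup>2 / 64 + D / 2"
  proof -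
    have "0 \<le> (u / 8 - 4 * 84 * h)\<^sup>2" by simp
    then have "84 * u * h \<le> u\<^sup>2 / 64 + 112896 * h\<^sup>2" by (simp add: power2_eq_square algebra_simps)
    moreover have "112959 * h\<^sup>2 \<le> D / 2"
    proof -
      have "112959 * h\<^sup>2 \<le> 112959 * (4 * \<beta> * D)" using hD by (rule mult_left_mono) simp
      also have "\<dots> = (451836 * \<beta>) * D" by simp
      also have "\<dots> \<le> (1/2) * D" using b D0 by (intro mult_right_mono) auto
      finally show ?thesis by simp
    qed
    ultimately show ?thesis by (simp add: q_def)
  qed
  ultimately show "u\<^sup>2 / 64 + D / 2 \<le> Gf \<beta> (kappa_star \<beta>) z" by (simp add: k_def)
qed

text \<open>
  The interaction energy controls the potential with its derivative, by the weighted
  Cauchy--Schwarz inequality.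
\<close>

lemma pnorm_coef_le_en:
  assumes b: "\<beta> > 0" "\<kappa> \<ge> 0" and cz: "cube z"
  shows "pnorm (coef \<beta> \<kappa> z) \<le> 2 * \<kappa> * sqrt ((\<Sum>j. (real (freq j))\<^sup>2 * wt \<beta> j) * en \<beta> z)"
proof -
  define y where "y j = \<bar>z j\<bar> / real (freq j)" for j
  have f1: "real (freq j) \<ge> 1" for j using freq_pos[of j] by simp
  have zb: "\<bar>z j\<bar> \<le> 1" for j using cz by (simp add: cube_def)
  have y: "0 \<le> y j" "y j \<le> 1" for j
  proof -
    have "\<bar>z j\<bar> \<le> real (freq j)" using zb[of j] f1[of j] by linarith
    then show "0 \<le> y j" "y j \<le> 1" using f1[of j] by (auto simp: y_def divide_le_eq_1)
  qed
  have wy: "(real (freq j))\<^sup>2 * wt \<beta> j * y j = real (freq j) * wt \<beta> j * \<bar>z j\<bar>"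
    "(real (freq j))\<^sup>2 * wt \<beta> j * (y j)\<^sup>2 = wt \<beta> j * (z j)\<^sup>2" for j
    using f1[of j] by (simp_all add: y_def power2_eq_square field_simps)
  have CS: "(\<Sum>j. real (freq j) * wt \<beta> j * \<bar>z j\<bar>)\<^sup>2 \<le> (\<Sum>j. (real (freq j))\<^sup>2 * wt \<beta> j) * en \<beta> z"
    using weighted_CS[of "\<lambda>j. (real (freq j))\<^sup>2 * wt \<beta> j" y] wt_nonneg[OF b(1)] wt_summable_sq[OF b(1)] y
    unfolding wy en_def by simp
  have s: "summable (\<lambda>j. real (freq j) * wt \<beta> j * \<bar>z j\<bar>)"
    by (rule summable_comparison_test'[OF wt_summable_freq[OF b(1)], of 0])
       (use wt_nonneg[OF b(1)] zb in \<open>auto simp: abs_mult mult_left_le\<close>)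
  have "pnorm (coef \<beta> \<kappa> z) = (\<Sum>j. 2 * \<kappa> * (real (freq j) * wt \<beta> j * \<bar>z j\<bar>))"
    unfolding pnorm_def coef_def using wt_nonneg[OF b(1)] b by (simp add: abs_mult mult_ac)
  also have "\<dots> = 2 * \<kappa> * (\<Sum>j. real (freq j) * wt \<beta> j * \<bar>z j\<bar>)" by (rule suminf_mult[OF s])
  also have "\<dots> \<le> 2 * \<kappa> * sqrt ((\<Sum>j. (real (freq j))\<^sup>2 * wt \<beta> j) * en \<beta> z)"
    using b by (intro mult_left_mono real_le_rsqrt CS) auto
  finally show ?thesis .
qed

text \<open>
  Coercivity of the reduced energy at \<open>\<kappa>\<^sup>*\<close> bounds the interaction
  energy of a minimizer at \<open>\<kappa>\<close> by a quantity that tends to zero with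
  \<open>\<kappa> - \<kappa>\<^sup>*\<close>; since a minimizer is a Gibbs density, its
  \<open>H\<^sup>1\<close> distance to the uniform density is controlled by this energy.
\<close>

lemma continuous_transition:
  assumes b: "0 < \<beta>" "\<beta> \<le> 1/1000000"
  shows "continuous_transition_point \<beta> (kappa_star \<beta>)"
proof -
  define k where "k = kappa_star \<beta>"
  have k0: "k > 0" unfolding k_def by (rule kappa_star_pos[OF b(1)])
  have Gn: "0 \<le> Gf \<beta> k z" if "cube z" for z
  proof -
    note G = Gf_lower_small_beta[OF b that]
    have "0 \<le> ((z 0)\<^sup>2 + (z 1)\<^sup>2)\<^sup>2 / 64" by simp
    then show ?thesis using G(1,4) unfolding k_def by linarith
  qed
  have st: "\<not> unstable \<beta> k" using Gn by (auto simp: unstable_def not_less)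
  have tp: "transition_point \<beta> k"
    by (rule transition_pointI[OF b(1) k0 st]) (use unstable_above[OF b(1)] in \<open>simp add: k_def\<close>)
  define S where "S = (\<Sum>j. wt \<beta> j)"
  have S0: "0 \<le> S" unfolding S_def by (intro suminf_nonneg wt_summable wt_nonneg b)
  \<comment> \<open>A minimizer at \<open>\<kappa>\<close> has reduced energy at most \<open>(\<kappa> - k) S\<close> at \<open>k\<close>, which coercivity turns into a bound on its modes.\<close>
  have key: "k * en \<beta> (mode \<rho>) \<le> 8 * sqrt ((\<kappa> - k) * S) + 2 * ((\<kappa> - k) * S)"
    if m: "global_minimizer \<beta> \<kappa> \<rho>" and kk: "k \<le> \<kappa>" for \<rho> \<kappa>
  proof -
    have r: "\<rho> \<in> pos_densities" "integrable cm (\<lambda>t. \<rho> t * ln (\<rho> t))" using m unfolding global_minimizer_iff[OF b(1)] by blast+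
    define z where "z = mode \<rho>"
    have cz: "cube z" unfolding z_def by (rule mode_cube[OF r(1)])
    have "ent \<rho> - \<kappa> * en \<beta> z \<le> 0"
      using m uniform_density unfolding global_minimizer_iff[OF b(1)]
      by (auto simp: mode_uniform z_def dest!: bspec[of _ _ "\<lambda>_. 1"])
    moreover have "(\<kappa> - k) * en \<beta> z \<le> (\<kappa> - k) * S"
      using en_le[OF b(1) cz] kk by (intro mult_left_mono) (auto simp: S_def)
    moreover have "Gf \<beta> k z \<le> ent \<rho> - k * en \<beta> z" unfolding z_def by (rule Gf_le(1)[OF b(1) r])
    ultimately have G: "Gf \<beta> k z \<le> (\<kappa> - k) * S" by (simp add: algebra_simps)
    define \<eta> where "\<eta> = (\<kappa> - k) * S"
    have eta: "0 \<le> \<eta>" using kk S0 by (simp add: \<eta>_def)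
    define u where "u = (z 0)\<^sup>2 + (z 1)\<^sup>2"
    define D where "D = (\<Sum>j. kappa_star \<beta> * wt \<beta> (j + 2) * (z (j + 2))\<^sup>2)"
    note GG = Gf_lower_small_beta[OF b cz, folded u_def D_def k_def]
    have D: "D \<le> 2 * \<eta>"
    proof -
      have "0 \<le> u\<^sup>2 / 64" by simp
      then show ?thesis using GG(1) G unfolding \<eta>_def by linarith
    qed
    have "u\<^sup>2 \<le> 64 * \<eta>" using GG(1,4) G unfolding \<eta>_def by linarith
    then have "u \<le> sqrt (64 * \<eta>)" by (rule real_le_rsqrt)
    also have "\<dots> = 8 * sqrt \<eta>" by (simp add: real_sqrt_mult)
    finally show ?thesis using D GG(2) by (simp add: \<eta>_def z_def)
  qed
  have uu: "uniform_unique_minimizer \<beta> k" unfolding uniform_unique_minimizer_def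
  proof (intro conjI allI impI)
    show "global_minimizer \<beta> k (\<lambda>_. 1)" by (rule not_unstable_minimizer) (use b k0 st in auto)
    fix \<rho> assume m: "global_minimizer \<beta> k \<rho>"
    then have r: "\<rho> \<in> pos_densities" "integrable cm (\<lambda>t. \<rho> t * ln (\<rho> t))" unfolding global_minimizer_iff[OF b(1)] by blast+
    have "ent \<rho> - k * en \<beta> (mode \<rho>) \<le> 0"
      using m uniform_density unfolding global_minimizer_iff[OF b(1)]
      by (auto simp: mode_uniform dest!: bspec[of _ _ "\<lambda>_. 1"])
    then have "ent \<rho> = 0" using key[OF m] ent_nonneg(1)[OF r] by simp
    then show "is_uniform \<rho>" by (rule ent_nonneg(2)[OF r])
  qed
  have mc: "minimizers_converge \<beta> k" unfolding minimizers_converge_def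
  proof (intro allI impI)
    fix \<rho> :: "real \<Rightarrow> real \<Rightarrow> real" assume m: "\<forall>\<kappa>>k. global_minimizer \<beta> \<kappa> (\<rho> \<kappa>)"
    define M where "M = (\<Sum>j. (real (freq j))\<^sup>2 * wt \<beta> j)"
    have M0: "0 \<le> M" unfolding M_def by (intro suminf_nonneg wt_summable_sq b) (use wt_nonneg[OF b(1)] in auto)
    define B where "B = (k + 1) * Lam \<beta>"
    define N where "N \<kappa> = 2 * \<kappa> * sqrt (M * ((8 * sqrt ((\<kappa> - k) * S) + 2 * ((\<kappa> - k) * S)) / k))" for \<kappa>
    have bound: "H1_norm (\<lambda>t. \<rho> \<kappa> t - 1) \<le> ennreal (4 * (2 * exp (2 * B) * (1 + B) * N \<kappa>))"
      if kk: "k < \<kappa>" "\<kappa> < k + 1" for \<kappa>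
    proof -
      have mk: "global_minimizer \<beta> \<kappa> (\<rho> \<kappa>)" using m kk by simp
      then have r: "\<rho> \<kappa> \<in> pos_densities" unfolding global_minimizer_iff[OF b(1)] by blast
      define z where "z = mode (\<rho> \<kappa>)"
      have cz: "cube z" unfolding z_def by (rule mode_cube[OF r])
      define a where "a = coef \<beta> \<kappa> z"
      have a: "adm a" unfolding a_def by (rule coef_adm[OF b(1) cz])
      have aB: "pnorm a \<le> B"
      proof -
        have "pnorm a \<le> \<bar>\<kappa>\<bar> * (Lam \<beta> * 1)" unfolding a_def by (rule coef_adm_bound(2)[OF b(1)]) (use cz in \<open>simp add: cube_def\<close>)
        also have "\<dots> \<le> B" unfolding B_def using kk k0 Lam_nonneg[OF b(1)] by (auto intro!: mult_right_mono)
        finally show ?thesis .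
      qed
      have B0: "0 \<le> B" using aB pnorm_nonneg[OF a] by linarith
      have aN: "pnorm a \<le> N \<kappa>"
      proof -
        have "en \<beta> z \<le> (8 * sqrt ((\<kappa> - k) * S) + 2 * ((\<kappa> - k) * S)) / k"
          using key[OF mk] kk k0 by (simp add: pos_le_divide_eq z_def mult.commute)
        then have "sqrt (M * en \<beta> z) \<le> sqrt (M * ((8 * sqrt ((\<kappa> - k) * S) + 2 * ((\<kappa> - k) * S)) / k))"
          using M0 by (intro real_sqrt_le_mono mult_left_mono)
        then have "2 * \<kappa> * sqrt (M * en \<beta> z) \<le> N \<kappa>" unfolding N_def using kk k0 by (intro mult_left_mono) auto
        moreover have "pnorm a \<le> 2 * \<kappa> * sqrt (M * en \<beta> z)" unfolding a_def M_def by (rule pnorm_coef_le_en[OF b(1) _ cz]) (use kk k0 in simp)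
        ultimately show ?thesis by linarith
      qed
      have "H1_norm (\<lambda>t. \<rho> \<kappa> t - 1) \<le> ennreal (4 * (2 * exp (2 * B) * (1 + B) * pnorm (\<lambda>j. a j - (\<lambda>_. 0) j)))"
      proof (rule H1_gibbs_diff[OF a aB adm_0])
        show "pnorm (\<lambda>_. 0) \<le> B" using B0 by simp
        show "(\<lambda>t. \<rho> \<kappa> t - 1) \<in> borel_measurable cm" using pos_densities_cm[OF r] by simp
        show "AE t in cm. \<rho> \<kappa> t - 1 = gibbs a t - gibbs (\<lambda>_. 0) t"
          using minimizer_selfconsistent[OF b(1) _ mk] kk k0 by (auto simp: a_def z_def)
      qed
      also have "\<dots> \<le> ennreal (4 * (2 * exp (2 * B) * (1 + B) * N \<kappa>))"
        using aN B0 by (intro ennreal_leI mult_left_mono) auto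
      finally show ?thesis .
    qed
    have "((\<lambda>\<kappa>. ennreal (4 * (2 * exp (2 * B) * (1 + B) * N \<kappa>))) \<longlongrightarrow> ennreal (4 * (2 * exp (2 * B) * (1 + B) * N k))) (at_right k)"
      unfolding N_def using k0 by (intro tendsto_ennrealI tendsto_intros) auto
    then have lim: "((\<lambda>\<kappa>. ennreal (4 * (2 * exp (2 * B) * (1 + B) * N \<kappa>))) \<longlongrightarrow> 0) (at_right k)" by (simp add: N_def)
    show "((\<lambda>\<kappa>. H1_norm (\<lambda>t. \<rho> \<kappa> t - 1)) \<longlongrightarrow> 0) (at_right k)"
    proof (rule tendsto_sandwich[OF _ _ tendsto_const lim])
      show "\<forall>\<^sub>F \<kappa> in at_right k. H1_norm (\<lambda>t. \<rho> \<kappa> t - 1) \<le> ennreal (4 * (2 * exp (2 * B) * (1 + B) * N \<kappa>))"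
      proof (rule eventually_mono)
        show "\<forall>\<^sub>F \<kappa> in at_right k. \<kappa> \<in> {k<..<k + 1}" by (rule eventually_at_right_real) simp
        show "H1_norm (\<lambda>t. \<rho> \<kappa> t - 1) \<le> ennreal (4 * (2 * exp (2 * B) * (1 + B) * N \<kappa>))" if "\<kappa> \<in> {k<..<k + 1}" for \<kappa>
          using that by (intro bound) auto
      qed
    qed simp
  qed
  show ?thesis using tp uu mc by (simp add: continuous_transition_point_def k_def)
qed

section \<open>Holomorphic fixed points\<close>

lemma holomorphic_uniform_series:
  fixes f :: "nat \<Rightarrow> complex \<Rightarrow> complex"
  assumes S: "open S" and f: "\<And>n. f n holomorphic_on S"
    and M: "\<And>n s. s \<in> S \<Longrightarrow> norm (f n s) \<le> M n" "summable M"
  shows "(\<lambda>s. \<Sum>n. f n s) holomorphic_on S"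
proof (rule holomorphic_uniform_sequence[OF S])
  show "(\<lambda>s. \<Sum>i<n. f i s) holomorphic_on S" for n by (intro holomorphic_intros f)
  fix x assume "x \<in> S"
  then obtain d where d: "0 < d" "cball x d \<subseteq> S" using S open_contains_cball by blast
  have "uniform_limit (cball x d) (\<lambda>n s. \<Sum>i<n. f i s) (\<lambda>s. \<Sum>n. f n s) sequentially"
    by (rule Weierstrass_m_test[of _ _ M]) (use M d in auto)
  then show "\<exists>d. 0 < d \<and> cball x d \<subseteq> S \<and> uniform_limit (cball x d) (\<lambda>n s. \<Sum>i<n. f i s) (\<lambda>s. \<Sum>n. f n s) sequentially"
    using d by blast
qed

text \<open>
  Cauchy's inequality bounds the derivatives uniformly in the parameter, so the difference
  quotients converge dominatedly.
\<close>

lemma holomorphic_avg: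
  fixes f :: "complex \<Rightarrow> real \<Rightarrow> complex"
  assumes S: "open S" and h: "\<And>t. (\<lambda>s. f s t) holomorphic_on S"
    and b: "\<And>s t. s \<in> S \<Longrightarrow> norm (f s t) \<le> B"
    and m: "\<And>s. s \<in> S \<Longrightarrow> f s \<in> borel_measurable cm"
  shows "(\<lambda>s. avg (f s)) holomorphic_on S"
  unfolding holomorphic_on_open[OF S]
proof
  fix s assume s: "s \<in> S"
  obtain d where d: "d > 0" "ball s d \<subseteq> S" using S s open_contains_ball by blast
  define r where "r = d / 3"
  have r: "r > 0" using d by (simp add: r_def)
  have in_S: "w \<in> S" if "dist s w < 2 * r + r" for w using that d by (auto simp: r_def)
  define f' where "f' t = deriv (\<lambda>s. f s t) s" for t
  have D: "((\<lambda>s. f s t) has_field_derivative deriv (\<lambda>s. f s t) w) (at w)" if "w \<in> S" for w t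
    by (rule holomorphic_derivI[OF h S that])
  have B0: "0 \<le> B" using order_trans[OF norm_ge_zero b[OF s]] .
  have Db: "norm (deriv (\<lambda>s. f s t) w) \<le> B / r" if "w \<in> ball s r" for w t
  proof -
    have sub: "cball w r \<subseteq> S"
    proof
      fix v assume "v \<in> cball w r"
      then have "dist s v < 2 * r" using that dist_triangle[of s v w] by simp
      then show "v \<in> S" using in_S r by simp
    qed
    have "norm ((deriv ^^ 1) (\<lambda>s. f s t) w) \<le> fact 1 * B / r ^ 1"
    proof (rule Cauchy_inequality)
      show "(\<lambda>s. f s t) holomorphic_on ball w r" using h sub ball_subset_cball by (meson holomorphic_on_subset subset_trans)
      show "continuous_on (cball w r) (\<lambda>s. f s t)" using holomorphic_on_imp_continuous_on[OF h] sub continuous_on_subset by blast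
      show "norm (f x t) \<le> B" if "norm (w - x) = r" for x
        by (rule b) (use that sub in \<open>auto simp: dist_norm\<close>)
    qed (rule r)
    then show ?thesis by simp
  qed
  have "((\<lambda>h. (avg (f (s + h)) - avg (f s)) / h) \<longlongrightarrow> avg f') (at 0)"
    unfolding tendsto_at_iff_sequentially
  proof (intro allI impI)
    fix X :: "nat \<Rightarrow> complex" assume X: "\<forall>i. X i \<in> UNIV - {0}" "X \<longlonglongrightarrow> 0"
    obtain N where N: "\<And>n. n \<ge> N \<Longrightarrow> norm (X n) < r"
      using LIMSEQ_D[OF X(2) r] by auto
    define Y where "Y n = X (n + N)" for n
    have Y0: "Y n \<noteq> 0" "norm (Y n) < r" for n using X(1) N[of "n + N"] by (auto simp: Y_def)
    have Yl: "Y \<longlonglongrightarrow> 0" unfolding Y_def using LIMSEQ_ignore_initial_segment[OF X(2)] .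
    have YS: "s + Y n \<in> S" for n by (rule in_S) (use Y0(2)[of n] r in \<open>simp add: dist_norm\<close>)
    have q: "(\<lambda>n. (f (s + Y n) t - f s t) / Y n) \<longlonglongrightarrow> f' t" for t
    proof -
      have "((\<lambda>h. (f (s + h) t - f s t) / h) \<longlongrightarrow> f' t) (at 0)"
        using D[OF s, of t] by (simp add: DERIV_def f'_def)
      then show ?thesis unfolding tendsto_at_iff_sequentially using Y0(1) Yl by (auto simp: o_def)
    qed
    have qm: "(\<lambda>t. (f (s + Y n) t - f s t) / Y n) \<in> borel_measurable cm" for n
      using m[OF YS] m[OF s] by (intro borel_measurable_divide borel_measurable_diff) auto
    have qb: "norm ((f (s + Y n) t - f s t) / Y n) \<le> B / r" for n t
    proof -
      define g where "g w = f w t" for w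
      have g: "(g has_field_derivative deriv g z) (at z within ball s r)" if "z \<in> ball s r" for z
        unfolding g_def by (rule has_field_derivative_at_within[OF D[OF in_S]]) (use that r in auto)
      have gb: "norm (deriv g z) \<le> B / r" if "z \<in> ball s r" for z unfolding g_def by (rule Db[OF that])
      have in_b: "s + Y n \<in> ball s r" "s \<in> ball s r" using Y0(2)[of n] r by (simp_all add: dist_norm)
      have "norm (g (s + Y n) - g s) \<le> (B / r) * norm ((s + Y n) - s)"
        by (rule field_differentiable_bound[OF convex_ball g gb in_b])
      then have "norm (f (s + Y n) t - f s t) \<le> (B / r) * norm (Y n)" by (simp add: g_def)
      then show ?thesis using Y0(1)[of n] by (simp add: norm_divide pos_divide_le_eq)
    qed
    have "(\<lambda>n. avg (\<lambda>t. (f (s + Y n) t - f s t) / Y n)) \<longlonglongrightarrow> avg f'"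
    proof (rule integral_dominated_convergence[where w="\<lambda>_. B / r"])
      show "f' \<in> borel_measurable cm"
        by (rule borel_measurable_LIMSEQ_metric[OF qm q])
    qed (use qm q qb in auto)
    moreover have eq: "avg (\<lambda>t. (f (s + Y n) t - f s t) / Y n) = (avg (f (s + Y n)) - avg (f s)) / Y n" for n
    proof -
      have "integrable cm (f w)" if "w \<in> S" for w
        by (rule cm.integrable_const_bound[where B=B]) (use b[OF that] m[OF that] in auto)
      from this[OF YS[of n]] this[OF s] show ?thesis by simp
    qed
    ultimately have "(\<lambda>n. (avg (f (s + Y n)) - avg (f s)) / Y n) \<longlonglongrightarrow> avg f'" unfolding eq by blast
    then show "((\<lambda>h. (avg (f (s + h)) - avg (f s)) / h) \<circ> X) \<longlonglongrightarrow> avg f'"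
      unfolding Y_def o_def by (rule LIMSEQ_offset)
  qed
  then show "\<exists>f'. ((\<lambda>s. avg (f s)) has_field_derivative f') (at s)" by (auto simp: DERIV_def)
qed

text \<open>
  The iterates of a uniform contraction are holomorphic and converge uniformly on the disc in
  each coordinate; the limit is holomorphic. All bounds are coordinatewise and uniform in the
  coordinate.
\<close>

lemma holomorphic_fixed_point:
  fixes T :: "complex \<Rightarrow> (nat \<Rightarrow> complex) \<Rightarrow> nat \<Rightarrow> complex" and e :: "nat \<Rightarrow> complex"
  assumes c: "0 \<le> c" "c < 1" and eta: "\<eta> > 0" and del: "\<delta> > 0" and L: "L \<ge> 0" "L * \<delta> \<le> (1 - c) * \<eta>"
    and base: "\<And>n. T 0 e n = e n"
    and lip: "\<And>s s' q q' d n. norm s < \<delta> \<Longrightarrow> norm s' < \<delta> \<Longrightarrow> (\<And>n. norm (q n - e n) \<le> \<eta>) \<Longrightarrow> (\<And>n. norm (q' n - e n) \<le> \<eta>) \<Longrightarrow>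
        (\<And>n. norm (q n - q' n) \<le> d) \<Longrightarrow> norm (T s q n - T s' q' n) \<le> L * norm (s - s') + c * d"
    and hol: "\<And>Q n. (\<And>n. (\<lambda>s. Q s n) holomorphic_on ball 0 \<delta>) \<Longrightarrow> (\<And>s n. norm s < \<delta> \<Longrightarrow> norm (Q s n - e n) \<le> \<eta>) \<Longrightarrow>
        (\<lambda>s. T s (Q s) n) holomorphic_on ball 0 \<delta>"
  obtains q where "\<And>s n. norm s < \<delta> \<Longrightarrow> norm (q s n - e n) \<le> \<eta>"
    "\<And>s n. norm s < \<delta> \<Longrightarrow> T s (q s) n = q s n"
    "\<And>n. (\<lambda>s. q s n) holomorphic_on ball 0 \<delta>" "\<And>n. q 0 n = e n"
    "\<And>s s' n. norm s < \<delta> \<Longrightarrow> norm s' < \<delta> \<Longrightarrow> norm (q s n - q s' n) \<le> L / (1 - c) * norm (s - s')"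
    "\<And>s p n. norm s < \<delta> \<Longrightarrow> (\<And>n. norm (p n - e n) \<le> \<eta>) \<Longrightarrow> (\<And>n. T s p n = p n) \<Longrightarrow> p n = q s n"
proof -
  define Q where "Q k = ((\<lambda>q s. T s (q s)) ^^ k) (\<lambda>_. e)" for k
  have Q0: "Q 0 = (\<lambda>_. e)" and QS: "Q (Suc k) s = T s (Q k s)" for k s by (simp_all add: Q_def)
  have Qb: "norm (Q k s n - e n) \<le> \<eta>" if "norm s < \<delta>" for k s n
  proof (induction k arbitrary: n)
    case (Suc k)
    have "norm (T s (Q k s) n - T 0 e n) \<le> L * norm (s - 0) + c * \<eta>"
      by (rule lip) (use that del eta Suc in auto)
    also have "L * norm (s - 0) \<le> L * \<delta>" using that L by (intro mult_left_mono) auto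
    finally show ?case using L by (simp add: QS base algebra_simps)
  qed (use eta in \<open>simp add: Q0\<close>)
  have Qh: "(\<lambda>s. Q k s n) holomorphic_on ball 0 \<delta>" for k n
  proof (induction k arbitrary: n)
    case (Suc k)
    show ?case unfolding QS by (rule hol) (use Suc Qb in auto)
  qed (simp add: Q0)
  have Qd: "norm (Q (Suc k) s n - Q k s n) \<le> \<eta> * c ^ k" if "norm s < \<delta>" for k s n
  proof (induction k arbitrary: n)
    case 0
    then show ?case using Qb[OF that, of 1 n] by (simp add: Q0)
  next
    case (Suc k)
    have "norm (T s (Q (Suc k) s) n - T s (Q k s) n) \<le> L * norm (s - s) + c * (\<eta> * c ^ k)"
      by (rule lip) (use that Qb Suc in auto)
    then show ?case by (simp add: QS mult_ac)
  qed
  have sm: "summable (\<lambda>k. \<eta> * c ^ k)" using c by (intro summable_mult summable_geometric) auto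
  define q where "q s n = e n + (\<Sum>k. Q (Suc k) s n - Q k s n)" for s n
  have qh: "(\<lambda>s. q s n) holomorphic_on ball 0 \<delta>" for n
    unfolding q_def
    by (intro holomorphic_intros holomorphic_uniform_series[where M="\<lambda>k. \<eta> * c ^ k"] Qh sm) (use Qd in auto)
  have ql: "(\<lambda>k. Q k s n) \<longlonglongrightarrow> q s n" if "norm s < \<delta>" for s n
  proof -
    have "summable (\<lambda>k. Q (Suc k) s n - Q k s n)"
      by (rule summable_comparison_test'[OF sm, of 0]) (use Qd[OF that] in auto)
    then have "(\<lambda>K. \<Sum>k<K. Q (Suc k) s n - Q k s n) \<longlonglongrightarrow> (\<Sum>k. Q (Suc k) s n - Q k s n)" by (rule summable_LIMSEQ)
    then have "(\<lambda>K. e n + (\<Sum>k<K. Q (Suc k) s n - Q k s n)) \<longlonglongrightarrow> q s n" unfolding q_def by (intro tendsto_intros)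
    moreover have "e n + (\<Sum>k<K. Q (Suc k) s n - Q k s n) = Q K s n" for K
      by (simp add: sum_lessThan_telescope[of "\<lambda>k. Q k s n"] Q0)
    ultimately show ?thesis by simp
  qed
  have qb: "norm (q s n - e n) \<le> \<eta>" if "norm s < \<delta>" for s n
    by (rule LIMSEQ_le_const2[OF tendsto_norm[OF tendsto_diff[OF ql[OF that] tendsto_const]]]) (use Qb[OF that] in auto)
  have rate: "norm (Q k s n - q s n) \<le> \<eta> * c ^ k / (1 - c)" if "norm s < \<delta>" for k s n
  proof -
    have "norm (Q (k + j) s n - Q k s n) \<le> \<eta> * c ^ k / (1 - c)" for j
    proof -
      have "Q (k + j) s n - Q k s n = (\<Sum>i<j. Q (Suc (k + i)) s n - Q (k + i) s n)"
        using sum_lessThan_telescope[of "\<lambda>i. Q (k + i) s n" j] by simp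
      also have "norm \<dots> \<le> (\<Sum>i<j. \<eta> * c ^ (k + i))"
        by (rule order_trans[OF norm_sum sum_mono]) (rule Qd[OF that])
      also have "\<dots> = (\<eta> * c ^ k) * (\<Sum>i<j. c ^ i)" by (simp add: sum_distrib_left power_add mult_ac)
      also have "(\<Sum>i<j. c ^ i) \<le> (\<Sum>i. c ^ i)" by (rule sum_le_suminf) (use c in \<open>auto intro: summable_geometric\<close>)
      also have "(\<Sum>i. c ^ i) = 1 / (1 - c)" using c by (intro suminf_geometric) auto
      finally show ?thesis using eta c by (simp add: mult_left_mono)
    qed
    moreover have "(\<lambda>j. norm (Q (k + j) s n - Q k s n)) \<longlonglongrightarrow> norm (q s n - Q k s n)"
      using LIMSEQ_ignore_initial_segment[OF ql[OF that, of n], of k] by (intro tendsto_intros) (simp add: add.commute)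
    ultimately have "norm (q s n - Q k s n) \<le> \<eta> * c ^ k / (1 - c)" by (intro LIMSEQ_le_const2) auto
    then show ?thesis by (simp add: norm_minus_commute)
  qed
  have qf: "T s (q s) n = q s n" if "norm s < \<delta>" for s n
  proof -
    have "norm (T s (q s) n - q s n) \<le> 2 * (\<eta> * c ^ k / (1 - c))" for k
    proof -
      have "norm (T s (Q k s) n - T s (q s) n) \<le> L * norm (s - s) + c * (\<eta> * c ^ k / (1 - c))"
        by (rule lip) (use that Qb qb rate in auto)
      also have "\<dots> = \<eta> * c ^ Suc k / (1 - c)" by simp
      also have "\<dots> \<le> \<eta> * c ^ k / (1 - c)" using c eta by (intro divide_right_mono mult_left_mono) (auto simp: mult_left_le_one_le)
      finally have 1: "norm (T s (Q k s) n - T s (q s) n) \<le> \<eta> * c ^ k / (1 - c)" .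
      have "norm (Q (Suc k) s n - q s n) \<le> \<eta> * c ^ Suc k / (1 - c)" by (rule rate[OF that])
      also have "\<dots> \<le> \<eta> * c ^ k / (1 - c)" using c eta by (intro divide_right_mono mult_left_mono) (auto simp: mult_left_le_one_le)
      finally have 2: "norm (T s (Q k s) n - q s n) \<le> \<eta> * c ^ k / (1 - c)" by (simp add: QS)
      have "norm (T s (q s) n - q s n) = norm ((T s (Q k s) n - q s n) - (T s (Q k s) n - T s (q s) n))" by simp
      also have "\<dots> \<le> norm (T s (Q k s) n - q s n) + norm (T s (Q k s) n - T s (q s) n)" by (rule norm_triangle_ineq4)
      finally show ?thesis using 1 2 by simp
    qed
    moreover have "(\<lambda>k. 2 * (\<eta> * c ^ k / (1 - c))) \<longlonglongrightarrow> 2 * (\<eta> * 0 / (1 - c))"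
      using c by (intro tendsto_intros LIMSEQ_realpow_zero) auto
    ultimately have "norm (T s (q s) n - q s n) \<le> 2 * (\<eta> * 0 / (1 - c))" by (intro LIMSEQ_le_const) auto
    then show ?thesis by simp
  qed
  have ab: "norm (p n - p' n) \<le> L / (1 - c) * norm (s - s')"
    if s: "norm s < \<delta>" "norm s' < \<delta>" and p: "\<And>n. norm (p n - e n) \<le> \<eta>" "\<And>n. T s p n = p n"
      and p': "\<And>n. norm (p' n - e n) \<le> \<eta>" "\<And>n. T s' p' n = p' n" for s s' p p' n
  proof -
    define m where "m = (SUP n. norm (p n - p' n))"
    have bd: "norm (p n - p' n) \<le> 2 * \<eta>" for n
    proof -
      have "norm (p n - p' n) = norm ((p n - e n) - (p' n - e n))" by simp
      also have "\<dots> \<le> norm (p n - e n) + norm (p' n - e n)" by (rule norm_triangle_ineq4)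
      finally show ?thesis using p(1)[of n] p'(1)[of n] by simp
    qed
    then have bdd: "bdd_above (range (\<lambda>n. norm (p n - p' n)))" by (auto intro!: bdd_aboveI)
    have pm: "norm (p n - p' n) \<le> m" for n unfolding m_def by (rule cSUP_upper[OF _ bdd]) simp
    have "norm (p n - p' n) \<le> L * norm (s - s') + c * m" for n
      using lip[OF s p(1) p'(1) pm, of n] p(2)[of n] p'(2)[of n] by simp
    then have "m \<le> L * norm (s - s') + c * m" unfolding m_def[symmetric] by (subst (1) m_def) (rule cSUP_least, auto)
    then have "(1 - c) * m \<le> L * norm (s - s')" by (simp add: algebra_simps)
    then have "m \<le> L * norm (s - s') / (1 - c)" using c by (simp add: pos_le_divide_eq mult.commute)
    then show ?thesis using pm[of n] by simp
  qed
  have e0: "q 0 n = e n" for n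
  proof -
    have "norm (q 0 n - e n) \<le> L / (1 - c) * norm (0 - (0::complex))"
      by (rule ab) (use del eta base qb qf in auto)
    then show ?thesis by simp
  qed
  show thesis
  proof (rule that[of q])
    show "p n = q s n" if "norm s < \<delta>" "\<And>n. norm (p n - e n) \<le> \<eta>" "\<And>n. T s p n = p n" for s p n
      using ab[OF that(1) that(1) that(2) that(3) qb[OF that(1)] qf[OF that(1)], of n] by simp
  qed (use qb qf qh e0 ab in auto)
qed

section \<open>An entire remainder function\<close>

text \<open>
  The entire function \<open>(exp x - 1 - x) / x\<^sup>2\<close>, which allows division by
  \<open>s\<^sup>2\<close> also at \<open>s = 0\<close>.
\<close>

definition expq :: "complex \<Rightarrow> complex" where "expq x = (\<Sum>n. x ^ n / fact (n + 2))"

lemma expq_summable: "summable (\<lambda>n. (x::complex) ^ n / fact (n + 2))"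
proof (rule summable_comparison_test'[of "\<lambda>n. inverse (fact n) * norm x ^ n" 0])
  show "summable (\<lambda>n. inverse (fact n) * norm x ^ n)" by (rule summable_exp)
  fix n
  have "(fact n :: real) \<le> fact (n + 2)" by (rule fact_mono) simp
  then have "inverse (fact (n + 2)) * norm x ^ n \<le> inverse (fact n :: real) * norm x ^ n"
    by (intro mult_right_mono le_imp_inverse_le) auto
  then show "norm (x ^ n / fact (n + 2)) \<le> inverse (fact n) * norm x ^ n"
    unfolding divide_inverse norm_mult norm_inverse norm_power norm_fact by (simp only: mult.commute)
qed

lemma expq_holomorphic: "expq holomorphic_on S"
proof -
  have "expq holomorphic_on ball 0 r" for r
  proof (rule power_series_holomorphic[where a="\<lambda>n. 1 / fact (n + 2)"])
    show "(\<lambda>n. 1 / fact (n + 2) * (w - 0) ^ n) sums expq w" for w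
      using summable_sums[OF expq_summable[of w]] by (simp add: expq_def)
  qed
  then have "\<exists>f'. (expq has_field_derivative f') (at z)" for z
    using holomorphic_on_open[of "ball 0 (norm z + 1)" expq] by auto
  then have "expq holomorphic_on UNIV" using holomorphic_on_open[of UNIV expq] by auto
  then show ?thesis by (rule holomorphic_on_subset) simp
qed

lemma exp_expq: "exp x = 1 + x + x\<^sup>2 * expq x"
proof -
  have "exp x = 1 + x + (\<Sum>n. inverse (fact (n + 2)) *\<^sub>R x ^ (n + 2))" by (rule exp_first_two_terms)
  also have "(\<Sum>n. inverse (fact (n + 2)) *\<^sub>R x ^ (n + 2)) = (\<Sum>n. x\<^sup>2 * (x ^ n / fact (n + 2)))"
    by (simp add: scaleR_conv_of_real power_add divide_inverse power2_eq_square mult_ac)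
  also have "\<dots> = x\<^sup>2 * expq x" unfolding expq_def by (rule suminf_mult[OF expq_summable])
  finally show ?thesis .
qed

lemma cnj_expq: "cnj (expq x) = expq (cnj x)"
  unfolding expq_def
  using bounded_linear.suminf[OF bounded_linear_cnj expq_summable[of x]] by simp

lemma holomorphic_bounded_lipschitz:
  assumes "f holomorphic_on UNIV"
  obtains K where "K > 0" "\<And>x. norm x \<le> B \<Longrightarrow> norm (f x) \<le> K"
    "\<And>x y. norm x \<le> B \<Longrightarrow> norm y \<le> B \<Longrightarrow> norm (f x - f y) \<le> K * norm (x - y)"
proof -
  have bounded: "\<exists>K. \<forall>x\<in>cball 0 B. norm (g x) \<le> K" if "g holomorphic_on UNIV" for g :: "complex \<Rightarrow> complex"
  proof -
    have "compact (g ` cball 0 B)" using holomorphic_on_imp_continuous_on[OF that] continuous_on_subset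
      by (intro compact_continuous_image) auto
    then show ?thesis using compact_imp_bounded bounded_iff by (metis imageI)
  qed
  obtain K1 where K1: "\<forall>x\<in>cball 0 B. norm (f x) \<le> K1" using bounded[OF assms] by blast
  obtain K2 where K2: "\<forall>x\<in>cball 0 B. norm (deriv f x) \<le> K2" using bounded[OF holomorphic_deriv[OF assms open_UNIV]] by blast
  define K where "K = \<bar>K1\<bar> + \<bar>K2\<bar> + 1"
  have "norm (f x - f y) \<le> K2 * norm (x - y)" if "norm x \<le> B" "norm y \<le> B" for x y
    by (rule field_differentiable_bound[of "cball 0 B" f "deriv f"])
       (use K2 that holomorphic_derivI[OF assms open_UNIV, THEN has_field_derivative_at_within] in auto)
  moreover have "K2 * norm (x - y) \<le> K * norm (x - y)" for x y by (intro mult_right_mono) (auto simp: K_def)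
  ultimately have "norm (f x - f y) \<le> K * norm (x - y)" if "norm x \<le> B" "norm y \<le> B" for x y using that order_trans by blast
  moreover have "norm (f x) \<le> K" if "norm x \<le> B" for x using K1 that by (force simp: K_def)
  moreover have "K > 0" by (simp add: K_def add_nonneg_pos)
  ultimately show thesis using that by blast
qed

section \<open>The bifurcation equation\<close>

text \<open>
  The weights of the cosine modes relative to the first one.
\<close>

definition rr :: "real \<Rightarrow> nat \<Rightarrow> real" where "rr \<beta> n = bessel_I (n + 1) \<beta> / bessel_I 1 \<beta>"

definition qhat :: "(nat \<Rightarrow> complex) \<Rightarrow> nat \<Rightarrow> complex" where "qhat q n = (if n = 0 then 1 else q n)"

text \<open>
  The field of modes \<open>s (1, q\<^sub>1, q\<^sub>2, \<dots>)\<close> at intensity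
  \<open>\<kappa>\<^sup>* q\<^sub>0\<close>, divided by \<open>s\<close>. The parameters are
  complex in order to obtain a holomorphic branch.
\<close>

definition Uf :: "real \<Rightarrow> (nat \<Rightarrow> complex) \<Rightarrow> real \<Rightarrow> complex" where
  "Uf \<beta> q t = 2 * q 0 * (\<Sum>n. of_real (rr \<beta> n) * qhat q n * of_real (cos (real (n + 1) * t)))"

definition Nf :: "real \<Rightarrow> complex \<Rightarrow> (nat \<Rightarrow> complex) \<Rightarrow> real \<Rightarrow> complex" where
  "Nf \<beta> s q t = (Uf \<beta> q t)\<^sup>2 * expq (s * Uf \<beta> q t)"

definition MN :: "real \<Rightarrow> complex \<Rightarrow> (nat \<Rightarrow> complex) \<Rightarrow> nat \<Rightarrow> complex" where
  "MN \<beta> s q n = avg (\<lambda>t. Nf \<beta> s q t * of_real (cos (real n * t)))"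

text \<open>
  The self-consistency equation for the modes reads \<open>q\<^sub>0 r\<^sub>n q\<^sub>n + s
  M\<^sub>n\<^sub>+\<^sub>1 = q\<^sub>n (1 + s\<^sup>2 M\<^sub>0)\<close> with
  \<open>q\<^sub>n\<close> replaced by \<open>1\<close> at \<open>n = 0\<close>; here \<open>1 +
  s\<^sup>2 M\<^sub>0\<close> is the partition function. It is solved for
  \<open>q\<^sub>0\<close> at \<open>n = 0\<close> and for the linear term
  \<open>q\<^sub>n\<close> otherwise.
\<close>

definition TT :: "real \<Rightarrow> complex \<Rightarrow> (nat \<Rightarrow> complex) \<Rightarrow> nat \<Rightarrow> complex" where
  "TT \<beta> s q n = (if n = 0 then 1 + s * (s * MN \<beta> s q 0 - MN \<beta> s q 1)
     else q 0 * of_real (rr \<beta> n) * q n + s * MN \<beta> s q (n + 1) - s * (s * MN \<beta> s q 0) * q n)"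

definition ee :: "nat \<Rightarrow> complex" where "ee n = (if n = 0 then 1 else 0)"

lemma rr_nonneg: "\<beta> > 0 \<Longrightarrow> 0 \<le> rr \<beta> n"
  using bessel_nonneg[of \<beta>] bessel_1_pos[of \<beta>] by (simp add: rr_def)

lemma rr_0: "\<beta> > 0 \<Longrightarrow> rr \<beta> 0 = 1"
  using bessel_1_pos[of \<beta>] by (simp add: rr_def)

lemma rr_1: "rr \<beta> 1 = bessel_R \<beta>" by (simp add: rr_def bessel_R_def numeral_2_eq_2)

lemma rr_le: assumes "\<beta> > 0" "n \<ge> 1" shows "rr \<beta> n \<le> bessel_R \<beta>"
  using bessel_le_2[of \<beta> "n + 1"] bessel_1_pos[of \<beta>] assms by (simp add: rr_def bessel_R_def divide_right_mono)

lemma bessel_R_bounds: assumes "\<beta> > 0" shows "0 \<le> bessel_R \<beta>" "bessel_R \<beta> < 1"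
  using bessel_2_less_1[OF assms] bessel_1_pos[OF assms] bessel_nonneg[of \<beta> 2] assms by (auto simp: bessel_R_def)

lemma wt_rr: "\<beta> > 0 \<Longrightarrow> kappa_star \<beta> * wt \<beta> (2 * n) = rr \<beta> n"
  by (simp add: kappa_star_def wt_def rr_def freq_def)

lemma rr_summable: assumes "\<beta> > 0" shows "summable (rr \<beta>)"
proof -
  have "summable (\<lambda>n. wt \<beta> (2 * n))"
  proof -
    have s: "summable (\<lambda>l. bessel_I l \<beta>)"
    proof (rule summable_comparison_test)
      show "\<exists>N. \<forall>n\<ge>N. norm (bessel_I n \<beta>) \<le> (real n)\<^sup>2 * bessel_I n \<beta>"
      proof (intro exI allI impI)
        fix n :: nat assume "n \<ge> 1"
        then have "1 * bessel_I n \<beta> \<le> (real n)\<^sup>2 * bessel_I n \<beta>"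
          using bessel_nonneg[of \<beta> n] assms by (intro mult_right_mono) (auto intro: one_le_power)
        then show "norm (bessel_I n \<beta>) \<le> (real n)\<^sup>2 * bessel_I n \<beta>" using bessel_nonneg[of \<beta> n] assms by simp
      qed
      show "summable (\<lambda>l. (real l)\<^sup>2 * bessel_I l \<beta>)" by (rule bessel_summable) (use assms in simp)
    qed
    then have "summable (\<lambda>n. bessel_I (n + 1) \<beta>)" by (subst summable_iff_shift)
    then show ?thesis using summable_divide[of "\<lambda>n. bessel_I (n + 1) \<beta>" \<beta>] by (simp add: wt_def freq_def)
  qed
  from summable_mult[OF this, of "kappa_star \<beta>"] show ?thesis by (simp add: wt_rr[OF assms])
qed

definition Rs :: "real \<Rightarrow> real" where "Rs \<beta> = (\<Sum>n. rr \<beta> n)"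

lemma Rs_nonneg: "\<beta> > 0 \<Longrightarrow> 0 \<le> Rs \<beta>"
  unfolding Rs_def by (intro suminf_nonneg rr_summable rr_nonneg)

definition near :: "real \<Rightarrow> (nat \<Rightarrow> complex) \<Rightarrow> bool" where
  "near \<eta> q \<longleftrightarrow> (\<forall>n. norm (q n - ee n) \<le> \<eta>)"

lemma near_bounds:
  assumes "near \<eta> q" "\<eta> \<le> 1"
  shows "norm (q 0) \<le> 1 + \<eta>" "norm (qhat q n) \<le> 1" "n \<ge> 1 \<Longrightarrow> norm (q n) \<le> \<eta>"
proof -
  have "norm (q 0 - 1) \<le> \<eta>" using assms(1) by (metis near_def ee_def)
  then show "norm (q 0) \<le> 1 + \<eta>" using norm_triangle_ineq[of "q 0 - 1" 1] by simp
  have n: "norm (q n) \<le> \<eta>" if "n \<ge> 1" for n using assms(1) that by (metis near_def ee_def diff_zero not_one_le_zero)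
  then show "n \<ge> 1 \<Longrightarrow> norm (q n) \<le> \<eta>" .
  show "norm (qhat q n) \<le> 1" using n[of n] assms(2) by (cases "n = 0") (auto simp: qhat_def)
qed

lemma U_term:
  fixes a :: complex
  assumes "\<beta> > 0" "norm a \<le> m"
  shows "norm (of_real (rr \<beta> n) * a * of_real (cos x)) \<le> m * rr \<beta> n"
proof -
  have "norm (of_real (rr \<beta> n) * a * (of_real (cos x) :: complex)) = rr \<beta> n * (norm a * \<bar>cos x\<bar>)"
    using rr_nonneg[OF assms(1), of n] by (simp add: norm_mult)
  also have "\<dots> \<le> rr \<beta> n * (m * 1)"
    using assms order_trans[OF norm_ge_zero assms(2)] by (intro mult_left_mono mult_mono rr_nonneg) auto
  finally show ?thesis by (simp add: mult.commute)
qed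

lemma U_bound:
  assumes b: "\<beta> > 0" and q: "near \<eta> q" "\<eta> \<le> 1"
  shows "norm (\<Sum>n. of_real (rr \<beta> n) * qhat q n * of_real (cos (real (n + 1) * x))) \<le> Rs \<beta>"
    "summable (\<lambda>n. of_real (rr \<beta> n) * qhat q n * of_real (cos (real (n + 1) * x)))"
    "norm (Uf \<beta> q x) \<le> 4 * Rs \<beta>"
proof -
  have t: "norm (of_real (rr \<beta> n) * qhat q n * of_real (cos (real (n + 1) * x))) \<le> rr \<beta> n" for n
    using U_term[OF b near_bounds(2)[OF q], of n n "real (n + 1) * x"] by simp
  show 1: "norm (\<Sum>n. of_real (rr \<beta> n) * qhat q n * of_real (cos (real (n + 1) * x))) \<le> Rs \<beta>"
    unfolding Rs_def by (rule suminf_norm_le[OF t rr_summable[OF b]])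
  show "summable (\<lambda>n. of_real (rr \<beta> n) * qhat q n * of_real (cos (real (n + 1) * x)))"
    by (rule summable_comparison_test'[OF rr_summable[OF b], of 0]) (rule t)
  have "norm (2 * q 0) \<le> 4" using near_bounds(1)[OF q] q(2) by (simp add: norm_mult)
  then show "norm (Uf \<beta> q x) \<le> 4 * Rs \<beta>" unfolding Uf_def norm_mult[of "2 * q 0"]
    by (intro mult_mono 1) auto
qed

lemma U_diff:
  assumes b: "\<beta> > 0" and q: "near \<eta> q" "near \<eta> q'" "\<eta> \<le> 1" and d: "\<And>n. norm (q n - q' n) \<le> d"
  shows "norm (Uf \<beta> q t - Uf \<beta> q' t) \<le> 6 * Rs \<beta> * d"
proof -
  define S where "S q = (\<Sum>n. of_real (rr \<beta> n) * qhat q n * of_real (cos (real (n + 1) * t)))" for q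
  have d0: "0 \<le> d" using d[of 0] norm_ge_zero order_trans by blast
  have "S q - S q' = (\<Sum>n. of_real (rr \<beta> n) * (qhat q n - qhat q' n) * of_real (cos (real (n + 1) * t)))"
    unfolding S_def using suminf_diff[OF U_bound(2)[OF b q(1,3), of t] U_bound(2)[OF b q(2,3), of t]]
    by (simp add: algebra_simps)
  also have "norm \<dots> \<le> (\<Sum>n. d * rr \<beta> n)"
  proof (rule suminf_norm_le[OF U_term[OF b] summable_mult[OF rr_summable[OF b]]])
    show "norm (qhat q n - qhat q' n) \<le> d" for n using d[of n] d0 by (simp add: qhat_def)
  qed
  also have "\<dots> = d * Rs \<beta>" unfolding Rs_def by (rule suminf_mult[OF rr_summable[OF b]])
  finally have 1: "norm (S q - S q') \<le> d * Rs \<beta>" .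
  have "Uf \<beta> q t - Uf \<beta> q' t = 2 * (q 0 - q' 0) * S q + 2 * q' 0 * (S q - S q')"
    unfolding Uf_def S_def[symmetric] by (simp add: algebra_simps)
  also have "norm \<dots> \<le> norm (2 * (q 0 - q' 0)) * norm (S q) + norm (2 * q' 0) * norm (S q - S q')"
    unfolding norm_mult[symmetric] by (rule norm_triangle_ineq)
  also have "\<dots> \<le> (2 * d) * Rs \<beta> + 4 * (d * Rs \<beta>)"
  proof (intro add_mono mult_mono)
    show "norm (2 * (q 0 - q' 0)) \<le> 2 * d" unfolding norm_mult using d[of 0] by simp
    show "norm (S q) \<le> Rs \<beta>" unfolding S_def by (rule U_bound(1)[OF b q(1,3)])
    show "norm (2 * q' 0) \<le> 4" using near_bounds(1)[OF q(2,3)] q(3) by (simp add: norm_mult)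
  qed (use d0 1 Rs_nonneg[OF b] in auto)
  finally show ?thesis by (simp add: algebra_simps)
qed

lemma U_continuous:
  assumes b: "\<beta> > 0" and q: "near \<eta> q" "\<eta> \<le> 1"
  shows "continuous_on A (Uf \<beta> q)"
proof -
  have t: "norm (of_real (rr \<beta> n) * qhat q n * of_real (cos (real (n + 1) * x))) \<le> rr \<beta> n" for n x
    using U_term[OF b near_bounds(2)[OF q], of n n "real (n + 1) * x"] by simp
  have "uniform_limit UNIV (\<lambda>N x. \<Sum>n<N. of_real (rr \<beta> n) * qhat q n * of_real (cos (real (n + 1) * x)))
     (\<lambda>x. \<Sum>n. of_real (rr \<beta> n) * qhat q n * of_real (cos (real (n + 1) * x))) sequentially"
    by (rule Weierstrass_m_test[OF t rr_summable[OF b]])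
  then have "continuous_on UNIV (\<lambda>x. \<Sum>n. of_real (rr \<beta> n) * qhat q n * of_real (cos (real (n + 1) * x)))"
    by (rule uniform_limit_theorem[rotated]) (auto intro!: always_eventually continuous_intros)
  then have "continuous_on UNIV (Uf \<beta> q)" unfolding Uf_def[abs_def] by (intro continuous_intros)
  then show ?thesis using continuous_on_subset by blast
qed

lemma N_continuous:
  assumes b: "\<beta> > 0" and q: "near \<eta> q" "\<eta> \<le> 1"
  shows "continuous_on A (Nf \<beta> s q)"
  unfolding Nf_def[abs_def]
  by (intro continuous_intros U_continuous[OF assms] continuous_on_compose2[OF holomorphic_on_imp_continuous_on[OF expq_holomorphic[of UNIV]]]) auto

lemma N_estimates:
  assumes b: "\<beta> > 0"
  obtains P where "P > 0"
    "\<And>s q t. norm s \<le> 1 \<Longrightarrow> near 1 q \<Longrightarrow> norm (Nf \<beta> s q t) \<le> P"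
    "\<And>s s' q q' d t. norm s \<le> 1 \<Longrightarrow> norm s' \<le> 1 \<Longrightarrow> near 1 q \<Longrightarrow> near 1 q' \<Longrightarrow> (\<And>n. norm (q n - q' n) \<le> d) \<Longrightarrow>
       norm (Nf \<beta> s q t - Nf \<beta> s' q' t) \<le> P * (norm (s - s') + d)"
proof -
  define B where "B = 4 * Rs \<beta> + 1"
  have B: "B \<ge> 1" using Rs_nonneg[OF b] by (simp add: B_def)
  obtain K where K: "K > 0" "\<And>x. norm x \<le> B \<Longrightarrow> norm (expq x) \<le> K"
    "\<And>x y. norm x \<le> B \<Longrightarrow> norm y \<le> B \<Longrightarrow> norm (expq x - expq y) \<le> K * norm (x - y)"
    using holomorphic_bounded_lipschitz[OF expq_holomorphic, of B] by blast
  have Ub: "norm (Uf \<beta> q t) \<le> B" if "near 1 q" for q t using U_bound(3)[OF b that, of t] by (simp add: B_def)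
  have sU: "norm (s * Uf \<beta> q t) \<le> B" if "norm s \<le> 1" "near 1 q" for s q t
  proof -
    have "norm s * norm (Uf \<beta> q t) \<le> 1 * B" using that Ub by (intro mult_mono) auto
    then show ?thesis by (simp add: norm_mult)
  qed
  define P where "P = 20 * B ^ 4 * K"
  have B4: "B ^ m \<le> B ^ 4" if "m \<le> 4" for m using B that by (rule power_increasing[rotated])
  show thesis
  proof (rule that[of P])
    show "P > 0" using B K by (simp add: P_def)
    show "norm (Nf \<beta> s q t) \<le> P" if "norm s \<le> 1" "near 1 q" for s q t
    proof -
      have "norm (Nf \<beta> s q t) \<le> B\<^sup>2 * K" unfolding Nf_def norm_mult norm_power
        using Ub[OF that(2)] sU[OF that] K by (intro mult_mono power_mono) auto
      also have "\<dots> \<le> B ^ 4 * K" using B4[of 2] K by (intro mult_right_mono) auto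
      also have "\<dots> \<le> P" using B K by (simp add: P_def)
      finally show ?thesis .
    qed
    fix s s' :: complex and q q' :: "nat \<Rightarrow> complex" and d t
    assume s: "norm s \<le> 1" "norm s' \<le> 1" and q: "near 1 q" "near 1 q'" and d: "\<And>n. norm (q n - q' n) \<le> d"
    have d0: "0 \<le> d" using d[of 0] norm_ge_zero order_trans by blast
    define u where "u = Uf \<beta> q t"
    define u' where "u' = Uf \<beta> q' t"
    have u: "norm u \<le> B" "norm u' \<le> B" using Ub q by (auto simp: u_def u'_def)
    have su: "norm (s * u) \<le> B" "norm (s' * u') \<le> B" using sU s q by (auto simp: u_def u'_def)
    have ud: "norm (u - u') \<le> 2 * B * d"
    proof -
      have "norm (u - u') \<le> 6 * Rs \<beta> * d" unfolding u_def u'_def by (rule U_diff[OF b q _ d]) simp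
      also have "\<dots> \<le> 2 * B * d" using d0 Rs_nonneg[OF b] by (intro mult_right_mono) (auto simp: B_def)
      finally show ?thesis .
    qed
    define \<sigma> where "\<sigma> = norm (s - s')"
    have 1: "norm (u\<^sup>2 - u'\<^sup>2) \<le> (2 * B) * (2 * B * d)"
    proof -
      have "norm (u\<^sup>2 - u'\<^sup>2) = norm (u + u') * norm (u - u')"
        unfolding norm_mult[symmetric] by (simp add: power2_eq_square algebra_simps)
      also have "\<dots> \<le> (2 * B) * (2 * B * d)"
        using ud u norm_triangle_ineq[of u u'] d0 B by (intro mult_mono) auto
      finally show ?thesis .
    qed
    have 2: "norm (s * u - s' * u') \<le> \<sigma> * B + 2 * B * d"
    proof -
      have "s * u - s' * u' = (s - s') * u + s' * (u - u')" by (simp add: algebra_simps)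
      also have "norm \<dots> \<le> norm (s - s') * norm u + norm s' * norm (u - u')"
        unfolding norm_mult[symmetric] by (rule norm_triangle_ineq)
      also have "\<dots> \<le> \<sigma> * B + 1 * (2 * B * d)" using u s ud by (intro add_mono mult_mono) (auto simp: \<sigma>_def)
      finally show ?thesis by simp
    qed
    have "Nf \<beta> s q t - Nf \<beta> s' q' t = (u\<^sup>2 - u'\<^sup>2) * expq (s * u) + u'\<^sup>2 * (expq (s * u) - expq (s' * u'))"
      by (simp add: Nf_def u_def u'_def algebra_simps)
    also have "norm \<dots> \<le> norm (u\<^sup>2 - u'\<^sup>2) * norm (expq (s * u)) + norm (u'\<^sup>2) * norm (expq (s * u) - expq (s' * u'))"
      unfolding norm_mult[symmetric] by (rule norm_triangle_ineq)
    also have "\<dots> \<le> ((2 * B) * (2 * B * d)) * K + B\<^sup>2 * (K * (\<sigma> * B + 2 * B * d))"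
    proof (intro add_mono mult_mono 1 K(2) su(1))
      show "norm (u'\<^sup>2) \<le> B\<^sup>2" unfolding norm_power using u by (intro power_mono) auto
      have "norm (expq (s * u) - expq (s' * u')) \<le> K * norm (s * u - s' * u')" by (rule K(3)[OF su])
      also have "\<dots> \<le> K * (\<sigma> * B + 2 * B * d)" using K 2 by (intro mult_left_mono) auto
      finally show "norm (expq (s * u) - expq (s' * u')) \<le> K * (\<sigma> * B + 2 * B * d)" .
    qed (use B d0 in auto)
    also have "\<dots> = 4 * (B\<^sup>2 * (K * d)) + B ^ 3 * (K * \<sigma>) + 2 * (B ^ 3 * (K * d))"
      by (simp add: power2_eq_square power3_eq_cube algebra_simps)
    also have "\<dots> \<le> 4 * (B ^ 4 * (K * d)) + B ^ 4 * (K * \<sigma>) + 2 * (B ^ 4 * (K * d))"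
      using B4[of 2] B4[of 3] K d0 by (intro add_mono mult_left_mono mult_right_mono) (auto simp: \<sigma>_def)
    also have "\<dots> \<le> P * (\<sigma> + d)"
    proof -
      have "0 \<le> B ^ 4 * (K * d)" "0 \<le> B ^ 4 * (K * \<sigma>)" using B K d0 by (auto simp: \<sigma>_def)
      then show ?thesis unfolding P_def distrib_left by (simp add: mult_ac)
    qed
    finally show "norm (Nf \<beta> s q t - Nf \<beta> s' q' t) \<le> P * (norm (s - s') + d)" by (simp add: \<sigma>_def)
  qed
qed

lemma near_mono: "near \<eta> q \<Longrightarrow> \<eta> \<le> \<eta>' \<Longrightarrow> near \<eta>' q"
  unfolding near_def using order_trans by blast

lemma N_mult_integrable:
  assumes "\<beta> > 0" "near 1 q"
  shows "integrable cm (\<lambda>t. Nf \<beta> s q t * of_real (cos (real n * t)))"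
  by (intro integrable_cm_continuous continuous_intros N_continuous[OF assms order_refl])

lemma norm_mult_cos: "norm (z * of_real (cos x) :: complex) \<le> norm z"
  by (simp add: norm_mult mult_left_le)

lemma MN_estimates:
  assumes b: "\<beta> > 0"
  obtains P where "P > 0"
    "\<And>s q n. norm s \<le> 1 \<Longrightarrow> near 1 q \<Longrightarrow> norm (MN \<beta> s q n) \<le> P"
    "\<And>s s' q q' d n. norm s \<le> 1 \<Longrightarrow> norm s' \<le> 1 \<Longrightarrow> near 1 q \<Longrightarrow> near 1 q' \<Longrightarrow> (\<And>n. norm (q n - q' n) \<le> d) \<Longrightarrow>
       norm (MN \<beta> s q n - MN \<beta> s' q' n) \<le> P * (norm (s - s') + d)"
proof -
  obtain P where P: "P > 0"
    "\<And>s q t. norm s \<le> 1 \<Longrightarrow> near 1 q \<Longrightarrow> norm (Nf \<beta> s q t) \<le> P"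
    "\<And>s s' q q' d t. norm s \<le> 1 \<Longrightarrow> norm s' \<le> 1 \<Longrightarrow> near 1 q \<Longrightarrow> near 1 q' \<Longrightarrow> (\<And>n. norm (q n - q' n) \<le> d) \<Longrightarrow>
       norm (Nf \<beta> s q t - Nf \<beta> s' q' t) \<le> P * (norm (s - s') + d)"
    using N_estimates[OF b] by blast
  show thesis
  proof (rule that[OF P(1)])
    show "norm (MN \<beta> s q n) \<le> P" if "norm s \<le> 1" "near 1 q" for s q n
      unfolding MN_def by (intro avg_norm_le order_trans[OF norm_mult_cos P(2)[OF that]])
    fix s s' :: complex and q q' :: "nat \<Rightarrow> complex" and d n
    assume A: "norm s \<le> 1" "norm s' \<le> 1" "near 1 q" "near 1 q'" and d: "\<And>n. norm (q n - q' n) \<le> d"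
    have "MN \<beta> s q n - MN \<beta> s' q' n = avg (\<lambda>t. (Nf \<beta> s q t - Nf \<beta> s' q' t) * of_real (cos (real n * t)))"
      unfolding MN_def left_diff_distrib
      by (rule Bochner_Integration.integral_diff[symmetric]) (rule N_mult_integrable[OF b], fact)+
    also have "norm \<dots> \<le> P * (norm (s - s') + d)"
      by (intro avg_norm_le order_trans[OF norm_mult_cos P(3)[OF A d]])
    finally show "norm (MN \<beta> s q n - MN \<beta> s' q' n) \<le> P * (norm (s - s') + d)" .
  qed
qed

text \<open>
  At \<open>s = 0\<close> and close to \<open>ee\<close> only the terms \<open>q\<^sub>0
  r\<^sub>n q\<^sub>n\<close> depend on \<open>q\<close>, with Lipschitz constant close to
  \<open>R\<close>; everything else carries a factor \<open>s\<close>.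
\<close>

lemma TT_lipschitz:
  assumes b: "\<beta> > 0"
  obtains P where "P > 0"
    "\<And>s s' q q' d n \<delta> \<eta>. norm s < \<delta> \<Longrightarrow> norm s' < \<delta> \<Longrightarrow> \<delta> \<le> 1 \<Longrightarrow> \<eta> \<le> 1 \<Longrightarrow> near \<eta> q \<Longrightarrow> near \<eta> q' \<Longrightarrow> (\<And>n. norm (q n - q' n) \<le> d) \<Longrightarrow>
       norm (TT \<beta> s q n - TT \<beta> s' q' n) \<le> 5 * P * norm (s - s') + (bessel_R \<beta> * (1 + 2 * \<eta>) + 3 * \<delta> * P) * d"
proof -
  obtain P where P: "P > 0"
    "\<And>s q n. norm s \<le> 1 \<Longrightarrow> near 1 q \<Longrightarrow> norm (MN \<beta> s q n) \<le> P"
    "\<And>s s' q q' d n. norm s \<le> 1 \<Longrightarrow> norm s' \<le> 1 \<Longrightarrow> near 1 q \<Longrightarrow> near 1 q' \<Longrightarrow> (\<And>n. norm (q n - q' n) \<le> d) \<Longrightarrow>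
       norm (MN \<beta> s q n - MN \<beta> s' q' n) \<le> P * (norm (s - s') + d)"
    using MN_estimates[OF b] by blast
  show thesis
  proof (rule that[OF P(1)])
    fix s s' :: complex and q q' :: "nat \<Rightarrow> complex" and d n \<delta> \<eta>
    assume s: "norm s < \<delta>" "norm s' < \<delta>" "\<delta> \<le> 1" and e: "\<eta> \<le> 1" and q: "near \<eta> q" "near \<eta> q'" and d: "\<And>n. norm (q n - q' n) \<le> d"
    have d0: "0 \<le> d" using d[of 0] norm_ge_zero order_trans by blast
    have del: "0 \<le> \<delta>" using s(1) norm_ge_zero[of s] by linarith
    have e0: "0 \<le> \<eta>" using q(1) norm_ge_zero order_trans unfolding near_def by blast
    have s1: "norm s \<le> 1" "norm s' \<le> 1" using s by auto
    have q1: "near 1 q" "near 1 q'" using q e near_mono by auto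
    define \<sigma> where "\<sigma> = norm (s - s')"
    have \<sigma>0: "0 \<le> \<sigma>" by (simp add: \<sigma>_def)
    define X where "X k = MN \<beta> s q k" for k
    define X' where "X' k = MN \<beta> s' q' k" for k
    have X: "norm (X k) \<le> P" "norm (X' k) \<le> P" "norm (X k - X' k) \<le> P * (\<sigma> + d)" for k
      unfolding X_def X'_def \<sigma>_def using P(2)[OF s1(1) q1(1)] P(2)[OF s1(2) q1(2)] P(3)[OF s1 q1 d] by auto
    have dP: "\<delta> * P \<le> P" "0 \<le> \<delta> * P" using s(3) P(1) del by (auto simp: mult_left_le_one_le)
    have sX: "norm (s * X k - s' * X' k) \<le> 2 * P * \<sigma> + \<delta> * P * d" for k
    proof -
      have "s * X k - s' * X' k = (s - s') * X k + s' * (X k - X' k)" by (simp add: algebra_simps)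
      also have "norm \<dots> \<le> norm (s - s') * norm (X k) + norm s' * norm (X k - X' k)"
        unfolding norm_mult[symmetric] by (rule norm_triangle_ineq)
      also have "\<dots> \<le> \<sigma> * P + \<delta> * (P * (\<sigma> + d))" using X s del by (intro add_mono mult_mono) (auto simp: \<sigma>_def)
      also have "\<dots> = \<sigma> * P + (\<delta> * P) * \<sigma> + \<delta> * P * d" by (simp add: algebra_simps)
      also have "\<dots> \<le> \<sigma> * P + P * \<sigma> + \<delta> * P * d" using dP \<sigma>0 d0 by (intro add_mono mult_right_mono) auto
      finally show ?thesis by (simp add: algebra_simps)
    qed
    have sXb: "norm (s * X k) \<le> P" "norm (s' * X' k) \<le> P" for k
    proof -
      have "norm s * norm (X k) \<le> 1 * P" "norm s' * norm (X' k) \<le> 1 * P" using X s1 by (intro mult_mono; auto)+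
      then show "norm (s * X k) \<le> P" "norm (s' * X' k) \<le> P" by (simp_all add: norm_mult)
    qed
    have ssX: "norm (s * (s * X 0) - s' * (s' * X' 0)) \<le> 3 * P * \<sigma> + \<delta> * P * d"
    proof -
      have "s * (s * X 0) - s' * (s' * X' 0) = (s - s') * (s * X 0) + s' * (s * X 0 - s' * X' 0)" by (simp add: algebra_simps)
      also have "norm \<dots> \<le> norm (s - s') * norm (s * X 0) + norm s' * norm (s * X 0 - s' * X' 0)"
        unfolding norm_mult[symmetric] by (rule norm_triangle_ineq)
      also have "\<dots> \<le> \<sigma> * P + 1 * (2 * P * \<sigma> + \<delta> * P * d)"
        by (intro add_mono mult_mono sX sXb) (use s1 in \<open>auto simp: \<sigma>_def\<close>)
      finally show ?thesis by (simp add: algebra_simps)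
    qed
    show "norm (TT \<beta> s q n - TT \<beta> s' q' n) \<le> 5 * P * norm (s - s') + (bessel_R \<beta> * (1 + 2 * \<eta>) + 3 * \<delta> * P) * d"
    proof (cases "n = 0")
      case True
      have "TT \<beta> s q n - TT \<beta> s' q' n = (s * (s * X 0) - s' * (s' * X' 0)) - (s * X 1 - s' * X' 1)"
        using True by (simp add: TT_def X_def X'_def algebra_simps)
      also have "norm \<dots> \<le> norm (s * (s * X 0) - s' * (s' * X' 0)) + norm (s * X 1 - s' * X' 1)" by (rule norm_triangle_ineq4)
      also have "\<dots> \<le> (3 * P * \<sigma> + \<delta> * P * d) + (2 * P * \<sigma> + \<delta> * P * d)" by (intro add_mono ssX sX)
      also have "\<dots> \<le> 5 * P * \<sigma> + (bessel_R \<beta> * (1 + 2 * \<eta>) + 3 * \<delta> * P) * d"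
      proof -
        have "0 \<le> bessel_R \<beta> * (1 + 2 * \<eta>) * d" "0 \<le> \<delta> * P * d" using bessel_R_bounds[OF b] e0 d0 dP by auto
        then show ?thesis by (simp add: algebra_simps)
      qed
      finally show ?thesis by (simp add: \<sigma>_def)
    next
      case False
      then have n1: "n \<ge> 1" by simp
      have 1: "norm (q 0 * of_real (rr \<beta> n) * q n - q' 0 * of_real (rr \<beta> n) * q' n) \<le> bessel_R \<beta> * (1 + 2 * \<eta>) * d"
      proof -
        have "q 0 * of_real (rr \<beta> n) * q n - q' 0 * of_real (rr \<beta> n) * q' n = of_real (rr \<beta> n) * (q 0 * (q n - q' n) + (q 0 - q' 0) * q' n)"
          by (simp add: algebra_simps)
        also have "norm \<dots> = rr \<beta> n * norm (q 0 * (q n - q' n) + (q 0 - q' 0) * q' n)"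
          using rr_nonneg[OF b, of n] by (simp add: norm_mult)
        also have "norm (q 0 * (q n - q' n) + (q 0 - q' 0) * q' n) \<le> norm (q 0) * norm (q n - q' n) + norm (q 0 - q' 0) * norm (q' n)"
          unfolding norm_mult[symmetric] by (rule norm_triangle_ineq)
        also have "\<dots> \<le> (1 + \<eta>) * d + d * \<eta>"
          using near_bounds(1)[OF q(1) e] near_bounds(3)[OF q(2) e n1] d e0 d0 by (intro add_mono mult_mono) auto
        finally have "norm (q 0 * of_real (rr \<beta> n) * q n - q' 0 * of_real (rr \<beta> n) * q' n) \<le> rr \<beta> n * ((1 + \<eta>) * d + d * \<eta>)"
          using rr_nonneg[OF b, of n] by (simp add: mult_left_mono)
        also have "\<dots> \<le> bessel_R \<beta> * ((1 + \<eta>) * d + d * \<eta>)" using rr_le[OF b n1] e0 d0 by (intro mult_right_mono) auto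
        finally show ?thesis by (simp add: algebra_simps)
      qed
      have 2: "norm (s * (s * X 0) * q n - s' * (s' * X' 0) * q' n) \<le> (3 * P * \<sigma> + \<delta> * P * d) + \<delta> * P * d"
      proof -
        have "s * (s * X 0) * q n - s' * (s' * X' 0) * q' n = (s * (s * X 0) - s' * (s' * X' 0)) * q n + (s' * (s' * X' 0)) * (q n - q' n)"
          by (simp add: algebra_simps)
        also have "norm \<dots> \<le> norm (s * (s * X 0) - s' * (s' * X' 0)) * norm (q n) + norm (s' * (s' * X' 0)) * norm (q n - q' n)"
          unfolding norm_mult[symmetric] by (rule norm_triangle_ineq)
        also have "\<dots> \<le> (3 * P * \<sigma> + \<delta> * P * d) * 1 + (\<delta> * P) * d"
        proof (intro add_mono mult_mono ssX d)
          show "norm (q n) \<le> 1" using near_bounds(3)[OF q(1) e n1] e by linarith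
          show "norm (s' * (s' * X' 0)) \<le> \<delta> * P" unfolding norm_mult[of s' "s' * _"] using s sXb by (intro mult_mono) (auto simp: del)
        qed (use dP d0 \<sigma>0 P in auto)
        finally show ?thesis by simp
      qed
      have "TT \<beta> s q n - TT \<beta> s' q' n = (q 0 * of_real (rr \<beta> n) * q n - q' 0 * of_real (rr \<beta> n) * q' n)
          + (s * X (n + 1) - s' * X' (n + 1)) - (s * (s * X 0) * q n - s' * (s' * X' 0) * q' n)"
        using False by (simp add: TT_def X_def X'_def algebra_simps)
      also have "norm \<dots> \<le> norm (q 0 * of_real (rr \<beta> n) * q n - q' 0 * of_real (rr \<beta> n) * q' n)
          + norm (s * X (n + 1) - s' * X' (n + 1)) + norm (s * (s * X 0) * q n - s' * (s' * X' 0) * q' n)"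
        by (rule order_trans[OF norm_triangle_ineq4 add_right_mono[OF norm_triangle_ineq]])
      also have "\<dots> \<le> bessel_R \<beta> * (1 + 2 * \<eta>) * d + (2 * P * \<sigma> + \<delta> * P * d) + ((3 * P * \<sigma> + \<delta> * P * d) + \<delta> * P * d)"
        by (intro add_mono 1 2 sX)
      finally show ?thesis by (simp add: \<sigma>_def algebra_simps)
    qed
  qed
qed

lemma TT_holomorphic:
  assumes b: "\<beta> > 0" and e: "\<eta> \<le> 1" and del: "\<delta> \<le> 1"
    and Qh: "\<And>n. (\<lambda>s. Q s n) holomorphic_on ball 0 \<delta>" and Qb: "\<And>s. norm s < \<delta> \<Longrightarrow> near \<eta> (Q s)"
  shows "(\<lambda>s. TT \<beta> s (Q s) n) holomorphic_on ball 0 \<delta>"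
proof -
  obtain P where P: "P > 0" "\<And>s q t. norm s \<le> 1 \<Longrightarrow> near 1 q \<Longrightarrow> norm (Nf \<beta> s q t) \<le> P"
    using N_estimates[OF b] by metis
  have qh: "(\<lambda>s. qhat (Q s) n) holomorphic_on ball 0 \<delta>" for n
    unfolding qhat_def by (cases "n = 0") (auto intro!: holomorphic_intros Qh)
  have Uh: "(\<lambda>s. Uf \<beta> (Q s) t) holomorphic_on ball 0 \<delta>" for t
    unfolding Uf_def
  proof (intro holomorphic_intros Qh holomorphic_uniform_series[where M="rr \<beta>"] qh rr_summable b)
    show "norm (of_real (rr \<beta> n) * qhat (Q s) n * of_real (cos (real (n + 1) * t))) \<le> rr \<beta> n" if "s \<in> ball 0 \<delta>" for n s
      using U_term[OF b near_bounds(2)[OF Qb e], of s n n "real (n + 1) * t"] that by simp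
  qed simp
  have Nh: "(\<lambda>s. Nf \<beta> s (Q s) t) holomorphic_on ball 0 \<delta>" for t
  proof -
    have "(\<lambda>s. s * Uf \<beta> (Q s) t) holomorphic_on ball 0 \<delta>" by (intro holomorphic_intros Uh)
    from holomorphic_on_compose[OF this expq_holomorphic] show ?thesis
      unfolding Nf_def o_def by (intro holomorphic_intros Uh)
  qed
  have Mh: "(\<lambda>s. MN \<beta> s (Q s) n) holomorphic_on ball 0 \<delta>" for n
    unfolding MN_def
  proof (rule holomorphic_avg[where B=P])
    show "(\<lambda>s. Nf \<beta> s (Q s) t * of_real (cos (real n * t))) holomorphic_on ball 0 \<delta>" for t
      by (intro holomorphic_intros Nh)
    fix s :: complex assume "s \<in> ball 0 \<delta>"
    then have s: "norm s < \<delta>" "near 1 (Q s)" using Qb e near_mono by auto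
    show "norm (Nf \<beta> s (Q s) t * of_real (cos (real n * t))) \<le> P" for t
      by (rule order_trans[OF norm_mult_cos P(2)]) (use s del in auto)
    show "(\<lambda>t. Nf \<beta> s (Q s) t * of_real (cos (real n * t))) \<in> borel_measurable cm"
      using N_mult_integrable[OF b s(2)] by auto
  qed simp
  show ?thesis unfolding TT_def by (cases "n = 0") (auto intro!: holomorphic_intros Mh Qh)
qed

lemma TT_base: "\<beta> > 0 \<Longrightarrow> TT \<beta> 0 ee n = ee n"
  by (simp add: TT_def ee_def)

text \<open>
  All coefficients are real; by uniqueness the branch is then real for real \<open>s\<close>.
\<close>

lemma TT_cnj: assumes b: "\<beta> > 0" and q: "near 1 q" shows "TT \<beta> (cnj s) (\<lambda>n. cnj (q n)) n = cnj (TT \<beta> s q n)"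
proof -
  have "qhat (\<lambda>n. cnj (q n)) n = cnj (qhat q n)" for n by (simp add: qhat_def)
  then have U: "Uf \<beta> (\<lambda>n. cnj (q n)) t = cnj (Uf \<beta> q t)" for t
    unfolding Uf_def complex_cnj_mult
    using bounded_linear.suminf[OF bounded_linear_cnj U_bound(2)[OF b q order_refl, of t]] by simp
  have N: "Nf \<beta> (cnj s) (\<lambda>n. cnj (q n)) t = cnj (Nf \<beta> s q t)" for t
    unfolding Nf_def U by (simp add: cnj_expq)
  have "MN \<beta> (cnj s) (\<lambda>n. cnj (q n)) k = cnj (MN \<beta> s q k)" for k
    unfolding MN_def N Bochner_Integration.integral_cnj[symmetric] by simp
  then show ?thesis by (simp add: TT_def)
qed

text \<open>
  The radii are chosen so that the Lipschitz constant is at most \<open>(3 + R) / 4 < 1\<close>.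
\<close>

lemma branch_exists:
  assumes b: "\<beta> > 0"
  obtains q :: "complex \<Rightarrow> nat \<Rightarrow> complex" and \<delta> \<eta> K where "0 < \<delta>" "\<delta> \<le> 1" "0 < \<eta>" "\<eta> \<le> 1/4" "0 \<le> K"
    "\<And>s. norm s < \<delta> \<Longrightarrow> near \<eta> (q s)"
    "\<And>s n. norm s < \<delta> \<Longrightarrow> TT \<beta> s (q s) n = q s n"
    "\<And>n. (\<lambda>s. q s n) holomorphic_on ball 0 \<delta>" "\<And>n. q 0 n = ee n"
    "\<And>s s' n. norm s < \<delta> \<Longrightarrow> norm s' < \<delta> \<Longrightarrow> norm (q s n - q s' n) \<le> K * norm (s - s')"
    "\<And>s p n. norm s < \<delta> \<Longrightarrow> near \<eta> p \<Longrightarrow> (\<And>n. TT \<beta> s p n = p n) \<Longrightarrow> p n = q s n"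
proof -
  define \<rho> where "\<rho> = bessel_R \<beta>"
  have r: "0 \<le> \<rho>" "\<rho> < 1" using bessel_R_bounds[OF b] by (auto simp: \<rho>_def)
  obtain P where P: "P > 0"
    "\<And>s s' q q' d n \<delta> \<eta>. norm s < \<delta> \<Longrightarrow> norm s' < \<delta> \<Longrightarrow> \<delta> \<le> 1 \<Longrightarrow> \<eta> \<le> 1 \<Longrightarrow> near \<eta> q \<Longrightarrow> near \<eta> q' \<Longrightarrow> (\<And>n. norm (q n - q' n) \<le> d) \<Longrightarrow>
       norm (TT \<beta> s q n - TT \<beta> s' q' n) \<le> 5 * P * norm (s - s') + (bessel_R \<beta> * (1 + 2 * \<eta>) + 3 * \<delta> * P) * d"
    using TT_lipschitz[OF b] by blast
  define \<eta> where "\<eta> = (1 - \<rho>) / 4"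
  have eta: "0 < \<eta>" "\<eta> \<le> 1/4" using r by (auto simp: \<eta>_def)
  define \<delta> where "\<delta> = min 1 ((1 - \<rho>) * \<eta> / (20 * P))"
  have del: "0 < \<delta>" "\<delta> \<le> 1" "\<delta> \<le> (1 - \<rho>) * \<eta> / (20 * P)" using r eta P(1) by (auto simp: \<delta>_def)
  have dP: "20 * (\<delta> * P) \<le> (1 - \<rho>) * \<eta>" using del(3) P(1) by (simp add: pos_le_divide_eq mult_ac)
  define c where "c = (3 + \<rho>) / 4"
  have c: "0 \<le> c" "c < 1" "1 - c = (1 - \<rho>) / 4" using r by (simp_all add: c_def field_simps)
  have cc: "\<rho> * (1 + 2 * \<eta>) + 3 * \<delta> * P \<le> c"
  proof -
    have "(1 - \<rho>) * \<eta> \<le> (1 - \<rho>) * (1/4)" using r eta by (intro mult_left_mono) auto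
    moreover have "0 \<le> \<delta> * P" using del P(1) by simp
    ultimately have "3 * \<delta> * P \<le> (1 - \<rho>) / 4" using dP by (simp add: mult.assoc)
    moreover have "\<rho> * (2 * \<eta>) \<le> 1 * (2 * \<eta>)" using r eta by (intro mult_right_mono) auto
    ultimately show ?thesis by (simp add: c_def \<eta>_def distrib_left)
  qed
  have lip: "norm (TT \<beta> s q n - TT \<beta> s' q' n) \<le> 5 * P * norm (s - s') + c * d"
    if "norm s < \<delta>" "norm s' < \<delta>" "\<And>n. norm (q n - ee n) \<le> \<eta>" "\<And>n. norm (q' n - ee n) \<le> \<eta>" "\<And>n. norm (q n - q' n) \<le> d" for s s' q q' d n
  proof -
    have d0: "0 \<le> d" using that(5)[of 0] norm_ge_zero order_trans by blast
    have "norm (TT \<beta> s q n - TT \<beta> s' q' n) \<le> 5 * P * norm (s - s') + (bessel_R \<beta> * (1 + 2 * \<eta>) + 3 * \<delta> * P) * d"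
      by (rule P(2)[OF that(1,2) del(2) _ _ _ that(5)]) (use that eta in \<open>auto simp: near_def\<close>)
    also have "(bessel_R \<beta> * (1 + 2 * \<eta>) + 3 * \<delta> * P) * d \<le> c * d" using cc d0 by (intro mult_right_mono) (auto simp: \<rho>_def)
    finally show ?thesis by simp
  qed
  have hol: "(\<lambda>s. TT \<beta> s (Q s) n) holomorphic_on ball 0 \<delta>"
    if "\<And>n. (\<lambda>s. Q s n) holomorphic_on ball 0 \<delta>" "\<And>s n. norm s < \<delta> \<Longrightarrow> norm (Q s n - ee n) \<le> \<eta>" for Q n
    by (rule TT_holomorphic[OF b _ del(2), of \<eta>]) (use that eta in \<open>auto simp: near_def\<close>)
  have Ld: "5 * P * \<delta> \<le> (1 - c) * \<eta>" using dP unfolding c(3) by (simp add: mult_ac)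
  show thesis
  proof (rule holomorphic_fixed_point[where c=c and \<eta>=\<eta> and \<delta>=\<delta> and L="5 * P" and e=ee and T="TT \<beta>"])
    show "TT \<beta> 0 ee n = ee n" for n by (rule TT_base[OF b])
    show "norm (TT \<beta> s q n - TT \<beta> s' q' n) \<le> 5 * P * norm (s - s') + c * d"
      if "norm s < \<delta>" "norm s' < \<delta>" "\<And>n. norm (q n - ee n) \<le> \<eta>" "\<And>n. norm (q' n - ee n) \<le> \<eta>" "\<And>n. norm (q n - q' n) \<le> d" for s s' q q' d n
      using that by (rule lip)
    show "(\<lambda>s. TT \<beta> s (Q s) n) holomorphic_on ball 0 \<delta>"
      if "\<And>n. (\<lambda>s. Q s n) holomorphic_on ball 0 \<delta>" "\<And>s n. norm s < \<delta> \<Longrightarrow> norm (Q s n - ee n) \<le> \<eta>" for Q n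
      using that by (rule hol)
    fix q assume q: "\<And>s n. norm s < \<delta> \<Longrightarrow> norm (q s n - ee n) \<le> \<eta>"
      "\<And>s n. norm s < \<delta> \<Longrightarrow> TT \<beta> s (q s) n = q s n"
      "\<And>n. (\<lambda>s. q s n) holomorphic_on ball 0 \<delta>" "\<And>n. q 0 n = ee n"
      "\<And>s s' n. norm s < \<delta> \<Longrightarrow> norm s' < \<delta> \<Longrightarrow> norm (q s n - q s' n) \<le> 5 * P / (1 - c) * norm (s - s')"
      "\<And>s p n. norm s < \<delta> \<Longrightarrow> (\<And>n. norm (p n - ee n) \<le> \<eta>) \<Longrightarrow> (\<And>n. TT \<beta> s p n = p n) \<Longrightarrow> p n = q s n"
    show thesis
    proof (rule that[of \<delta> \<eta> "5 * P / (1 - c)" q])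
      show "0 \<le> 5 * P / (1 - c)" using P(1) c by simp
      show "near \<eta> (q s)" if "norm s < \<delta>" for s using q(1)[OF that] by (simp add: near_def)
      show "p n = q s n" if "norm s < \<delta>" "near \<eta> p" "\<And>n. TT \<beta> s p n = p n" for s p n
        by (rule q(6)) (use that in \<open>auto simp: near_def\<close>)
    qed (fact del eta q)+
  qed (use c eta del Ld P(1) in auto)
qed

section \<open>The branch of stationary densities\<close>

definition cq :: "(nat \<Rightarrow> real) \<Rightarrow> nat \<Rightarrow> complex" where "cq v n = of_real (v n)"

text \<open>
  The full sequence of modes on the branch, sines included.
\<close>

definition Zm :: "real \<Rightarrow> (nat \<Rightarrow> real) \<Rightarrow> nat \<Rightarrow> real" where
  "Zm s v j = (if even j then s * (if j = 0 then 1 else v (j div 2)) else 0)"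

definition Ab :: "real \<Rightarrow> real \<Rightarrow> (nat \<Rightarrow> real) \<Rightarrow> nat \<Rightarrow> real" where
  "Ab \<beta> s v = coef \<beta> (kappa_star \<beta> * v 0) (Zm s v)"

text \<open>
  The real counterpart of \<open>MN\<close>.
\<close>

definition MR :: "real \<Rightarrow> real \<Rightarrow> (nat \<Rightarrow> real) \<Rightarrow> nat \<Rightarrow> real" where
  "MR \<beta> s v n = avg (\<lambda>t. (exp (pot (Ab \<beta> s v) t) - 1 - pot (Ab \<beta> s v) t) / s\<^sup>2 * cos (real n * t))"

lemma near_cqD:
  assumes "near \<eta> (cq v)"
  shows "\<bar>v 0 - 1\<bar> \<le> \<eta>" "n \<ge> 1 \<Longrightarrow> \<bar>v n\<bar> \<le> \<eta>"
proof -
  have *: "norm (cq v n - ee n) \<le> \<eta>" for n using assms by (simp add: near_def)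
  have "cq v 0 - ee 0 = of_real (v 0 - 1)" by (simp add: cq_def ee_def)
  then show "\<bar>v 0 - 1\<bar> \<le> \<eta>" using *[of 0] by (simp only: norm_of_real)
  show "\<bar>v n\<bar> \<le> \<eta>" if "n \<ge> 1" using *[of n] that by (simp add: cq_def ee_def)
qed

lemma near_cqI:
  assumes "\<bar>v 0 - 1\<bar> \<le> \<eta>" "\<And>n. n \<ge> 1 \<Longrightarrow> \<bar>v n\<bar> \<le> \<eta>"
  shows "near \<eta> (cq v)"
  unfolding near_def
proof
  fix n show "norm (cq v n - ee n) \<le> \<eta>"
  proof (cases "n = 0")
    case True
    have "cq v 0 - ee 0 = of_real (v 0 - 1)" by (simp add: cq_def ee_def)
    then show ?thesis using assms(1) True by (simp only: norm_of_real)
  next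
    case False
    then show ?thesis using assms(2)[of n] by (simp add: cq_def ee_def)
  qed
qed

lemma Zm_le: assumes "near 1 (cq v)" shows "\<bar>Zm s v j\<bar> \<le> \<bar>s\<bar>"
proof -
  have "j div 2 \<ge> 1" if "even j" "j \<noteq> 0" using that by (auto elim!: evenE)
  then show ?thesis using near_cqD(2)[OF assms, of "j div 2"] by (auto simp: Zm_def abs_mult mult_left_le)
qed

lemma Ab_adm:
  assumes b: "\<beta> > 0" and v: "near 1 (cq v)"
  shows "adm (Ab \<beta> s v)" "pnorm (Ab \<beta> s v) \<le> 2 * kappa_star \<beta> * Lam \<beta> * \<bar>s\<bar>"
proof -
  show "adm (Ab \<beta> s v)" unfolding Ab_def by (rule coef_adm_bound(1)[OF b Zm_le[OF v]])
  have *: "pnorm (Ab \<beta> s v) \<le> \<bar>kappa_star \<beta> * v 0\<bar> * (Lam \<beta> * \<bar>s\<bar>)"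
    unfolding Ab_def by (rule coef_adm_bound(2)[OF b Zm_le[OF v]])
  have "\<bar>v 0\<bar> \<le> 2" using near_cqD(1)[OF v] by linarith
  then have "\<bar>kappa_star \<beta> * v 0\<bar> \<le> kappa_star \<beta> * 2" using kappa_star_pos[OF b] by (simp add: abs_mult)
  then have "\<bar>kappa_star \<beta> * v 0\<bar> * (Lam \<beta> * \<bar>s\<bar>) \<le> (kappa_star \<beta> * 2) * (Lam \<beta> * \<bar>s\<bar>)"
    using Lam_nonneg[OF b] by (intro mult_right_mono) auto
  with * show "pnorm (Ab \<beta> s v) \<le> 2 * kappa_star \<beta> * Lam \<beta> * \<bar>s\<bar>" by (simp add: mult_ac)
qed

lemma Ab_even: "\<beta> > 0 \<Longrightarrow> Ab \<beta> s v (2 * n) = 2 * v 0 * s * (rr \<beta> n * (if n = 0 then 1 else v n))"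
  using wt_rr[of \<beta> n] by (simp add: Ab_def coef_def Zm_def mult_ac flip: wt_rr)

lemma Ab_odd: "odd j \<Longrightarrow> Ab \<beta> s v j = 0"
  by (simp add: Ab_def coef_def Zm_def)

lemma Ab_scale: "Ab \<beta> s v = (\<lambda>j. s * Ab \<beta> 1 v j)"
  by (rule ext) (simp add: Ab_def coef_def Zm_def)

lemma tb_even: "tb (2 * n) t = cos (real (n + 1) * t)" by (simp add: tb_def freq_def)

lemma pot_Ab:
  assumes b: "\<beta> > 0" and v: "near 1 (cq v)"
  shows "complex_of_real (pot (Ab \<beta> s v) t) = of_real s * Uf \<beta> (cq v) t"
proof -
  have "(\<lambda>j. Ab \<beta> s v j * tb j t) sums pot (Ab \<beta> s v) t"
    unfolding pot_def by (intro summable_sums pot_summable Ab_adm[OF assms])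
  then have "(\<lambda>n. Ab \<beta> s v (2 * n) * tb (2 * n) t) sums pot (Ab \<beta> s v) t"
    by (subst sums_mono_reindex[of "\<lambda>n. 2 * n"]) (auto simp: strict_mono_def image_iff intro!: Ab_odd elim!: evenE)
  then have 1: "(\<lambda>n. complex_of_real (Ab \<beta> s v (2 * n) * cos (real (n + 1) * t))) sums of_real (pot (Ab \<beta> s v) t)"
    unfolding tb_even by (rule sums_of_real)
  have "(\<lambda>n. (of_real s * (2 * cq v 0)) * (of_real (rr \<beta> n) * qhat (cq v) n * of_real (cos (real (n + 1) * t))))
     sums (of_real s * Uf \<beta> (cq v) t)"
    unfolding Uf_def using sums_mult[OF summable_sums[OF U_bound(2)[OF b v order_refl]], of "of_real s * (2 * cq v 0)" t] by (simp add: mult.assoc)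
  moreover have "(of_real s * (2 * cq v 0)) * (of_real (rr \<beta> n) * qhat (cq v) n * of_real (cos (real (n + 1) * t)))
     = complex_of_real (Ab \<beta> s v (2 * n) * cos (real (n + 1) * t))" for n
    by (simp add: Ab_even[OF b] cq_def qhat_def)
  ultimately have "(\<lambda>n. complex_of_real (Ab \<beta> s v (2 * n) * cos (real (n + 1) * t))) sums (of_real s * Uf \<beta> (cq v) t)" by (simp only:)
  with 1 show ?thesis by (rule sums_unique2)
qed

lemma MN_real:
  assumes b: "\<beta> > 0" and v: "near 1 (cq v)" and s: "s \<noteq> 0"
  shows "MN \<beta> (of_real s) (cq v) n = of_real (MR \<beta> s v n)"
proof -
  have "Nf \<beta> (of_real s) (cq v) t * of_real (cos (real n * t)) =
      complex_of_real ((exp (pot (Ab \<beta> s v) t) - 1 - pot (Ab \<beta> s v) t) / s\<^sup>2 * cos (real n * t))" for t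
  proof -
    define x where "x = of_real s * Uf \<beta> (cq v) t"
    have "complex_of_real (exp (pot (Ab \<beta> s v) t) - 1 - pot (Ab \<beta> s v) t) = exp x - 1 - x"
      using pot_Ab[OF b v, of s t] by (simp add: x_def exp_of_real[symmetric])
    also have "\<dots> = x\<^sup>2 * expq x" using exp_expq[of x] by simp
    finally have "complex_of_real (exp (pot (Ab \<beta> s v) t) - 1 - pot (Ab \<beta> s v) t) = of_real (s\<^sup>2) * Nf \<beta> (of_real s) (cq v) t"
      by (simp add: Nf_def x_def power_mult_distrib)
    then show ?thesis using s by simp
  qed
  then show ?thesis unfolding MN_def MR_def by (simp only: integral_complex_of_real)
qed

lemma TT_real:
  assumes b: "\<beta> > 0" and v: "near 1 (cq v)" and s: "s \<noteq> 0"
  shows "TT \<beta> (of_real s) (cq v) n = cq v n \<longleftrightarrow>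
     (if n = 0 then 1 + s * (s * MR \<beta> s v 0 - MR \<beta> s v 1) else
      v 0 * rr \<beta> n * v n + s * MR \<beta> s v (n + 1) - s * (s * MR \<beta> s v 0) * v n) = v n"
proof -
  have "TT \<beta> (of_real s) (cq v) n = of_real (if n = 0 then 1 + s * (s * MR \<beta> s v 0 - MR \<beta> s v 1) else
      v 0 * rr \<beta> n * v n + s * MR \<beta> s v (n + 1) - s * (s * MR \<beta> s v 0) * v n)"
    unfolding TT_def MN_real[OF assms] by (simp add: cq_def)
  then show ?thesis by (simp only: cq_def of_real_eq_iff)
qed

text \<open>
  Fixed points of \<open>TT\<close> are exactly the self-consistency of the cosine modes,
  divided by \<open>s\<close>.
\<close>

lemma fixed_iff:
  assumes b: "\<beta> > 0" and v: "near 1 (cq v)" and s: "s \<noteq> 0"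
  shows "TT \<beta> (of_real s) (cq v) n = cq v n \<longleftrightarrow> mode (gibbs (Ab \<beta> s v)) (2 * n) = Zm s v (2 * n)"
proof -
  define A where "A = Ab \<beta> s v"
  have a: "adm A" unfolding A_def by (rule Ab_adm[OF b v])
  define Z where "Z = avg (\<lambda>t. exp (pot A t))"
  have Z: "Z > 0" using exp_pot_avg_pos[OF a] by (simp add: Z_def)
  define h where "h n = (if n = 0 then 1 else v n)" for n
  have i: "integrable cm (\<lambda>t. exp (pot A t) * cos (real k * t))" "integrable cm (\<lambda>t. pot A t * cos (real k * t))" for k
    by (intro integrable_cm_continuous continuous_intros pot_continuous a)+
  have M: "s\<^sup>2 * MR \<beta> s v k = avg (\<lambda>t. exp (pot A t) * cos (real k * t)) - avg (\<lambda>t. cos (real k * t)) - avg (\<lambda>t. pot A t * cos (real k * t))" for k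
  proof -
    have "s\<^sup>2 * MR \<beta> s v k = avg (\<lambda>t. s\<^sup>2 * ((exp (pot A t) - 1 - pot A t) / s\<^sup>2 * cos (real k * t)))"
      by (simp add: MR_def A_def)
    also have "\<dots> = avg (\<lambda>t. exp (pot A t) * cos (real k * t) - cos (real k * t) - pot A t * cos (real k * t))"
      using s by (intro Bochner_Integration.integral_cong refl) (simp add: left_diff_distrib)
    finally show ?thesis using i[of k] by simp
  qed
  have Z0: "Z = 1 + s\<^sup>2 * MR \<beta> s v 0" using M[of 0] avg_pot[OF a] by (simp add: Z_def)
  have "avg (\<lambda>t. pot A t * cos (real (n + 1) * t)) = A (2 * n) / 2"
    using mode_pot[OF a, of "2 * n"] unfolding tb_even .
  then have E: "avg (\<lambda>t. exp (pot A t) * cos (real (n + 1) * t)) = v 0 * s * (rr \<beta> n * h n) + s\<^sup>2 * MR \<beta> s v (n + 1)"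
    using M[of "n + 1"] avg_cos[of "n + 1"] by (simp add: A_def Ab_even[OF b] h_def)
  have "mode (gibbs A) (2 * n) = avg (\<lambda>t. exp (pot A t) * cos (real (n + 1) * t)) / Z"
    unfolding mode_def gibbs_def Z_def[symmetric] tb_even by simp
  then have "mode (gibbs A) (2 * n) = Zm s v (2 * n) \<longleftrightarrow> v 0 * s * (rr \<beta> n * h n) + s\<^sup>2 * MR \<beta> s v (n + 1) = s * h n * Z"
    using Z unfolding E by (simp add: divide_eq_eq Zm_def h_def)
  also have "\<dots> \<longleftrightarrow> s * (v 0 * (rr \<beta> n * h n) + s * MR \<beta> s v (n + 1)) = s * (h n * (1 + s\<^sup>2 * MR \<beta> s v 0))"
    unfolding Z0 by (simp add: algebra_simps power2_eq_square)
  also have "\<dots> \<longleftrightarrow> v 0 * (rr \<beta> n * h n) + s * MR \<beta> s v (n + 1) = h n * (1 + s\<^sup>2 * MR \<beta> s v 0)"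
    using s by simp
  also have "\<dots> \<longleftrightarrow> TT \<beta> (of_real s) (cq v) n = cq v n"
    unfolding TT_real[OF assms] by (auto simp: h_def rr_0[OF b] algebra_simps power2_eq_square)
  finally show ?thesis by (simp add: A_def)
qed

lemma pot_even: assumes "\<And>j. odd j \<Longrightarrow> a j = 0" shows "pot a (- t) = pot a t"
  unfolding pot_def
proof (rule suminf_cong)
  fix j show "a j * tb j (- t) = a j * tb j t" using assms[of j] by (cases "even j") (auto simp: tb_def)
qed

lemma mode_gibbs_odd: assumes a: "adm a" and o: "\<And>j. odd j \<Longrightarrow> a j = 0" and j: "odd j" shows "mode (gibbs a) j = 0"
proof -
  have e: "gibbs a (- t) = gibbs a t" for t by (simp add: gibbs_def pot_even[OF o])
  have "avg (\<lambda>t. gibbs a (-1 * t + 0) * tb j (-1 * t + 0)) = avg (\<lambda>t. gibbs a t * tb j t)"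
    by (rule avg_isometry[of "-1" "\<lambda>t. gibbs a t * tb j t" 0])
       (auto intro!: continuous_intros gibbs_continuous a simp: gibbs_periodic tb_periodic)
  moreover have "tb j (- t) = - tb j t" for t using j by (simp add: tb_def)
  ultimately show ?thesis by (simp add: mode_def e)
qed

section \<open>Second-order expansion of the branch\<close>

text \<open>
  An expansion to second order does not by itself give a second derivative; once that derivative
  is known to exist, l'Hospital's rule identifies it.
\<close>

lemma second_derivative_from_expansion:
  fixes f f' :: "real \<Rightarrow> real"
  assumes d: "\<delta> > 0" and f: "\<And>s. \<bar>s\<bar> < \<delta> \<Longrightarrow> (f has_real_derivative f' s) (at s)"
    and f2: "(f' has_real_derivative L) (at 0)"
    and ex: "\<And>s. \<bar>s\<bar> < \<delta> \<Longrightarrow> \<bar>f s - f 0 - c * s\<^sup>2\<bar> \<le> C * \<bar>s\<bar> ^ 3"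
  shows "f' 0 = 0" "L = 2 * c"
proof -
  have near0: "eventually (\<lambda>s. \<bar>s\<bar> < \<delta>) (at (0::real))"
    using d eventually_at[of "\<lambda>s. \<bar>s\<bar> < \<delta>" 0 UNIV] by (auto simp: dist_real_def intro!: exI[of _ \<delta>])
  have q: "((\<lambda>s. (f s - f 0) / s\<^sup>2) \<longlongrightarrow> c) (at 0)"
  proof (rule LIM_zero_cancel, rule Lim_null_comparison)
    show "eventually (\<lambda>s. norm ((f s - f 0) / s\<^sup>2 - c) \<le> C * \<bar>s\<bar>) (at 0)"
      using near0 eventually_neq_at_within[of 0 0 UNIV]
    proof eventually_elim
      case (elim s)
      have "(f s - f 0) / s\<^sup>2 - c = (f s - f 0 - c * s\<^sup>2) / s\<^sup>2" using elim by (simp add: diff_divide_distrib)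
      also have "\<bar>\<dots>\<bar> \<le> (C * \<bar>s\<bar> ^ 3) / s\<^sup>2" unfolding abs_divide using ex elim by (auto intro!: divide_right_mono)
      also have "\<dots> = C * \<bar>s\<bar>" using elim by (simp add: power2_eq_square power3_eq_cube abs_mult_self_eq mult.assoc[symmetric])
      finally show ?case by simp
    qed
    show "((\<lambda>s. C * \<bar>s\<bar>) \<longlongrightarrow> 0) (at 0)" by (auto intro!: tendsto_eq_intros)
  qed
  have "((\<lambda>s. (f s - f 0) / s\<^sup>2 * s) \<longlongrightarrow> c * 0) (at 0)" by (intro tendsto_intros q)
  then have "((\<lambda>s. (f s - f 0) / (s - 0)) \<longlongrightarrow> 0) (at 0)"
    using Lim_transform_eventually[of "\<lambda>s. (f s - f 0) / s\<^sup>2 * s" "c * 0" "at 0" "\<lambda>s. (f s - f 0) / (s - 0)"]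
    by (auto simp: power2_eq_square eventually_at_filter)
  then have "(f has_real_derivative 0) (at 0)" by (simp add: has_field_derivative_iff)
  then show f0: "f' 0 = 0" using f[of 0] d by (auto dest: DERIV_unique)
  have fc: "(f \<longlongrightarrow> f 0) (at 0)" using DERIV_isCont[OF f[of 0]] d by (simp add: isCont_def)
  have "((\<lambda>s. (f s - f 0) / s\<^sup>2) \<longlongrightarrow> L / 2) (at 0)"
  proof (rule lhopital[where f'=f' and g'="\<lambda>s. 2 * s"])
    show "((\<lambda>s. f s - f 0) \<longlongrightarrow> 0) (at 0)" using fc by (rule LIM_zero)
    show "((\<lambda>s. s\<^sup>2) \<longlongrightarrow> 0) (at (0::real))" by (auto intro!: tendsto_eq_intros)
    show "eventually (\<lambda>s::real. s\<^sup>2 \<noteq> 0) (at 0)" "eventually (\<lambda>s::real. 2 * s \<noteq> 0) (at 0)"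
      by (auto simp: eventually_at_filter)
    show "eventually (\<lambda>s. ((\<lambda>s. f s - f 0) has_real_derivative f' s) (at s)) (at 0)"
      using near0 by eventually_elim (auto intro!: derivative_eq_intros f)
    show "eventually (\<lambda>s. ((\<lambda>s. s\<^sup>2) has_real_derivative 2 * s) (at s)) (at (0::real))"
      by (rule always_eventually) (auto intro!: derivative_eq_intros)
    have "((\<lambda>s. (f' s - f' 0) / (s - 0)) \<longlongrightarrow> L) (at 0)" using f2 by (simp add: has_field_derivative_iff)
    then have "((\<lambda>s. f' s / s / 2) \<longlongrightarrow> L / 2) (at 0)" using f0 by (intro tendsto_intros) simp_all
    then show "((\<lambda>s. f' s / (2 * s)) \<longlongrightarrow> L / 2) (at 0)" by (simp add: mult.commute)
  qed
  then have "L / 2 = c" using q tendsto_unique by (metis trivial_limit_at)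
  then show "L = 2 * c" by simp
qed

lemma cos_cube: "(cos t) ^ 3 = (3 * cos t + cos (real 3 * t)) / 4" for t :: real
  using cos_treble_cos[of t] by simp

text \<open>
  On the branch the field is \<open>2 cos + O(s)\<close>, so \<open>M\<^sub>0 = 1 + O(s)\<close>
  and \<open>M\<^sub>2 = 1/2 + O(s)\<close>, which gives \<open>v\<^sub>1 = s / (2 (1 - R)) +
  O(s\<^sup>2)\<close>. The coefficient \<open>M\<^sub>1\<close> is itself of order
  \<open>s\<close> and is needed one order further: \<open>M\<^sub>1 = v\<^sub>0 R v\<^sub>1 + s
  / 2 + O(s\<^sup>2)\<close>. Inserting both into \<open>v\<^sub>0 = 1 + s\<^sup>2 M\<^sub>0 - s
  M\<^sub>1\<close> gives the claim.
\<close>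

lemma second_order:
  fixes v :: "real \<Rightarrow> nat \<Rightarrow> real"
  assumes b: "\<beta> > 0" and d: "0 < \<delta>" "\<delta> \<le> 1" and K: "0 \<le> K"
    and v: "\<And>s. \<bar>s\<bar> < \<delta> \<Longrightarrow> near 1 (cq (v s))"
    and fp: "\<And>s n. \<bar>s\<bar> < \<delta> \<Longrightarrow> s \<noteq> 0 \<Longrightarrow> TT \<beta> (of_real s) (cq (v s)) n = cq (v s) n"
    and lip: "\<And>s n. \<bar>s\<bar> < \<delta> \<Longrightarrow> norm (cq (v s) n - ee n) \<le> K * \<bar>s\<bar>"
  shows "\<exists>C. \<forall>s. \<bar>s\<bar> < \<delta> \<longrightarrow> \<bar>v s 0 - 1 - (1 - 2 * bessel_R \<beta>) / (2 * (1 - bessel_R \<beta>)) * s\<^sup>2\<bar> \<le> C * \<bar>s\<bar> ^ 3"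
proof -
  define R where "R = bessel_R \<beta>"
  have R: "0 \<le> R" "R < 1" using bessel_R_bounds[OF b] by (auto simp: R_def)
  define B where "B = 4 * Rs \<beta> + 2"
  have B: "B \<ge> 2" using Rs_nonneg[OF b] by (simp add: B_def)
  define L where "L = 6 * Rs \<beta> * K"
  have L: "L \<ge> 0" using Rs_nonneg[OF b] K by (simp add: L_def)
  define C0 where "C0 = 2 * B * L + B ^ 3 * exp B"
  have C0: "C0 \<ge> 0" using B L by (simp add: C0_def)
  define C1 where "C1 = L\<^sup>2 + 3 * B\<^sup>2 * L + B ^ 4 * exp B"
  have C1: "C1 \<ge> 0" using B L by (simp add: C1_def)
  define C2 where "C2 = (K * R * K + C0 + (1 + C0) * K) / (1 - R)"
  have C2: "C2 \<ge> 0" using K R C0 by (simp add: C2_def)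
  define C where "C = C0 + C1 + R * C2 + K * R * K"
  show ?thesis
  proof (intro exI[of _ C] allI impI)
    fix s :: real assume s: "\<bar>s\<bar> < \<delta>"
    show "\<bar>v s 0 - 1 - (1 - 2 * bessel_R \<beta>) / (2 * (1 - bessel_R \<beta>)) * s\<^sup>2\<bar> \<le> C * \<bar>s\<bar> ^ 3"
    proof (cases "s = 0")
      case True
      have "norm (cq (v 0) 0 - ee 0) \<le> 0" using lip[of 0 0] d by simp
      then have "cq (v 0) 0 = 1" by (simp add: ee_def)
      then show ?thesis using True by (simp add: cq_def)
    next
      case False
      have s1: "\<bar>s\<bar> \<le> 1" using s d by simp
      have vn: "near 1 (cq (v s))" by (rule v[OF s])
      define U where "U = pot (Ab \<beta> 1 (v s))"
      have aU: "adm (Ab \<beta> 1 (v s))" by (rule Ab_adm[OF b vn])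
      have UU: "complex_of_real (U t) = Uf \<beta> (cq (v s)) t" for t using pot_Ab[OF b vn, of 1 t] by (simp add: U_def)
      have sU: "pot (Ab \<beta> s (v s)) t = s * U t" for t
        by (subst Ab_scale) (simp add: pot_scale aU U_def)
      have Ub: "\<bar>U t\<bar> \<le> B" for t
      proof -
        have "norm (complex_of_real (U t)) \<le> 4 * Rs \<beta>" unfolding UU by (rule U_bound(3)[OF b vn order_refl])
        then show ?thesis by (simp add: B_def)
      qed
      have Ue: "Uf \<beta> ee t = complex_of_real (2 * cos t)" for t
      proof -
        have "(\<lambda>n. of_real (rr \<beta> n) * qhat ee n * complex_of_real (cos (real (n + 1) * t))) = (\<lambda>n. if n = 0 then complex_of_real (cos (real (n + 1) * t)) else 0)"
          by (auto simp: qhat_def ee_def rr_0[OF b])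
        then show ?thesis unfolding Uf_def using suminf_finite[of "{0}" "\<lambda>n. if n = 0 then complex_of_real (cos (real (n + 1) * t)) else 0"]
          by (simp add: ee_def)
      qed
      define D where "D t = U t - 2 * cos t" for t
      have Db: "\<bar>D t\<bar> \<le> L * \<bar>s\<bar>" for t
      proof -
        have "near 1 ee" by (simp add: near_def)
        then have "norm (Uf \<beta> (cq (v s)) t - Uf \<beta> ee t) \<le> 6 * Rs \<beta> * (K * \<bar>s\<bar>)"
          by (intro U_diff[OF b vn _ order_refl] lip s)
        moreover have "Uf \<beta> (cq (v s)) t - Uf \<beta> ee t = complex_of_real (D t)" by (simp add: UU[symmetric] Ue D_def)
        ultimately show ?thesis by (simp add: L_def mult_ac del: of_real_diff)
      qed
      define N where "N t = (exp (s * U t) - 1 - s * U t) / s\<^sup>2" for t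
      have M: "MR \<beta> s (v s) n = avg (\<lambda>t. N t * cos (real n * t))" for n
        by (simp add: MR_def sU N_def)
      have Uc: "continuous_on UNIV U" unfolding U_def by (rule pot_continuous[OF aU])
      have Nc: "continuous_on UNIV N" unfolding N_def[abs_def] using False by (intro continuous_intros Uc) auto
      have sB: "\<bar>s * U t\<bar> \<le> B" for t
        using mult_mono[OF s1 Ub[of t]] by (simp add: abs_mult)
      have tay: "\<bar>exp (s * U t) - (\<Sum>n<k. (s * U t) ^ n /\<^sub>R fact n)\<bar> \<le> \<bar>s\<bar> ^ k * (B ^ k * exp B)" for k t
      proof -
        have "\<bar>exp (s * U t) - (\<Sum>n<k. (s * U t) ^ n /\<^sub>R fact n)\<bar> \<le> \<bar>s * U t\<bar> ^ k * exp \<bar>s * U t\<bar>"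
          using exp_taylor[of "s * U t" k] by simp
        also have "\<dots> \<le> (\<bar>s\<bar> * B) ^ k * exp B"
          using Ub[of t] sB[of t] by (intro mult_mono power_mono) (auto simp: abs_mult mult_left_mono)
        finally show ?thesis by (simp add: power_mult_distrib mult.assoc)
      qed
      have N1: "\<bar>N t - (U t)\<^sup>2 / 2\<bar> \<le> \<bar>s\<bar> * (B ^ 3 * exp B)" for t
      proof -
        have "N t - (U t)\<^sup>2 / 2 = (exp (s * U t) - (\<Sum>n<3. (s * U t) ^ n /\<^sub>R fact n)) / s\<^sup>2"
          using False by (simp add: N_def eval_nat_numeral field_simps)
        also have "\<bar>\<dots>\<bar> \<le> (\<bar>s\<bar> ^ 3 * (B ^ 3 * exp B)) / s\<^sup>2" unfolding abs_divide using tay[of t 3] by (simp add: divide_right_mono)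
        also have "\<dots> = \<bar>s\<bar> * (B ^ 3 * exp B)" using False by (simp add: power2_eq_square power3_eq_cube mult.assoc[symmetric])
        finally show ?thesis .
      qed
      have N2: "\<bar>N t - (U t)\<^sup>2 / 2 - s * (U t) ^ 3 / 6\<bar> \<le> s\<^sup>2 * (B ^ 4 * exp B)" for t
      proof -
        have "N t - (U t)\<^sup>2 / 2 - s * (U t) ^ 3 / 6 = (exp (s * U t) - (\<Sum>n<4. (s * U t) ^ n /\<^sub>R fact n)) / s\<^sup>2"
          using False by (simp add: N_def eval_nat_numeral field_simps)
        also have "\<bar>\<dots>\<bar> \<le> (\<bar>s\<bar> ^ 4 * (B ^ 4 * exp B)) / s\<^sup>2" unfolding abs_divide using tay[of t 4] by (simp add: divide_right_mono)
        also have "\<dots> = s\<^sup>2 * (B ^ 4 * exp B)" using False by (simp add: power4_eq_xxxx power2_eq_square)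
        finally show ?thesis .
      qed
      have N0: "\<bar>N t - 2 * (cos t)\<^sup>2\<bar> \<le> C0 * \<bar>s\<bar>" for t
      proof -
        have "\<bar>(U t)\<^sup>2 / 2 - 2 * (cos t)\<^sup>2\<bar> = \<bar>D t\<bar> * \<bar>U t + 2 * cos t\<bar> / 2"
          unfolding abs_mult[symmetric] by (simp add: D_def power2_eq_square algebra_simps abs_if)
        also have "\<dots> \<le> (L * \<bar>s\<bar>) * (2 * B) / 2"
        proof (intro divide_right_mono mult_mono Db)
          have "\<bar>cos t\<bar> \<le> 1" by simp
          then show "\<bar>U t + 2 * cos t\<bar> \<le> 2 * B" using Ub[of t] B by linarith
        qed (use L in auto)
        also have "\<dots> \<le> (2 * B * L) * \<bar>s\<bar>" using L B by simp
        finally show ?thesis using N1[of t] by (simp add: C0_def algebra_simps)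
      qed
      have avgN: "\<bar>MR \<beta> s (v s) n - avg (\<lambda>t. 2 * (cos t)\<^sup>2 * cos (real n * t))\<bar> \<le> C0 * \<bar>s\<bar>" for n
      proof -
        have "integrable cm (\<lambda>t. N t * cos (real n * t))" "integrable cm (\<lambda>t. 2 * (cos t)\<^sup>2 * cos (real n * t))"
          by (intro integrable_cm_continuous continuous_intros Nc)+
        then have "MR \<beta> s (v s) n - avg (\<lambda>t. 2 * (cos t)\<^sup>2 * cos (real n * t)) = avg (\<lambda>t. (N t - 2 * (cos t)\<^sup>2) * cos (real n * t))"
          unfolding M by (simp add: left_diff_distrib)
        also have "norm \<dots> \<le> C0 * \<bar>s\<bar>"
        proof (rule avg_norm_le)
          fix t
          have "norm ((N t - 2 * (cos t)\<^sup>2) * cos (real n * t)) \<le> (C0 * \<bar>s\<bar>) * 1"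
            unfolding norm_mult using N0[of t] C0 by (intro mult_mono) auto
          then show "norm ((N t - 2 * (cos t)\<^sup>2) * cos (real n * t)) \<le> C0 * \<bar>s\<bar>" by simp
        qed
        finally show ?thesis by simp
      qed
      have c2: "2 * (cos t)\<^sup>2 = 1 + cos (real 2 * t)" for t :: real using cos_double_cos[of t] by simp
      have av: "avg (\<lambda>t. 2 * (cos t)\<^sup>2 * cos (real n * t)) = (if n = 0 then 1 else 0) + (if n = 2 then 1/2 else 0)" for n
      proof -
        have "integrable cm (\<lambda>t. cos (real 2 * t) * cos (real n * t))" by (intro integrable_cm_continuous continuous_intros)
        then have "avg (\<lambda>t. 2 * (cos t)\<^sup>2 * cos (real n * t)) = avg (\<lambda>t. cos (real n * t)) + avg (\<lambda>t. cos (real 2 * t) * cos (real n * t))"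
          unfolding c2 by (simp add: distrib_right)
        then show ?thesis unfolding avg_cos avg_cos_cos by auto
      qed
      have m0: "\<bar>MR \<beta> s (v s) 0 - 1\<bar> \<le> C0 * \<bar>s\<bar>" and m2: "\<bar>MR \<beta> s (v s) 2 - 1/2\<bar> \<le> C0 * \<bar>s\<bar>"
        using avgN[of 0, unfolded av] avgN[of 2, unfolded av] by simp_all
      have m1: "\<bar>MR \<beta> s (v s) 1 - (v s 0 * R * v s 1 + s / 2)\<bar> \<le> C1 * s\<^sup>2"
      proof -
        \<comment> \<open>Expand \<open>(U\<^sup>2 / 2 + s U\<^sup>3 / 6) cos\<close> around \<open>U = 2 cos\<close>: linearly in the first term, at order zero in the second.\<close>
        define E where "E t = U t + U t * cos (real 2 * t) - 2 * cos t ^ 3 + 4 / 3 * s * cos t ^ 4" for t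
        have Ec: "continuous_on UNIV E" unfolding E_def[abs_def] by (intro continuous_intros Uc)
        have i: "integrable cm U" "integrable cm (\<lambda>t. U t * cos (real 2 * t))" "integrable cm (\<lambda>t. cos t ^ 3)" "integrable cm (\<lambda>t. cos t ^ 4)" "integrable cm cos"
          by (intro integrable_cm_continuous continuous_intros Uc)+
        have c3: "avg (\<lambda>t. cos t ^ 3) = 0"
          unfolding cos_cube using avg_cos[of 1] avg_cos[of 3] i(5) integrable_cos_nat[of 3] by simp
        have c4: "avg (\<lambda>t. cos t ^ 4) = 3 / 8"
        proof -
          have cp: "cos t ^ 4 = (1 + 2 * cos (real 2 * t) + cos (real 2 * t) * cos (real 2 * t)) / 4" for t :: real
          proof -
            have "4 * cos t ^ 4 = (2 * (cos t)\<^sup>2)\<^sup>2" by (simp add: power_mult_distrib flip: power_mult)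
            then show ?thesis unfolding c2 by (simp add: power2_eq_square algebra_simps)
          qed
          have "integrable cm (\<lambda>t. cos (real 2 * t) * cos (real 2 * t))" by (intro integrable_cm_continuous continuous_intros)
          then show ?thesis unfolding cp using avg_cos[of 2] avg_cos_cos[of 2 2] integrable_cos_nat[of 2] by simp
        qed
        have "avg (\<lambda>t. U t * cos (real 2 * t)) = v s 0 * R * v s 1"
          using mode_pot[OF aU, of "2 * 1"] unfolding tb_even Ab_even[OF b] by (simp add: U_def rr_1[unfolded One_nat_def] R_def)
        then have Ea: "avg E = v s 0 * R * v s 1 + s / 2"
          unfolding E_def[abs_def] using i c3 c4 avg_pot[OF aU] by (simp add: U_def)
        have "integrable cm (\<lambda>t. N t * cos t)" "integrable cm E"
          by (intro integrable_cm_continuous continuous_intros Nc Ec)+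
        then have "MR \<beta> s (v s) 1 - avg E = avg (\<lambda>t. N t * cos t - E t)" unfolding M by simp
        also have "norm \<dots> \<le> C1 * s\<^sup>2"
        proof (rule avg_norm_le)
          fix t :: real
          define c where "c = cos t"
          have cb: "\<bar>c\<bar> \<le> 1" by (simp add: c_def)
          have cc: "cos (real 2 * t) = 2 * c\<^sup>2 - 1" using c2[of t] by (simp add: c_def)
          have "N t * cos t - E t = (N t - (U t)\<^sup>2 / 2 - s * (U t) ^ 3 / 6) * c + ((D t)\<^sup>2 / 2) * c + (s / 6 * c) * ((U t) ^ 3 - (2 * c) ^ 3)"
            unfolding E_def cc D_def c_def[symmetric] by (simp add: power2_eq_square power3_eq_cube eval_nat_numeral field_simps)
          also have "\<bar>\<dots>\<bar> \<le> \<bar>N t - (U t)\<^sup>2 / 2 - s * (U t) ^ 3 / 6\<bar> * \<bar>c\<bar> + \<bar>(D t)\<^sup>2 / 2\<bar> * \<bar>c\<bar> + \<bar>s / 6 * c\<bar> * \<bar>(U t) ^ 3 - (2 * c) ^ 3\<bar>"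
            unfolding abs_mult[symmetric] by linarith
          also have "\<dots> \<le> (s\<^sup>2 * (B ^ 4 * exp B)) * 1 + (L * \<bar>s\<bar>)\<^sup>2 * 1 + \<bar>s\<bar> * (L * \<bar>s\<bar> * (3 * B\<^sup>2))"
          proof (intro add_mono mult_mono N2 cb)
            have "(D t)\<^sup>2 \<le> (L * \<bar>s\<bar>)\<^sup>2" using Db[of t] by (simp add: abs_le_square_iff[symmetric] abs_mult L)
            moreover have "0 \<le> (D t)\<^sup>2" by simp
            ultimately show "\<bar>(D t)\<^sup>2 / 2\<bar> \<le> (L * \<bar>s\<bar>)\<^sup>2" by linarith
            have "\<bar>s\<bar> * \<bar>c\<bar> \<le> \<bar>s\<bar> * 1" using cb by (intro mult_left_mono) auto
            then show "\<bar>s / 6 * c\<bar> \<le> \<bar>s\<bar>" by (simp add: abs_mult)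
            have cB: "\<bar>2 * c\<bar> \<le> B" using cb B by (simp add: abs_mult)
            have "\<bar>(U t) ^ 3 - (2 * c) ^ 3\<bar> = \<bar>D t\<bar> * \<bar>(U t)\<^sup>2 + U t * (2 * c) + (2 * c)\<^sup>2\<bar>"
              unfolding abs_mult[symmetric] D_def c_def[symmetric] by (simp add: power2_eq_square power3_eq_cube algebra_simps)
            also have "\<dots> \<le> (L * \<bar>s\<bar>) * (B\<^sup>2 + B * B + B\<^sup>2)"
            proof (intro mult_mono Db)
              have "(U t)\<^sup>2 \<le> B\<^sup>2" "(2 * c)\<^sup>2 \<le> B\<^sup>2" using Ub[of t] cB B abs_le_square_iff[of "U t" B] abs_le_square_iff[of "2 * c" B] by linarith+
              moreover have "\<bar>U t * (2 * c)\<bar> \<le> B * B" unfolding abs_mult[of "U t"] using Ub[of t] cB B by (intro mult_mono) auto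
              moreover have "0 \<le> (U t)\<^sup>2" "0 \<le> (2 * c)\<^sup>2" by simp_all
              ultimately show "\<bar>(U t)\<^sup>2 + U t * (2 * c) + (2 * c)\<^sup>2\<bar> \<le> B\<^sup>2 + B * B + B\<^sup>2" by linarith
            qed (use L in auto)
            finally show "\<bar>(U t) ^ 3 - (2 * c) ^ 3\<bar> \<le> (L * \<bar>s\<bar>) * (3 * B\<^sup>2)" by (simp add: power2_eq_square)
          qed (use B L in auto)
          finally show "norm (N t * cos t - E t) \<le> C1 * s\<^sup>2" by (simp add: C1_def algebra_simps power2_eq_square)
        qed
        finally show ?thesis by (simp add: Ea)
      qed
      define n0 where "n0 = MR \<beta> s (v s) 0"
      define n1 where "n1 = MR \<beta> s (v s) 1"
      define n2 where "n2 = MR \<beta> s (v s) 2"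
      define x where "x = v s 0 - 1"
      define y where "y = v s 1"
      define a where "a = \<bar>s\<bar>"
      define w where "w = s / (2 * (1 - R))"
      have a: "0 \<le> a" "a \<le> 1" "\<bar>s\<bar> = a" "s\<^sup>2 = a * a" using s1 by (auto simp: a_def power2_eq_square abs_mult_self_eq)
      have x: "\<bar>x\<bar> \<le> K * a" and y: "\<bar>y\<bar> \<le> K * a"
        using near_cqD[of "K * a" "v s"] lip[OF s] unfolding near_def a_def x_def y_def by simp_all
      have F0: "x = s\<^sup>2 * n0 - s * n1"
        using fp[OF s False, of 0] unfolding TT_real[OF b vn False] by (simp add: x_def n0_def n1_def algebra_simps power2_eq_square)
      have F1: "(1 + x) * R * y + s * n2 - s\<^sup>2 * n0 * y = y"
        using fp[OF s False, of 1] unfolding TT_real[OF b vn False]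
        by (simp add: x_def n0_def n2_def y_def rr_1[unfolded One_nat_def] R_def algebra_simps power2_eq_square numeral_2_eq_2)
      have n0: "\<bar>n0\<bar> \<le> 1 + C0"
      proof -
        have "C0 * a \<le> C0 * 1" using a C0 by (intro mult_left_mono) auto
        then show ?thesis using m0 unfolding n0_def[symmetric] a by linarith
      qed
      have xy: "\<bar>x * R * y\<bar> \<le> K * R * K * (a * a)"
      proof -
        have "\<bar>x * R * y\<bar> = R * (\<bar>x\<bar> * \<bar>y\<bar>)" using R by (simp add: abs_mult)
        also have "\<dots> \<le> R * ((K * a) * (K * a))" using x y R by (intro mult_left_mono mult_mono) auto
        finally show ?thesis by (simp add: mult_ac)
      qed
      have yw: "\<bar>y - w\<bar> \<le> C2 * (a * a)"
      proof -
        have "(y - w) * (1 - R) = y * (1 - R) - s / 2" using R by (simp add: w_def left_diff_distrib field_simps)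
        also have "\<dots> = x * R * y + s * (n2 - 1/2) - s\<^sup>2 * (n0 * y)" using F1 by (simp add: algebra_simps)
        also have "\<bar>\<dots>\<bar> \<le> \<bar>x * R * y\<bar> + a * \<bar>n2 - 1/2\<bar> + (a * a) * (\<bar>n0\<bar> * \<bar>y\<bar>)"
        proof -
          have "\<bar>s * (n2 - 1/2)\<bar> = a * \<bar>n2 - 1/2\<bar>" "\<bar>s\<^sup>2 * (n0 * y)\<bar> = (a * a) * (\<bar>n0\<bar> * \<bar>y\<bar>)"
            using a by (simp_all add: abs_mult)
          then show ?thesis by linarith
        qed
        also have "\<dots> \<le> K * R * K * (a * a) + a * (C0 * a) + (a * a) * ((1 + C0) * K)"
        proof (intro add_mono xy mult_left_mono mult_mono n0)
          show "\<bar>n2 - 1/2\<bar> \<le> C0 * a" using m2 unfolding n2_def[symmetric] a .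
          have "K * a \<le> K * 1" using a K by (intro mult_left_mono) auto
          then show "\<bar>y\<bar> \<le> K" using y by linarith
        qed (use a C0 in auto)
        also have "\<dots> = (C2 * (a * a)) * (1 - R)" using R by (simp add: C2_def field_simps)
        finally have "\<bar>y - w\<bar> * (1 - R) \<le> (C2 * (a * a)) * (1 - R)" using R by (simp add: abs_mult)
        then show ?thesis using R by simp
      qed
      define P where "P = (1 + x) * R * y + s / 2"
      have nP: "\<bar>n1 - P\<bar> \<le> C1 * (a * a)" using m1 unfolding n1_def[symmetric] a P_def by (simp add: x_def y_def)
      have c: "(1 - 2 * R) / (2 * (1 - R)) * s\<^sup>2 = s\<^sup>2 / 2 - s * (R * w)"
        using R by (simp add: w_def power2_eq_square field_simps)
      have "x - (1 - 2 * R) / (2 * (1 - R)) * s\<^sup>2 = s\<^sup>2 * (n0 - 1) - s * (n1 - P) - s * (R * (y - w)) - s * (x * R * y)"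
        unfolding c using F0 by (simp add: P_def algebra_simps power2_eq_square)
      also have "\<bar>\<dots>\<bar> \<le> (a * a) * \<bar>n0 - 1\<bar> + a * \<bar>n1 - P\<bar> + a * (R * \<bar>y - w\<bar>) + a * \<bar>x * R * y\<bar>"
      proof -
        have "\<bar>s\<^sup>2 * (n0 - 1)\<bar> = (a * a) * \<bar>n0 - 1\<bar>" "\<bar>s * (n1 - P)\<bar> = a * \<bar>n1 - P\<bar>" "\<bar>s * (R * (y - w))\<bar> = a * (R * \<bar>y - w\<bar>)"
          "\<bar>s * (x * R * y)\<bar> = a * \<bar>x * R * y\<bar>"
          using R a by (simp_all add: abs_mult)
        then show ?thesis by linarith
      qed
      also have "\<dots> \<le> (a * a) * (C0 * a) + a * (C1 * (a * a)) + a * (R * (C2 * (a * a))) + a * (K * R * K * (a * a))"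
        using m0 unfolding n0_def[symmetric] a by (intro add_mono mult_left_mono nP yw xy) (use a R in auto)
      also have "\<dots> = C * \<bar>s\<bar> ^ 3" unfolding a by (simp add: C_def power3_eq_cube algebra_simps)
      finally show ?thesis by (simp add: x_def R_def)
    qed
  qed
qed

section \<open>The branch as a curve of densities\<close>

text \<open>
  By uniqueness and the conjugation symmetry the complex branch is real on the real axis, and
  derivatives along the axis are those of holomorphic functions.
\<close>

lemma real_branch:
  assumes b: "\<beta> > 0"
  obtains v :: "real \<Rightarrow> nat \<Rightarrow> real" and f' f'' :: "real \<Rightarrow> real" and \<delta> \<eta> K where
    "0 < \<delta>" "\<delta> \<le> 1" "0 < \<eta>" "\<eta> \<le> 1/4" "0 \<le> K"
    "\<And>s. \<bar>s\<bar> < \<delta> \<Longrightarrow> near \<eta> (cq (v s))"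
    "\<And>s n. \<bar>s\<bar> < \<delta> \<Longrightarrow> TT \<beta> (of_real s) (cq (v s)) n = cq (v s) n"
    "\<And>n. v 0 n = (if n = 0 then 1 else 0)"
    "\<And>s t n. \<bar>s\<bar> < \<delta> \<Longrightarrow> \<bar>t\<bar> < \<delta> \<Longrightarrow> \<bar>v s n - v t n\<bar> \<le> K * \<bar>s - t\<bar>"
    "\<And>s w. \<bar>s\<bar> < \<delta> \<Longrightarrow> near \<eta> (cq w) \<Longrightarrow> (\<And>n. TT \<beta> (of_real s) (cq w) n = cq w n) \<Longrightarrow> w = v s"
    "\<And>s. \<bar>s\<bar> < \<delta> \<Longrightarrow> ((\<lambda>s. v s 0) has_real_derivative f' s) (at s)"
    "\<And>s. \<bar>s\<bar> < \<delta> \<Longrightarrow> (f' has_real_derivative f'' s) (at s)"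
proof (rule branch_exists[OF b])
  fix q :: "complex \<Rightarrow> nat \<Rightarrow> complex" and \<delta> \<eta> K :: real
  assume d: "0 < \<delta>" "\<delta> \<le> 1" "0 < \<eta>" "\<eta> \<le> 1/4" "0 \<le> K"
    and nq: "\<And>s. norm s < \<delta> \<Longrightarrow> near \<eta> (q s)"
    and fq: "\<And>s n. norm s < \<delta> \<Longrightarrow> TT \<beta> s (q s) n = q s n"
    and hq: "\<And>n. (\<lambda>s. q s n) holomorphic_on ball 0 \<delta>" and q0: "\<And>n. q 0 n = ee n"
    and lq: "\<And>s s' n. norm s < \<delta> \<Longrightarrow> norm s' < \<delta> \<Longrightarrow> norm (q s n - q s' n) \<le> K * norm (s - s')"
    and uq: "\<And>s p n. norm s < \<delta> \<Longrightarrow> near \<eta> p \<Longrightarrow> (\<And>n. TT \<beta> s p n = p n) \<Longrightarrow> p n = q s n"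
  define v where "v s n = Re (q (of_real s) n)" for s n
  have re: "cq (v s) = q (of_real s)" if s: "\<bar>s\<bar> < \<delta>" for s
  proof
    fix n
    have ns: "norm (complex_of_real s) < \<delta>" using s by simp
    have n1: "near 1 (q (of_real s))" using nq[OF ns] d(4) near_mono[of \<eta> _ 1] by simp
    have "norm (cnj (q (of_real s) n) - ee n) = norm (q (of_real s) n - ee n)" for n
    proof -
      have "cnj (q (of_real s) n - ee n) = cnj (q (of_real s) n) - ee n" by (simp add: ee_def)
      then show ?thesis by (metis complex_mod_cnj)
    qed
    then have "near \<eta> (\<lambda>n. cnj (q (of_real s) n))" using nq[OF ns] by (simp add: near_def)
    then have "cnj (q (of_real s) n) = q (of_real s) n"
      by (rule uq[OF ns]) (use TT_cnj[OF b n1, of "of_real s"] fq[OF ns] in simp)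
    then show "cq (v s) n = q (of_real s) n" by (simp add: cq_def v_def complex_eq_iff)
  qed
  define g where "g s = q s 0" for s
  have gh: "g holomorphic_on ball 0 \<delta>" unfolding g_def[abs_def] by (rule hq)
  have dh: "deriv g holomorphic_on ball 0 \<delta>" by (rule holomorphic_deriv[OF gh open_ball])
  have rd: "((\<lambda>s. Re (h (of_real s))) has_real_derivative Re (deriv h (of_real s))) (at s)"
    if h: "h holomorphic_on ball 0 \<delta>" and s: "\<bar>s\<bar> < \<delta>" for h s
  proof -
    have "(h has_field_derivative deriv h (of_real s)) (at (of_real s))"
      by (rule holomorphic_derivI[OF h open_ball]) (use s in simp)
    then have "((\<lambda>x. h (of_real x)) has_vector_derivative deriv h (of_real s)) (at s)"
      by (rule has_vector_derivative_real_field)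
    from bounded_linear.has_vector_derivative[OF bounded_linear_Re this]
    show ?thesis by (simp add: has_real_derivative_iff_has_vector_derivative)
  qed
  show thesis
  proof (rule that[of \<delta> \<eta> K v "\<lambda>s. Re (deriv g (of_real s))" "\<lambda>s. Re (deriv (deriv g) (of_real s))"])
    show "near \<eta> (cq (v s))" if "\<bar>s\<bar> < \<delta>" for s using re[OF that] nq[of "of_real s"] that by simp
    show "TT \<beta> (of_real s) (cq (v s)) n = cq (v s) n" if "\<bar>s\<bar> < \<delta>" for s n using re[OF that] fq[of "of_real s"] that by simp
    show "v 0 n = (if n = 0 then 1 else 0)" for n by (simp add: v_def q0 ee_def)
    show "\<bar>v s n - v t n\<bar> \<le> K * \<bar>s - t\<bar>" if "\<bar>s\<bar> < \<delta>" "\<bar>t\<bar> < \<delta>" for s t n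
    proof -
      have "\<bar>v s n - v t n\<bar> \<le> norm (q (of_real s) n - q (of_real t) n)" using abs_Re_le_cmod[of "q (of_real s) n - q (of_real t) n"] by (simp add: v_def)
      also have "\<dots> \<le> K * norm (complex_of_real s - of_real t)" by (rule lq) (use that in auto)
      also have "norm (complex_of_real s - of_real t) = \<bar>s - t\<bar>" unfolding of_real_diff[symmetric] by (rule norm_of_real)
      finally show ?thesis .
    qed
    show "w = v s" if s: "\<bar>s\<bar> < \<delta>" and w: "near \<eta> (cq w)" "\<And>n. TT \<beta> (of_real s) (cq w) n = cq w n" for s w
    proof
      fix n
      have "cq w n = q (of_real s) n" by (rule uq[OF _ w]) (use s in simp)
      then show "w n = v s n" by (simp add: v_def cq_def complex_eq_iff)
    qed
    show "((\<lambda>s. v s 0) has_real_derivative Re (deriv g (of_real s))) (at s)" if "\<bar>s\<bar> < \<delta>" for s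
      using rd[OF gh that] by (simp add: v_def g_def)
    show "((\<lambda>s. Re (deriv g (of_real s))) has_real_derivative Re (deriv (deriv g) (of_real s))) (at s)" if "\<bar>s\<bar> < \<delta>" for s
      using rd[OF dh that] .
  qed (fact d)+
qed

lemma branch_density:
  assumes b: "\<beta> > 0" and v: "near 1 (cq v)" and s: "s \<noteq> 0"
    and fp: "\<And>n. TT \<beta> (of_real s) (cq v) n = cq v n"
  shows "mode (gibbs (Ab \<beta> s v)) = Zm s v" "nontrivial_even_stationary \<beta> (kappa_star \<beta> * v 0) (gibbs (Ab \<beta> s v))"
proof -
  have a: "adm (Ab \<beta> s v)" by (rule Ab_adm[OF b v])
  show m: "mode (gibbs (Ab \<beta> s v)) = Zm s v"
  proof
    fix j show "mode (gibbs (Ab \<beta> s v)) j = Zm s v j"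
    proof (cases "even j")
      case True
      then obtain n where "j = 2 * n" by blast
      then show ?thesis using fp fixed_iff[OF b v s] by blast
    next
      case False
      then show ?thesis using mode_gibbs_odd[OF a Ab_odd] by (simp add: Zm_def)
    qed
  qed
  have "selfcons \<beta> (kappa_star \<beta> * v 0) (gibbs (Ab \<beta> s v))"
    unfolding selfcons_def m Ab_def[symmetric] using gibbs_density[OF a] by simp
  moreover have "gibbs (Ab \<beta> s v) (2 * pi - t) = gibbs (Ab \<beta> s v) t" for t
    using pot_periodic(1)[of "Ab \<beta> s v" "- t"] pot_even[of "Ab \<beta> s v" t] by (simp add: gibbs_def Ab_odd)
  moreover have "\<not> is_uniform (gibbs (Ab \<beta> s v))"
  proof
    assume "is_uniform (gibbs (Ab \<beta> s v))"
    then have "mode (gibbs (Ab \<beta> s v)) 0 = 0" using mode_cong[OF gibbs_cm[OF a], of "\<lambda>_. 1"] by (simp add: is_uniform_cm mode_uniform)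
    then show False using s by (simp add: m Zm_def)
  qed
  ultimately show "nontrivial_even_stationary \<beta> (kappa_star \<beta> * v 0) (gibbs (Ab \<beta> s v))"
    by (simp add: nontrivial_even_stationary_def even_on_circle_def stationary_iff_selfcons[OF b])
qed

lemma Ab_diff:
  assumes b: "\<beta> > 0" and v: "near 1 (cq v)" and w: "near 1 (cq w)" and s: "\<bar>s\<bar> \<le> 1"
    and d: "\<And>n. \<bar>v n - w n\<bar> \<le> d"
  shows "pnorm (\<lambda>j. Ab \<beta> s v j - Ab \<beta> t w j) \<le> kappa_star \<beta> * (Lam \<beta> * (3 * d + 2 * \<bar>s - t\<bar>))"
proof -
  define y where "y j = v 0 * Zm s v j - w 0 * Zm t w j" for j
  have d0: "0 \<le> d" using d[of 0] by linarith
  have y: "\<bar>y j\<bar> \<le> 3 * d + 2 * \<bar>s - t\<bar>" for j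
  proof -
    have 1: "\<bar>Zm s v j - Zm t w j\<bar> \<le> d + \<bar>s - t\<bar>"
    proof (cases "even j \<and> j \<noteq> 0")
      case True
      then have j: "j div 2 \<ge> 1" by (auto elim!: evenE)
      have "Zm s v j - Zm t w j = s * (v (j div 2) - w (j div 2)) + (s - t) * w (j div 2)"
        using True by (simp add: Zm_def algebra_simps)
      also have "\<bar>\<dots>\<bar> \<le> \<bar>s\<bar> * \<bar>v (j div 2) - w (j div 2)\<bar> + \<bar>s - t\<bar> * \<bar>w (j div 2)\<bar>"
        unfolding abs_mult[symmetric] by (rule abs_triangle_ineq)
      also have "\<dots> \<le> 1 * d + \<bar>s - t\<bar> * 1" using near_cqD(2)[OF w j] s d by (intro add_mono mult_mono) auto
      finally show ?thesis by simp
    qed (use d0 in \<open>auto simp: Zm_def\<close>)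
    have "y j = (v 0 - w 0) * Zm s v j + w 0 * (Zm s v j - Zm t w j)" by (simp add: y_def algebra_simps)
    also have "\<bar>\<dots>\<bar> \<le> \<bar>v 0 - w 0\<bar> * \<bar>Zm s v j\<bar> + \<bar>w 0\<bar> * \<bar>Zm s v j - Zm t w j\<bar>"
      unfolding abs_mult[symmetric] by (rule abs_triangle_ineq)
    also have "\<dots> \<le> d * 1 + 2 * (d + \<bar>s - t\<bar>)"
      using order_trans[OF Zm_le[OF v] s] near_cqD(1)[OF w] d d0 1 by (intro add_mono mult_mono) auto
    finally show ?thesis by simp
  qed
  have "(\<lambda>j. Ab \<beta> s v j - Ab \<beta> t w j) = coef \<beta> (kappa_star \<beta>) y"
    by (rule ext) (simp add: Ab_def coef_def y_def algebra_simps)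
  then show ?thesis using coef_adm_bound(2)[OF b y, of "kappa_star \<beta>"] kappa_star_pos[OF b] by simp
qed

text \<open>
  The trigonometric polynomial with the modes of \<open>f\<close> is its orthogonal projection.
\<close>

lemma bessel_inequality:
  assumes f: "continuous_on UNIV f" and B: "\<And>t. \<bar>f t\<bar> \<le> B"
  shows "(\<Sum>j<N. (mode f j)\<^sup>2) \<le> B\<^sup>2"
proof -
  define a where "a j = (if j < N then 2 * mode f j else 0)" for j
  have a: "adm a" unfolding adm_def a_def by (rule summable_finite[of "{..<N}"]) auto
  define Q where "Q = (\<Sum>j<N. (mode f j)\<^sup>2)"
  have s: "(\<lambda>j. a j * c j) sums (\<Sum>j<N. a j * c j)" for c by (rule sums_finite) (auto simp: a_def)
  have i: "integrable cm f" "integrable cm (pot a)" by (intro integrable_cm_continuous f pot_continuous a)+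
  have 1: "avg (\<lambda>t. f t * pot a t) = 2 * Q"
    using sums_unique2[OF avg_mult_pot(1)[OF i(1) a] s] by (simp add: a_def Q_def sum_distrib_left power2_eq_square mult_ac)
  have "avg (\<lambda>t. pot a t * pot a t) = (\<Sum>j<N. a j * mode (pot a) j)"
    by (rule sums_unique2[OF avg_mult_pot(1)[OF i(2) a] s])
  also have "\<dots> = 2 * Q" unfolding mode_def mode_pot[OF a] by (simp add: a_def Q_def sum_distrib_left power2_eq_square mult_ac)
  finally have 2: "avg (\<lambda>t. pot a t * pot a t) = 2 * Q" .
  have i2: "integrable cm (\<lambda>t. f t * f t)" "integrable cm (\<lambda>t. f t * pot a t)" "integrable cm (\<lambda>t. pot a t * pot a t)"
    by (intro integrable_cm_continuous continuous_intros f pot_continuous a)+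
  have "0 \<le> avg (\<lambda>t. (f t - pot a t)\<^sup>2)" by (rule integral_nonneg_AE) simp
  also have "\<dots> = avg (\<lambda>t. f t * f t - 2 * (f t * pot a t) + pot a t * pot a t)"
    by (simp add: power2_eq_square algebra_simps)
  also have "\<dots> = avg (\<lambda>t. f t * f t) - 2 * Q" using i2 1 2 by simp
  finally have 3: "2 * Q \<le> avg (\<lambda>t. f t * f t)" by simp
  have "norm (avg (\<lambda>t. f t * f t)) \<le> B\<^sup>2"
  proof (rule avg_norm_le)
    show "norm (f t * f t) \<le> B\<^sup>2" for t
      using mult_mono[OF B[of t] B[of t]] B[of t] by (simp add: power2_eq_square abs_mult)
  qed
  moreover have "0 \<le> Q" unfolding Q_def by (intro sum_nonneg) auto
  ultimately show ?thesis using 3 by (simp add: Q_def)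
qed

text \<open>
  The weighted sum of squares is the sum of squares of the modes of a derivative. Bessel's
  inequality for \<open>p' + 2 s sin\<close>, which is \<open>O(s\<^sup>2)\<close> uniformly,
  bounds it without any decay estimate for the modes.
\<close>

lemma branch_mode_norm:
  assumes b: "\<beta> > 0" and v: "near 1 (cq v)" and s: "s \<noteq> 0" "\<bar>s\<bar> \<le> 1" and K: "0 \<le> K"
    and fp: "\<And>n. TT \<beta> (of_real s) (cq v) n = cq v n"
    and lip: "\<And>n. \<bar>v n - (if n = 0 then 1 else 0)\<bar> \<le> K * \<bar>s\<bar>"
  defines "H \<equiv> kappa_star \<beta> * Lam \<beta>"
  shows "\<bar>mode_norm (\<lambda>l. fourier_mode (gibbs (Ab \<beta> s v)) l - (if l = 1 then s else 0))\<bar>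
     \<le> 2 * ((3 * H * K * exp (2 * H) + 2 * (2 * exp (2 * (2 * H)) * (1 + 2 * H) * (2 * H))) * s\<^sup>2)"
proof -
  define a where "a = Ab \<beta> s v"
  define u where "u = Ab \<beta> 1 v"
  define e where "e = Ab \<beta> 1 (\<lambda>n. if n = 0 then 1 else 0)"
  have H: "0 \<le> H" unfolding H_def using kappa_star_pos[OF b] Lam_nonneg[OF b] by simp
  have ne: "near 1 (cq (\<lambda>n. if n = 0 then 1 else 0))" by (rule near_cqI) auto
  have a: "adm a" "adm u" "adm e" unfolding a_def u_def e_def by (rule Ab_adm[OF b v] Ab_adm[OF b ne])+
  have pa: "pnorm a \<le> 2 * H * \<bar>s\<bar>" unfolding a_def H_def using Ab_adm(2)[OF b v, of s] by (simp add: mult.assoc)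
  have "2 * H * \<bar>s\<bar> \<le> 2 * H * 1" using s H by (intro mult_left_mono) auto
  then have pa2: "pnorm a \<le> 2 * H" using pa by simp
  have g1: "\<bar>gibbs a y - 1\<bar> \<le> 2 * exp (2 * (2 * H)) * (1 + 2 * H) * (2 * H * \<bar>s\<bar>)" for y
  proof -
    have "\<bar>gibbs a y - gibbs (\<lambda>_. 0) y\<bar> \<le> 2 * exp (2 * (2 * H)) * (1 + 2 * H) * pnorm (\<lambda>j. a j - 0)"
      by (rule gibbs_lipschitz(1)[OF a(1) pa2]) (use H in auto)
    also have "\<dots> \<le> 2 * exp (2 * (2 * H)) * (1 + 2 * H) * (2 * H * \<bar>s\<bar>)" using pa H by (intro mult_left_mono) auto
    finally show ?thesis by simp
  qed
  have e_eq: "e = (\<lambda>j. if j = 0 then 2 else 0)"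
  proof
    fix j :: nat
    have "j div 2 \<noteq> 0" if "even j" "j \<noteq> 0" using that by (auto elim!: evenE)
    then show "e j = (if j = 0 then 2 else 0)"
      using kappa_star_pos[OF b] by (auto simp: e_def Ab_def coef_def Zm_def wt_first[OF b])
  qed
  have pe: "pot' e y = - 2 * sin y" for y
  proof -
    have "pot' e y = (\<Sum>j\<in>{0}. e j * (real (freq j) * tb' j y))"
      unfolding pot'_def by (rule suminf_finite) (auto simp: e_eq)
    then show ?thesis by (simp add: e_eq freq_def tb'_def)
  qed
  have pu: "\<bar>pot' u y + 2 * sin y\<bar> \<le> 3 * H * (K * \<bar>s\<bar>)" for y
  proof -
    have "\<bar>pot' (\<lambda>j. u j - e j) y\<bar> \<le> pnorm (\<lambda>j. u j - e j)" by (rule pot'_le[OF adm_diff[OF a(2,3)]])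
    also have "\<dots> \<le> kappa_star \<beta> * (Lam \<beta> * (3 * (K * \<bar>s\<bar>) + 2 * \<bar>1 - 1\<bar>))"
      unfolding u_def e_def by (rule Ab_diff[OF b v ne _ lip]) simp
    finally show ?thesis by (simp add: pot'_diff a pe H_def mult_ac)
  qed
  define D where "D = (3 * H * K * exp (2 * H) + 2 * (2 * exp (2 * (2 * H)) * (1 + 2 * H) * (2 * H))) * s\<^sup>2"
  define h where "h y = gibbs' a y + 2 * s * sin y" for y
  have hc: "continuous_on UNIV h" unfolding h_def[abs_def] by (intro continuous_intros gibbs'_continuous a)
  have hb: "\<bar>h y\<bar> \<le> D" for y
  proof -
    have au: "a = (\<lambda>j. s * u j)" unfolding a_def u_def by (rule Ab_scale)
    have "pot' a y = s * pot' u y" unfolding au by (rule pot'_scale[OF a(2)])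
    then have "h y = s * ((pot' u y + 2 * sin y) * gibbs a y - 2 * sin y * (gibbs a y - 1))"
      by (simp add: h_def gibbs'_def algebra_simps)
    also have "\<bar>\<dots>\<bar> \<le> \<bar>s\<bar> * (\<bar>pot' u y + 2 * sin y\<bar> * \<bar>gibbs a y\<bar> + \<bar>2 * sin y\<bar> * \<bar>gibbs a y - 1\<bar>)"
      unfolding abs_mult[of s] abs_mult[symmetric, of "_ + _"] abs_mult[symmetric, of "2 * _"] by (intro mult_left_mono abs_triangle_ineq4) simp
    also have "\<dots> \<le> \<bar>s\<bar> * ((3 * H * (K * \<bar>s\<bar>)) * exp (2 * H) + 2 * (2 * exp (2 * (2 * H)) * (1 + 2 * H) * (2 * H * \<bar>s\<bar>)))"
      using gibbs_le[OF a(1) pa2, of y] gibbs_pos[OF a(1), of y] H K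
      by (intro mult_left_mono add_mono mult_mono pu g1) (auto simp: abs_mult)
    also have "\<dots> = (3 * H * K * exp (2 * H) + 2 * (2 * exp (2 * (2 * H)) * (1 + 2 * H) * (2 * H))) * (\<bar>s\<bar> * \<bar>s\<bar>)" by (simp add: algebra_simps)
    finally show ?thesis by (simp add: D_def power2_eq_square)
  qed
  have D0: "0 \<le> D" using hb[of 0] by linarith
  define x where "x l = fourier_mode (gibbs a) l - (if l = 1 then s else 0)" for l
  have x: "real (Suc n) * x (Suc n) = - mode h (2 * n + 1)" for n
  proof -
    have sc: "tb (2 * n + 1) y = sin (real (Suc n) * y)" for y by (simp add: tb_def freq_def)
    have "avg (\<lambda>y. sin (real (Suc n) * y) * gibbs' a y) = - avg (\<lambda>y. (cos (real (Suc n) * y) * real (Suc n)) * gibbs a y)"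
      by (rule avg_by_parts)
         (auto intro!: derivative_eq_intros gibbs_deriv a continuous_intros gibbs'_continuous simp: gibbs_periodic simp del: of_nat_Suc)
    also have "\<dots> = - avg (\<lambda>y. real (Suc n) * (gibbs a y * cos (real (Suc n) * y)))" by (simp only: mult_ac)
    also have "\<dots> = - (real (Suc n) * fourier_mode (gibbs a) (Suc n))"
      unfolding fourier_mode_def LINT_eq_avg by (simp del: of_nat_Suc)
    finally have 1: "avg (\<lambda>y. sin (real (Suc n) * y) * gibbs' a y) = - (real (Suc n) * fourier_mode (gibbs a) (Suc n))" .
    have i: "integrable cm (\<lambda>y. sin (real (Suc n) * y) * gibbs' a y)" "integrable cm (\<lambda>y. sin (real 1 * y) * sin (real (Suc n) * y))"
      by (intro integrable_cm_continuous continuous_intros gibbs'_continuous a)+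
    have "mode h (2 * n + 1) = avg (\<lambda>y. sin (real (Suc n) * y) * gibbs' a y + 2 * s * (sin (real 1 * y) * sin (real (Suc n) * y)))"
      unfolding mode_def sc h_def by (rule Bochner_Integration.integral_cong) (simp_all add: algebra_simps del: of_nat_Suc One_nat_def)
    also have "\<dots> = - (real (Suc n) * fourier_mode (gibbs a) (Suc n)) + 2 * s * avg (\<lambda>y. sin (real 1 * y) * sin (real (Suc n) * y))"
      using i 1 by (simp del: of_nat_Suc of_nat_1 One_nat_def)
    also have "\<dots> = - (real (Suc n) * x (Suc n))" unfolding avg_sin_sin by (auto simp: x_def algebra_simps)
    finally show ?thesis by simp
  qed
  define t where "t n = (1 + (real (Suc n))\<^sup>2) * (x (Suc n))\<^sup>2" for n
  have t0: "0 \<le> t n" for n by (simp add: t_def)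
  have tm: "t n \<le> 2 * (mode h (2 * n + 1))\<^sup>2" for n
  proof -
    have "1 \<le> (real (Suc n))\<^sup>2" by (rule one_le_power) simp
    then have "t n \<le> (2 * (real (Suc n))\<^sup>2) * (x (Suc n))\<^sup>2" unfolding t_def by (intro mult_right_mono) auto
    also have "\<dots> = 2 * (real (Suc n) * x (Suc n))\<^sup>2" by (simp add: power_mult_distrib)
    finally show ?thesis unfolding x by simp
  qed
  have ts: "(\<Sum>n<N. t n) \<le> 2 * D\<^sup>2" for N
  proof -
    have "(\<Sum>n<N. t n) \<le> 2 * (\<Sum>n<N. (mode h (2 * n + 1))\<^sup>2)" unfolding sum_distrib_left by (intro sum_mono tm)
    also have "(\<Sum>n<N. (mode h (2 * n + 1))\<^sup>2) = (\<Sum>j\<in>(\<lambda>n. 2 * n + 1) ` {..<N}. (mode h j)\<^sup>2)"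
      by (subst sum.reindex) (auto simp: inj_on_def)
    also have "\<dots> \<le> (\<Sum>j<2 * N. (mode h j)\<^sup>2)" by (rule sum_mono2) auto
    also have "\<dots> \<le> D\<^sup>2" by (rule bessel_inequality[OF hc hb])
    finally show ?thesis by simp
  qed
  have "summable t" by (rule summableI_nonneg_bounded[OF t0 ts])
  then have "suminf t \<le> 2 * D\<^sup>2" "0 \<le> suminf t" using ts t0 by (auto intro: suminf_le_const suminf_nonneg)
  then have "\<bar>mode_norm x\<bar> \<le> sqrt ((2 * D)\<^sup>2)" unfolding mode_norm_def t_def[symmetric] by (simp add: power_mult_distrib)
  also have "sqrt ((2 * D)\<^sup>2) = 2 * D" using D0 by (intro real_sqrt_unique) auto
  finally show ?thesis unfolding x_def[abs_def] a_def D_def .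
qed

text \<open>
  Evenness holds only almost everywhere for the given density; it passes to the continuous
  representative, whose sine modes then vanish by reflection.
\<close>

lemma gibbs_coef_even_modes:
  assumes a: "adm a" and p: "p \<in> borel_measurable cm" "AE t in cm. p t = gibbs a t" and ev: "even_on_circle p" and j: "odd j"
  shows "mode (gibbs a) j = 0"
proof -
  define g where "g = gibbs a"
  have gb: "g \<in> borel_measurable borel" unfolding g_def by (intro borel_measurable_continuous_onI gibbs_continuous a)
  define P where "P x \<longleftrightarrow> indicator circle x *\<^sub>R p x = indicator circle x * g x" for x
  have "(\<lambda>x. indicator circle x *\<^sub>R p x) \<in> borel_measurable borel"
    using p(1) unfolding borel_measurable_cm_iff set_borel_measurable_def by simp
  moreover have "(\<lambda>x. indicator circle x * g x) \<in> borel_measurable borel" using gb by measurable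
  ultimately have Pm: "Measurable.pred borel P" unfolding P_def[abs_def] by measurable
  have P_iff: "P x \<longleftrightarrow> (x \<in> circle \<longrightarrow> p x = g x)" for x by (auto simp: P_def indicator_def)
  have 1: "AE x in lborel. P x" using p(2) unfolding AE_cm_iff P_iff g_def by simp
  have 2: "AE x in lborel. P (2 * pi + (-1) * x)" by (rule AE_borel_affine[OF _ Pm 1]) simp
  have 3: "AE x in lborel. x \<noteq> (0::real)" by (rule AE_lborel_singleton)
  have 4: "AE x in lborel. x \<in> circle \<longrightarrow> p (2 * pi - x) = p x" using ev by (simp add: even_on_circle_def)
  have "AE x in lborel. x \<in> circle \<longrightarrow> g (2 * pi - x) = g x"
    using 1 2 3 4
  proof eventually_elim
    case (elim x)
    then show ?case by (auto simp: P_iff)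
  qed
  then have ae: "AE x in cm. g (- x) = g x"
    unfolding AE_cm_iff using gibbs_periodic(1)[of a "- x" for x] by (simp add: g_def)
  have gm: "g \<in> borel_measurable cm" "(\<lambda>x. g (- x)) \<in> borel_measurable cm" using gb by (auto intro!: measurable_cm_borel)
  have "mode g j = avg (\<lambda>t. g (-1 * t + 0) * tb j (-1 * t + 0))"
    unfolding mode_def
    by (rule avg_isometry[of "-1" "\<lambda>t. g t * tb j t" 0, symmetric])
       (auto intro!: continuous_intros gibbs_continuous a simp: g_def gibbs_periodic tb_periodic)
  also have "\<dots> = avg (\<lambda>t. - (g (- t) * tb j t))" using j by (simp add: tb_def)
  also have "\<dots> = avg (\<lambda>t. - (g t * tb j t))"
  proof (rule integral_cong_AE)
    show "AE x in cm. - (g (- x) * tb j x) = - (g x * tb j x)" using ae by eventually_elim simp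
  qed (use gm tb_cm in auto)
  finally show ?thesis by (simp add: mode_def g_def)
qed

section \<open>Local uniqueness\<close>

text \<open>
  Modes of frequency at least two are contracted with factor \<open>R r < 1\<close>, so
  self-consistency bounds them by the square of the largest mode. The first sine mode vanishes;
  if the largest mode is small, it must therefore be the first cosine mode, and all others are
  small relative to it.
\<close>

lemma small_modes_dichotomy:
  assumes b: "\<beta> > 0" and r: "0 \<le> r" "bessel_R \<beta> * r < 1"
  shows "\<exists>C>0. \<forall>\<kappa> \<rho> \<epsilon>. 0 \<le> \<kappa> \<and> \<kappa> \<le> r * kappa_star \<beta> \<and> selfcons \<beta> \<kappa> \<rho> \<and> mode \<rho> 1 = 0 \<and>
       (\<forall>j. \<bar>mode \<rho> j\<bar> \<le> \<epsilon>) \<and> C * \<epsilon> < 1 \<and> \<epsilon> \<le> 1 \<longrightarrow> (\<forall>j\<ge>2. \<bar>mode \<rho> j\<bar> \<le> C * \<epsilon> * \<bar>mode \<rho> 0\<bar>)"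
proof -
  define q where "q = bessel_R \<beta> * r"
  have q: "0 \<le> q" "q < 1" using r bessel_R_bounds[OF b] by (auto simp: q_def)
  define L where "L = r * kappa_star \<beta> * Lam \<beta>"
  have L: "0 \<le> L" using Lam_nonneg[OF b] kappa_star_pos[OF b] r by (simp add: L_def)
  define C where "C = (L\<^sup>2 * exp L + 1) / (1 - q)"
  have C: "C > 0" "C * (1 - q) = L\<^sup>2 * exp L + 1" using q by (auto simp: C_def add_nonneg_pos)
  show ?thesis
  proof (intro exI[of _ C] conjI allI impI C(1))
    fix \<kappa> \<rho> \<epsilon> and j :: nat
    assume A: "0 \<le> \<kappa> \<and> \<kappa> \<le> r * kappa_star \<beta> \<and> selfcons \<beta> \<kappa> \<rho> \<and> mode \<rho> 1 = 0 \<and>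
       (\<forall>j. \<bar>mode \<rho> j\<bar> \<le> \<epsilon>) \<and> C * \<epsilon> < 1 \<and> \<epsilon> \<le> 1" and j: "2 \<le> j"
    then have k: "0 \<le> \<kappa>" "\<kappa> \<le> r * kappa_star \<beta>" and sc: "selfcons \<beta> \<kappa> \<rho>" and o: "mode \<rho> 1 = 0"
      and ze: "\<And>j. \<bar>mode \<rho> j\<bar> \<le> \<epsilon>" and Ce: "C * \<epsilon> < 1" "\<epsilon> \<le> 1" by auto
    define z where "z = mode \<rho>"
    define m where "m = (SUP j. \<bar>z j\<bar>)"
    have bdd: "bdd_above (range (\<lambda>j. \<bar>z j\<bar>))" using ze by (auto intro!: bdd_aboveI simp: z_def)
    have zm: "\<bar>z j\<bar> \<le> m" for j unfolding m_def by (rule cSUP_upper[OF _ bdd]) simp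
    have m: "0 \<le> m" "m \<le> \<epsilon>" using zm[of 0] ze by (auto simp: m_def z_def intro: cSUP_least)
    define a where "a = coef \<beta> \<kappa> z"
    have a: "adm a" "pnorm a \<le> L * m"
    proof -
      show "adm a" unfolding a_def by (rule coef_adm_bound(1)[OF b zm])
      have "pnorm a \<le> \<bar>\<kappa>\<bar> * (Lam \<beta> * m)" unfolding a_def by (rule coef_adm_bound(2)[OF b zm])
      also have "\<dots> \<le> (r * kappa_star \<beta>) * (Lam \<beta> * m)" using k m Lam_nonneg[OF b] by (intro mult_right_mono) auto
      finally show "pnorm a \<le> L * m" by (simp add: L_def mult_ac)
    qed
    define Z where "Z = avg (\<lambda>t. exp (pot a t))"
    have Z: "Z \<ge> 1" unfolding Z_def by (rule exp_pot_avg_ge_1[OF a(1)])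
    have zj: "\<bar>z j\<bar> \<le> C * m * m" if j: "2 \<le> j" for j
    proof -
      have "z j = mode (gibbs a) j" using selfcons_mode[OF b sc] by (simp add: a_def z_def)
      then have "\<bar>z j * Z - a j / 2\<bar> \<le> (L * m)\<^sup>2 * exp (L * m)"
        using mode_gibbs_approx[OF a, of j] by (simp add: Z_def)
      also have "\<dots> \<le> (L * m)\<^sup>2 * exp L"
        using m Ce L by (intro mult_left_mono) (auto intro: mult_left_le)
      also have "\<dots> = (L\<^sup>2 * exp L) * (m * m)" by (simp add: power_mult_distrib power2_eq_square)
      also have "\<dots> \<le> (C * (1 - q)) * (m * m)" unfolding C(2) by (intro mult_right_mono) auto
      finally have 1: "\<bar>z j * Z - a j / 2\<bar> \<le> (C * m * m) * (1 - q)" by (simp add: mult_ac)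
      have "\<kappa> * wt \<beta> j \<le> (r * kappa_star \<beta>) * (bessel_R \<beta> / kappa_star \<beta>)"
        using k wt_later[OF b j] wt_nonneg[OF b, of j] kappa_star_pos[OF b] r by (intro mult_mono) auto
      also have "\<dots> = q" using kappa_star_pos[OF b] by (simp add: q_def)
      finally have "\<kappa> * wt \<beta> j * \<bar>z j\<bar> \<le> q * \<bar>z j\<bar>" by (intro mult_right_mono) auto
      then have 2: "\<bar>a j / 2\<bar> \<le> q * \<bar>z j\<bar>" using k wt_nonneg[OF b, of j] by (simp add: a_def coef_def abs_mult)
      have "\<bar>z j\<bar> * 1 \<le> \<bar>z j\<bar> * Z" using Z by (intro mult_left_mono) auto
      also have "\<dots> = \<bar>z j * Z\<bar>" using Z by (simp add: abs_mult)
      finally have 3: "\<bar>z j\<bar> \<le> \<bar>z j * Z\<bar>" by simp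
      define y where "y = a j / 2"
      have "\<bar>z j\<bar> \<le> (C * m * m) * (1 - q) + q * \<bar>z j\<bar>" using 1 2 3 unfolding y_def[symmetric] by linarith
      then have "\<bar>z j\<bar> * (1 - q) \<le> (C * m * m) * (1 - q)" by (simp add: algebra_simps)
      then show ?thesis using q by simp
    qed
    have "m \<le> \<bar>z 0\<bar>"
    proof (rule ccontr)
      assume n: "\<not> m \<le> \<bar>z 0\<bar>"
      then have m0: "0 < m" by linarith
      have "\<bar>z i\<bar> \<le> max \<bar>z 0\<bar> (C * m * m)" for i
      proof -
        consider "i = 0" | "i = 1" | "2 \<le> i" by linarith
        then show ?thesis using zj[of i] o by cases (auto simp: z_def)
      qed
      then have "m \<le> max \<bar>z 0\<bar> (C * m * m)" unfolding m_def by (intro cSUP_least) auto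
      then have "m \<le> (C * m) * m" using n by auto
      moreover have "(C * m) * m < 1 * m"
      proof (rule mult_strict_right_mono[OF _ m0])
        have "C * m \<le> C * \<epsilon>" using m C by (intro mult_left_mono) auto
        then show "C * m < 1" using Ce by linarith
      qed
      ultimately show False by simp
    qed
    have "C * m * m \<le> C * \<epsilon> * \<bar>z 0\<bar>" using m C \<open>m \<le> \<bar>z 0\<bar>\<close> by (intro mult_mono) auto
    then show "\<bar>mode \<rho> j\<bar> \<le> C * \<epsilon> * \<bar>mode \<rho> 0\<bar>" using zj[OF j] by (simp add: z_def)
  qed
qed

text \<open>
  The parameter is the first mode: the other modes divided by it are small by the previous
  lemma, so together with the ratio of intensities they lie in the region where the fixed point
  is unique.
\<close>

lemma local_uniqueness:
  assumes b: "\<beta> > 0" and d: "0 < \<delta>" and eta: "0 < \<eta>" "\<eta> \<le> 1"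
    and u: "\<And>s w. \<bar>s\<bar> < \<delta> \<Longrightarrow> near \<eta> (cq w) \<Longrightarrow> (\<And>n. TT \<beta> (of_real s) (cq w) n = cq w n) \<Longrightarrow> w = v s"
  shows "\<exists>\<epsilon>>0. \<forall>p \<kappa>. nontrivial_even_stationary \<beta> \<kappa> p \<and> \<bar>\<kappa> - kappa_star \<beta>\<bar> < \<epsilon> \<and> H1_norm (\<lambda>t. p t - 1) < ennreal \<epsilon> \<longrightarrow>
    (\<exists>s\<in>{-\<delta><..<\<delta>}. \<kappa> = kappa_star \<beta> * v s 0 \<and> (AE t in cm. p t = gibbs (Ab \<beta> s (v s)) t))"
proof -
  define R where "R = bessel_R \<beta>"
  have R: "0 \<le> R" "R < 1" using bessel_R_bounds[OF b] by (auto simp: R_def)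
  have ks: "kappa_star \<beta> > 0" by (rule kappa_star_pos[OF b])
  define r where "r = 1 + (1 - R) / 2"
  have Rr: "R * r < 1"
  proof -
    obtain y where y: "y = (1 - R) / 2" by blast
    have "R * y \<le> 1 * y" using R by (intro mult_right_mono) (auto simp: y)
    moreover have "R * r = R + R * y" by (simp add: r_def y distrib_left)
    moreover have "R = 1 - 2 * y" "0 < y" using R unfolding y by (simp_all add: field_simps)
    ultimately show ?thesis by linarith
  qed
  obtain C where C: "C > 0"
    "\<And>\<kappa> \<rho> \<epsilon> j. 0 \<le> \<kappa> \<Longrightarrow> \<kappa> \<le> r * kappa_star \<beta> \<Longrightarrow> selfcons \<beta> \<kappa> \<rho> \<Longrightarrow> mode \<rho> 1 = 0 \<Longrightarrow>
       (\<And>j. \<bar>mode \<rho> j\<bar> \<le> \<epsilon>) \<Longrightarrow> C * \<epsilon> < 1 \<Longrightarrow> \<epsilon> \<le> 1 \<Longrightarrow> 2 \<le> j \<Longrightarrow> \<bar>mode \<rho> j\<bar> \<le> C * \<epsilon> * \<bar>mode \<rho> 0\<bar>"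
  proof -
    have "0 \<le> r" "bessel_R \<beta> * r < 1" using R Rr by (auto simp: R_def r_def)
    from small_modes_dichotomy[OF b this] show ?thesis using that by blast
  qed
  define \<epsilon> where "\<epsilon> = Min {1, \<delta> / 2, \<eta> / (2 * C), \<eta> * kappa_star \<beta>, (1 - R) / 2 * kappa_star \<beta>}"
  have e: "0 < \<epsilon>" "\<epsilon> \<le> 1" "\<epsilon> \<le> \<delta> / 2" "\<epsilon> \<le> \<eta> / (2 * C)" "\<epsilon> \<le> \<eta> * kappa_star \<beta>" "\<epsilon> \<le> (1 - R) / 2 * kappa_star \<beta>"
    using d eta C(1) ks R by (auto simp: \<epsilon>_def)
  have "(1 - R) / 2 * kappa_star \<beta> \<le> 1 * kappa_star \<beta>" using R ks by (intro mult_right_mono) auto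
  then have e': "\<epsilon> \<le> kappa_star \<beta>" using e(6) by linarith
  have "C * \<epsilon> \<le> C * (\<eta> / (2 * C))" using e C by (intro mult_left_mono) auto
  then have Ce: "C * \<epsilon> \<le> \<eta> / 2" using C by simp
  show ?thesis
  proof (intro exI[of _ \<epsilon>] conjI allI impI)
    fix p \<kappa> assume A: "nontrivial_even_stationary \<beta> \<kappa> p \<and> \<bar>\<kappa> - kappa_star \<beta>\<bar> < \<epsilon> \<and> H1_norm (\<lambda>t. p t - 1) < ennreal \<epsilon>"
    then have sc: "selfcons \<beta> \<kappa> p" and ev: "even_on_circle p" and nu: "\<not> is_uniform p" and k: "\<bar>\<kappa> - kappa_star \<beta>\<bar> < \<epsilon>"
      by (auto simp: nontrivial_even_stationary_def stationary_iff_selfcons[OF b])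
    have p: "p \<in> pos_densities" and ri: "integrable cm p" using sc by (auto simp: selfcons_def pos_densities_iff)
    define z where "z = mode p"
    define a where "a = coef \<beta> \<kappa> z"
    have a: "adm a" unfolding a_def z_def by (intro coef_adm b mode_cube p)
    have pa: "AE t in cm. p t = gibbs a t" using sc by (simp add: selfcons_def a_def z_def)
    have zg: "z = mode (gibbs a)" using selfcons_mode[OF b sc] by (simp add: a_def z_def)
    have ze: "\<bar>z j\<bar> \<le> \<epsilon>" for j using mode_diff_le[OF ri, of j 1] H1_norm_less_imp(2)[of "\<lambda>t. p t - 1" \<epsilon>] A by (simp add: z_def)
    have odd0: "z j = 0" if "odd j" for j
      unfolding zg by (rule gibbs_coef_even_modes[OF a pos_densities_cm[OF p] pa ev that])
    have zj: "\<bar>z j\<bar> \<le> C * \<epsilon> * \<bar>z 0\<bar>" if "2 \<le> j" for j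
    proof -
      have "\<bar>mode p j\<bar> \<le> C * \<epsilon> * \<bar>mode p 0\<bar>"
      proof (rule C(2)[OF _ _ sc])
        show "0 \<le> \<kappa>" using k e' by linarith
        show "\<kappa> \<le> r * kappa_star \<beta>"
        proof -
          have "r * kappa_star \<beta> = kappa_star \<beta> + (1 - R) / 2 * kappa_star \<beta>" by (simp add: r_def distrib_right)
          then show ?thesis using k e(6) by linarith
        qed
        show "mode p 1 = 0" using odd0[of 1] by (simp add: z_def)
        show "\<bar>mode p j\<bar> \<le> \<epsilon>" for j using ze by (simp add: z_def)
        show "C * \<epsilon> < 1" using Ce eta by linarith
      qed (use e that in simp_all)
      then show ?thesis by (simp add: z_def)
    qed
    define s where "s = z 0"
    have s0: "s \<noteq> 0"
    proof
      assume "s = 0"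
      then have "z j = 0" for j
      proof -
        consider "j = 0" | "j = 1" | "2 \<le> j" by linarith
        then show ?thesis using zj[of j] odd0[of j] \<open>s = 0\<close> by cases (auto simp: s_def)
      qed
      then show False using selfcons_uniformI[OF b sc] nu by (simp add: z_def)
    qed
    have sd: "\<bar>s\<bar> < \<delta>" using ze[of 0] e d by (simp add: s_def)
    define w where "w n = (if n = 0 then \<kappa> / kappa_star \<beta> else z (2 * n) / s)" for n
    have nw: "near \<eta> (cq w)"
    proof (rule near_cqI)
      have "w 0 - 1 = (\<kappa> - kappa_star \<beta>) / kappa_star \<beta>" using ks by (simp add: w_def diff_divide_distrib)
      then have "\<bar>w 0 - 1\<bar> = \<bar>\<kappa> - kappa_star \<beta>\<bar> / kappa_star \<beta>" using ks by (simp add: abs_divide)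
      also have "\<dots> \<le> (\<eta> * kappa_star \<beta>) / kappa_star \<beta>" using k e ks by (intro divide_right_mono) auto
      finally show "\<bar>w 0 - 1\<bar> \<le> \<eta>" using ks by simp
      fix n :: nat assume n: "1 \<le> n"
      have "\<bar>z (2 * n)\<bar> \<le> C * \<epsilon> * \<bar>s\<bar>" unfolding s_def by (rule zj) (use n in simp)
      also have "\<dots> \<le> \<eta> * \<bar>s\<bar>" using Ce eta by (intro mult_right_mono) auto
      finally show "\<bar>w n\<bar> \<le> \<eta>" using n s0 by (simp add: w_def abs_divide pos_divide_le_eq)
    qed
    then have nw1: "near 1 (cq w)" using eta near_mono by blast
    have Zw: "Zm s w = z"
    proof
      fix j show "Zm s w j = z j" using s0 odd0[of j] by (cases "even j") (auto simp: Zm_def w_def s_def elim!: evenE)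
    qed
    have Aw: "Ab \<beta> s w = a" unfolding Ab_def Zw a_def using ks by (simp add: w_def)
    have "TT \<beta> (of_real s) (cq w) n = cq w n" for n
      unfolding fixed_iff[OF b nw1 s0] Aw Zw zg ..
    then have wv: "w = v s" by (rule u[OF sd nw])
    show "\<exists>s\<in>{-\<delta><..<\<delta>}. \<kappa> = kappa_star \<beta> * v s 0 \<and> (AE t in cm. p t = gibbs (Ab \<beta> s (v s)) t)"
    proof (intro bexI[of _ s] conjI)
      show "\<kappa> = kappa_star \<beta> * v s 0" unfolding wv[symmetric] using ks by (simp add: w_def)
      show "AE t in cm. p t = gibbs (Ab \<beta> s (v s)) t" using pa unfolding wv[symmetric] Aw .
    qed (use sd in auto)
  qed (use e in simp)
qed

lemma Ab_zero: "Ab \<beta> 0 v = (\<lambda>_. 0)" by (rule ext) (simp add: Ab_def coef_def Zm_def)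

lemma branch:
  assumes b: "\<beta> > 0"
  obtains \<delta> p \<kappa> where "bifurcation_branch \<beta> \<delta> p \<kappa>" "p 0 = (\<lambda>_. 1)"
    "deriv (deriv \<kappa>) 0 = kappa_star \<beta> * ((1 - 2 * bessel_R \<beta>) / (1 - bessel_R \<beta>))"
proof (rule real_branch[OF b])
  fix v :: "real \<Rightarrow> nat \<Rightarrow> real" and f' f'' :: "real \<Rightarrow> real" and \<delta> \<eta> K :: real
  assume d: "0 < \<delta>" "\<delta> \<le> 1" and eta: "0 < \<eta>" "\<eta> \<le> 1/4" and K: "0 \<le> K"
    and nv: "\<And>s. \<bar>s\<bar> < \<delta> \<Longrightarrow> near \<eta> (cq (v s))"
    and fv: "\<And>s n. \<bar>s\<bar> < \<delta> \<Longrightarrow> TT \<beta> (of_real s) (cq (v s)) n = cq (v s) n"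
    and v0: "\<And>n. v 0 n = (if n = 0 then 1 else 0)"
    and lv: "\<And>s t n. \<bar>s\<bar> < \<delta> \<Longrightarrow> \<bar>t\<bar> < \<delta> \<Longrightarrow> \<bar>v s n - v t n\<bar> \<le> K * \<bar>s - t\<bar>"
    and uv: "\<And>s w. \<bar>s\<bar> < \<delta> \<Longrightarrow> near \<eta> (cq w) \<Longrightarrow> (\<And>n. TT \<beta> (of_real s) (cq w) n = cq w n) \<Longrightarrow> w = v s"
    and dv: "\<And>s. \<bar>s\<bar> < \<delta> \<Longrightarrow> ((\<lambda>s. v s 0) has_real_derivative f' s) (at s)"
    and dv2: "\<And>s. \<bar>s\<bar> < \<delta> \<Longrightarrow> (f' has_real_derivative f'' s) (at s)"
  have nv1: "near 1 (cq (v s))" if "\<bar>s\<bar> < \<delta>" for s using nv[OF that] eta near_mono[of \<eta> _ 1] by simp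
  define k where "k = kappa_star \<beta>"
  have k: "k > 0" unfolding k_def by (rule kappa_star_pos[OF b])
  define c where "c = (1 - 2 * bessel_R \<beta>) / (2 * (1 - bessel_R \<beta>))"
  have lv0: "\<bar>v s n - (if n = 0 then 1 else 0)\<bar> \<le> K * \<bar>s\<bar>" if "\<bar>s\<bar> < \<delta>" for s n
    using lv[OF that, of 0 n] d v0[of n] by simp
  have "norm (cq (v s) n - ee n) = \<bar>v s n - (if n = 0 then 1 else 0)\<bar>" for s n
  proof -
    have "cq (v s) n - ee n = of_real (v s n - (if n = 0 then 1 else 0))" by (simp add: cq_def ee_def)
    then show ?thesis by (simp only: norm_of_real)
  qed
  then have "\<exists>C. \<forall>s. \<bar>s\<bar> < \<delta> \<longrightarrow> \<bar>v s 0 - 1 - c * s\<^sup>2\<bar> \<le> C * \<bar>s\<bar> ^ 3"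
    unfolding c_def by (intro second_order[OF b d K nv1 fv]) (use lv0 in auto)
  then obtain C where C: "\<And>s. \<bar>s\<bar> < \<delta> \<Longrightarrow> \<bar>v s 0 - v 0 0 - c * s\<^sup>2\<bar> \<le> C * \<bar>s\<bar> ^ 3" using v0[of 0] by auto
  have L: "f' 0 = 0" "f'' 0 = 2 * c"
    using second_derivative_from_expansion[OF d(1) dv dv2[of 0] C] d(1) by auto
  define \<kappa> where "\<kappa> s = k * v s 0" for s
  define p where "p s = gibbs (Ab \<beta> s (v s))" for s
  have dk: "(\<kappa> has_real_derivative k * f' s) (at s)" if "\<bar>s\<bar> < \<delta>" for s
    unfolding \<kappa>_def[abs_def] by (intro DERIV_cmult dv that)
  have op: "open {-\<delta><..<\<delta>}" by simp
  have dk2: "(deriv \<kappa> has_real_derivative k * f'' s) (at s)" if s: "\<bar>s\<bar> < \<delta>" for s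
  proof -
    have "((\<lambda>s. k * f' s) has_real_derivative k * f'' s) (at s)" by (intro DERIV_cmult dv2 s)
    moreover have "eventually (\<lambda>t. k * f' t = deriv \<kappa> t) (nhds s)"
      using eventually_nhds_in_open[OF op, of s] s
      by (auto elim!: eventually_mono simp: abs_less_iff intro!: DERIV_imp_deriv[OF dk, symmetric])
    ultimately show ?thesis by (subst (asm) DERIV_cong_ev[OF refl _ refl])
  qed
  have sI: "\<bar>s\<bar> < \<delta> \<longleftrightarrow> s \<in> {-\<delta><..<\<delta>}" for s by auto
  define H where "H = 2 * kappa_star \<beta> * Lam \<beta>"
  have H: "0 \<le> H" using k Lam_nonneg[OF b] by (simp add: H_def k_def)
  have pn: "pnorm (Ab \<beta> s (v s)) \<le> H" if "\<bar>s\<bar> < \<delta>" for s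
  proof -
    have "H * \<bar>s\<bar> \<le> H * 1" using that d H by (intro mult_left_mono) auto
    then show ?thesis using Ab_adm(2)[OF b nv1[OF that], of s] by (simp add: H_def)
  qed
  have ad: "adm (Ab \<beta> s (v s))" if "\<bar>s\<bar> < \<delta>" for s using Ab_adm(1)[OF b nv1[OF that]] .
  define M where "M = 4 * (2 * exp (2 * H) * (1 + H) * (kappa_star \<beta> * (Lam \<beta> * (3 * K + 2))))"
  have H1: "H1_norm (\<lambda>x. p t x - p s x) \<le> ennreal (M * \<bar>t - s\<bar>)" if t: "\<bar>t\<bar> < \<delta>" and s: "\<bar>s\<bar> < \<delta>" for s t
  proof -
    have "H1_norm (\<lambda>x. p t x - p s x) \<le> ennreal (4 * (2 * exp (2 * H) * (1 + H) * pnorm (\<lambda>j. Ab \<beta> t (v t) j - Ab \<beta> s (v s) j)))"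
      by (rule H1_gibbs_diff[OF ad[OF t] pn[OF t] ad[OF s] pn[OF s]])
         (auto simp: p_def intro!: borel_measurable_diff gibbs_cm ad t s)
    also have "\<dots> \<le> ennreal (4 * (2 * exp (2 * H) * (1 + H) * (kappa_star \<beta> * (Lam \<beta> * (3 * (K * \<bar>t - s\<bar>) + 2 * \<bar>t - s\<bar>)))))"
      using H d t by (intro ennreal_leI mult_left_mono Ab_diff[OF b nv1[OF t] nv1[OF s] _ lv[OF t s]]) auto
    also have "4 * (2 * exp (2 * H) * (1 + H) * (kappa_star \<beta> * (Lam \<beta> * (3 * (K * \<bar>t - s\<bar>) + 2 * \<bar>t - s\<bar>)))) = M * \<bar>t - s\<bar>"
      by (simp add: M_def algebra_simps)
    finally show ?thesis .
  qed
  have p0: "p 0 = (\<lambda>_. 1)" by (simp add: p_def Ab_zero)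
  show thesis
  proof (rule that[of \<delta> p \<kappa>])
    show "deriv (deriv \<kappa>) 0 = kappa_star \<beta> * ((1 - 2 * bessel_R \<beta>) / (1 - bessel_R \<beta>))"
    proof -
      have "2 * c = (1 - 2 * bessel_R \<beta>) / (1 - bessel_R \<beta>)" unfolding c_def using bessel_R_bounds[OF b] by (simp add: divide_simps) (simp add: algebra_simps)
      then show ?thesis using DERIV_imp_deriv[OF dk2[of 0]] d L(2) by (simp add: k_def)
    qed
    show "p 0 = (\<lambda>_. 1)" by fact
    show "bifurcation_branch \<beta> \<delta> p \<kappa>" unfolding bifurcation_branch_def
    proof (intro conjI ballI impI)
      show "0 < \<delta>" by fact
      show "is_uniform (p 0)" by (simp add: p0 is_uniform_cm)
      show "\<kappa> 0 = kappa_star \<beta>" by (simp add: \<kappa>_def v0 k_def)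
      show "deriv \<kappa> 0 = 0" using DERIV_imp_deriv[OF dk[of 0]] d L(1) by simp
      show "nontrivial_even_stationary \<beta> (\<kappa> s) (p s)" if "s \<in> {-\<delta><..<\<delta>}" "s \<noteq> 0" for s
        unfolding \<kappa>_def p_def k_def using that by (intro branch_density(2) b nv1 fv) (auto simp: sI[symmetric])
      show "\<kappa> differentiable (at s)" "deriv \<kappa> differentiable (at s)" if "s \<in> {-\<delta><..<\<delta>}" for s
        using dk[OF iffD2[OF sI that]] dk2[OF iffD2[OF sI that]] unfolding real_differentiable_def by blast+
      show "((\<lambda>t. H1_norm (\<lambda>x. p t x - p s x)) \<longlongrightarrow> 0) (at s)" if s: "s \<in> {-\<delta><..<\<delta>}" for s
      proof (rule tendsto_sandwich[where f="\<lambda>_. 0" and h="\<lambda>t. ennreal (M * \<bar>t - s\<bar>)"])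
        show "eventually (\<lambda>t. H1_norm (\<lambda>x. p t x - p s x) \<le> ennreal (M * \<bar>t - s\<bar>)) (at s)"
          using eventually_at_in_open'[OF op s] by eventually_elim (rule H1; use s in \<open>simp add: sI\<close>)
        have "((\<lambda>t. M * \<bar>t - s\<bar>) \<longlongrightarrow> 0) (at s)" by (auto intro!: tendsto_eq_intros)
        then show "((\<lambda>t. ennreal (M * \<bar>t - s\<bar>)) \<longlongrightarrow> 0) (at s)" using tendsto_ennrealI[of _ 0] by simp
      qed auto
      show "(\<lambda>s. mode_norm (\<lambda>l. fourier_mode (p s) l - (if l = 1 then s else 0))) \<in> o[at 0](\<lambda>s. s)"
      proof -
        define h where "h = kappa_star \<beta> * Lam \<beta>"
        define Q where "Q = 2 * (3 * h * K * exp (2 * h) + 2 * (2 * exp (2 * (2 * h)) * (1 + 2 * h) * (2 * h)))"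
        define F where "F s = mode_norm (\<lambda>l. fourier_mode (p s) l - (if l = 1 then s else 0))" for s
        have F: "\<bar>F s\<bar> \<le> Q * s\<^sup>2" if s: "\<bar>s\<bar> < \<delta>" "s \<noteq> 0" for s
        proof -
          have "\<bar>s\<bar> \<le> 1" using s d by simp
          from branch_mode_norm[OF b nv1[OF s(1)] s(2) this K fv[OF s(1)] lv0[OF s(1)], folded h_def]
          show ?thesis unfolding F_def p_def Q_def by (simp only: mult.assoc)
        qed
        have "F \<in> o[at 0](\<lambda>s. s)"
        proof (rule smalloI_tendsto)
          show "((\<lambda>s. F s / s) \<longlongrightarrow> 0) (at 0)"
          proof (rule Lim_null_comparison)
            show "eventually (\<lambda>s. norm (F s / s) \<le> Q * \<bar>s\<bar>) (at 0)"
              using eventually_at_in_open[OF op, of 0] d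
            proof (simp, elim eventually_mono)
              fix s assume s: "- \<delta> < s \<and> s < \<delta> \<and> s \<noteq> 0"
              then have "\<bar>F s\<bar> / \<bar>s\<bar> \<le> (Q * s\<^sup>2) / \<bar>s\<bar>" by (intro divide_right_mono F) auto
              also have "\<dots> = Q * \<bar>s\<bar>" using s by (simp add: power2_eq_square field_simps abs_mult_self_eq)
              finally show "\<bar>F s\<bar> / \<bar>s\<bar> \<le> Q * \<bar>s\<bar>" .
            qed
            show "((\<lambda>s. Q * \<bar>s\<bar>) \<longlongrightarrow> 0) (at 0)" by (auto intro!: tendsto_eq_intros)
          qed
          show "eventually (\<lambda>s::real. s \<noteq> 0) (at 0)" by (auto simp: eventually_at_filter)
        qed
        then show ?thesis by (simp only: F_def[abs_def])
      qed
      have e1: "\<eta> \<le> 1" using eta by simp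
      show "\<exists>\<epsilon>>0. \<forall>p' \<kappa>'. nontrivial_even_stationary \<beta> \<kappa>' p' \<and> \<bar>\<kappa>' - kappa_star \<beta>\<bar> < \<epsilon> \<and> H1_norm (\<lambda>x. p' x - 1) < ennreal \<epsilon> \<longrightarrow>
        (\<exists>s\<in>{-\<delta><..<\<delta>}. \<kappa>' = \<kappa> s \<and> (AE x\<in>circle in lborel. p' x = p s x))"
        using local_uniqueness[OF b d(1) eta(1) e1 uv] unfolding \<kappa>_def p_def k_def AE_cm_iff .
    qed
  qed
qed

text \<open>
  Along the branch both the density and the intensity converge as the parameter tends to zero.
\<close>

lemma branch_imp_bifurcation_point:
  assumes b: "\<beta> > 0" and br: "bifurcation_branch \<beta> \<delta> p \<kappa>" and p0: "p 0 = (\<lambda>_. 1)"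
  shows "bifurcation_point \<beta> (kappa_star \<beta>)"
  unfolding bifurcation_point_def
proof (intro conjI allI impI kappa_star_pos b)
  fix \<epsilon> :: real assume e: "\<epsilon> > 0"
  have d: "0 < \<delta>" and k0: "\<kappa> 0 = kappa_star \<beta>" and
    st: "\<And>s. s \<in> {-\<delta><..<\<delta>} \<Longrightarrow> s \<noteq> 0 \<Longrightarrow> nontrivial_even_stationary \<beta> (\<kappa> s) (p s)"
    and "((\<lambda>t. H1_norm (\<lambda>x. p t x - p 0 x)) \<longlongrightarrow> 0) (at 0)" and kd: "\<kappa> differentiable (at 0)"
    using br unfolding bifurcation_branch_def by auto
  then have "eventually (\<lambda>t. H1_norm (\<lambda>x. p t x - p 0 x) < ennreal (\<epsilon>)) (at 0)"
    using e by (intro order_tendstoD(2)) auto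
  moreover have "(\<kappa> \<longlongrightarrow> kappa_star \<beta>) (at 0)"
    using differentiable_imp_continuous_within[OF kd] by (simp add: continuous_within k0)
  then have "eventually (\<lambda>t. dist (\<kappa> t) (kappa_star \<beta>) < \<epsilon>) (at 0)" using e by (rule tendstoD)
  moreover have "eventually (\<lambda>t. t \<in> {-\<delta><..<\<delta>} - {0}) (at 0)" using d by (intro eventually_at_in_open) auto
  ultimately have "eventually (\<lambda>t. H1_norm (\<lambda>x. p t x - p 0 x) < ennreal \<epsilon> \<and> dist (\<kappa> t) (kappa_star \<beta>) < \<epsilon> \<and> t \<in> {-\<delta><..<\<delta>} - {0}) (at 0)"
    by eventually_elim auto
  then obtain t where t: "H1_norm (\<lambda>x. p t x - p 0 x) < ennreal \<epsilon>" "dist (\<kappa> t) (kappa_star \<beta>) < \<epsilon>" "t \<in> {-\<delta><..<\<delta>}" "t \<noteq> 0"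
    using eventually_happens[of _ "at (0::real)"] trivial_limit_at[of "0::real"] by auto
  show "\<exists>p \<kappa>'. nontrivial_even_stationary \<beta> \<kappa>' p \<and> \<bar>\<kappa>' - kappa_star \<beta>\<bar> < \<epsilon> \<and> H1_norm (\<lambda>x. p x - 1) < ennreal \<epsilon>"
    using st[OF t(3,4)] t(1,2) by (auto simp: p0 dist_real_def)
qed

section \<open>Transitions and bifurcations for the Transformer potential\<close>

theorem theorem2p7:
  shows "(\<exists>\<beta>\<^sub>m \<beta>\<^sub>p :: real. 0 < \<beta>\<^sub>m \<and> \<beta>\<^sub>m < \<beta>\<^sub>p \<and>
      (\<forall>\<beta>. 0 < \<beta> \<and> \<beta> \<le> \<beta>\<^sub>m \<longrightarrow> continuous_transition_point \<beta> (kappa_star \<beta>)) \<and>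
      (\<forall>\<beta>>\<beta>\<^sub>p. \<exists>\<kappa>\<^sub>c<kappa_star \<beta>. discontinuous_transition_point \<beta> \<kappa>\<^sub>c) \<and>
      \<beta>\<^sub>p \<le> bessel_R_inv (1/2)) \<and>
    0 < bessel_R_inv (1/2) \<and> bessel_R (bessel_R_inv (1/2)) = 1/2 \<and>
    \<bar>bessel_R_inv (1/2) - 2.447\<bar> < 0.0005 \<and>
    (\<forall>\<beta>>0. first_bifurcation_point \<beta> (kappa_star \<beta>)) \<and>
    (\<forall>\<beta>. 0 < \<beta> \<and> \<beta> < bessel_R_inv (1/2) \<longrightarrow> supercritical \<beta>) \<and>
    (\<forall>\<beta>>bessel_R_inv (1/2). subcritical \<beta>)"
proof -
  define b where "b = bessel_R_inv (1/2)"
  have b: "0 < b" "bessel_R b = 1/2" "\<bar>b - 2.447\<bar> < 0.0005"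
    unfolding b_def using bessel_R_inv_half by auto
  have below: "bessel_R \<beta> < 1/2" if "0 < \<beta>" "\<beta> < b" for \<beta> using bessel_R_strict_mono[of \<beta> b] that b by simp
  have above: "1/2 < bessel_R \<beta>" if "b < \<beta>" for \<beta> using bessel_R_strict_mono[of b \<beta>] that b by simp
  have first: "first_bifurcation_point \<beta> (kappa_star \<beta>)" if "0 < \<beta>" for \<beta>
    using branch[OF that] branch_imp_bifurcation_point[OF that] below_kappa_star_not_bifurcation[OF that]
    unfolding first_bifurcation_point_def by metis
  have super: "supercritical \<beta>" if bt: "0 < \<beta>" "\<beta> < b" for \<beta>
  proof -
    obtain \<delta> p \<kappa> where br: "bifurcation_branch \<beta> \<delta> p \<kappa>"
      "deriv (deriv \<kappa>) 0 = kappa_star \<beta> * ((1 - 2 * bessel_R \<beta>) / (1 - bessel_R \<beta>))" using branch[OF bt(1)] by metis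
    have "0 < (1 - 2 * bessel_R \<beta>) / (1 - bessel_R \<beta>)" using below[OF bt] by (intro divide_pos_pos) auto
    then have "0 < deriv (deriv \<kappa>) 0" unfolding br(2) using kappa_star_pos[OF bt(1)] by (rule mult_pos_pos[rotated])
    then show ?thesis unfolding supercritical_def using br(1) by blast
  qed
  have sub: "subcritical \<beta>" if bt: "b < \<beta>" for \<beta>
  proof -
    have b0: "0 < \<beta>" using b bt by simp
    obtain \<delta> p \<kappa> where br: "bifurcation_branch \<beta> \<delta> p \<kappa>"
      "deriv (deriv \<kappa>) 0 = kappa_star \<beta> * ((1 - 2 * bessel_R \<beta>) / (1 - bessel_R \<beta>))" using branch[OF b0] by metis
    have "(1 - 2 * bessel_R \<beta>) / (1 - bessel_R \<beta>) < 0"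
      using above[OF bt] bessel_R_bounds[OF b0] by (intro divide_neg_pos) auto
    then have "deriv (deriv \<kappa>) 0 < 0" unfolding br(2) using kappa_star_pos[OF b0] by (rule mult_pos_neg[rotated])
    then show ?thesis unfolding subcritical_def using br(1) by blast
  qed
  have disc: "\<exists>\<kappa>\<^sub>c<kappa_star \<beta>. discontinuous_transition_point \<beta> \<kappa>\<^sub>c" if "b < \<beta>" for \<beta>
    by (rule discontinuous_transition) (use that b above in auto)
  have "\<exists>\<beta>\<^sub>m \<beta>\<^sub>p :: real. 0 < \<beta>\<^sub>m \<and> \<beta>\<^sub>m < \<beta>\<^sub>p \<and>
      (\<forall>\<beta>. 0 < \<beta> \<and> \<beta> \<le> \<beta>\<^sub>m \<longrightarrow> continuous_transition_point \<beta> (kappa_star \<beta>)) \<and>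
      (\<forall>\<beta>>\<beta>\<^sub>p. \<exists>\<kappa>\<^sub>c<kappa_star \<beta>. discontinuous_transition_point \<beta> \<kappa>\<^sub>c) \<and> \<beta>\<^sub>p \<le> b"
  proof (rule exI[of _ "1/1000000"], rule exI[of _ b], intro conjI allI impI)
    show "1/1000000 < b" using b(3) by (simp add: abs_if split: if_splits)
    show "continuous_transition_point \<beta> (kappa_star \<beta>)" if "0 < \<beta> \<and> \<beta> \<le> 1/1000000" for \<beta>
      using continuous_transition that by blast
  qed (use disc in auto)
  then show ?thesis using b first super sub unfolding b_def[symmetric] by blast
qed

end
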